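(* Let $h\in[1,n]$ and let $A=(a_{i,j}),B=(b_{i,j})\in\Xi_{N,2r}$ with $B=E^\theta_{h,h+1}+\mathrm{diag}(\widehat\gamma)$ for some $\gamma\in\Lambda(n+1,r-1)$, and assume $\mathrm{ro}(B)=\widehat\lambda$, $\mathrm{co}(B)=\mathrm{ro}(A)=\widehat\mu$, $\mathrm{co}(A)=\widehat\nu$ with $\lambda,\mu,\nu\in\Lambda(n+1,r)$. Let $\varepsilon=\mathrm{sgn}(A)$, $a=a_{n+1,n+1}$, and let $$g_{h,A,p}=\begin{cases}\boldsymbol q^{\sum_{j>p}a_{h,j}}[\![a_{h,p}+1]\!],&a_{h+1,p}>0,\\0,&a_{h+1,p}=0.\end{cases}$$ Suppose $b_{n+1,n+1}\ne0$ (i.e. $B\in\Xi^{\bullet}$). Then $B$ gives the single basis element $\phi_{\dot B}$ and the following hold in $S^{D}_{\boldsymbol q}(n,r)$ (terms with coefficient $g_{h,A,p}=0$ being zero): (1) If $a\ne0$ (i.e. $A\in\Xi^{\bullet}$), then $$\phi_{\dot B}\,\phi_{\dot A}=\begin{cases}\displaystyle\sum_{1\le p\le N}g_{h,A,p}\,\phi_{{}_h\dot A_p},&\text{if }h<n,\text{ or }h=n\text{ and }a\ne2,\\[2ex]\displaystyle\sum_{1\le p\le N,\,p\ne n+1}g_{n,A,p}\,\phi_{{}_n\dot A_p}+g_{n,A,n+1}\big(\phi_{{}^{+}({}_nA_{n+1})^{\varepsilon}}+\phi_{{}^{-}({}_nA_{n+1})^{-\varepsilon}}\big),&\text{if }h=n\text{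 and }a=2.\end{cases}$$ (2) If $A\in\Xi^{\bullet\circ\circ}\sqcup\Xi^{\bullet\circ\bullet}$ (i.e. $a=0$ and $\mu_{n+1}\neq0$), then $$\phi_{\dot B}\,\phi_{{}^{+}A^{\varepsilon}}=\begin{cases}\displaystyle\sum_{1\le p\le N}g_{h,A,p}\,\phi_{{}^{+}({}_hA_p)^{\varepsilon}},&h<n,\\[2ex]\displaystyle\sum_{1\le p<n+1}g_{n,A,p}\,\phi_{{}^{+}({}_nA_p)^{\varepsilon}}+\sum_{p>n+1}g_{n,A,p}\,\phi_{{}^{-}({}_nA_p)^{\varepsilon}},&h=n,\end{cases}$$ $$\phi_{\dot B}\,\phi_{{}^{-}A^{-\varepsilon}}=\begin{cases}\displaystyle\sum_{1\le p\le N}g_{h,A,p}\,\phi_{{}^{-}({}_hA_p)^{-\varepsilon}},&h<n,\\[2ex]\displaystyle\sum_{1\le p<n+1}g_{n,A,p}\,\phi_{{}^{-}({}_nA_p)^{-\varepsilon}}+\sum_{p>n+1}g_{n,A,p}\,\phi_{{}^{+}({}_nA_p)^{-\varepsilon}},&h=n.\end{cases}$$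
   Context: Let $n\ge1$, $r\ge4$, $N=2n+1$, $[a,b]=\{x\in\mathbb Z:a\le x\le b\}$, $\mathcal A=\mathbb Z[\boldsymbol q]$ with $\boldsymbol q$ an indeterminate, $[\![m]\!]=(\boldsymbol q^m-1)/(\boldsymbol q-1)$. $W$ is the group of permutations $w$ of $[1,2r]$ with $w(i)+w(2r+1-i)=2r+1$ for all $i$ (type $B_r$), with Coxeter generators $s_i=(i,i+1)(2r-i,2r+1-i)$ ($1\le i<r$) and $s_r=(r,r+1)$. $H=H_{\boldsymbol q,1}$ is the $\mathcal A$-algebra generated by $T_1,\dots,T_r$ with relations $T_iT_j=T_jT_i$ ($|i-j|\ge2$), $T_jT_{j+1}T_j=T_{j+1}T_jT_{j+1}$ ($1\le j<r-1$), $T_{r-1}T_rT_{r-1}T_r=T_rT_{r-1}T_rT_{r-1}$, $T_i^2=(\boldsymbol q-1)T_i+\boldsymbol q$ ($i<r$), $T_r^2=1$; it has basis $\{T_w\}_{w\in W}$ defined via reduced expressions. $\Lambda(n+1,m)=\{\lambda\in\mathbb N^{n+1}:\sum\lambda_i=m\}$, $\widehat\lambda=(\lambda_1,\dots,\lambda_n,2\lambda_{n+1},\lambda_n,\dots,\lambda_1)$. For $\lambda\in\Lambda(n+1,r)$, $W_\lambda$ is generated by the $s_j$, $j\in[1,r]$, with $j\notin\{\lambda_1+\dots+\lambda_i:i\in[1,n]\}$. $\Xi_{N,2r}$ is the set of $N\times N$ matrices $A=(a_{i,j})$ over $\mathbb N$ with $a_{i,j}=a_{N+1-i,N+1-j}$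 and $\sum a_{i,j}=2r$; $\mathrm{ro}(A),\mathrm{co}(A)$ are the row sum and column sum vectors. Let $R_i^{\widehat\lambda}$ ($1\le i\le N$) be the consecutive intervals of lengths $\widehat\lambda_i$ partitioning $[1,2r]$. The map $(\lambda,d,\mu)\mapsto(|R_i^{\widehat\lambda}\cap dR_j^{\widehat\mu}|)_{i,j}$, with $\lambda,\mu\in\Lambda(n+1,r)$ and $d$ a minimal length representative of a $W_\lambda$-$W_\mu$ double coset, is a bijection onto $\Xi_{N,2r}$; if $A$ is the image of $(\lambda,d,\mu)$ write $d_A=d$ (then $\mathrm{ro}(A)=\widehat\lambda$, $\mathrm{co}(A)=\widehat\mu$). $\check W\le W$ is the subgroup of $w$ with $\#\{i\in[1,r]:w(i)>r\}$ even (type $D_r$), with Coxeter generators $s_1,\dots,s_{r-1},s_rs_{r-1}s_r$; $\check H\subset H$ is the subalgebra generated by $T_1,\dots,T_{r-1},T_rT_{r-1}T_r$, with basis $\{T_w\}_{w\in\check W}$. $\Lambda^{D}(n,r)$ consists of symbols $\lambda^\bullet$ ($\lambda\in\Lambda(n+1,r)$, $\lambda_{n+1}\ne0$) and $\lambda^+,\lambda^-$ ($\lambda_{n+1}=0$); $\check W_{\lambda^\bullet}=W_\lambda\cap\check W$, $\check W_{\lambda^+}=W_\lambda$, $\check W_{\lambda^-}=s_rW_\lambda s_r$; $\check x_\alpha=\sum_{w\in\check W_\alpha}T_w$; $S^{D}_{\boldsymbol q}(n,r)=\mathrm{End}_{\check H}(\bigoplus_{\alpha\in\Lambda^{D}(n,r)}\check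 x_\alpha\check H)$, product being composition (also written $*$). For $\alpha,\beta\in\Lambda^{D}(n,r)$ and $d$ the minimal length representative (for $\check W$) of a $\check W_\alpha$-$\check W_\beta$ double coset in $\check W$, $\phi^d_{\alpha,\beta}(\check x_\gamma h)=\delta_{\beta,\gamma}\sum_{w\in\check W_\alpha d\check W_\beta}T_wh$. $\mathrm{sgn}(A)\in\{+,-\}$ is $+$ iff $\sum_{i\in[1,n],\,j\in[n+2,N]}a_{i,j}$ is even; signs multiply as usual and $-\varepsilon$ is the opposite sign. $\check\Xi(n,r)$ is the set of symbols $\dot A$ for $A\in\Xi_{N,2r}$ with $a_{n+1,n+1}\ne0$ and ${}^{\varepsilon}A^{\varepsilon'}$ for $A\in\Xi_{N,2r}$ with $a_{n+1,n+1}=0$ and $\varepsilon\varepsilon'=\mathrm{sgn}(A)$. With $\mathrm{ro}(A)=\widehat\lambda$, $\mathrm{co}(A)=\widehat\mu$, put $\lambda^{[\varepsilon]}=\lambda^\varepsilon$ if $\lambda_{n+1}=0$, $\lambda^{[\varepsilon]}=\lambda^\bullet$ otherwise (same for $\mu$), $s^{+}=1$, $s^{-}=s_r$. Then $\phi_{\dot A}=\phi^{d}_{\lambda^\bullet,\mu^\bullet}$, $d$ the minimal representative of $\check W_{\lambda^\bullet}d_A\check W_{\mu^\bullet}$ if $d_A\in\check W$, of $\check W_{\lambda^\bullet}s_rd_A\check W_{\mu^\bullet}$ if $d_A\notin\check W$; and $\phi_{{}^{\varepsilon}A^{\varepsilon'}}=\phi^{d}_{\lambda^{[\varepsilon]},\mu^{[\varepsilon']}}$,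 $d$ the minimal representative of $\check W_{\lambda^{[\varepsilon]}}s^{\varepsilon}d_As^{\varepsilon'}\check W_{\mu^{[\varepsilon']}}$. These form an $\mathcal A$-basis of $S^{D}_{\boldsymbol q}(n,r)$. $\Xi^{\bullet}=\{A\in\Xi_{N,2r}:a_{n+1,n+1}\ne0\}$. With $\mathrm{ro}(A)=\widehat\lambda,\mathrm{co}(A)=\widehat\mu$, the matrices with $a_{n+1,n+1}=0$ are divided into $\Xi^{\circ\circ\circ}$ ($\lambda_{n+1}=0=\mu_{n+1}$), $\Xi^{\circ\circ\bullet}$ ($\lambda_{n+1}=0\ne\mu_{n+1}$), $\Xi^{\bullet\circ\circ}$ ($\lambda_{n+1}\ne0=\mu_{n+1}$), $\Xi^{\bullet\circ\bullet}$ ($\lambda_{n+1}\ne0\ne\mu_{n+1}$). $E^\theta_{i,j}=E_{i,j}+E_{N+1-i,N+1-j}$ ($E_{i,j}$ matrix units), ${}_hA_p=A+E^\theta_{h,p}-E^\theta_{h+1,p}$, and ${}_h\dot A_p$ denotes the symbol $\dot{M}$ for $M={}_hA_p$. *)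

theory Defs
  imports
    "HOL-Algebra.QuotRing"
    "HOL-Algebra.Generated_Rings"
    "HOL-Algebra.Generated_Groups"
    "HOL-Algebra.Module"
    "HOL-Combinatorics.Permutations"
    "HOL-Computational_Algebra.Polynomial"
begin

(* Throughout, n, r are natural numbers and N = 2 * n + 1.  Integer vectors and matrices are
   functions on nat with 1-based indices that vanish outside the index range. *)

definition qq :: "int poly" where
  "qq = [:0, 1:]"

definition qint :: "nat \<Rightarrow> int poly" where
  "qint m = (qq ^ m - 1) div (qq - 1)"

(* Products of permutations are compositions of functions: (u \<circ> v) i = u (v i). *)

definition WB :: "nat \<Rightarrow> (nat \<Rightarrow> nat) set" where
  "WB r = {w. w permutes {1..2*r} \<and> (\<forall>i\<in>{1..2*r}. w i + w (2*r+1-i) = 2*r+1)}"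

definition WB_group :: "nat \<Rightarrow> (nat \<Rightarrow> nat) monoid" where
  "WB_group r = \<lparr>carrier = WB r, monoid.mult = (\<circ>), one = id\<rparr>"

definition sB :: "nat \<Rightarrow> nat \<Rightarrow> nat \<Rightarrow> nat" where
  "sB r i = (if i < r then transpose i (i+1) \<circ> transpose (2*r-i) (2*r+1-i)
             else transpose r (r+1))"

definition WD :: "nat \<Rightarrow> (nat \<Rightarrow> nat) set" where
  "WD r = {w \<in> WB r. even (card {i \<in> {1..r}. w i > r})}"

definition sD :: "nat \<Rightarrow> nat \<Rightarrow> nat \<Rightarrow> nat" where
  "sD r i = (if i < r then sB r i else sB r r \<circ> sB r (r-1) \<circ> sB r r)"

definition word_val :: "(nat \<Rightarrow> nat \<Rightarrow> nat) \<Rightarrow> nat list \<Rightarrow> nat \<Rightarrow> nat" where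
  "word_val s u = foldr (\<lambda>i w. s i \<circ> w) u id"

definition cox_len :: "(nat \<Rightarrow> nat \<Rightarrow> nat) \<Rightarrow> nat \<Rightarrow> (nat \<Rightarrow> nat) \<Rightarrow> nat" where
  "cox_len s r w = (LEAST k. \<exists>u. set u \<subseteq> {1..r} \<and> length u = k \<and> word_val s u = w)"

abbreviation lenB :: "nat \<Rightarrow> (nat \<Rightarrow> nat) \<Rightarrow> nat" where
  "lenB r \<equiv> cox_len (sB r) r"

abbreviation lenD :: "nat \<Rightarrow> (nat \<Rightarrow> nat) \<Rightarrow> nat" where
  "lenD r \<equiv> cox_len (sD r) r"

definition reduced_wordB :: "nat \<Rightarrow> (nat \<Rightarrow> nat) \<Rightarrow> nat list \<Rightarrow> bool" where
  "reduced_wordB r w u \<longleftrightarrow> set u \<subseteq> {1..r} \<and> word_val (sB r) u = w \<and> length u = lenB r w"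

definition dcoset :: "(nat \<Rightarrow> nat) set \<Rightarrow> (nat \<Rightarrow> nat) \<Rightarrow> (nat \<Rightarrow> nat) set \<Rightarrow> (nat \<Rightarrow> nat) set" where
  "dcoset P d Q = {u \<circ> d \<circ> v | u v. u \<in> P \<and> v \<in> Q}"

(* The free associative algebra over int poly on the letters 1, ..., r: an element is a finitely
   supported coefficient function on words. *)
definition free_alg :: "nat \<Rightarrow> (nat list \<Rightarrow> int poly) ring" where
  "free_alg r =
    \<lparr>carrier = {f. finite {u. f u \<noteq> 0} \<and> (\<forall>u. f u \<noteq> 0 \<longrightarrow> set u \<subseteq> {1..r})},
     monoid.mult = (\<lambda>f g u. \<Sum>k\<le>length u. f (take k u) * g (drop k u)),
     one = (\<lambda>u. if u = [] then 1 else 0),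
     zero = (\<lambda>u. 0),
     add = (\<lambda>f g u. f u + g u)\<rparr>"

definition mon :: "int poly \<Rightarrow> nat list \<Rightarrow> nat list \<Rightarrow> int poly" where
  "mon c u = (\<lambda>v. if v = u then c else 0)"

(* A relation X = Y is encoded as the relator X - Y. *)
definition relators :: "nat \<Rightarrow> (nat list \<Rightarrow> int poly) set" where
  "relators r =
    {\<lambda>v. mon 1 [i,j] v - mon 1 [j,i] v | i j.
        i \<in> {1..r} \<and> j \<in> {1..r} \<and> (i + 2 \<le> j \<or> j + 2 \<le> i)} \<union>
    {\<lambda>v. mon 1 [j,j+1,j] v - mon 1 [j+1,j,j+1] v | j. 1 \<le> j \<and> j < r - 1} \<union>
    {\<lambda>v. mon 1 [r-1,r,r-1,r] v - mon 1 [r,r-1,r,r-1] v} \<union>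
    {\<lambda>v. mon 1 [i,i] v - (mon (qq - 1) [i] v + mon qq [] v) | i. 1 \<le> i \<and> i < r} \<union>
    {\<lambda>v. mon 1 [r,r] v - mon 1 [] v}"

type_synonym hecke = "(nat list \<Rightarrow> int poly) set"

definition rel_ideal :: "nat \<Rightarrow> (nat list \<Rightarrow> int poly) set" where
  "rel_ideal r = Idl\<^bsub>free_alg r\<^esub> (relators r)"

definition HB :: "nat \<Rightarrow> hecke ring" where
  "HB r = free_alg r Quot rel_ideal r"

definition Hclass :: "nat \<Rightarrow> (nat list \<Rightarrow> int poly) \<Rightarrow> hecke" where
  "Hclass r f = rel_ideal r +>\<^bsub>free_alg r\<^esub> f"

definition Hconst :: "nat \<Rightarrow> int poly \<Rightarrow> hecke" where
  "Hconst r c = Hclass r (mon c [])"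

definition Tgen :: "nat \<Rightarrow> nat \<Rightarrow> hecke" where
  "Tgen r i = Hclass r (mon 1 [i])"

(* By Matsumoto's theorem the choice of the reduced word is immaterial. *)
definition Tw :: "nat \<Rightarrow> (nat \<Rightarrow> nat) \<Rightarrow> hecke" where
  "Tw r w = foldr (\<lambda>i x. Tgen r i \<otimes>\<^bsub>HB r\<^esub> x) (SOME u. reduced_wordB r w u) \<one>\<^bsub>HB r\<^esub>"

(* Including the scalars among the ring generators makes this the generated subalgebra. *)
definition HD :: "nat \<Rightarrow> hecke set" where
  "HD r = generate_ring (HB r)
     (range (Hconst r) \<union> Tgen r ` {1..<r} \<union>
      {Tgen r r \<otimes>\<^bsub>HB r\<^esub> Tgen r (r-1) \<otimes>\<^bsub>HB r\<^esub> Tgen r r})"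

definition Lam :: "nat \<Rightarrow> nat \<Rightarrow> (nat \<Rightarrow> nat) set" where
  "Lam k m = {l. (\<forall>i. i \<notin> {1..k} \<longrightarrow> l i = 0) \<and> (\<Sum>i\<in>{1..k}. l i) = m}"

definition hat :: "nat \<Rightarrow> (nat \<Rightarrow> nat) \<Rightarrow> nat \<Rightarrow> nat" where
  "hat n l i = (if 1 \<le> i \<and> i \<le> n then l i
                else if i = n + 1 then 2 * l (n+1)
                else if n + 2 \<le> i \<and> i \<le> 2*n+1 then l (2*n+2-i)
                else 0)"

definition WBpar :: "nat \<Rightarrow> nat \<Rightarrow> (nat \<Rightarrow> nat) \<Rightarrow> (nat \<Rightarrow> nat) set" where
  "WBpar n r l = generate (WB_group r)
     {sB r j | j. j \<in> {1..r} \<and> j \<notin> {\<Sum>k\<in>{1..i}. l k | i. i \<in> {1..n}}}"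

datatype sg = Plus | Minus

definition sg_mult :: "sg \<Rightarrow> sg \<Rightarrow> sg" where
  "sg_mult e e' = (if e = e' then Plus else Minus)"

fun opp :: "sg \<Rightarrow> sg" where
  "opp Plus = Minus"
| "opp Minus = Plus"

fun s_pow :: "nat \<Rightarrow> sg \<Rightarrow> nat \<Rightarrow> nat" where
  "s_pow r Plus = id"
| "s_pow r Minus = sB r r"

datatype lamD = LBul "nat \<Rightarrow> nat" | LSgn sg "nat \<Rightarrow> nat"

definition LamD :: "nat \<Rightarrow> nat \<Rightarrow> lamD set" where
  "LamD n r = {LBul l | l. l \<in> Lam (n+1) r \<and> l (n+1) \<noteq> 0} \<union>
              {LSgn e l | e l. l \<in> Lam (n+1) r \<and> l (n+1) = 0}"

fun WDpar :: "nat \<Rightarrow> nat \<Rightarrow> lamD \<Rightarrow> (nat \<Rightarrow> nat) set" where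
  "WDpar n r (LBul l) = WBpar n r l \<inter> WD r"
| "WDpar n r (LSgn Plus l) = WBpar n r l"
| "WDpar n r (LSgn Minus l) = (\<lambda>w. sB r r \<circ> w \<circ> sB r r) ` WBpar n r l"

definition lam_br :: "nat \<Rightarrow> (nat \<Rightarrow> nat) \<Rightarrow> sg \<Rightarrow> lamD" where
  "lam_br n l e = (if l (n+1) = 0 then LSgn e l else LBul l)"

definition xD :: "nat \<Rightarrow> nat \<Rightarrow> lamD \<Rightarrow> hecke" where
  "xD n r \<alpha> = (\<Oplus>\<^bsub>HB r\<^esub> w\<in>WDpar n r \<alpha>. Tw r w)"

definition xH :: "nat \<Rightarrow> nat \<Rightarrow> lamD \<Rightarrow> hecke set" where
  "xH n r \<alpha> = {xD n r \<alpha> \<otimes>\<^bsub>HB r\<^esub> h | h. h \<in> HD r}"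

(* The (external) direct sum of the right ideals; LamD n r is finite, so it is the product. *)
definition DS :: "nat \<Rightarrow> nat \<Rightarrow> (lamD \<Rightarrow> hecke) set" where
  "DS n r = (\<Pi>\<^sub>E \<alpha>\<in>LamD n r. xH n r \<alpha>)"

definition ds_zero :: "nat \<Rightarrow> nat \<Rightarrow> lamD \<Rightarrow> hecke" where
  "ds_zero n r = (\<lambda>\<alpha>\<in>LamD n r. \<zero>\<^bsub>HB r\<^esub>)"

definition ds_add :: "nat \<Rightarrow> nat \<Rightarrow> (lamD \<Rightarrow> hecke) \<Rightarrow> (lamD \<Rightarrow> hecke) \<Rightarrow> lamD \<Rightarrow> hecke" where
  "ds_add n r x y = (\<lambda>\<alpha>\<in>LamD n r. x \<alpha> \<oplus>\<^bsub>HB r\<^esub> y \<alpha>)"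

definition ds_act :: "nat \<Rightarrow> nat \<Rightarrow> (lamD \<Rightarrow> hecke) \<Rightarrow> hecke \<Rightarrow> lamD \<Rightarrow> hecke" where
  "ds_act n r x h = (\<lambda>\<alpha>\<in>LamD n r. x \<alpha> \<otimes>\<^bsub>HB r\<^esub> h)"

definition ds_smult :: "nat \<Rightarrow> nat \<Rightarrow> int poly \<Rightarrow> (lamD \<Rightarrow> hecke) \<Rightarrow> lamD \<Rightarrow> hecke" where
  "ds_smult n r c x = (\<lambda>\<alpha>\<in>LamD n r. Hconst r c \<otimes>\<^bsub>HB r\<^esub> x \<alpha>)"

definition ds_inj :: "nat \<Rightarrow> nat \<Rightarrow> lamD \<Rightarrow> hecke \<Rightarrow> lamD \<Rightarrow> hecke" where
  "ds_inj n r \<alpha> x = (\<lambda>\<beta>\<in>LamD n r. if \<beta> = \<alpha> then x else \<zero>\<^bsub>HB r\<^esub>)"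

type_synonym schur = "(lamD \<Rightarrow> hecke) \<Rightarrow> lamD \<Rightarrow> hecke"

(* HD r contains the scalars, so HD r-linear maps are automatically linear over int poly. *)
definition SD :: "nat \<Rightarrow> nat \<Rightarrow> (int poly, schur) module" where
  "SD n r =
    \<lparr>carrier = {f \<in> DS n r \<rightarrow>\<^sub>E DS n r.
        (\<forall>x\<in>DS n r. \<forall>y\<in>DS n r. f (ds_add n r x y) = ds_add n r (f x) (f y)) \<and>
        (\<forall>x\<in>DS n r. \<forall>h\<in>HD r. f (ds_act n r x h) = ds_act n r (f x) h)},
     monoid.mult = (\<lambda>f g. compose (DS n r) f g),
     one = (\<lambda>x\<in>DS n r. x),
     zero = (\<lambda>x\<in>DS n r. ds_zero n r),
     add = (\<lambda>f g. \<lambda>x\<in>DS n r. ds_add n r (f x) (g x)),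
     module.smult = (\<lambda>c f. \<lambda>x\<in>DS n r. ds_smult n r c (f x))\<rparr>"

definition phi_std :: "nat \<Rightarrow> nat \<Rightarrow> lamD \<Rightarrow> lamD \<Rightarrow> (nat \<Rightarrow> nat) \<Rightarrow> schur" where
  "phi_std n r \<alpha> \<beta> d = (THE f. f \<in> carrier (SD n r) \<and>
     (\<forall>\<gamma>\<in>LamD n r. \<forall>h\<in>HD r.
        f (ds_inj n r \<gamma> (xD n r \<gamma> \<otimes>\<^bsub>HB r\<^esub> h)) =
          (if \<beta> = \<gamma>
           then ds_inj n r \<alpha>
                  (\<Oplus>\<^bsub>HB r\<^esub> w\<in>dcoset (WDpar n r \<alpha>) d (WDpar n r \<beta>). Tw r w \<otimes>\<^bsub>HB r\<^esub> h)
           else ds_zero n r)))"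

(* The (unique) minimal length element of the double coset of d. *)
definition min_repD :: "nat \<Rightarrow> nat \<Rightarrow> lamD \<Rightarrow> lamD \<Rightarrow> (nat \<Rightarrow> nat) \<Rightarrow> nat \<Rightarrow> nat" where
  "min_repD n r \<alpha> \<beta> d =
     (ARG_MIN (lenD r) w. w \<in> dcoset (WDpar n r \<alpha>) d (WDpar n r \<beta>))"

type_synonym nmat = "nat \<Rightarrow> nat \<Rightarrow> nat"

definition Xi :: "nat \<Rightarrow> nat \<Rightarrow> nmat set" where
  "Xi n r = {A. (\<forall>i j. \<not> (i \<in> {1..2*n+1} \<and> j \<in> {1..2*n+1}) \<longrightarrow> A i j = 0) \<and>
                (\<forall>i\<in>{1..2*n+1}. \<forall>j\<in>{1..2*n+1}. A i j = A (2*n+2-i) (2*n+2-j)) \<and>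
                (\<Sum>i\<in>{1..2*n+1}. \<Sum>j\<in>{1..2*n+1}. A i j) = 2*r}"

definition ro :: "nat \<Rightarrow> nmat \<Rightarrow> nat \<Rightarrow> nat" where
  "ro n A = (\<lambda>i. \<Sum>j\<in>{1..2*n+1}. A i j)"

definition co :: "nat \<Rightarrow> nmat \<Rightarrow> nat \<Rightarrow> nat" where
  "co n A = (\<lambda>j. \<Sum>i\<in>{1..2*n+1}. A i j)"

definition block :: "(nat \<Rightarrow> nat) \<Rightarrow> nat \<Rightarrow> nat set" where
  "block v i = {(\<Sum>k\<in>{1..<i}. v k)<..(\<Sum>k\<in>{1..i}. v k)}"

definition triple_mat :: "nat \<Rightarrow> (nat \<Rightarrow> nat) \<times> (nat \<Rightarrow> nat) \<times> (nat \<Rightarrow> nat) \<Rightarrow> nmat" where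
  "triple_mat n = (\<lambda>(l, d, m). \<lambda>i j.
     if i \<in> {1..2*n+1} \<and> j \<in> {1..2*n+1}
     then card (block (hat n l) i \<inter> d ` block (hat n m) j) else 0)"

definition triples :: "nat \<Rightarrow> nat \<Rightarrow> ((nat \<Rightarrow> nat) \<times> (nat \<Rightarrow> nat) \<times> (nat \<Rightarrow> nat)) set" where
  "triples n r = {(l, d, m). l \<in> Lam (n+1) r \<and> m \<in> Lam (n+1) r \<and> d \<in> WB r \<and>
     (\<forall>w\<in>dcoset (WBpar n r l) d (WBpar n r m). lenB r d \<le> lenB r w)}"

(* triple_mat n is a bijection from triples n r onto Xi n r; this is its inverse. *)
definition mat_triple :: "nat \<Rightarrow> nat \<Rightarrow> nmat \<Rightarrow> (nat \<Rightarrow> nat) \<times> (nat \<Rightarrow> nat) \<times> (nat \<Rightarrow> nat)" where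
  "mat_triple n r = inv_into (triples n r) (triple_mat n)"

definition sgn_mat :: "nat \<Rightarrow> nmat \<Rightarrow> sg" where
  "sgn_mat n A = (if even (\<Sum>i\<in>{1..n}. \<Sum>j\<in>{n+2..2*n+1}. A i j) then Plus else Minus)"

datatype symD = Dot nmat | Sgn sg nmat sg

primrec sym_mat :: "symD \<Rightarrow> nmat" where
  "sym_mat (Dot A) = A"
| "sym_mat (Sgn e A e') = A"

definition XiD :: "nat \<Rightarrow> nat \<Rightarrow> symD set" where
  "XiD n r = {Dot A | A. A \<in> Xi n r \<and> A (n+1) (n+1) \<noteq> 0} \<union>
             {Sgn e A e' | e A e'. A \<in> Xi n r \<and> A (n+1) (n+1) = 0 \<and> sg_mult e e' = sgn_mat n A}"

primrec phi :: "nat \<Rightarrow> nat \<Rightarrow> symD \<Rightarrow> schur" where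
  "phi n r (Dot A) =
    (let (l, dA, m) = mat_triple n r A;
         \<alpha> = LBul l; \<beta> = LBul m;
         d = (if dA \<in> WD r then dA else sB r r \<circ> dA)
     in phi_std n r \<alpha> \<beta> (min_repD n r \<alpha> \<beta> d))"
| "phi n r (Sgn e A e') =
    (let (l, dA, m) = mat_triple n r A;
         \<alpha> = lam_br n l e; \<beta> = lam_br n m e';
         d = s_pow r e \<circ> dA \<circ> s_pow r e'
     in phi_std n r \<alpha> \<beta> (min_repD n r \<alpha> \<beta> d))"

definition Eth :: "nat \<Rightarrow> nat \<Rightarrow> nat \<Rightarrow> nmat" where
  "Eth n i j = (\<lambda>k l. of_bool (k = i \<and> l = j) + of_bool (k = 2*n+2-i \<and> l = 2*n+2-j))"

definition diag :: "(nat \<Rightarrow> nat) \<Rightarrow> nmat" where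
  "diag v = (\<lambda>i j. if i = j then v i else 0)"

(* The matrix A + E^theta_{h,p} - E^theta_{h+1,p}.  For A in Xi n r, h in {1..n} and
   A (h+1) p > 0 the subtraction on nat is exact: by symmetry A (n+1) (n+1) is even, hence at
   least 2 when h = n and p = n + 1. *)
definition shift :: "nat \<Rightarrow> nat \<Rightarrow> nmat \<Rightarrow> nat \<Rightarrow> nmat" where
  "shift n h A p = (\<lambda>i j. A i j + Eth n h p i j - Eth n (h+1) p i j)"

definition gcf :: "nat \<Rightarrow> nat \<Rightarrow> nmat \<Rightarrow> nat \<Rightarrow> int poly" where
  "gcf n h A p = (if A (h+1) p > 0
     then qq ^ (\<Sum>j\<in>{p<..2*n+1}. A h j) * qint (A h p + 1) else 0)"

(* A scalar multiple c f in which a zero coefficient annihilates the term even if f is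
   meaningless (such as phi of a matrix which would have a negative entry). *)
definition term_SD :: "nat \<Rightarrow> nat \<Rightarrow> int poly \<Rightarrow> schur \<Rightarrow> schur" where
  "term_SD n r c f = (if c = 0 then \<zero>\<^bsub>SD n r\<^esub> else c \<odot>\<^bsub>SD n r\<^esub> f)"

end

theory Submission imports Defs
begin

text \<open>A homomorphism out of a summand is determined by the image of its generator \<open>xD n r \<beta>\<close>, and both
factors of the product are, on the summands where they live, left multiplications by elements of
the generic algebra.  So the theorem is an identity between two elements of that algebra: on one
side an element \<open>y\<close> representing \<open>phi n r (Dot B)\<close>, times the sum of \<open>Tw r w\<close> over the double coset
of \<open>A\<close>; on the other side a combination of the sums over the double cosets of the shifted matrices.
The predicate \<open>reps\<close> and the lemmas \<open>reps_mult\<close> and \<open>reps_unique\<close> carry out this reduction.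

The matrix of a double coset of Young subgroups is a joint count: \<open>cnt r b c w i j\<close> is the number of
points of column block \<open>j\<close> that \<open>w\<close> sends to row block \<open>i\<close>.  It is a complete invariant
(\<open>cnt_orbit\<close>) and takes all admissible values (\<open>cnt_exists\<close>), because both statements say that two
families of fibres with equal sizes can be matched compatibly with the mirror symmetry of
\<open>{1..2*r}\<close>.  Hence the sum over a double coset is the sum over all \<open>w\<close> with a given matrix.

Since \<open>B\<close> is diagonal up to one unit and its mirror image, the element \<open>y\<close> can be chosen as a sum
of chains \<open>Y = 1 + T\<^sub>c\<^sub>-\<^sub>1 + T\<^sub>c\<^sub>-\<^sub>2 T\<^sub>c\<^sub>-\<^sub>1 + \<dots>\<close> with one summand for each point of the
row block \<open>h\<close> (\<open>phi_move\<close>).  Multiplying a sum over \<open>w\<close> by one chain produces correction terms with the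
coefficient \<open>qq - 1\<close>; adding up all chains, they telescope to pure powers of \<open>qq\<close>
(\<open>Gop_formula\<close>, \<open>Gop_sum\<close>).  Each resulting term moves one point from the row block \<open>h + 1\<close> to the
row block \<open>h\<close>, and \<open>p\<close> is the column block of that point; summed over the \<open>A h p + 1\<close> points that
could have been moved, the powers give exactly \<open>gcf n h A p\<close> (\<open>move_coefficient\<close>).  This is \<open>Ysum_TS\<close>.

It remains to see how a double coset of \<open>WB r\<close> meets the even subgroup.  If the central entry is not
zero, the intersection is a single double coset, since the row group shares an odd element with a
conjugate of the column group (\<open>dcoset_central\<close>).  If the central entry is zero but the middle
blocks of rows and columns are not empty, the intersection splits in two, and the parity \<open>lsign\<close> of
the entries in the first half of the middle row block that come from the right half of the columns
tells the halves apart (\<open>lsign_Yg\<close>, \<open>dcoset_signed\<close>).  Moving a point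
changes \<open>lsign\<close> only if it comes from the middle row block and from the right half, that is, for
\<open>h = n\<close> and \<open>p > n + 1\<close> (\<open>lsign_move\<close>): this is the exchange of signs in the second part of the
theorem.  When the central entry drops from two to zero both halves occur, which gives the two
extra terms of the first part.\<close>

section \<open>The generic algebra as a quotient of the free algebra\<close>

lemma free_mult_split:
  "(f \<otimes>\<^bsub>free_alg r\<^esub> g) u = (\<Sum>k\<le>length u. f (take k u) * g (drop k u))"
  by (simp add: free_alg_def)

lemma free_mult_nz:
  assumes "(f \<otimes>\<^bsub>free_alg r\<^esub> g) u \<noteq> 0"
  obtains a b where "u = a @ b" "f a \<noteq> 0" "g b \<noteq> 0"
proof -
  obtain k where "f (take k u) * g (drop k u) \<noteq> 0"
    using assms unfolding free_mult_split by (meson sum.neutral)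
  then show ?thesis
    using that[of "take k u" "drop k u"] by auto
qed

lemma free_mult_closed:
  assumes "f \<in> carrier (free_alg r)" "g \<in> carrier (free_alg r)"
  shows "f \<otimes>\<^bsub>free_alg r\<^esub> g \<in> carrier (free_alg r)"
proof -
  have "{u. (f \<otimes>\<^bsub>free_alg r\<^esub> g) u \<noteq> 0} \<subseteq> (\<lambda>(a,b). a @ b) ` ({u. f u \<noteq> 0} \<times> {u. g u \<noteq> 0})"
    by (auto elim!: free_mult_nz)
  moreover have "finite ({u. f u \<noteq> 0} \<times> {u. g u \<noteq> 0})"
    using assms by (auto simp: free_alg_def)
  ultimately have "finite {u. (f \<otimes>\<^bsub>free_alg r\<^esub> g) u \<noteq> 0}"
    by (meson finite_imageI finite_subset)
  moreover have "set u \<subseteq> {1..r}" if "(f \<otimes>\<^bsub>free_alg r\<^esub> g) u \<noteq> 0" for u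
  proof -
    obtain a b where u: "u = a @ b" and "f a \<noteq> 0" "g b \<noteq> 0"
      using free_mult_nz \<open>(f \<otimes>\<^bsub>free_alg r\<^esub> g) u \<noteq> 0\<close> by blast
    then have "set a \<subseteq> {1..r}" "set b \<subseteq> {1..r}"
      using assms by (auto simp: free_alg_def)
    then show ?thesis by (simp add: u)
  qed
  ultimately show ?thesis
    by (simp add: free_alg_def)
qed

lemma free_mult_assoc:
  "(f \<otimes>\<^bsub>free_alg r\<^esub> g) \<otimes>\<^bsub>free_alg r\<^esub> h = f \<otimes>\<^bsub>free_alg r\<^esub> (g \<otimes>\<^bsub>free_alg r\<^esub> h)"
proof
  fix u :: "nat list"
  define n where "n = length u"
  let ?t = "\<lambda>l k. f (take l u) * g (drop l (take k u)) * h (drop k u)"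
  have "((f \<otimes>\<^bsub>free_alg r\<^esub> g) \<otimes>\<^bsub>free_alg r\<^esub> h) u = (\<Sum>k\<le>n. \<Sum>l\<le>k. ?t l k)"
    unfolding free_mult_split n_def
    by (intro sum.cong refl) (auto simp: sum_distrib_right min_def intro!: sum.cong)
  also have "\<dots> = (\<Sum>l\<le>n. \<Sum>k=l..n. ?t l k)"
  proof -
    have "{..k} = {l \<in> {..n}. l \<le> k}" if "k \<le> n" for k using that by auto
    moreover have "{l..n} = {k \<in> {..n}. l \<le> k}" for l by auto
    ultimately show ?thesis
      using sum.swap_restrict[of "{..n}" "{..n}" "\<lambda>k l. ?t l k" "\<lambda>k l. l \<le> k"] by simp
  qed
  also have "\<dots> = (\<Sum>l\<le>n. \<Sum>k\<le>n-l. ?t l (l+k))"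
  proof (rule sum.cong[OF refl])
    fix l assume "l \<in> {..n}"
    then have "{l..n} = (\<lambda>k. l + k) ` {..n-l}"
      using image_add_atLeastAtMost[of l 0 "n-l"] by (simp add: atLeast0AtMost)
    then show "(\<Sum>k=l..n. ?t l k) = (\<Sum>k\<le>n-l. ?t l (l+k))"
      by (simp add: sum.reindex)
  qed
  also have "\<dots> = (f \<otimes>\<^bsub>free_alg r\<^esub> (g \<otimes>\<^bsub>free_alg r\<^esub> h)) u"
    unfolding free_mult_split n_def
    by (intro sum.cong refl) (auto simp: sum_distrib_left drop_take add.commute mult.assoc intro!: sum.cong)
  finally show "((f \<otimes>\<^bsub>free_alg r\<^esub> g) \<otimes>\<^bsub>free_alg r\<^esub> h) u = (f \<otimes>\<^bsub>free_alg r\<^esub> (g \<otimes>\<^bsub>free_alg r\<^esub> h)) u" .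
qed

lemma mon_mult_left: "(mon c v \<otimes>\<^bsub>free_alg r\<^esub> f) u = (if take (length v) u = v then c * f (drop (length v) u) else 0)"
proof -
  have *: "mon c v (take k u) * f (drop k u) =
     (if k = length v then (if take (length v) u = v then c * f (drop (length v) u) else 0) else 0)"
    if "k \<in> {..length u}" for k
    using that by (auto simp: mon_def)
  have "(mon c v \<otimes>\<^bsub>free_alg r\<^esub> f) u =
    (\<Sum>k\<le>length u. if k = length v then (if take (length v) u = v then c * f (drop (length v) u) else 0) else 0)"
    unfolding free_mult_split by (intro sum.cong refl *)
  also have "\<dots> = (if take (length v) u = v then c * f (drop (length v) u) else 0)"
    by (auto simp: min_def split: if_splits)
  finally show ?thesis .
qed

lemma mon_mult_const_right: "(f \<otimes>\<^bsub>free_alg r\<^esub> mon c []) u = c * f u"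
proof -
  have *: "f (take k u) * mon c [] (drop k u) = (if k = length u then c * f u else 0)"
    if "k \<in> {..length u}" for k
    using that by (auto simp: mon_def)
  have "(f \<otimes>\<^bsub>free_alg r\<^esub> mon c []) u = (\<Sum>k\<le>length u. if k = length u then c * f u else 0)"
    unfolding free_mult_split by (intro sum.cong refl *)
  then show ?thesis by simp
qed

lemma mon_closed: "set v \<subseteq> {1..r} \<Longrightarrow> mon c v \<in> carrier (free_alg r)"
  by (auto simp: free_alg_def mon_def split: if_splits)

lemma mon_mult_mon: "mon c u \<otimes>\<^bsub>free_alg r\<^esub> mon d v = mon (c * d) (u @ v)"
  apply (rule ext)
  apply (simp add: mon_mult_left)
  apply (auto simp: mon_def)
  by (metis append_take_drop_id)

lemma free_alg_one: "\<one>\<^bsub>free_alg r\<^esub> = mon 1 []"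
  by (auto simp: free_alg_def mon_def)

lemma free_alg_ring: "ring (free_alg r)"
proof (rule ringI)
  show "abelian_group (free_alg r)"
  proof (rule abelian_groupI)
    fix x y assume "x \<in> carrier (free_alg r)" "y \<in> carrier (free_alg r)"
    then have "finite ({u. x u \<noteq> 0} \<union> {u. y u \<noteq> 0})" and
      *: "\<forall>u. x u \<noteq> 0 \<longrightarrow> set u \<subseteq> {1..r}" "\<forall>u. y u \<noteq> 0 \<longrightarrow> set u \<subseteq> {1..r}"
      by (auto simp: free_alg_def)
    then have "finite {u. x u + y u \<noteq> 0}"
      by (rule_tac finite_subset[of _ "{u. x u \<noteq> 0} \<union> {u. y u \<noteq> 0}"]) auto
    then show "x \<oplus>\<^bsub>free_alg r\<^esub> y \<in> carrier (free_alg r)"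
      using * by (simp add: free_alg_def) (metis add_cancel_right_right)
  next
    fix x assume x: "x \<in> carrier (free_alg r)"
    then have "(\<lambda>u. - x u) \<in> carrier (free_alg r)"
      by (auto simp: free_alg_def)
    moreover have "(\<lambda>u. - x u) \<oplus>\<^bsub>free_alg r\<^esub> x = \<zero>\<^bsub>free_alg r\<^esub>"
      by (simp add: free_alg_def)
    ultimately show "\<exists>y\<in>carrier (free_alg r). y \<oplus>\<^bsub>free_alg r\<^esub> x = \<zero>\<^bsub>free_alg r\<^esub>"
      by blast
  qed (auto simp: free_alg_def algebra_simps)
  show "monoid (free_alg r)"
  proof (rule monoidI)
    show "\<one>\<^bsub>free_alg r\<^esub> \<in> carrier (free_alg r)"
      unfolding free_alg_one by (rule mon_closed) simp
    fix x assume "x \<in> carrier (free_alg r)"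
    show "\<one>\<^bsub>free_alg r\<^esub> \<otimes>\<^bsub>free_alg r\<^esub> x = x"
      by (rule ext) (simp add: free_alg_one mon_mult_left)
    show "x \<otimes>\<^bsub>free_alg r\<^esub> \<one>\<^bsub>free_alg r\<^esub> = x"
      by (rule ext) (simp add: free_alg_one mon_mult_const_right)
  qed (auto simp: free_mult_closed free_mult_assoc)
qed (auto simp: free_alg_def algebra_simps sum.distrib)

text \<open>For \<open>r = 1\<close> the braid relator of length four would involve the letter \<open>0\<close>.\<close>

lemma relators_carrier:
  assumes "2 \<le> r"
  shows "relators r \<subseteq> carrier (free_alg r)"
proof -
  have diff: "(\<lambda>v. f v - g v) \<in> carrier (free_alg r)"
    if "f \<in> carrier (free_alg r)" "g \<in> carrier (free_alg r)" for f g
  proof -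
    have "finite {u. f u - g u \<noteq> 0}"
      using that by (rule_tac finite_subset[of _ "{u. f u \<noteq> 0} \<union> {u. g u \<noteq> 0}"])
        (auto simp: free_alg_def)
    then show ?thesis
      using that by (auto simp: free_alg_def) (metis atLeastAtMost_iff diff_self subset_eq)+
  qed
  have plus: "(\<lambda>v. f v + g v) \<in> carrier (free_alg r)"
    if "f \<in> carrier (free_alg r)" "g \<in> carrier (free_alg r)" for f g
    using abelian_monoid.a_closed[OF _ that] free_alg_ring[of r]
    by (simp add: free_alg_def ring_def abelian_group_def)
  show ?thesis
    using assms unfolding relators_def
    by (auto intro!: diff plus mon_closed)
qed

lemma rel_ideal_ideal: "2 \<le> r \<Longrightarrow> ideal (rel_ideal r) (free_alg r)"
  unfolding rel_ideal_def
  by (intro ring.genideal_ideal free_alg_ring relators_carrier)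

lemma HB_ring: "2 \<le> r \<Longrightarrow> ring (HB r)"
  unfolding HB_def by (intro ideal.quotient_is_ring rel_ideal_ideal)

lemma Hclass_hom: "2 \<le> r \<Longrightarrow> ring_hom_ring (free_alg r) (HB r) (Hclass r)"
  unfolding HB_def Hclass_def by (intro ideal.rcos_ring_hom_ring rel_ideal_ideal)

context
  fixes r :: nat
  assumes r2: "2 \<le> r"
begin

interpretation F: ring "free_alg r" by (rule free_alg_ring)
interpretation H: ring "HB r" by (rule HB_ring[OF r2])
interpretation C: ring_hom_ring "free_alg r" "HB r" "Hclass r" by (rule Hclass_hom[OF r2])

lemma HB_carrierE:
  assumes "x \<in> carrier (HB r)"
  obtains f where "f \<in> carrier (free_alg r)" "x = Hclass r f"
  using assms unfolding HB_def FactRing_def Hclass_def A_RCOSETS_def RCOSETS_def a_r_coset_def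
  by auto

lemma Hconst_closed [simp]: "Hconst r c \<in> carrier (HB r)"
  unfolding Hconst_def by (intro C.hom_closed mon_closed) simp

lemma Hconst_central:
  assumes "x \<in> carrier (HB r)"
  shows "x \<otimes>\<^bsub>HB r\<^esub> Hconst r c = Hconst r c \<otimes>\<^bsub>HB r\<^esub> x"
proof -
  obtain f where f: "f \<in> carrier (free_alg r)" "x = Hclass r f"
    using assms by (rule HB_carrierE)
  have m: "mon c [] \<in> carrier (free_alg r)" by (rule mon_closed) simp
  have "f \<otimes>\<^bsub>free_alg r\<^esub> mon c [] = mon c [] \<otimes>\<^bsub>free_alg r\<^esub> f"
    by (rule ext) (simp add: mon_mult_left mon_mult_const_right)
  then show ?thesis
    using f m unfolding Hconst_def by (metis C.hom_mult)
qed

lemma Hconst_mult: "Hconst r (c * d) = Hconst r c \<otimes>\<^bsub>HB r\<^esub> Hconst r d"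
proof -
  have "mon (c * d) [] = mon c [] \<otimes>\<^bsub>free_alg r\<^esub> mon d []" by (simp add: mon_mult_mon)
  then show ?thesis
    unfolding Hconst_def by (simp add: C.hom_mult mon_closed)
qed

lemma Hconst_add: "Hconst r (c + d) = Hconst r c \<oplus>\<^bsub>HB r\<^esub> Hconst r d"
proof -
  have "mon (c + d) [] = mon c [] \<oplus>\<^bsub>free_alg r\<^esub> mon d []"
    by (auto simp: mon_def free_alg_def)
  then show ?thesis
    unfolding Hconst_def by (simp add: C.hom_add mon_closed)
qed

lemma Hconst_1 [simp]: "Hconst r 1 = \<one>\<^bsub>HB r\<^esub>"
  unfolding Hconst_def using C.hom_one by (simp add: free_alg_one)

lemma Hconst_0 [simp]: "Hconst r 0 = \<zero>\<^bsub>HB r\<^esub>"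
proof -
  have "mon 0 [] = \<zero>\<^bsub>free_alg r\<^esub>"
    by (auto simp: mon_def free_alg_def)
  then show ?thesis unfolding Hconst_def by simp
qed

lemma Tgen_closed [simp]: "i \<in> {1..r} \<Longrightarrow> Tgen r i \<in> carrier (HB r)"
  unfolding Tgen_def by (intro C.hom_closed mon_closed) simp

lemma relatorsI:
  shows "i \<in> {1..r} \<Longrightarrow> j \<in> {1..r} \<Longrightarrow> i + 2 \<le> j \<or> j + 2 \<le> i \<Longrightarrow>
      (\<lambda>v. mon 1 [i,j] v - mon 1 [j,i] v) \<in> relators r"
    and "1 \<le> j \<Longrightarrow> j < r - 1 \<Longrightarrow>
      (\<lambda>v. mon 1 [j,j+1,j] v - mon 1 [j+1,j,j+1] v) \<in> relators r"
    and "(\<lambda>v. mon 1 [r-1,r,r-1,r] v - mon 1 [r,r-1,r,r-1] v) \<in> relators r"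
    and "1 \<le> i \<Longrightarrow> i < r \<Longrightarrow>
      (\<lambda>v. mon 1 [i,i] v - (mon (qq - 1) [i] v + mon qq [] v)) \<in> relators r"
    and "(\<lambda>v. mon 1 [r,r] v - mon 1 [] v) \<in> relators r"
  unfolding relators_def
      apply (rule UnI1, rule UnI1, rule UnI1, rule UnI1, rule CollectI, rule exI, rule exI, rule conjI, rule refl, simp)
     apply (rule UnI1, rule UnI1, rule UnI1, rule UnI2, rule CollectI, rule exI, rule conjI, rule refl, simp)
    apply (rule UnI1, rule UnI1, rule UnI2, rule singletonI)
   apply (rule UnI1, rule UnI2, rule CollectI, rule exI, rule conjI, rule refl, simp)
  apply (rule UnI2, rule singletonI)
  done

lemma Hclass_eqI:
  assumes "f \<in> carrier (free_alg r)" "g \<in> carrier (free_alg r)" "(\<lambda>v. f v - g v) \<in> relators r"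
  shows "Hclass r f = Hclass r g"
proof -
  interpret I: ideal "rel_ideal r" "free_alg r" by (rule rel_ideal_ideal[OF r2])
  have "(\<lambda>v. f v - g v) \<in> rel_ideal r"
    unfolding rel_ideal_def by (rule subsetD[OF F.genideal_self[OF relators_carrier[OF r2]]]) (rule assms)
  moreover have "f = (\<lambda>v. f v - g v) \<oplus>\<^bsub>free_alg r\<^esub> g"
    by (simp add: free_alg_def)
  ultimately have "f \<in> rel_ideal r +>\<^bsub>free_alg r\<^esub> g"
    unfolding a_r_coset_def' by blast
  then show ?thesis
    unfolding Hclass_def
    by (rule F.a_repr_independence[OF _ assms(2) I.a_subgroup, symmetric])
qed

lemma Hclass_mon_Cons:
  assumes "i \<in> {1..r}" "set v \<subseteq> {1..r}"
  shows "Hclass r (mon c (i # v)) = Tgen r i \<otimes>\<^bsub>HB r\<^esub> Hclass r (mon c v)"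
proof -
  have "mon c (i # v) = mon 1 [i] \<otimes>\<^bsub>free_alg r\<^esub> mon c v" by (simp add: mon_mult_mon)
  then show ?thesis
    unfolding Tgen_def using assms by (simp add: C.hom_mult mon_closed)
qed

lemma Hclass_mon_Nil: "Hclass r (mon c []) = Hconst r c"
  by (simp add: Hconst_def)

lemma Tgen_commute:
  assumes "i \<in> {1..r}" "j \<in> {1..r}" "i + 2 \<le> j \<or> j + 2 \<le> i"
  shows "Tgen r i \<otimes>\<^bsub>HB r\<^esub> Tgen r j = Tgen r j \<otimes>\<^bsub>HB r\<^esub> Tgen r i"
proof -
  have "Hclass r (mon 1 [i,j]) = Hclass r (mon 1 [j,i])"
    by (rule Hclass_eqI[OF _ _ relatorsI(1)]) (use assms r2 in \<open>auto intro!: mon_closed\<close>)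
  then show ?thesis
    using assms by (simp add: Hclass_mon_Cons Hclass_mon_Nil)
qed

lemma Tgen_braid3:
  assumes "1 \<le> j" "j < r - 1"
  shows "Tgen r j \<otimes>\<^bsub>HB r\<^esub> (Tgen r (j+1) \<otimes>\<^bsub>HB r\<^esub> Tgen r j) =
         Tgen r (j+1) \<otimes>\<^bsub>HB r\<^esub> (Tgen r j \<otimes>\<^bsub>HB r\<^esub> Tgen r (j+1))"
proof -
  have "Hclass r (mon 1 [j,j+1,j]) = Hclass r (mon 1 [j+1,j,j+1])" "Suc j \<le> r" "j \<le> r"
    subgoal by (rule Hclass_eqI[OF _ _ relatorsI(2)]) (use assms r2 in \<open>auto intro!: mon_closed\<close>)
    using assms by auto
  then show ?thesis
    using assms by (simp add: Hclass_mon_Cons Hclass_mon_Nil less_diff_conv)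
qed

lemma Tgen_braid4:
  "Tgen r (r-1) \<otimes>\<^bsub>HB r\<^esub> (Tgen r r \<otimes>\<^bsub>HB r\<^esub> (Tgen r (r-1) \<otimes>\<^bsub>HB r\<^esub> Tgen r r)) =
   Tgen r r \<otimes>\<^bsub>HB r\<^esub> (Tgen r (r-1) \<otimes>\<^bsub>HB r\<^esub> (Tgen r r \<otimes>\<^bsub>HB r\<^esub> Tgen r (r-1)))"
proof -
  have "Hclass r (mon 1 [r-1,r,r-1,r]) = Hclass r (mon 1 [r,r-1,r,r-1])"
    by (rule Hclass_eqI[OF _ _ relatorsI(3)]) (use r2 in \<open>auto intro!: mon_closed\<close>)
  then show ?thesis
    using r2 by (simp add: Hclass_mon_Cons Hclass_mon_Nil)
qed

lemma Tgen_square_last: "Tgen r r \<otimes>\<^bsub>HB r\<^esub> Tgen r r = \<one>\<^bsub>HB r\<^esub>"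
proof -
  have "Hclass r (mon 1 [r,r]) = Hclass r (mon 1 [])"
    by (rule Hclass_eqI[OF _ _ relatorsI(5)]) (use r2 in \<open>auto intro!: mon_closed\<close>)
  then show ?thesis
    using r2 by (simp add: Hclass_mon_Cons Hclass_mon_Nil)
qed

lemma Tgen_square:
  assumes "1 \<le> i" "i < r"
  shows "Tgen r i \<otimes>\<^bsub>HB r\<^esub> Tgen r i =
    Hconst r (qq - 1) \<otimes>\<^bsub>HB r\<^esub> Tgen r i \<oplus>\<^bsub>HB r\<^esub> Hconst r qq"
proof -
  have m: "mon (qq - 1) [i] \<in> carrier (free_alg r)" "mon qq [] \<in> carrier (free_alg r)"
    using assms by (auto intro!: mon_closed)
  have "Hclass r (mon 1 [i,i]) = Hclass r (\<lambda>v. mon (qq - 1) [i] v + mon qq [] v)"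
  proof (rule Hclass_eqI[OF _ _ relatorsI(4)])
    show "(\<lambda>v. mon (qq - 1) [i] v + mon qq [] v) \<in> carrier (free_alg r)"
      using F.a_closed[OF m] by (simp add: free_alg_def)
  qed (use assms in \<open>auto intro!: mon_closed\<close>)
  also have "(\<lambda>v. mon (qq - 1) [i] v + mon qq [] v) = mon (qq - 1) [i] \<oplus>\<^bsub>free_alg r\<^esub> mon qq []"
    by (simp add: free_alg_def)
  also have "Hclass r \<dots> = Hclass r (mon (qq - 1) [i]) \<oplus>\<^bsub>HB r\<^esub> Hclass r (mon qq [])"
    using m by (rule C.hom_add)
  finally show ?thesis
    using assms by (simp add: Hclass_mon_Cons Hclass_mon_Nil Hconst_central)
qed

end

section \<open>Signed permutations: length, descents and parity\<close>

text \<open>The inverse of a permutation as a function, as opposed to inverses in a group structure.\<close>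

abbreviation pinv :: "('a \<Rightarrow> 'b) \<Rightarrow> 'b \<Rightarrow> 'a" where
  "pinv \<equiv> inv_into UNIV"

lemma WB_permutes: "w \<in> WB r \<Longrightarrow> w permutes {1..2*r}"
  by (simp add: WB_def)

lemma WB_range:
  assumes "w \<in> WB r" "x \<in> {1..2*r}"
  shows "w x \<in> {1..2*r}"
  using permutes_in_image[OF WB_permutes[OF assms(1)]] assms(2) by blast

lemma WB_mirror:
  assumes "w \<in> WB r" "x \<in> {1..2*r}"
  shows "w (2*r+1-x) = 2*r+1 - w x"
proof -
  have "w x + w (2*r+1-x) = 2*r+1"
    using assms by (simp add: WB_def)
  then show ?thesis by linarith
qed

lemma WBI:
  assumes "w permutes {1..2*r}" "\<And>x. x \<in> {1..2*r} \<Longrightarrow> w (2*r+1-x) = 2*r+1 - w x"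
  shows "w \<in> WB r"
proof -
  have "w x + w (2*r+1-x) = 2*r+1" if x: "x \<in> {1..2*r}" for x
  proof -
    have "w x \<in> {1..2*r}"
      using permutes_in_image[OF assms(1)] x by simp
    then show ?thesis using assms(2)[OF x] by simp
  qed
  then show ?thesis using assms(1) by (simp add: WB_def)
qed

lemma WB_inj: "w \<in> WB r \<Longrightarrow> w x = w y \<longleftrightarrow> x = y"
  using permutes_inj[OF WB_permutes] by (auto simp: inj_def)

lemma WB_inv_apply:
  assumes "w \<in> WB r" shows "pinv w (w x) = x" "w (pinv w x) = x"
  using permutes_inverses[OF WB_permutes[OF assms]] by auto

lemma WB_inv_eq_iff: "w \<in> WB r \<Longrightarrow> pinv w x = y \<longleftrightarrow> w y = x"
  using WB_inv_apply[of w r] by auto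

lemma WB_id [simp]: "id \<in> WB r"
  by (rule WBI) (auto simp: permutes_id)

lemma WB_comp:
  assumes "u \<in> WB r" "w \<in> WB r" shows "u \<circ> w \<in> WB r"
proof (rule WBI)
  show "u \<circ> w permutes {1..2*r}"
    using assms by (intro permutes_compose WB_permutes)
  fix x assume "x \<in> {1..2*r}"
  then show "(u \<circ> w) (2*r+1-x) = 2*r+1 - (u \<circ> w) x"
    using assms WB_mirror[of w r x] WB_mirror[of u r "w x"] WB_range[of w r x] by simp
qed

lemma WB_inv:
  assumes "w \<in> WB r" shows "pinv w \<in> WB r"
proof (rule WBI)
  show p: "pinv w permutes {1..2*r}"
    using assms by (intro permutes_inv WB_permutes)
  fix x assume "x \<in> {1..2*r}"
  then have "pinv w x \<in> {1..2*r}" using permutes_in_image[OF p] by simp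
  then have "w (2*r+1 - pinv w x) = 2*r+1-x"
    using WB_mirror[OF assms, of "pinv w x"] by (simp add: WB_inv_apply[OF assms])
  then show "pinv w (2*r+1-x) = 2*r+1 - pinv w x"
    by (simp add: WB_inv_eq_iff[OF assms])
qed

lemma WB_inv_inv: "w \<in> WB r \<Longrightarrow> pinv (pinv w) = w"
  by (intro inv_inv_eq permutes_bij[OF WB_permutes])

lemma WB_inv_comp: "u \<in> WB r \<Longrightarrow> w \<in> WB r \<Longrightarrow> pinv (u \<circ> w) = pinv w \<circ> pinv u"
  by (intro o_inv_distrib permutes_bij[OF WB_permutes])

lemma WB_comp_inv [simp]:
  assumes "w \<in> WB r" shows "w \<circ> pinv w = id" "pinv w \<circ> w = id"
  by (simp_all add: fun_eq_iff WB_inv_apply[OF assms])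

lemma WB_inv_range: "w \<in> WB r \<Longrightarrow> x \<in> {1..2*r} \<Longrightarrow> pinv w x \<in> {1..2*r}"
  using WB_range WB_inv by blast

lemma WB_outside: "w \<in> WB r \<Longrightarrow> x \<notin> {1..2*r} \<Longrightarrow> w x = x"
  using permutes_not_in[OF WB_permutes] by blast

lemma finite_WB: "finite (WB r)"
  by (rule finite_subset[OF _ finite_permutations[of "{1..2*r}"]]) (auto simp: WB_def)

lemma WB_eqI:
  assumes "w \<in> WB r" "v \<in> WB r" "\<And>x. x \<in> {1..r} \<Longrightarrow> w x = v x"
  shows "w = v"
proof
  fix x
  consider "x \<in> {1..r}" | "x \<in> {r+1..2*r}" | "x \<notin> {1..2*r}" by fastforce
  then show "w x = v x"
  proof cases
    case 2
    then have "2*r+1-x \<in> {1..r}" by auto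
    with 2 assms show ?thesis
      using WB_mirror[of w r "2*r+1-x"] WB_mirror[of v r "2*r+1-x"] by auto
  next
    case 1
    then show ?thesis by (rule assms(3))
  next
    case 3
    then show ?thesis
      using WB_outside[OF assms(1)] WB_outside[OF assms(2)] by simp
  qed
qed

lemma sB_apply:
  assumes "i \<in> {1..r}"
  shows "sB r i x = (if x = i then i+1 else if x = i+1 then i
     else if x = 2*r-i then 2*r+1-i else if x = 2*r+1-i then 2*r-i else x)"
proof -
  obtain j where j: "2*r = i + j" "i \<le> j"
    using assms le_Suc_ex[of i "2*r"] by auto
  have "j \<noteq> Suc i" using j(1) by presburger
  moreover have "2*r - i = j" "2*r + 1 - i = j + 1" using j by simp_all
  moreover have "i = r \<longleftrightarrow> j = i" "i \<le> r" using j assms by auto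
  ultimately show ?thesis
    using j unfolding sB_def by (auto simp: transpose_def)
qed

text \<open>The second swapped pair is written $(j,j+1)$ with $i+j=2r$, which keeps truncated
  subtraction out of the case distinctions.\<close>

lemma sB_pairE:
  assumes "i \<in> {1..r}"
  obtains j where "i + j = 2*r" "i \<le> j" "j \<noteq> i + 1" "i = r \<longleftrightarrow> j = i"
    "\<And>x. sB r i x = (if x = i then i+1 else if x = i+1 then i
     else if x = j then j+1 else if x = j+1 then j else x)"
proof -
  have j: "i + (2*r - i) = 2*r" "i \<le> 2*r - i" using assms by auto
  have "i + (i + 1) \<noteq> 2*r" by presburger
  then have neq: "2*r - i \<noteq> i + 1" using j by metis
  have iff: "i = r \<longleftrightarrow> 2*r-i = i" using assms by auto
  have "2*r+1-i = (2*r-i)+1" using j by simp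
  then have "sB r i x = (if x = i then i+1 else if x = i+1 then i
     else if x = 2*r-i then (2*r-i)+1 else if x = (2*r-i)+1 then 2*r-i else x)" for x
    using sB_apply[OF assms, of x] by (simp only:)
  then show ?thesis by (rule that[OF j neq iff])
qed

lemma sB_WB:
  assumes i: "i \<in> {1..r}"
  shows "sB r i \<in> WB r"
proof -
  have "sB r i permutes {1..2*r}"
  proof (cases "i < r")
    case True
    have "transpose i (i+1) \<circ> transpose (2*r-i) (2*r+1-i) permutes {1..2*r}"
      by (rule permutes_compose; rule permutes_swap_id) (use i in auto)
    then show ?thesis using True by (simp add: sB_def)
  next
    case False
    have "transpose r (r+1) permutes {1..2*r}"
      by (rule permutes_swap_id) (use i in auto)
    then show ?thesis using False by (simp add: sB_def)
  qed
  moreover have "sB r i x + sB r i (2*r+1-x) = 2*r+1" if "x \<in> {1..2*r}" for x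
  proof -
    obtain j where j: "i + j = 2*r" "i \<le> j" "j \<noteq> i + 1" "i = r \<longleftrightarrow> j = i"
      "\<And>x. sB r i x = (if x = i then i+1 else if x = i+1 then i
       else if x = j then j+1 else if x = j+1 then j else x)"
      by (rule sB_pairE[OF i]) (rule that)
    define y where "y = 2*r+1-x"
    then have y: "x + y = i + j + 1" "2*r+1-x = y"
      using that j(1) by auto
    have "sB r i x + sB r i y = i + j + 1"
      unfolding j(5) using y(1) j(2,3) by auto
    then show ?thesis using y(2) j(1) by simp
  qed
  ultimately show ?thesis by (simp add: WB_def)
qed

lemma sB_sB [simp]: "i \<in> {1..r} \<Longrightarrow> sB r i (sB r i x) = x"
  by (erule sB_pairE) simp

lemma sB_comp_sB [simp]: "i \<in> {1..r} \<Longrightarrow> sB r i \<circ> (sB r i \<circ> w) = w"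
  by (auto simp: fun_eq_iff)

lemma sB_comp_self [simp]: "i \<in> {1..r} \<Longrightarrow> sB r i \<circ> sB r i = id"
  by (auto simp: fun_eq_iff)

lemma inv_sB: "i \<in> {1..r} \<Longrightarrow> pinv (sB r i) = sB r i"
  by (rule inv_unique_comp) auto

lemma inv_sB_comp: "i \<in> {1..r} \<Longrightarrow> w \<in> WB r \<Longrightarrow> pinv (sB r i \<circ> w) x = pinv w (sB r i x)"
  by (simp add: WB_inv_comp[OF sB_WB] inv_sB)

lemma sB_order_aux:
  fixes u v i j su sv :: nat
  assumes "(u = i \<and> su = i+1) \<or> (u = i+1 \<and> su = i) \<or>
      (u = j \<and> su = j+1) \<or> (u = j+1 \<and> su = j) \<or>
      (u \<noteq> i \<and> u \<noteq> i+1 \<and> u \<noteq> j \<and> u \<noteq> j+1 \<and> su = u)"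
    "(v = i \<and> sv = i+1) \<or> (v = i+1 \<and> sv = i) \<or>
      (v = j \<and> sv = j+1) \<or> (v = j+1 \<and> sv = j) \<or>
      (v \<noteq> i \<and> v \<noteq> i+1 \<and> v \<noteq> j \<and> v \<noteq> j+1 \<and> sv = v)"
    "u < v" "i \<le> j" "j \<noteq> i + 1"
  shows "sv < su \<longleftrightarrow> (u = i \<and> v = i+1) \<or> (u = j \<and> v = j+1)"
  using assms by (elim disjE) (simp_all, linarith+)

lemma sB_order:
  assumes "i \<in> {1..r}" "u < v"
  shows "sB r i v < sB r i u \<longleftrightarrow> (u = i \<and> v = i+1) \<or> (u = 2*r-i \<and> v = 2*r+1-i)"
proof -
  obtain j where j: "i + j = 2*r" "i \<le> j" "j \<noteq> i + 1" "i = r \<longleftrightarrow> j = i"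
    "\<And>x. sB r i x = (if x = i then i+1 else if x = i+1 then i
       else if x = j then j+1 else if x = j+1 then j else x)"
    by (rule sB_pairE[OF assms(1)]) (rule that)
  have e: "2*r - i = j" "2*r + 1 - i = j + 1" using j(1) by simp_all
  have cases: "(x = i \<and> sB r i x = i+1) \<or> (x = i+1 \<and> sB r i x = i) \<or>
      (x = j \<and> sB r i x = j+1) \<or> (x = j+1 \<and> sB r i x = j) \<or>
      (x \<noteq> i \<and> x \<noteq> i+1 \<and> x \<noteq> j \<and> x \<noteq> j+1 \<and> sB r i x = x)" for x
    using j(5)[of x] by presburger
  show ?thesis
    unfolding e by (rule sB_order_aux[OF cases cases assms(2) j(2,3)])
qed

text \<open>Inversions of a signed permutation come in mirror pairs; a pair is represented by its
  member $(x,y)$ with $x+y\le 2r+1$.  Counting representatives gives the Coxeter length.\<close>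

definition InvB :: "nat \<Rightarrow> (nat \<Rightarrow> nat) \<Rightarrow> (nat \<times> nat) set" where
  "InvB r w = {(x,y). 1 \<le> x \<and> x < y \<and> x + y \<le> 2*r+1 \<and> w y < w x}"

definition ellB :: "nat \<Rightarrow> (nat \<Rightarrow> nat) \<Rightarrow> nat" where
  "ellB r w = card (InvB r w)"

lemma finite_InvB: "finite (InvB r w)"
  by (rule finite_subset[of _ "{1..2*r} \<times> {1..2*r}"]) (auto simp: InvB_def)

text \<open>The two values \<open>i\<close> and \<open>i+1\<close>, together with their mirror images, are the only ones whose order
  changes (\<open>sB_order\<close>); the positions of these two pairs have a single representative.\<close>

lemma InvB_step:
  assumes w: "w \<in> WB r" and i: "i \<in> {1..r}" and less: "pinv w i < pinv w (i+1)"
  shows "\<exists>p. p \<notin> InvB r w \<and> InvB r (sB r i \<circ> w) = insert p (InvB r w)"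
proof -
  define a b where "a = pinv w i" and "b = pinv w (i+1)"
  have wa: "w a = i" and wb: "w b = i+1"
    by (simp_all add: a_def b_def WB_inv_apply[OF w])
  have ab: "a \<in> {1..2*r}" "b \<in> {1..2*r}"
    unfolding a_def b_def by (intro WB_inv_range[OF w]; use i in auto)+
  have wma: "w (2*r+1-a) = 2*r+1-i" and wmb: "w (2*r+1-b) = 2*r-i"
    using WB_mirror[OF w ab(1)] WB_mirror[OF w ab(2)] wa wb by auto
  have inj: "w x = i \<longleftrightarrow> x = a" "w x = i+1 \<longleftrightarrow> x = b"
     "w x = 2*r+1-i \<longleftrightarrow> x = 2*r+1-a" "w x = 2*r-i \<longleftrightarrow> x = 2*r+1-b" for x
    using WB_inj[OF w, of x a] WB_inj[OF w, of x b] WB_inj[OF w, of x "2*r+1-a"]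
      WB_inj[OF w, of x "2*r+1-b"] wa wb wma wmb by simp_all
  have lab: "a < b" using less by (simp add: a_def b_def)
  define p where "p = (if a + b \<le> 2*r+1 then (a,b) else (2*r+1-b, 2*r+1-a))"
  have *: "(x,y) \<in> InvB r (sB r i \<circ> w) \<longleftrightarrow> (x,y) = p \<or> (x,y) \<in> InvB r w" for x y
  proof (cases "1 \<le> x \<and> x < y \<and> x + y \<le> 2*r+1")
    case False
    then show ?thesis using ab lab by (auto simp: InvB_def p_def)
  next
    case True
    then have neq: "w x \<noteq> w y" using WB_inj[OF w] by auto
    show ?thesis
    proof (cases "w x < w y")
      case less: True
      have "sB r i (w y) < sB r i (w x) \<longleftrightarrow> (x = a \<and> y = b) \<or> (x = 2*r+1-b \<and> y = 2*r+1-a)"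
        unfolding sB_order[OF i less] inj by blast
      also have "\<dots> \<longleftrightarrow> (x,y) = p"
        using True ab lab by (auto simp: p_def)
      finally show ?thesis using True less by (auto simp: InvB_def)
    next
      case False
      then have less: "w y < w x" using neq by simp
      have "\<not> sB r i (w x) < sB r i (w y)"
        unfolding sB_order[OF i less] inj using True ab lab by auto
      moreover have "sB r i (w x) \<noteq> sB r i (w y)"
        using WB_inj[OF sB_WB[OF i]] neq by simp
      ultimately show ?thesis using True less by (auto simp: InvB_def)
    qed
  qed
  have "\<not> w b < w a" "\<not> w (2*r+1-a) < w (2*r+1-b)"
    unfolding wa wb wma wmb by simp_all
  then have "p \<notin> InvB r w"
    unfolding InvB_def p_def by (cases "a + b \<le> 2*r+1") simp_all
  moreover have "InvB r (sB r i \<circ> w) = insert p (InvB r w)"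
    using * by auto
  ultimately show ?thesis by blast
qed

lemma ellB_up:
  assumes "w \<in> WB r" "i \<in> {1..r}" "pinv w i < pinv w (i+1)"
  shows "ellB r (sB r i \<circ> w) = ellB r w + 1"
proof -
  obtain p where "p \<notin> InvB r w" "InvB r (sB r i \<circ> w) = insert p (InvB r w)"
    using InvB_step[OF assms] by blast
  then show ?thesis by (simp add: ellB_def finite_InvB)
qed

lemma ellB_down:
  assumes "w \<in> WB r" "i \<in> {1..r}" "pinv w (i+1) < pinv w i"
  shows "ellB r w = ellB r (sB r i \<circ> w) + 1"
proof -
  have "sB r i (i+1) = i" "sB r i i = i+1"
    using assms(2) by (simp_all add: sB_apply)
  then have "pinv (sB r i \<circ> w) i < pinv (sB r i \<circ> w) (i+1)"
    using assms by (simp only: inv_sB_comp)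
  from ellB_up[OF WB_comp[OF sB_WB[OF assms(2)] assms(1)] assms(2) this]
  show ?thesis using assms(2) by simp
qed

lemma WB_asc_cases:
  assumes "w \<in> WB r"
  obtains "w i < w (i+1)" | "w (i+1) < w i"
  using WB_inj[OF assms, of i "i+1"] by fastforce

lemma ellB_id: "ellB r id = 0"
proof -
  have "InvB r id = {}" by (auto simp: InvB_def)
  then show ?thesis by (simp add: ellB_def)
qed

text \<open>Increasing up to \<open>r\<close> gives \<open>i \<le> w i\<close>; the step from \<open>r\<close> to \<open>r+1\<close> forces \<open>w r \<le> r\<close>, since
  \<open>w (r+1)\<close> is the mirror image of \<open>w r\<close>, and descending from there gives \<open>w i \<le> i\<close>.\<close>

lemma no_descent_id:
  assumes w: "w \<in> WB r" and "\<And>i. i \<in> {1..r} \<Longrightarrow> w i < w (i+1)"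
  shows "w = id"
proof (rule WB_eqI[OF w WB_id])
  fix x assume x: "x \<in> {1..r}"
  have up: "i \<le> w i" if "i \<le> r" for i
    using that
  proof (induction i)
    case (Suc i)
    show ?case
    proof (cases "i = 0")
      case True
      then show ?thesis using WB_range[OF w, of 1] Suc.prems by simp
    next
      case False
      then have "w i < w (i+1)" using assms(2)[of i] Suc.prems by simp
      then show ?thesis using Suc by simp
    qed
  qed simp
  have "w (r+1) = 2*r+1 - w r"
    using WB_mirror[OF w, of r] x by (simp add: mult_2)
  then have wr: "w r \<le> r" using assms(2)[of r] x by auto
  have down: "w (r - j) \<le> r - j" if "j < r" for j
    using that
  proof (induction j)
    case 0
    then show ?case using wr by simp
  next
    case (Suc j)
    then have "w (r - Suc j) < w (r - Suc j + 1)" using assms(2)[of "r - Suc j"] by simp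
    then show ?case using Suc by (simp add: Suc_diff_Suc)
  qed
  show "w x = id x"
    using up[of x] down[of "r-x"] x by simp
qed

lemma word_val_simps [simp]:
  "word_val s [] = id" "word_val s (i # u) = s i \<circ> word_val s u"
  by (simp_all add: word_val_def)

lemma word_val_append: "word_val s (u @ v) = word_val s u \<circ> word_val s v"
  by (induction u) (simp_all add: o_assoc)

lemma word_val_WB: "set u \<subseteq> {1..r} \<Longrightarrow> word_val (sB r) u \<in> WB r"
  by (induction u) (auto intro!: WB_comp sB_WB)

lemma ellB_word_le: "set u \<subseteq> {1..r} \<Longrightarrow> ellB r (word_val (sB r) u) \<le> length u"
proof (induction u)
  case (Cons i u)
  then have i: "i \<in> {1..r}" and w: "word_val (sB r) u \<in> WB r"
    using word_val_WB by auto
  have "ellB r (sB r i \<circ> word_val (sB r) u) \<le> ellB r (word_val (sB r) u) + 1"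
    using WB_asc_cases[OF WB_inv[OF w], of i] ellB_up[OF w i] ellB_down[OF w i]
    by (metis le_add1 le_refl trans_le_add1)
  also have "\<dots> \<le> length (i # u)" using Cons by simp
  finally show ?case by (simp only: word_val_simps)
qed (simp add: ellB_id)

lemma ex_reduced_word:
  assumes "w \<in> WB r"
  shows "\<exists>u. set u \<subseteq> {1..r} \<and> word_val (sB r) u = w \<and> length u = ellB r w"
  using assms
proof (induction "ellB r w" arbitrary: w rule: less_induct)
  case less
  show ?case
  proof (cases "\<exists>i\<in>{1..r}. pinv w (i+1) < pinv w i")
    case True
    then obtain i where i: "i \<in> {1..r}" "pinv w (i+1) < pinv w i" by blast
    have e: "ellB r w = ellB r (sB r i \<circ> w) + 1" by (rule ellB_down[OF less.prems i])
    then obtain u where u: "set u \<subseteq> {1..r}" "word_val (sB r) u = sB r i \<circ> w" "length u = ellB r (sB r i \<circ> w)"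
      using less.hyps[of "sB r i \<circ> w"] WB_comp[OF sB_WB[OF i(1)] less.prems] by auto
    show ?thesis
      by (rule exI[of _ "i # u"]) (use u i e in auto)
  next
    case False
    then have "pinv w = id"
      using WB_asc_cases[OF WB_inv[OF less.prems]]
      by (intro no_descent_id[OF WB_inv[OF less.prems]]) metis
    then have "w = id" using WB_inv_inv[OF less.prems] by simp
    then show ?thesis by (intro exI[of _ "[]"]) (simp add: ellB_id)
  qed
qed

lemma lenB_eq_ellB:
  assumes "w \<in> WB r" shows "lenB r w = ellB r w"
  unfolding cox_len_def
proof (rule Least_equality)
  show "\<exists>u. set u \<subseteq> {1..r} \<and> length u = ellB r w \<and> word_val (sB r) u = w"
    using ex_reduced_word[OF assms] by blast
  show "ellB r w \<le> k" if "\<exists>u. set u \<subseteq> {1..r} \<and> length u = k \<and> word_val (sB r) u = w" for k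
    using that ellB_word_le by blast
qed

lemma reduced_wordB_iff:
  assumes "w \<in> WB r"
  shows "reduced_wordB r w u \<longleftrightarrow> set u \<subseteq> {1..r} \<and> word_val (sB r) u = w \<and> length u = ellB r w"
  by (simp add: reduced_wordB_def lenB_eq_ellB[OF assms])

lemma word_val_rev:
  assumes "set u \<subseteq> {1..r}" shows "word_val (sB r) (rev u) = pinv (word_val (sB r) u)"
  using assms
proof (induction u)
  case (Cons i u)
  then show ?case
    using word_val_WB[of u r]
    by (simp add: word_val_append WB_inv_comp[OF sB_WB] inv_sB del: o_apply)
qed simp

lemma ellB_inv:
  assumes "w \<in> WB r" shows "ellB r (pinv w) = ellB r w"
proof -
  have le: "ellB r (pinv v) \<le> ellB r v" if "v \<in> WB r" for v
  proof -
    obtain u where u: "set u \<subseteq> {1..r}" "word_val (sB r) u = v" "length u = ellB r v"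
      using ex_reduced_word[OF \<open>v \<in> WB r\<close>] by blast
    then show ?thesis
      using ellB_word_le[of "rev u" r] by (simp add: word_val_rev)
  qed
  show ?thesis
    using le[OF assms] le[OF WB_inv[OF assms]] WB_inv_inv[OF assms] by simp
qed

lemma inv_comp_sB: "i \<in> {1..r} \<Longrightarrow> w \<in> WB r \<Longrightarrow> pinv (w \<circ> sB r i) = sB r i \<circ> pinv w"
  using WB_inv_comp[OF _ sB_WB[of i r], of w] by (simp only: inv_sB)

lemma ellB_right_up:
  assumes "w \<in> WB r" "i \<in> {1..r}" "w i < w (i+1)"
  shows "ellB r (w \<circ> sB r i) = ellB r w + 1"
proof -
  have "ellB r (sB r i \<circ> pinv w) = ellB r (pinv w) + 1"
    using ellB_up[OF WB_inv[OF assms(1)] assms(2)] assms(3) WB_inv_inv[OF assms(1)] by simp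
  then show ?thesis
    using ellB_inv[OF assms(1)] ellB_inv[OF WB_comp[OF assms(1) sB_WB[OF assms(2)]]]
      inv_comp_sB[OF assms(2,1)] by simp
qed

lemma ellB_right_down:
  assumes "w \<in> WB r" "i \<in> {1..r}" "w (i+1) < w i"
  shows "ellB r w = ellB r (w \<circ> sB r i) + 1"
proof -
  have "ellB r (pinv w) = ellB r (sB r i \<circ> pinv w) + 1"
    using ellB_down[OF WB_inv[OF assms(1)] assms(2)] assms(3) WB_inv_inv[OF assms(1)] by simp
  then show ?thesis
    using ellB_inv[OF assms(1)] ellB_inv[OF WB_comp[OF assms(1) sB_WB[OF assms(2)]]]
      inv_comp_sB[OF assms(2,1)] by simp
qed

text \<open>The parity of the number of sign changes; its kernel is \<open>WD\<close>.\<close>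

definition oddB :: "nat \<Rightarrow> (nat \<Rightarrow> nat) \<Rightarrow> bool" where
  "oddB r w \<longleftrightarrow> odd (card {i \<in> {1..r}. w i > r})"

lemma WD_iff: "w \<in> WD r \<longleftrightarrow> w \<in> WB r \<and> \<not> oddB r w"
  by (auto simp: WD_def oddB_def)

lemma oddB_sB_comp:
  assumes w: "w \<in> WB r" and i: "i \<in> {1..r}"
  shows "oddB r (sB r i \<circ> w) \<longleftrightarrow> (if i = r then \<not> oddB r w else oddB r w)"
proof (cases "i = r")
  case False
  then have "r < sB r i v \<longleftrightarrow> r < v" for v
    using i by (auto simp: sB_apply)
  then show ?thesis using False by (simp add: oddB_def)
next
  case True
  have s: "sB r r v = (if v = r then r+1 else if v = r+1 then r else v)" for v
    using i True by (simp add: sB_apply)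
  define x where "x = min (pinv w r) (pinv w (r+1))"
  have wr: "w (pinv w r) = r" "w (pinv w (r+1)) = r+1"
    by (simp_all add: WB_inv_apply[OF w])
  have inv1: "pinv w (r+1) = 2*r+1 - pinv w r" "pinv w r \<in> {1..2*r}"
    using WB_mirror[OF WB_inv[OF w], of r] WB_inv_range[OF w, of r] i by (auto simp: mult_2)
  then have x: "x \<in> {1..r}" "w x = r \<or> w x = r+1"
    using wr by (auto simp: x_def min_def)
  have uniq: "y = x" if "y \<in> {1..r}" "w y = r \<or> w y = r+1" for y
  proof -
    have "y = pinv w r \<or> y = pinv w (r+1)"
      using that(2) WB_inv_apply(1)[OF w, of y] by auto
    then show ?thesis using that(1) inv1 by (auto simp: x_def min_def)
  qed
  have sd: "r < sB r r (w y) \<longleftrightarrow> (if y = x then \<not> r < w y else r < w y)" if "y \<in> {1..r}" for y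
  proof (cases "w y = r \<or> w y = r+1")
    case True
    then have "y = x" by (rule uniq[OF that])
    then show ?thesis using True unfolding s by (elim disjE) simp_all
  next
    case False
    then have "y \<noteq> x" using x(2) by metis
    then show ?thesis using False unfolding s by simp
  qed
  have fin: "finite {y \<in> {1..r}. w y > r}" by simp
  show ?thesis
  proof (cases "w x > r")
    case gt: True
    then have "{y \<in> {1..r}. w y > r} = insert x {y \<in> {1..r}. sB r r (w y) > r}"
      "x \<notin> {y \<in> {1..r}. sB r r (w y) > r}"
      using sd x(1) by (auto split: if_splits)
    then show ?thesis using True by (simp add: oddB_def)
  next
    case False
    then have "{y \<in> {1..r}. sB r r (w y) > r} = insert x {y \<in> {1..r}. w y > r}"
      "x \<notin> {y \<in> {1..r}. w y > r}"
      using sd x(1) by (auto split: if_splits)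
    then show ?thesis using True by (simp add: oddB_def)
  qed
qed

lemma oddB_id [simp]: "\<not> oddB r id"
proof -
  have "{i \<in> {1..r}. id i > r} = {}" by auto
  then show ?thesis unfolding oddB_def by (simp only: card.empty) simp
qed

lemma oddB_comp:
  assumes "v \<in> WB r" "w \<in> WB r"
  shows "oddB r (v \<circ> w) \<longleftrightarrow> oddB r v \<noteq> oddB r w"
proof -
  have *: "oddB r (word_val (sB r) u \<circ> w) \<longleftrightarrow> oddB r (word_val (sB r) u) \<noteq> oddB r w"
    if "set u \<subseteq> {1..r}" for u
    using that
  proof (induction u)
    case (Cons i u)
    then have i: "i \<in> {1..r}" and u: "word_val (sB r) u \<in> WB r"
      using word_val_WB[of u r] by auto
    have "oddB r (sB r i \<circ> (word_val (sB r) u \<circ> w)) \<longleftrightarrow>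
      (if i = r then \<not> oddB r (word_val (sB r) u \<circ> w) else oddB r (word_val (sB r) u \<circ> w))"
      by (rule oddB_sB_comp[OF WB_comp[OF u assms(2)] i])
    then show ?case
      using Cons oddB_sB_comp[OF u i] by (auto simp: o_assoc[symmetric] simp del: o_apply)
  qed simp
  obtain u where "set u \<subseteq> {1..r}" "word_val (sB r) u = v"
    using ex_reduced_word[OF assms(1)] by blast
  then show ?thesis using *[of u] by simp
qed

lemma oddB_sB:
  assumes "i \<in> {1..r}" shows "oddB r (sB r i) \<longleftrightarrow> i = r"
  using oddB_sB_comp[OF WB_id assms] by (simp only: o_id oddB_id) simp

lemma oddB_inv:
  assumes "w \<in> WB r" shows "oddB r (pinv w) \<longleftrightarrow> oddB r w"
  using oddB_comp[OF WB_inv[OF assms] assms] unfolding WB_comp_inv(2)[OF assms] by simp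

section \<open>The standard basis elements\<close>

lemma sB_small:
  assumes "1 \<le> i" "i < r" "x \<le> r"
  shows "sB r i x = (if x = i then i+1 else if x = i+1 then i else x)"
proof -
  have "i \<in> {1..r}" using assms by simp
  then obtain j where j: "i + j = 2*r" "i \<le> j" "j \<noteq> i + 1" "i = r \<longleftrightarrow> j = i"
    "\<And>x. sB r i x = (if x = i then i+1 else if x = i+1 then i
       else if x = j then j+1 else if x = j+1 then j else x)"
    by (rule sB_pairE) (rule that)
  have "x \<noteq> j" "x \<noteq> j + 1" using assms j(1) by linarith+
  then show ?thesis using j(5)[of x] by simp
qed

lemma sB_last:
  assumes "1 \<le> r"
  shows "sB r r x = (if x = r then r+1 else if x = r+1 then r else x)"
  using assms by (simp add: sB_def transpose_def)

lemma sB_mid: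
  assumes "1 \<le> i" "i < r"
  shows "sB r i (r+1) = (if i + 1 = r then r+2 else r+1)" "sB r i (r+2) = (if i + 1 = r then r+1 else if i + 2 = r then r+3 else r+2)"
proof -
  have "i \<in> {1..r}" using assms by simp
  then obtain j where j: "i + j = 2*r" "i \<le> j" "j \<noteq> i + 1" "i = r \<longleftrightarrow> j = i"
    "\<And>x. sB r i x = (if x = i then i+1 else if x = i+1 then i
       else if x = j then j+1 else if x = j+1 then j else x)"
    by (rule sB_pairE) (rule that)
  have e: "r + 1 \<noteq> i" "r + 1 \<noteq> i + 1" "r + 1 \<noteq> j + 1" "r + 1 = j \<longleftrightarrow> i + 1 = r"
    "r + 2 \<noteq> i" "r + 2 \<noteq> i + 1" "r + 2 = j \<longleftrightarrow> i + 2 = r" "r + 2 = j + 1 \<longleftrightarrow> i + 1 = r"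
    using assms j(1) by linarith+
  show "sB r i (r+1) = (if i + 1 = r then r+2 else r+1)"
    unfolding j(5) e(4)[symmetric] using e(1-3) by simp
  show "sB r i (r+2) = (if i + 1 = r then r+1 else if i + 2 = r then r+3 else r+2)"
    unfolding j(5) e(7,8)[symmetric] using e(5,6) by simp
qed

lemma sB_commute:
  assumes "1 \<le> i" "i + 2 \<le> j" "j \<le> r"
  shows "sB r i \<circ> sB r j = sB r j \<circ> sB r i"
proof (rule WB_eqI[of _ r])
  show "sB r i \<circ> sB r j \<in> WB r" "sB r j \<circ> sB r i \<in> WB r"
    by (intro WB_comp sB_WB; use assms in simp)+
  fix x assume "x \<in> {1..r}"
  then have x: "x \<le> r" by simp
  show "(sB r i \<circ> sB r j) x = (sB r j \<circ> sB r i) x"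
  proof (cases "j = r")
    case True
    have i: "i + 1 \<noteq> r" "i \<noteq> r" "i < r" "1 \<le> r" using assms True by linarith+
    have v: "sB r i y = (if y = i then i+1 else if y = i+1 then i else y)" if "y \<le> r" for y
      by (rule sB_small[OF assms(1) i(3) that])
    show ?thesis
      using x i sB_mid(1)[OF assms(1) i(3)] unfolding True o_apply sB_last[OF i(4)]
      by (cases "x = r"; cases "x = i"; cases "x = i + 1") (simp_all add: v)
  next
    case False
    then have b: "i < r" "1 \<le> j" "j < r" "i + 1 < j" using assms by linarith+
    have vi: "sB r i y = (if y = i then i+1 else if y = i+1 then i else y)" if "y \<le> r" for y
      by (rule sB_small[OF assms(1) b(1) that])
    have vj: "sB r j y = (if y = j then j+1 else if y = j+1 then j else y)" if "y \<le> r" for y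
      by (rule sB_small[OF b(2,3) that])
    show ?thesis
      using x b unfolding o_apply
      by (cases "x = i"; cases "x = i + 1"; cases "x = j"; cases "x = j+1") (simp_all add: vi vj)
  qed
qed

lemma sB_braid3:
  assumes "1 \<le> i" "i + 1 < r"
  shows "sB r i \<circ> (sB r (i+1) \<circ> sB r i) = sB r (i+1) \<circ> (sB r i \<circ> sB r (i+1))"
proof (rule WB_eqI[of _ r])
  show "sB r i \<circ> (sB r (i+1) \<circ> sB r i) \<in> WB r" "sB r (i+1) \<circ> (sB r i \<circ> sB r (i+1)) \<in> WB r"
    by (intro WB_comp sB_WB; use assms in simp)+
  fix x assume "x \<in> {1..r}"
  then have x: "x \<le> r" by simp
  have vi: "sB r i y = (if y = i then Suc i else if y = Suc i then i else y)" if "y \<le> r" for y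
    using sB_small[of i r y] that assms by simp
  have vj: "sB r (Suc i) y = (if y = Suc i then Suc (Suc i) else if y = Suc (Suc i) then Suc i else y)"
    if "y \<le> r" for y
    using sB_small[of "Suc i" r y] that assms by simp
  show "(sB r i \<circ> (sB r (i+1) \<circ> sB r i)) x = (sB r (i+1) \<circ> (sB r i \<circ> sB r (i+1))) x"
    using x assms unfolding o_apply
    by (cases "x = i"; cases "x = Suc i"; cases "x = Suc (Suc i)") (simp_all add: vi vj)
qed

lemma sB_braid4:
  assumes "2 \<le> r"
  shows "sB r (r-1) \<circ> (sB r r \<circ> (sB r (r-1) \<circ> sB r r)) = sB r r \<circ> (sB r (r-1) \<circ> (sB r r \<circ> sB r (r-1)))"
proof (rule WB_eqI[of _ r])
  show "sB r (r-1) \<circ> (sB r r \<circ> (sB r (r-1) \<circ> sB r r)) \<in> WB r"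
    "sB r r \<circ> (sB r (r-1) \<circ> (sB r r \<circ> sB r (r-1))) \<in> WB r"
    by (intro WB_comp sB_WB; use assms in simp)+
  define i where "i = r - 1"
  have r: "r = Suc i" "1 \<le> i" "r - 1 = i" using assms by (simp_all add: i_def)
  fix x assume "x \<in> {1..r}"
  then have x: "x \<le> Suc i" using r by simp
  have vi: "sB (Suc i) i y = (if y = i then Suc i else if y = Suc i then i else y)" if "y \<le> Suc i" for y
    using sB_small[of i r y] that r by simp
  have mi: "sB (Suc i) i (Suc (Suc i)) = Suc (Suc (Suc i))" "sB (Suc i) i (Suc (Suc (Suc i))) = Suc (Suc i)"
    using sB_mid[of i r] r by (simp_all add: numeral_eq_Suc)
  have vr: "sB (Suc i) (Suc i) y = (if y = Suc i then Suc (Suc i) else if y = Suc (Suc i) then Suc i else y)" for y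
    using sB_last[of r y] r by simp
  show "(sB r (r-1) \<circ> (sB r r \<circ> (sB r (r-1) \<circ> sB r r))) x =
      (sB r r \<circ> (sB r (r-1) \<circ> (sB r r \<circ> sB r (r-1)))) x"
    using x unfolding o_apply r(3) unfolding r(1)
    by (cases "x = i"; cases "x = Suc i") (simp_all add: vi vr mi)
qed

locale heckeB =
  fixes r :: nat
  assumes r2: "2 \<le> r"
begin

sublocale H: ring "HB r"
  by (rule HB_ring[OF r2])

abbreviation hmult (infixl "\<cdot>" 70) where "x \<cdot> y \<equiv> x \<otimes>\<^bsub>HB r\<^esub> y"
abbreviation hadd (infixl "\<boxplus>" 65) where "x \<boxplus> y \<equiv> x \<oplus>\<^bsub>HB r\<^esub> y"

lemmas Tgen_closed' [simp, intro] = Tgen_closed[OF r2]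
lemmas Hconst_closed' [simp, intro] = Hconst_closed[OF r2]

definition prodT :: "nat list \<Rightarrow> hecke" where
  "prodT u = foldr (\<lambda>i x. Tgen r i \<cdot> x) u \<one>\<^bsub>HB r\<^esub>"

lemma prodT_simps [simp]: "prodT [] = \<one>\<^bsub>HB r\<^esub>" "prodT (i # u) = Tgen r i \<cdot> prodT u"
  by (simp_all add: prodT_def)

lemma prodT_closed: "set u \<subseteq> {1..r} \<Longrightarrow> prodT u \<in> carrier (HB r)"
proof (induction u)
  case (Cons i u)
  then show ?case using Tgen_closed'[of i] by (simp del: Tgen_closed')
qed simp

lemma prodT_append:
  "set u \<subseteq> {1..r} \<Longrightarrow> set v \<subseteq> {1..r} \<Longrightarrow> prodT (u @ v) = prodT u \<cdot> prodT v"
proof (induction u)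
  case (Cons i u)
  then show ?case using prodT_closed[of u] prodT_closed[of v] by (simp add: H.m_assoc)
qed (simp add: prodT_closed)

text \<open>If \<open>w\<close> has the two left descents \<open>i\<close> and \<open>j\<close>, it has reduced words starting with either
  side of the braid relation between \<open>i\<close> and \<open>j\<close>.\<close>

lemma braid_descent:
  assumes w: "w \<in> WB r" and ij: "1 \<le> i" "i < j" "j \<le> r"
    and d: "pinv w (i+1) < pinv w i" "pinv w (j+1) < pinv w j"
  shows "\<exists>P Q v. set P \<subseteq> {1..r} \<and> set Q \<subseteq> {1..r} \<and> v \<in> WB r \<and> length P = length Q \<and>
     word_val (sB r) (i # P) = word_val (sB r) (j # Q) \<and> prodT (i # P) = prodT (j # Q) \<and>
     word_val (sB r) (i # P) \<circ> v = w \<and> ellB r w = ellB r v + length (i # P)"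
proof -
  have i: "i \<in> {1..r}" and j: "j \<in> {1..r}" and ir: "i < r" using ij by auto
  note cl = Tgen_closed'[OF i] Tgen_closed'[OF j]
  have e1: "ellB r w = ellB r (sB r i \<circ> w) + 1" by (rule ellB_down[OF w i d(1)])
  have w1: "sB r i \<circ> w \<in> WB r" by (intro WB_comp sB_WB i w)
  consider "i + 2 \<le> j" | "j = i + 1" "j < r" | "j = r" "i = r - 1" using ij by linarith
  then show ?thesis
  proof cases
    case 1
    have "sB r i j = j" "sB r i (j+1) = j+1"
    proof -
      show "sB r i j = j" using sB_small[OF ij(1) ir ij(3)] 1 by simp
      show "sB r i (j+1) = j+1"
        using sB_small[OF ij(1) ir, of "j+1"] sB_mid(1)[OF ij(1) ir] 1 ij by (cases "j = r") auto
    qed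
    then have "pinv (sB r i \<circ> w) (j+1) < pinv (sB r i \<circ> w) j"
      unfolding inv_sB_comp[OF i w] using d by simp
    from ellB_down[OF w1 j this] have e2: "ellB r w = ellB r (sB r j \<circ> (sB r i \<circ> w)) + 2"
      using e1 by simp
    have c: "sB r i \<circ> sB r j = sB r j \<circ> sB r i" by (rule sB_commute[OF ij(1) 1 ij(3)])
    have f: "set [j] \<subseteq> {1..r}" "set [i] \<subseteq> {1..r}" "length [j] = length [i]"
      using i j by simp_all
    have a1: "word_val (sB r) (i # [j]) = word_val (sB r) (j # [i])"
      by (simp only: word_val_simps o_id c)
    have a2: "prodT (i # [j]) = prodT (j # [i])"
      by (simp only: prodT_simps H.r_one cl Tgen_commute[OF r2 i j disjI1[OF 1]])
    have a3: "word_val (sB r) (i # [j]) \<circ> (sB r j \<circ> (sB r i \<circ> w)) = w"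
      by (simp only: word_val_simps o_id o_assoc[symmetric] sB_comp_sB[OF i] sB_comp_sB[OF j])
    have a4: "ellB r w = ellB r (sB r j \<circ> (sB r i \<circ> w)) + length (i # [j])"
      using e2 by simp
    have a5: "sB r j \<circ> (sB r i \<circ> w) \<in> WB r" by (intro WB_comp sB_WB i j w)
    show ?thesis
      by (rule exI[of _ "[j]"], rule exI[of _ "[i]"], rule exI[of _ "sB r j \<circ> (sB r i \<circ> w)"],
          intro conjI) (fact f a1 a2 a3 a4 a5)+
  next
    case 2
    have s: "sB r i i = i+1" "sB r i (i+1) = i" "sB r i (i+2) = i+2"
      "sB r j i = i" "sB r j (i+1) = i+2" "sB r j (i+2) = i+1"
      using sB_small[of i r] sB_small[of j r] 2 ij by simp_all
    have "pinv (sB r i \<circ> w) (j+1) < pinv (sB r i \<circ> w) j"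
      unfolding inv_sB_comp[OF i w] using d s 2 by simp
    from ellB_down[OF w1 j this] have e2: "ellB r w = ellB r (sB r j \<circ> (sB r i \<circ> w)) + 2"
      using e1 by simp
    have w2: "sB r j \<circ> (sB r i \<circ> w) \<in> WB r" by (intro WB_comp sB_WB j w1)
    have "pinv (sB r j \<circ> (sB r i \<circ> w)) (i+1) < pinv (sB r j \<circ> (sB r i \<circ> w)) i"
      unfolding inv_sB_comp[OF j w1] inv_sB_comp[OF i w] s using d 2 by simp
    from ellB_down[OF w2 i this]
    have e3: "ellB r w = ellB r (sB r i \<circ> (sB r j \<circ> (sB r i \<circ> w))) + 3"
      using e2 by simp
    have b: "sB r i \<circ> (sB r j \<circ> sB r i) = sB r j \<circ> (sB r i \<circ> sB r j)"
      using sB_braid3[of i r] ij 2 by simp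
    have t: "Tgen r i \<cdot> (Tgen r j \<cdot> Tgen r i) = Tgen r j \<cdot> (Tgen r i \<cdot> Tgen r j)"
      using Tgen_braid3[OF r2, of i] ij 2 by simp
    have f: "set [j,i] \<subseteq> {1..r}" "set [i,j] \<subseteq> {1..r}" "length [j,i] = length [i,j]"
      using i j by simp_all
    have a1: "word_val (sB r) (i # [j,i]) = word_val (sB r) (j # [i,j])"
      by (simp only: word_val_simps o_id b)
    have a2: "prodT (i # [j,i]) = prodT (j # [i,j])"
      by (simp only: prodT_simps H.r_one cl t)
    have a3: "word_val (sB r) (i # [j,i]) \<circ> (sB r i \<circ> (sB r j \<circ> (sB r i \<circ> w))) = w"
      by (simp only: word_val_simps o_id o_assoc[symmetric] sB_comp_sB[OF i] sB_comp_sB[OF j])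
    have a4: "ellB r w = ellB r (sB r i \<circ> (sB r j \<circ> (sB r i \<circ> w))) + length (i # [j,i])"
      using e3 by simp
    have a5: "sB r i \<circ> (sB r j \<circ> (sB r i \<circ> w)) \<in> WB r" by (intro WB_comp sB_WB i j w)
    show ?thesis
      by (rule exI[of _ "[j,i]"], rule exI[of _ "[i,j]"], rule exI[of _ "sB r i \<circ> (sB r j \<circ> (sB r i \<circ> w))"],
          intro conjI) (fact f a1 a2 a3 a4 a5)+
  next
    case 3
    have r: "r = i + 1" "j = i + 1" using 3 r2 by auto
    have s: "sB r i i = i+1" "sB r i (i+1) = i" "sB r i (i+2) = i+3" "sB r i (i+3) = i+2"
      using sB_small[of i r] sB_mid[of i r] ij r by (simp_all add: numeral_eq_Suc)
    have sj: "sB r j i = i" "sB r j (i+1) = i+2" "sB r j (i+2) = i+1" "sB r j (i+3) = i+3"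
      using sB_last[of r] ij r by simp_all
    have "pinv w (i+3) = 2*r+1 - pinv w i" "pinv w (i+2) = 2*r+1 - pinv w (i+1)"
      "pinv w i \<in> {1..2*r}"
      using WB_mirror[OF WB_inv[OF w], of i] WB_mirror[OF WB_inv[OF w], of "i+1"]
        WB_inv_range[OF w, of i] i r by (simp_all add: numeral_3_eq_3)
    then have d3: "pinv w (i+3) < pinv w (i+2)" using d by auto
    note dd = d(1) d(2)[unfolded r(2)] d3
    have "pinv (sB r i \<circ> w) (j+1) < pinv (sB r i \<circ> w) j"
      unfolding inv_sB_comp[OF i w] using dd s r by simp
    from ellB_down[OF w1 j this] have e2: "ellB r w = ellB r (sB r j \<circ> (sB r i \<circ> w)) + 2"
      using e1 by simp
    have w2: "sB r j \<circ> (sB r i \<circ> w) \<in> WB r" by (intro WB_comp sB_WB j w1)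
    have "pinv (sB r j \<circ> (sB r i \<circ> w)) (i+1) < pinv (sB r j \<circ> (sB r i \<circ> w)) i"
      unfolding inv_sB_comp[OF j w1] inv_sB_comp[OF i w] s sj using dd by simp
    from ellB_down[OF w2 i this]
    have e3: "ellB r w = ellB r (sB r i \<circ> (sB r j \<circ> (sB r i \<circ> w))) + 3"
      using e2 by simp
    have w3: "sB r i \<circ> (sB r j \<circ> (sB r i \<circ> w)) \<in> WB r" by (intro WB_comp sB_WB i w2)
    have inv3: "pinv (sB r i \<circ> (sB r j \<circ> (sB r i \<circ> w))) x = pinv w (sB r i (sB r j (sB r i x)))" for x
      by (simp only: inv_sB_comp[OF i w2] inv_sB_comp[OF j w1] inv_sB_comp[OF i w])
    have "sB r i (sB r j (sB r i (i+1))) = i+1" "sB r i (sB r j (sB r i (i+2))) = i+2"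
      by (simp_all only: s sj)
    then have "pinv (sB r i \<circ> (sB r j \<circ> (sB r i \<circ> w))) (i+2) < pinv (sB r i \<circ> (sB r j \<circ> (sB r i \<circ> w))) (i+1)"
      unfolding inv3 using dd(2) by simp
    then have "pinv (sB r i \<circ> (sB r j \<circ> (sB r i \<circ> w))) (j+1) < pinv (sB r i \<circ> (sB r j \<circ> (sB r i \<circ> w))) j"
      by (simp add: r(2))
    from ellB_down[OF w3 j this]
    have e4: "ellB r w = ellB r (sB r j \<circ> (sB r i \<circ> (sB r j \<circ> (sB r i \<circ> w)))) + 4"
      using e3 by simp
    have jr: "j = r" "i = r - 1" using 3 by simp_all
    have b: "sB r i \<circ> (sB r j \<circ> (sB r i \<circ> sB r j)) = sB r j \<circ> (sB r i \<circ> (sB r j \<circ> sB r i))"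
      unfolding jr by (rule sB_braid4[OF r2])
    have t: "Tgen r i \<cdot> (Tgen r j \<cdot> (Tgen r i \<cdot> Tgen r j)) = Tgen r j \<cdot> (Tgen r i \<cdot> (Tgen r j \<cdot> Tgen r i))"
      unfolding jr by (rule Tgen_braid4[OF r2])
    have f: "set [j,i,j] \<subseteq> {1..r}" "set [i,j,i] \<subseteq> {1..r}" "length [j,i,j] = length [i,j,i]"
      using i j by simp_all
    have a1: "word_val (sB r) (i # [j,i,j]) = word_val (sB r) (j # [i,j,i])"
      by (simp only: word_val_simps o_id b)
    have a2: "prodT (i # [j,i,j]) = prodT (j # [i,j,i])"
      by (simp only: prodT_simps H.r_one cl t)
    have a3: "word_val (sB r) (i # [j,i,j]) \<circ> (sB r j \<circ> (sB r i \<circ> (sB r j \<circ> (sB r i \<circ> w)))) = w"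
      by (simp only: word_val_simps o_id o_assoc[symmetric] sB_comp_sB[OF i] sB_comp_sB[OF j])
    have a4: "ellB r w = ellB r (sB r j \<circ> (sB r i \<circ> (sB r j \<circ> (sB r i \<circ> w)))) + length (i # [j,i,j])"
      using e4 by simp
    have a5: "sB r j \<circ> (sB r i \<circ> (sB r j \<circ> (sB r i \<circ> w))) \<in> WB r" by (intro WB_comp sB_WB i j w)
    show ?thesis
      by (rule exI[of _ "[j,i,j]"], rule exI[of _ "[i,j,i]"], rule exI[of _ "sB r j \<circ> (sB r i \<circ> (sB r j \<circ> (sB r i \<circ> w)))"],
          intro conjI) (fact f a1 a2 a3 a4 a5)+
  qed
qed

lemma reduced_tail:
  assumes "w \<in> WB r" "reduced_wordB r w (i # u)"
  shows "i \<in> {1..r}" "pinv w (i+1) < pinv w i" "reduced_wordB r (sB r i \<circ> w) u"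
    "sB r i \<circ> w \<in> WB r" "ellB r w = ellB r (sB r i \<circ> w) + 1"
proof -
  have u: "set u \<subseteq> {1..r}" "sB r i \<circ> word_val (sB r) u = w" "length u + 1 = ellB r w"
    using assms(2) unfolding reduced_wordB_iff[OF assms(1)] by simp_all
  show i: "i \<in> {1..r}"
    using assms(2) unfolding reduced_wordB_iff[OF assms(1)] by simp
  show w1: "sB r i \<circ> w \<in> WB r" by (intro WB_comp sB_WB i assms(1))
  have e: "word_val (sB r) u = sB r i \<circ> w"
    unfolding u(2)[symmetric] by (simp only: sB_comp_sB[OF i])
  then have le: "ellB r (sB r i \<circ> w) \<le> length u"
    using ellB_word_le[OF u(1)] by simp
  show d: "pinv w (i+1) < pinv w i"
  proof (rule WB_asc_cases[OF WB_inv[OF assms(1)], of i])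
    assume "pinv w i < pinv w (i+1)"
    from ellB_up[OF assms(1) i this] show ?thesis using le u(3) by simp
  qed simp
  show "ellB r w = ellB r (sB r i \<circ> w) + 1"
    by (rule ellB_down[OF assms(1) i d])
  then show "reduced_wordB r (sB r i \<circ> w) u"
    unfolding reduced_wordB_iff[OF w1] using u e by simp
qed

text \<open>Matsumoto's theorem: two reduced words of \<open>w\<close> with different first letters are linked,
  through the inductive hypothesis, by the two sides of a braid relation.\<close>

theorem matsumoto:
  assumes "w \<in> WB r" "reduced_wordB r w u" "reduced_wordB r w u'"
  shows "prodT u = prodT u'"
  using assms
proof (induction "ellB r w" arbitrary: w u u' rule: less_induct)
  case less
  note w = less.prems(1)
  have len: "length u = length u'"
    using less.prems unfolding reduced_wordB_iff[OF w] by simp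
  show ?case
  proof (cases u)
    case Nil
    then show ?thesis using len by simp
  next
    case (Cons i u1)
    then obtain j u1' where u': "u' = j # u1'" using len by (cases u') auto
    note u = reduced_tail[OF w less.prems(2)[unfolded Cons]]
    note v = reduced_tail[OF w less.prems(3)[unfolded u']]
    have step: "prodT u2 = prodT u3" if "reduced_wordB r (sB r k \<circ> w) u2" "reduced_wordB r (sB r k \<circ> w) u3"
       "sB r k \<circ> w \<in> WB r" "ellB r w = ellB r (sB r k \<circ> w) + 1" for k u2 u3
      using less.hyps[OF _ that(3,1,2)] that(4) by simp
    have main: "prodT (a # x) = prodT (b # y)"
      if ab: "a < b" "reduced_wordB r w (a # x)" "reduced_wordB r w (b # y)" for a b x y
    proof -
      note xa = reduced_tail[OF w ab(2)] and yb = reduced_tail[OF w ab(3)]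
      have ab': "1 \<le> a" "b \<le> r" using xa(1) yb(1) by simp_all
      obtain P Q z where P: "set P \<subseteq> {1..r}" "set Q \<subseteq> {1..r}" "z \<in> WB r" "length P = length Q"
        "word_val (sB r) (a # P) = word_val (sB r) (b # Q)" "prodT (a # P) = prodT (b # Q)"
        "word_val (sB r) (a # P) \<circ> z = w" "ellB r w = ellB r z + length (a # P)"
        using braid_descent[OF w ab'(1) ab(1) ab'(2) xa(2) yb(2)] by blast
      obtain t where t: "set t \<subseteq> {1..r}" "word_val (sB r) t = z" "length t = ellB r z"
        using ex_reduced_word[OF P(3)] by blast
      have rP: "reduced_wordB r w (a # P @ t)"
        unfolding reduced_wordB_iff[OF w] using P(1-4,7,8) t xa(1)
        by (simp add: word_val_append o_assoc[symmetric])
      have Qz: "word_val (sB r) (b # Q) \<circ> z = w" using P(5,7) by simp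
      have rQ: "reduced_wordB r w (b # Q @ t)"
        unfolding reduced_wordB_iff[OF w] using P(1-4,8) Qz t yb(1)
        by (simp add: word_val_append o_assoc[symmetric])
      have "prodT (a # x) = prodT (a # P @ t)"
        using step[OF xa(3) reduced_tail(3)[OF w rP] xa(4,5)] by simp
      also have "\<dots> = prodT (a # P) \<cdot> prodT t"
        using prodT_append[of "a # P" t] P(1) t(1) xa(1) by simp
      also have "\<dots> = prodT (b # Q @ t)"
        unfolding P(6) using prodT_append[of "b # Q" t] P(2) t(1) yb(1) by simp
      also have "\<dots> = prodT (b # y)"
        using step[OF yb(3) reduced_tail(3)[OF w rQ] yb(4,5)] by simp
      finally show ?thesis .
    qed
    show ?thesis
    proof (rule linorder_cases[of i j])
      assume "i = j"
      then show ?thesis using step[OF u(3) _ u(4,5)] v(3) Cons u' by simp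
    next
      assume "i < j"
      from main[OF this] show ?thesis using less.prems Cons u' by simp
    next
      assume "j < i"
      from main[OF this] show ?thesis using less.prems Cons u' by metis
    qed
  qed
qed

lemma Tw_reduced:
  assumes "w \<in> WB r" "reduced_wordB r w u"
  shows "Tw r w = prodT u"
proof -
  have "reduced_wordB r w (SOME u. reduced_wordB r w u)"
    by (rule someI[of _ u]) (rule assms(2))
  then have "prodT (SOME u. reduced_wordB r w u) = prodT u"
    by (rule matsumoto[OF assms(1) _ assms(2)])
  then show ?thesis by (simp only: Tw_def prodT_def)
qed

lemma ex_reduced_wordB: "w \<in> WB r \<Longrightarrow> \<exists>u. reduced_wordB r w u"
  using ex_reduced_word reduced_wordB_iff by blast

lemma reduced_wordB_set: "reduced_wordB r w u \<Longrightarrow> set u \<subseteq> {1..r}"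
  by (simp add: reduced_wordB_def)

lemma Tw_closed [simp, intro]:
  assumes "w \<in> WB r" shows "Tw r w \<in> carrier (HB r)"
proof -
  obtain u where "reduced_wordB r w u" using ex_reduced_wordB[OF assms] by blast
  then show ?thesis using Tw_reduced[OF assms] prodT_closed[OF reduced_wordB_set] by metis
qed

lemma Tw_id [simp]: "Tw r id = \<one>\<^bsub>HB r\<^esub>"
proof -
  have "reduced_wordB r id []" by (simp add: reduced_wordB_iff ellB_id)
  from Tw_reduced[OF WB_id this] show ?thesis by simp
qed

lemma Tw_left_up:
  assumes "w \<in> WB r" "i \<in> {1..r}" "pinv w i < pinv w (i+1)"
  shows "Tgen r i \<cdot> Tw r w = Tw r (sB r i \<circ> w)"
proof -
  obtain u where u: "reduced_wordB r w u" using ex_reduced_wordB[OF assms(1)] by blast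
  have w1: "sB r i \<circ> w \<in> WB r" by (intro WB_comp sB_WB assms)
  have "reduced_wordB r (sB r i \<circ> w) (i # u)"
    using u assms(2) ellB_up[OF assms] unfolding reduced_wordB_iff[OF w1] reduced_wordB_iff[OF assms(1)]
    by simp
  then show ?thesis using Tw_reduced[OF w1] Tw_reduced[OF assms(1) u] by simp
qed

lemma Tw_right_up:
  assumes "w \<in> WB r" "i \<in> {1..r}" "w i < w (i+1)"
  shows "Tw r w \<cdot> Tgen r i = Tw r (w \<circ> sB r i)"
proof -
  obtain u where u: "reduced_wordB r w u" using ex_reduced_wordB[OF assms(1)] by blast
  have w1: "w \<circ> sB r i \<in> WB r" by (intro WB_comp sB_WB assms)
  have "reduced_wordB r (w \<circ> sB r i) (u @ [i])"
    using u assms(2) ellB_right_up[OF assms] unfolding reduced_wordB_iff[OF w1] reduced_wordB_iff[OF assms(1)]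
    by (simp add: word_val_append)
  then have "Tw r (w \<circ> sB r i) = prodT (u @ [i])" by (rule Tw_reduced[OF w1])
  then show ?thesis
    using Tw_reduced[OF assms(1) u] prodT_append[OF reduced_wordB_set[OF u], of "[i]"] assms(2) by simp
qed

lemma Tw_left_down:
  assumes w: "w \<in> WB r" and i: "1 \<le> i" "i < r" and d: "pinv w (i+1) < pinv w i"
  shows "Tgen r i \<cdot> Tw r w = Hconst r qq \<cdot> Tw r (sB r i \<circ> w) \<boxplus> Hconst r (qq - 1) \<cdot> Tw r w"
proof -
  have ir: "i \<in> {1..r}" using i by simp
  define v where "v = sB r i \<circ> w"
  have v: "v \<in> WB r" unfolding v_def by (intro WB_comp sB_WB ir w)
  have s: "sB r i (i+1) = i" "sB r i i = i+1"
    using sB_small[of i r] i by simp_all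
  have "pinv v i < pinv v (i+1)"
    unfolding v_def inv_sB_comp[OF ir w] s by (rule d)
  from Tw_left_up[OF v ir this] have e: "Tgen r i \<cdot> Tw r v = Tw r w"
    unfolding v_def sB_comp_sB[OF ir] .
  have "Tgen r i \<cdot> Tw r w = (Tgen r i \<cdot> Tgen r i) \<cdot> Tw r v"
    unfolding e[symmetric] by (simp only: H.m_assoc Tgen_closed'[OF ir] Tw_closed[OF v])
  also have "\<dots> = Hconst r (qq - 1) \<cdot> (Tgen r i \<cdot> Tw r v) \<boxplus> Hconst r qq \<cdot> Tw r v"
    unfolding Tgen_square[OF r2 i]
    by (simp only: H.l_distr H.m_assoc H.m_closed Tgen_closed'[OF ir] Tw_closed[OF v] Hconst_closed')
  also have "\<dots> = Hconst r qq \<cdot> Tw r v \<boxplus> Hconst r (qq - 1) \<cdot> Tw r w"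
    unfolding e by (intro H.a_comm H.m_closed Hconst_closed' Tw_closed v w)
  finally show ?thesis unfolding v_def .
qed

lemma r_mem: "r \<in> {1..r}" using r2 by simp

text \<open>As \<open>Tgen r r\<close> is an involution, multiplying by it permutes the basis elements in both directions
  of the length.\<close>

lemma Tw_left_last:
  assumes w: "w \<in> WB r"
  shows "Tgen r r \<cdot> Tw r w = Tw r (sB r r \<circ> w)"
proof (rule WB_asc_cases[OF WB_inv[OF w], of r])
  assume "pinv w (r+1) < pinv w r"
  define v where "v = sB r r \<circ> w"
  have v: "v \<in> WB r" unfolding v_def by (intro WB_comp sB_WB r_mem w)
  have s: "sB r r (r+1) = r" "sB r r r = r+1"
    using sB_last[of r] r2 by simp_all
  have "pinv v r < pinv v (r+1)"
    unfolding v_def inv_sB_comp[OF r_mem w] s by fact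
  from Tw_left_up[OF v r_mem this] have e: "Tgen r r \<cdot> Tw r v = Tw r w"
    unfolding v_def sB_comp_sB[OF r_mem] .
  have "Tgen r r \<cdot> Tw r w = (Tgen r r \<cdot> Tgen r r) \<cdot> Tw r v"
    unfolding e[symmetric] by (simp only: H.m_assoc Tgen_closed'[OF r_mem] Tw_closed[OF v])
  also have "\<dots> = Tw r v"
    unfolding Tgen_square_last[OF r2] by (simp only: H.l_one Tw_closed[OF v])
  finally show ?thesis unfolding v_def .
qed (rule Tw_left_up[OF w r_mem])

lemma Tw_right_last:
  assumes w: "w \<in> WB r"
  shows "Tw r w \<cdot> Tgen r r = Tw r (w \<circ> sB r r)"
proof (rule WB_asc_cases[OF w, of r])
  assume d: "w (r+1) < w r"
  define v where "v = w \<circ> sB r r"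
  have v: "v \<in> WB r" unfolding v_def by (intro WB_comp sB_WB r_mem w)
  have s: "sB r r (r+1) = r" "sB r r r = r+1"
    using sB_last[of r] r2 by simp_all
  have "v r < v (r+1)" unfolding v_def o_apply s by (rule d)
  from Tw_right_up[OF v r_mem this] have e: "Tw r v \<cdot> Tgen r r = Tw r w"
    unfolding v_def by (simp only: o_assoc[symmetric] sB_comp_self[OF r_mem] o_id)
  have "Tw r w \<cdot> Tgen r r = Tw r v \<cdot> (Tgen r r \<cdot> Tgen r r)"
    unfolding e[symmetric] by (simp only: H.m_assoc Tgen_closed'[OF r_mem] Tw_closed[OF v])
  also have "\<dots> = Tw r v"
    unfolding Tgen_square_last[OF r2] by (simp only: H.r_one Tw_closed[OF v])
  finally show ?thesis unfolding v_def .
qed (rule Tw_right_up[OF w r_mem])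

subsection \<open>The subalgebra of type D\<close>

lemma HD_gens_closed: "range (Hconst r) \<union> Tgen r ` {1..<r} \<union> {Tgen r r \<cdot> Tgen r (r-1) \<cdot> Tgen r r} \<subseteq> carrier (HB r)"
  using r2 by auto

lemma HD_subset: "HD r \<subseteq> carrier (HB r)"
  unfolding HD_def by (rule H.generate_ring_incl[OF HD_gens_closed])

lemma HD_carrier: "x \<in> HD r \<Longrightarrow> x \<in> carrier (HB r)"
  using HD_subset by blast

lemma HD_mult: "x \<in> HD r \<Longrightarrow> y \<in> HD r \<Longrightarrow> x \<cdot> y \<in> HD r"
  unfolding HD_def by (rule generate_ring.eng_mult)

lemma HD_add: "x \<in> HD r \<Longrightarrow> y \<in> HD r \<Longrightarrow> x \<boxplus> y \<in> HD r"
  unfolding HD_def by (rule generate_ring.eng_add)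

lemma HD_const: "Hconst r c \<in> HD r"
  unfolding HD_def by (rule generate_ring.incl) simp

lemma HD_one: "\<one>\<^bsub>HB r\<^esub> \<in> HD r"
  unfolding HD_def by (rule generate_ring.one)

lemma HD_zero: "\<zero>\<^bsub>HB r\<^esub> \<in> HD r"
  using HD_const[of 0] Hconst_0[OF r2] by simp

lemma HD_gen: "1 \<le> i \<Longrightarrow> i < r \<Longrightarrow> Tgen r i \<in> HD r"
  unfolding HD_def by (rule generate_ring.incl) simp

lemma HD_conj_gen:
  assumes i: "1 \<le> i" "i < r"
  shows "Tgen r r \<cdot> (Tgen r i \<cdot> Tgen r r) \<in> HD r"
proof (cases "i = r - 1")
  case True
  have "Tgen r r \<cdot> Tgen r (r-1) \<cdot> Tgen r r \<in> HD r"
    unfolding HD_def by (rule generate_ring.incl) simp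
  then show ?thesis
    unfolding True using r2 by (subst H.m_assoc[symmetric]) simp_all
next
  case False
  have "i \<in> {1..r}" using i by simp
  note cl = Tgen_closed'[OF this] Tgen_closed'[OF r_mem]
  have "i + 2 \<le> r" using i False by linarith
  then have "Tgen r i \<cdot> Tgen r r = Tgen r r \<cdot> Tgen r i"
    using Tgen_commute[OF r2 \<open>i \<in> {1..r}\<close> r_mem] by simp
  then have "Tgen r r \<cdot> (Tgen r i \<cdot> Tgen r r) = (Tgen r r \<cdot> Tgen r r) \<cdot> Tgen r i"
    using cl by (simp only: H.m_assoc)
  then show ?thesis
    using HD_gen[OF i] cl by (simp only: Tgen_square_last[OF r2] H.l_one)
qed

text \<open>Words with an even number of letters \<open>r\<close> lie in the subalgebra; the induction carries
  along the words with an odd number, multiplied by one more \<open>Tgen r r\<close>.\<close>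

lemma prodT_HD:
  assumes "set u \<subseteq> {1..r}"
  shows "if oddB r (word_val (sB r) u) then Tgen r r \<cdot> prodT u \<in> HD r else prodT u \<in> HD r"
  using assms
proof (induction u)
  case Nil
  show ?case unfolding word_val_simps prodT_simps by (simp only: oddB_id if_False HD_one)
next
  case (Cons i u)
  then have i: "i \<in> {1..r}" and u: "set u \<subseteq> {1..r}" by auto
  have IH: "if oddB r (word_val (sB r) u) then Tgen r r \<cdot> prodT u \<in> HD r else prodT u \<in> HD r"
    by (rule Cons.IH[OF u])
  have o: "oddB r (word_val (sB r) (i # u)) \<longleftrightarrow>
     (if i = r then \<not> oddB r (word_val (sB r) u) else oddB r (word_val (sB r) u))"
    unfolding word_val_simps by (rule oddB_sB_comp[OF word_val_WB[OF u] i])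
  note cl = Tgen_closed'[OF i] Tgen_closed'[OF r_mem] prodT_closed[OF u]
  have sq: "Tgen r r \<cdot> (Tgen r r \<cdot> x) = x" if "x \<in> carrier (HB r)" for x
    using that cl by (simp only: H.m_assoc[symmetric] Tgen_square_last[OF r2] H.l_one)
  show ?case
  proof (cases "i = r")
    case True
    then show ?thesis unfolding o prodT_simps using IH sq[OF cl(3)] by (simp split: if_splits)
  next
    case False
    then have i': "1 \<le> i" "i < r" using i by auto
    show ?thesis
    proof (cases "oddB r (word_val (sB r) u)")
      case odd: True
      have "Tgen r r \<cdot> (Tgen r i \<cdot> prodT u) = Tgen r r \<cdot> (Tgen r i \<cdot> (Tgen r r \<cdot> (Tgen r r \<cdot> prodT u)))"
        unfolding sq[OF cl(3)] ..
      also have "\<dots> = (Tgen r r \<cdot> (Tgen r i \<cdot> Tgen r r)) \<cdot> (Tgen r r \<cdot> prodT u)"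
        using cl by (simp only: H.m_assoc H.m_closed)
      finally have "Tgen r r \<cdot> (Tgen r i \<cdot> prodT u) \<in> HD r"
        using HD_mult[OF HD_conj_gen[OF i']] IH odd by simp
      then show ?thesis unfolding o prodT_simps using False odd by simp
    next
      case even: False
      then have "Tgen r i \<cdot> prodT u \<in> HD r"
        using HD_mult[OF HD_gen[OF i']] IH by simp
      then show ?thesis unfolding o prodT_simps using False even by simp
    qed
  qed
qed

lemma Tw_HD:
  assumes "w \<in> WD r" shows "Tw r w \<in> HD r"
proof -
  have w: "w \<in> WB r" "\<not> oddB r w" using assms by (simp_all add: WD_iff)
  obtain u where u: "reduced_wordB r w u" using ex_reduced_wordB[OF w(1)] by blast
  have "word_val (sB r) u = w" using u by (simp add: reduced_wordB_def)
  then show ?thesis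
    using prodT_HD[OF reduced_wordB_set[OF u]] w(2) Tw_reduced[OF w(1) u] by simp
qed

end

section \<open>Sums of standard basis elements\<close>

context heckeB
begin

text \<open>Elements of the algebra are handled through their coefficient functions: every identity of
  coefficient functions yields an identity in the algebra.\<close>

definition ev :: "((nat \<Rightarrow> nat) \<Rightarrow> int poly) \<Rightarrow> hecke" where
  "ev f = (\<Oplus>\<^bsub>HB r\<^esub> w\<in>WB r. Hconst r (f w) \<cdot> Tw r w)"

definition TS :: "(nat \<Rightarrow> nat) set \<Rightarrow> hecke" where
  "TS D = (\<Oplus>\<^bsub>HB r\<^esub> w\<in>D. Tw r w)"

lemma ev_closed [simp, intro]: "ev f \<in> carrier (HB r)"
  unfolding ev_def by (intro H.finsum_closed) auto

lemma TS_closed [simp, intro]: "D \<subseteq> WB r \<Longrightarrow> TS D \<in> carrier (HB r)"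
  unfolding TS_def by (intro H.finsum_closed) auto

lemma ev_cong: "(\<And>w. w \<in> WB r \<Longrightarrow> f w = g w) \<Longrightarrow> ev f = ev g"
  unfolding ev_def by (intro H.finsum_cong') auto

lemma ev_add: "ev (\<lambda>w. f w + g w) = ev f \<boxplus> ev g"
proof -
  have "ev (\<lambda>w. f w + g w) =
      (\<Oplus>\<^bsub>HB r\<^esub> w\<in>WB r. Hconst r (f w) \<cdot> Tw r w \<boxplus> Hconst r (g w) \<cdot> Tw r w)"
    unfolding ev_def
    by (intro H.finsum_cong') (auto simp: Hconst_add[OF r2] H.l_distr)
  also have "\<dots> = ev f \<boxplus> ev g"
    unfolding ev_def by (intro H.finsum_addf) auto
  finally show ?thesis .
qed

lemma ev_smult: "ev (\<lambda>w. c * f w) = Hconst r c \<cdot> ev f"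
proof -
  have "ev (\<lambda>w. c * f w) = (\<Oplus>\<^bsub>HB r\<^esub> w\<in>WB r. Hconst r c \<cdot> (Hconst r (f w) \<cdot> Tw r w))"
    unfolding ev_def
    by (intro H.finsum_cong') (auto simp: Hconst_mult[OF r2] H.m_assoc)
  also have "\<dots> = Hconst r c \<cdot> ev f"
    unfolding ev_def by (intro H.finsum_rdistr[symmetric] finite_WB) auto
  finally show ?thesis .
qed

lemma ev_zero: "ev (\<lambda>w. 0) = \<zero>\<^bsub>HB r\<^esub>"
  using ev_smult[of 0 "\<lambda>w. 0"] by (simp add: Hconst_0[OF r2])

lemma ev_sum: "finite K \<Longrightarrow> ev (\<lambda>w. \<Sum>k\<in>K. F k w) = (\<Oplus>\<^bsub>HB r\<^esub> k\<in>K. ev (F k))"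
proof (induction K rule: finite_induct)
  case empty
  then show ?case by (simp add: ev_zero)
next
  case (insert k K)
  then have "ev (\<lambda>w. \<Sum>k\<in>insert k K. F k w) = ev (\<lambda>w. F k w + (\<Sum>k\<in>K. F k w))"
    by (intro ev_cong) simp
  also have "\<dots> = ev (F k) \<boxplus> (\<Oplus>\<^bsub>HB r\<^esub> k\<in>K. ev (F k))"
    using insert.IH by (simp add: ev_add)
  also have "\<dots> = (\<Oplus>\<^bsub>HB r\<^esub> k\<in>insert k K. ev (F k))"
    using insert.hyps by (intro H.finsum_insert[symmetric]) auto
  finally show ?case .
qed

lemma ev_indicator:
  assumes "D \<subseteq> WB r"
  shows "ev (\<lambda>w. if w \<in> D then 1 else 0) = TS D"
  unfolding ev_def TS_def
  by (rule H.add.finprod_mono_neutral_cong_right[OF finite_WB assms])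
    (use assms in \<open>auto simp: Hconst_0[OF r2] Hconst_1[OF r2]\<close>)

lemma TS_Un_disjoint:
  assumes "D \<subseteq> WB r" "E \<subseteq> WB r" "D \<inter> E = {}"
  shows "TS (D \<union> E) = TS D \<boxplus> TS E"
  unfolding TS_def
  by (intro H.finsum_Un_disjoint assms finite_subset[OF assms(1) finite_WB]
      finite_subset[OF assms(2) finite_WB]) (use assms in auto)

lemma TS_empty [simp]: "TS {} = \<zero>\<^bsub>HB r\<^esub>"
  by (simp add: TS_def)

lemma TS_left_last:
  assumes "D \<subseteq> WB r"
  shows "Tgen r r \<cdot> TS D = TS ((\<lambda>w. sB r r \<circ> w) ` D)"
proof -
  have inj: "inj_on (\<lambda>w. sB r r \<circ> w) D"
    by (rule inj_on_inverseI[of _ "\<lambda>w. sB r r \<circ> w"]) (simp only: sB_comp_sB[OF r_mem])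
  have WB: "sB r r \<circ> w \<in> WB r" if "w \<in> D" for w
    using that assms by (intro WB_comp sB_WB r_mem) auto
  have "Tgen r r \<cdot> TS D = (\<Oplus>\<^bsub>HB r\<^esub> w\<in>D. Tgen r r \<cdot> Tw r w)"
    unfolding TS_def using assms r_mem
    by (intro H.finsum_rdistr finite_subset[OF assms finite_WB]) auto
  also have "\<dots> = (\<Oplus>\<^bsub>HB r\<^esub> w\<in>D. Tw r (sB r r \<circ> w))"
    using assms WB by (intro H.finsum_cong') (auto simp: Tw_left_last)
  also have "\<dots> = TS ((\<lambda>w. sB r r \<circ> w) ` D)"
    unfolding TS_def
    by (rule H.finsum_reindex[symmetric, OF _ inj], rule Pi_I) (erule imageE, hypsubst, rule Tw_closed, erule WB)
  finally show ?thesis .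
qed

lemma TS_right_last:
  assumes "D \<subseteq> WB r"
  shows "TS D \<cdot> Tgen r r = TS ((\<lambda>w. w \<circ> sB r r) ` D)"
proof -
  have inj: "inj_on (\<lambda>w. w \<circ> sB r r) D"
    by (rule inj_on_inverseI[of _ "\<lambda>w. w \<circ> sB r r"])
      (simp only: o_assoc[symmetric] sB_comp_self[OF r_mem] o_id)
  have WB: "w \<circ> sB r r \<in> WB r" if "w \<in> D" for w
    using that assms by (intro WB_comp sB_WB r_mem) auto
  have "TS D \<cdot> Tgen r r = (\<Oplus>\<^bsub>HB r\<^esub> w\<in>D. Tw r w \<cdot> Tgen r r)"
    unfolding TS_def using assms r_mem
    by (intro H.finsum_ldistr finite_subset[OF assms finite_WB]) auto
  also have "\<dots> = (\<Oplus>\<^bsub>HB r\<^esub> w\<in>D. Tw r (w \<circ> sB r r))"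
    using assms WB by (intro H.finsum_cong') (auto simp: Tw_right_last)
  also have "\<dots> = TS ((\<lambda>w. w \<circ> sB r r) ` D)"
    unfolding TS_def
    by (rule H.finsum_reindex[symmetric, OF _ inj], rule Pi_I) (erule imageE, hypsubst, rule Tw_closed, erule WB)
  finally show ?thesis .
qed

text \<open>Left multiplication by a generator, transported to coefficient functions.\<close>

definition Lop :: "nat \<Rightarrow> ((nat \<Rightarrow> nat) \<Rightarrow> int poly) \<Rightarrow> (nat \<Rightarrow> nat) \<Rightarrow> int poly" where
  "Lop j f v = (if pinv v j < pinv v (j+1) then qq * f (sB r j \<circ> v)
     else f (sB r j \<circ> v) + (qq - 1) * f v)"

lemma ev_left:
  assumes j: "1 \<le> j" "j < r"
  shows "Tgen r j \<cdot> ev f = ev (Lop j f)"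
proof -
  have jr: "j \<in> {1..r}" using j by simp
  let ?asc = "\<lambda>w. pinv w j < pinv w (j+1)"
  define a b :: "(nat \<Rightarrow> nat) \<Rightarrow> int poly" where "a = (\<lambda>w. if ?asc w then 1 else qq)" and "b = (\<lambda>w. if ?asc w then 0 else qq - 1)"
  have sW: "sB r j \<circ> w \<in> WB r" if "w \<in> WB r" for w
    using that by (intro WB_comp sB_WB jr)
  have trm: "Tgen r j \<cdot> (Hconst r (f w) \<cdot> Tw r w) =
      Hconst r (f w * a w) \<cdot> Tw r (sB r j \<circ> w) \<boxplus> Hconst r (f w * b w) \<cdot> Tw r w"
    if w: "w \<in> WB r" for w
  proof -
    note cl = Tgen_closed'[OF jr] Tw_closed[OF w] Tw_closed[OF sW[OF w]] Hconst_closed'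
    have "Tgen r j \<cdot> (Hconst r (f w) \<cdot> Tw r w) = Hconst r (f w) \<cdot> (Tgen r j \<cdot> Tw r w)"
      using cl by (simp only: H.m_assoc[symmetric] Hconst_central[OF r2])
    also have "Tgen r j \<cdot> Tw r w = Hconst r (a w) \<cdot> Tw r (sB r j \<circ> w) \<boxplus> Hconst r (b w) \<cdot> Tw r w"
    proof (cases "?asc w")
      case True
      then show ?thesis
        using Tw_left_up[OF w jr True] cl
        by (simp add: a_def b_def Hconst_0[OF r2] Hconst_1[OF r2])
    next
      case False
      then have "pinv w (j+1) < pinv w j"
        using WB_inj[OF WB_inv[OF w], of j "j+1"] by linarith
      from Tw_left_down[OF w j this] show ?thesis
        using False by (simp add: a_def b_def)
    qed
    finally show ?thesis
      using cl by (simp only: H.r_distr H.m_closed H.m_assoc[symmetric] Hconst_mult[OF r2])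
  qed
  have "Tgen r j \<cdot> ev f = (\<Oplus>\<^bsub>HB r\<^esub> w\<in>WB r. Tgen r j \<cdot> (Hconst r (f w) \<cdot> Tw r w))"
    unfolding ev_def using jr by (intro H.finsum_rdistr finite_WB) auto
  also have "\<dots> = (\<Oplus>\<^bsub>HB r\<^esub> w\<in>WB r. Hconst r (f w * a w) \<cdot> Tw r (sB r j \<circ> w) \<boxplus> Hconst r (f w * b w) \<cdot> Tw r w)"
    using sW by (intro H.finsum_cong') (auto simp: trm)
  also have "\<dots> = (\<Oplus>\<^bsub>HB r\<^esub> w\<in>WB r. Hconst r (f w * a w) \<cdot> Tw r (sB r j \<circ> w)) \<boxplus> ev (\<lambda>w. f w * b w)"
    unfolding ev_def using sW by (intro H.finsum_addf) auto
  also have "(\<Oplus>\<^bsub>HB r\<^esub> w\<in>WB r. Hconst r (f w * a w) \<cdot> Tw r (sB r j \<circ> w)) =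
      ev (\<lambda>w. f (sB r j \<circ> w) * a (sB r j \<circ> w))"
  proof -
    have inj: "inj_on (\<lambda>w. sB r j \<circ> w) (WB r)"
      by (rule inj_on_inverseI[of _ "\<lambda>w. sB r j \<circ> w"]) (simp only: sB_comp_sB[OF jr])
    have im: "(\<lambda>w. sB r j \<circ> w) ` WB r = WB r"
    proof
      show "WB r \<subseteq> (\<lambda>w. sB r j \<circ> w) ` WB r"
      proof
        fix w assume "w \<in> WB r"
        then show "w \<in> (\<lambda>w. sB r j \<circ> w) ` WB r"
          by (intro image_eqI[of _ _ "sB r j \<circ> w"] sW) (simp_all only: sB_comp_sB[OF jr])
      qed
    qed (use sW in auto)
    let ?G = "\<lambda>w. Hconst r (f (sB r j \<circ> w) * a (sB r j \<circ> w)) \<cdot> Tw r w"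
    have "ev (\<lambda>w. f (sB r j \<circ> w) * a (sB r j \<circ> w)) =
        (\<Oplus>\<^bsub>HB r\<^esub> w\<in>(\<lambda>w. sB r j \<circ> w) ` WB r. ?G w)"
      unfolding ev_def im ..
    also have "\<dots> = (\<Oplus>\<^bsub>HB r\<^esub> w\<in>WB r. ?G (sB r j \<circ> w))"
      using sW by (intro H.finsum_reindex inj) auto
    also have "\<dots> = (\<Oplus>\<^bsub>HB r\<^esub> w\<in>WB r. Hconst r (f w * a w) \<cdot> Tw r (sB r j \<circ> w))"
      by (simp only: sB_comp_sB[OF jr])
    finally show ?thesis by simp
  qed
  also have "ev (\<lambda>w. f (sB r j \<circ> w) * a (sB r j \<circ> w)) \<boxplus> ev (\<lambda>w. f w * b w) = ev (Lop j f)"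
    unfolding ev_add[symmetric]
  proof (rule ev_cong)
    fix w assume w: "w \<in> WB r"
    have s: "sB r j j = j + 1" "sB r j (j+1) = j" using sB_small[of j r] j by simp_all
    have "?asc (sB r j \<circ> w) \<longleftrightarrow> pinv w (j+1) < pinv w j"
      unfolding inv_sB_comp[OF jr w] s ..
    moreover have "pinv w (j+1) < pinv w j \<longleftrightarrow> \<not> ?asc w"
      using WB_inj[OF WB_inv[OF w], of j "j+1"] by linarith
    ultimately show "f (sB r j \<circ> w) * a (sB r j \<circ> w) + f w * b w = Lop j f w"
      by (simp add: a_def b_def Lop_def mult.commute)
  qed
  finally show ?thesis .
qed

end

section \<open>Blocks, Young subgroups and double cosets\<close>

text \<open>A block is encoded by the map to block indices instead of an interval: such maps compose with
  permutations, and intersection numbers of blocks become joint counts of two of them.\<close>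

definition psum :: "nat \<Rightarrow> (nat \<Rightarrow> nat) \<Rightarrow> nat \<Rightarrow> nat" where
  "psum n l i = (\<Sum>k\<in>{1..i}. hat n l k)"

definition bl :: "nat \<Rightarrow> (nat \<Rightarrow> nat) \<Rightarrow> nat \<Rightarrow> nat" where
  "bl n l x = (LEAST i. x \<le> psum n l i)"

lemma psum_mono: "i \<le> j \<Longrightarrow> psum n l i \<le> psum n l j"
  unfolding psum_def by (rule sum_mono2) auto

lemma psum_0 [simp]: "psum n l 0 = 0"
  by (simp add: psum_def)

lemma psum_Suc: "psum n l (Suc i) = psum n l i + hat n l (Suc i)"
  by (simp add: psum_def)

lemma hat_sym: "i \<in> {1..2*n+1} \<Longrightarrow> hat n l (2*n+2-i) = hat n l i"
  unfolding hat_def by auto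

lemma psum_small: "i \<le> n \<Longrightarrow> psum n l i = (\<Sum>k\<in>{1..i}. l k)"
  unfolding psum_def by (rule sum.cong) (auto simp: hat_def)

lemma bl_mono: "x \<le> y \<Longrightarrow> \<exists>i. y \<le> psum n l i \<Longrightarrow> bl n l x \<le> bl n l y"
  unfolding bl_def by (rule Least_le) (metis (mono_tags, lifting) LeastI_ex order_trans)

lemma bl_eqI:
  assumes "1 \<le> i" "psum n l (i - 1) < x" "x \<le> psum n l i"
  shows "bl n l x = i"
  unfolding bl_def
proof (rule Least_equality)
  show "x \<le> psum n l i" by (rule assms(3))
  fix j assume j: "x \<le> psum n l j"
  show "i \<le> j"
  proof (rule ccontr)
    assume "\<not> i \<le> j"
    then have "j \<le> i - 1" by simp
    from psum_mono[OF this, of n l] show False using j assms(2) by simp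
  qed
qed

context
  fixes n r :: nat and l :: "nat \<Rightarrow> nat"
  assumes l: "l \<in> Lam (n+1) r"
begin

lemma psum_n: "psum n l n + l (n+1) = r"
  using l psum_small[of n n l] by (simp add: Lam_def)

lemma psum_mid: "psum n l (n+1) = r + l (n+1)"
  using psum_n psum_Suc[of n l n] by (simp add: hat_def)

lemma psum_mirror_total:
  assumes "i \<le> 2*n+1"
  shows "psum n l (2*n+1-i) + psum n l i = psum n l (2*n+1)"
proof -
  have "psum n l (2*n+1-i) = (\<Sum>k\<in>{i+1..2*n+1}. hat n l k)"
    unfolding psum_def
  proof (rule sum.reindex_bij_witness[of _ "\<lambda>k. 2*n+2-k" "\<lambda>k. 2*n+2-k"])
    fix k assume "k \<in> {1..2*n+1-i}"
    then show "hat n l (2*n+2-k) = hat n l k" by (intro hat_sym) auto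
  qed (use assms in auto)
  moreover have "psum n l (2*n+1) = psum n l i + (\<Sum>k\<in>{i+1..2*n+1}. hat n l k)"
    unfolding psum_def using assms sum.ub_add_nat[of 1 i "hat n l" "2*n+1-i"] by simp
  ultimately show ?thesis by simp
qed

lemma psum_total: "psum n l (2*n+1) = 2*r"
  using psum_mirror_total[of n] psum_n psum_mid by (simp add: mult_2)

lemma psum_mirror: "i \<le> 2*n+1 \<Longrightarrow> psum n l (2*n+1-i) = 2*r - psum n l i"
  using psum_mirror_total[of i] psum_total by simp

lemma bl_props:
  assumes "x \<in> {1..2*r}"
  shows "psum n l (bl n l x - 1) < x" "x \<le> psum n l (bl n l x)" "1 \<le> bl n l x" "bl n l x \<le> 2*n+1"
proof -
  have ex: "x \<le> psum n l (2*n+1)" using assms psum_total by simp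
  show le: "x \<le> psum n l (bl n l x)" unfolding bl_def by (rule LeastI[of _ "2*n+1"]) (rule ex)
  show "bl n l x \<le> 2*n+1" unfolding bl_def by (rule Least_le) (rule ex)
  have "bl n l x \<noteq> 0"
  proof
    assume "bl n l x = 0"
    then show False using le assms by simp
  qed
  then show "1 \<le> bl n l x" by simp
  then have "bl n l x - 1 < bl n l x" by simp
  then have "\<not> x \<le> psum n l (bl n l x - 1)"
    using not_less_Least[of "bl n l x - 1" "\<lambda>i. x \<le> psum n l i"] unfolding bl_def by blast
  then show "psum n l (bl n l x - 1) < x" by simp
qed

lemma bl_range: "x \<in> {1..2*r} \<Longrightarrow> bl n l x \<in> {1..2*n+1}"
  using bl_props by auto

lemma bl_le: "x \<le> y \<Longrightarrow> y \<in> {1..2*r} \<Longrightarrow> bl n l x \<le> bl n l y"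
  by (rule bl_mono) (use bl_props in blast)+

lemma bl_mirror:
  assumes "x \<in> {1..2*r}"
  shows "bl n l (2*r+1-x) = 2*n+2 - bl n l x"
proof -
  define b where "b = bl n l x"
  have b: "psum n l (b - 1) < x" "x \<le> psum n l b" "1 \<le> b" "b \<le> 2*n+1"
    using bl_props[OF assms] by (simp_all add: b_def)
  have p1: "psum n l (2*n+1-b) = 2*r - psum n l b" using b(4) by (rule psum_mirror)
  have "b - 1 \<le> 2*n+1" using b(4) by simp
  from psum_mirror[OF this] have p2: "psum n l (2*n+1-(b-1)) = 2*r - psum n l (b-1)" .
  have e: "2*n+1-(b-1) = 2*n+2-b" "2*n+2-b-1 = 2*n+1-b" using b(3,4) by simp_all
  have x: "1 \<le> x" "x \<le> 2*r" using assms by simp_all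
  have le: "psum n l b \<le> 2*r" using psum_mono[OF b(4), of n l] psum_total by simp
  have "bl n l (2*r+1-x) = 2*n+2-b"
  proof (rule bl_eqI)
    show "1 \<le> 2*n+2-b" using b(4) by simp
    show "psum n l (2*n+2-b-1) < 2*r+1-x" unfolding e p1 using b(2) x le by linarith
    show "2*r+1-x \<le> psum n l (2*n+2-b)" unfolding e(1)[symmetric] p2 using b(1) x by linarith
  qed
  then show ?thesis by (simp add: b_def)
qed

lemma block_iff:
  assumes "i \<in> {1..2*n+1}"
  shows "x \<in> block (hat n l) i \<longleftrightarrow> x \<in> {1..2*r} \<and> bl n l x = i"
proof -
  have "{1..<i} = {1..i-1}" using assms by auto
  then have "block (hat n l) i = {psum n l (i-1)<..psum n l i}"
    by (simp add: block_def psum_def)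
  moreover have "psum n l i \<le> 2*r"
    using psum_mono[of i "2*n+1" n l] assms psum_total by simp
  ultimately show ?thesis
    using bl_eqI[of i n l x] bl_props[of x] assms by auto
qed

lemma card_bl:
  assumes "i \<in> {1..2*n+1}"
  shows "card {x \<in> {1..2*r}. bl n l x = i} = hat n l i"
proof -
  have "{x \<in> {1..2*r}. bl n l x = i} = block (hat n l) i"
    using block_iff[OF assms] by blast
  moreover have "{1..<i} = {1..i-1}" "Suc (i - 1) = i" using assms by auto
  moreover from this have "psum n l i = psum n l (i-1) + hat n l i"
    using psum_Suc[of n l "i-1"] by simp
  ultimately show ?thesis by (simp add: block_def psum_def)
qed

lemma bl_adjacent:
  assumes "j \<in> {1..r}"
  shows "bl n l j = bl n l (j+1) \<longleftrightarrow> j \<notin> {\<Sum>k\<in>{1..i}. l k | i. i \<in> {1..n}}"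
proof -
  have j: "j \<in> {1..2*r}" "j + 1 \<in> {1..2*r}" using assms by auto
  define b where "b = bl n l j"
  have b: "psum n l (b - 1) < j" "j \<le> psum n l b" "1 \<le> b" "b \<le> 2*n+1"
    using bl_props[OF j(1)] by (simp_all add: b_def)
  have "bl n l j \<noteq> bl n l (j+1) \<longleftrightarrow> psum n l b = j"
  proof
    assume ne: "bl n l j \<noteq> bl n l (j+1)"
    show "psum n l b = j"
    proof (rule ccontr)
      assume "psum n l b \<noteq> j"
      then have "bl n l (j+1) = b" using b by (intro bl_eqI) auto
      then show False using ne by (simp add: b_def)
    qed
  next
    assume "psum n l b = j"
    then show "bl n l j \<noteq> bl n l (j+1)" using bl_props(2)[OF j(2)] by (auto simp: b_def)
  qed
  also have "\<dots> \<longleftrightarrow> (\<exists>i\<in>{1..n}. psum n l i = j)"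
  proof
    assume pb: "psum n l b = j"
    have "b \<le> n"
    proof (rule ccontr)
      assume "\<not> b \<le> n"
      then have "psum n l n \<le> psum n l (b-1)" "psum n l (n+1) \<le> psum n l b"
        by (auto intro: psum_mono)
      then show False using psum_n psum_mid pb b(1) assms by simp
    qed
    then show "\<exists>i\<in>{1..n}. psum n l i = j" using pb b(3) by auto
  next
    assume "\<exists>i\<in>{1..n}. psum n l i = j"
    then obtain i where i: "psum n l i = j" by blast
    have "\<not> i \<le> b - 1" using psum_mono[of i "b-1" n l] i b(1) by auto
    then have "psum n l b \<le> psum n l i" by (intro psum_mono) simp
    then show "psum n l b = j" using i b(2) by simp
  qed
  also have "\<dots> \<longleftrightarrow> j \<in> {\<Sum>k\<in>{1..i}. l k | i. i \<in> {1..n}}"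
    using psum_small[of _ n l] by fastforce
  finally show ?thesis by blast
qed

lemma bl_low: "x \<le> r \<Longrightarrow> bl n l x \<le> n+1"
  unfolding bl_def using psum_mid by (intro Least_le) simp

lemma bl_high:
  assumes "r < x" "x \<le> 2*r" shows "n + 1 \<le> bl n l x"
proof (rule ccontr)
  assume "\<not> n + 1 \<le> bl n l x"
  then have "psum n l (bl n l x) \<le> psum n l n" by (intro psum_mono) simp
  then show False using bl_props(2)[of x] assms psum_n by simp
qed

lemma bl_mid: "l (n+1) \<noteq> 0 \<Longrightarrow> 1 \<le> r \<Longrightarrow> bl n l r = n+1 \<and> bl n l (r+1) = n+1"
  using psum_n psum_mid by (intro conjI bl_eqI) auto

lemma bl_mid_nonzero:
  assumes "x \<in> {1..2*r}" "bl n l x = n+1" shows "l (n+1) \<noteq> 0"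
proof
  assume "l (n+1) = 0"
  then show False using bl_props(1,2)[OF assms(1)] assms(2) psum_n psum_mid by simp
qed

end

definition Yg :: "nat \<Rightarrow> (nat \<Rightarrow> nat) \<Rightarrow> (nat \<Rightarrow> nat) set" where
  "Yg r b = {w \<in> WB r. \<forall>x\<in>{1..2*r}. b (w x) = b x}"

lemma YgI: "w \<in> WB r \<Longrightarrow> (\<And>x. x \<in> {1..2*r} \<Longrightarrow> b (w x) = b x) \<Longrightarrow> w \<in> Yg r b"
  by (simp add: Yg_def)

lemma Yg_WB: "w \<in> Yg r b \<Longrightarrow> w \<in> WB r"
  by (simp add: Yg_def)

lemma Yg_apply: "w \<in> Yg r b \<Longrightarrow> x \<in> {1..2*r} \<Longrightarrow> b (w x) = b x"
  by (simp add: Yg_def)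

lemma Yg_id: "id \<in> Yg r b"
  by (simp add: Yg_def)

lemma Yg_comp:
  assumes "u \<in> Yg r b" "w \<in> Yg r b" shows "u \<circ> w \<in> Yg r b"
proof (rule YgI)
  show "u \<circ> w \<in> WB r" by (rule WB_comp[OF Yg_WB[OF assms(1)] Yg_WB[OF assms(2)]])
  fix x assume x: "x \<in> {1..2*r}"
  then have "w x \<in> {1..2*r}" by (rule WB_range[OF Yg_WB[OF assms(2)]])
  then show "b ((u \<circ> w) x) = b x"
    using x by (simp add: Yg_apply[OF assms(1)] Yg_apply[OF assms(2)])
qed

lemma Yg_inv:
  assumes "w \<in> Yg r b" shows "pinv w \<in> Yg r b"
proof (rule YgI)
  show "pinv w \<in> WB r" by (rule WB_inv[OF Yg_WB[OF assms]])
  fix x assume x: "x \<in> {1..2*r}"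
  then have "pinv w x \<in> {1..2*r}" by (rule WB_inv_range[OF Yg_WB[OF assms]])
  from Yg_apply[OF assms this] show "b (pinv w x) = b x"
    by (simp add: WB_inv_apply[OF Yg_WB[OF assms]])
qed

lemma WB_group_simps:
  "carrier (WB_group r) = WB r" "u \<otimes>\<^bsub>WB_group r\<^esub> v = u \<circ> v" "\<one>\<^bsub>WB_group r\<^esub> = id"
  by (simp_all add: WB_group_def)

lemma WB_group: "group (WB_group r)"
proof (rule groupI)
  fix w assume "w \<in> carrier (WB_group r)"
  then show "\<exists>v\<in>carrier (WB_group r). v \<otimes>\<^bsub>WB_group r\<^esub> w = \<one>\<^bsub>WB_group r\<^esub>"
    by (intro bexI[of _ "pinv w"]) (simp_all add: WB_group_def WB_inv)
qed (simp_all add: WB_group_def WB_comp o_assoc)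

lemma sB_Yg_iff:
  assumes l: "l \<in> Lam (n+1) r" and j: "j \<in> {1..r}"
  shows "sB r j \<in> Yg r (bl n l) \<longleftrightarrow> bl n l j = bl n l (j+1)"
proof
  assume "sB r j \<in> Yg r (bl n l)"
  from Yg_apply[OF this, of j] show "bl n l j = bl n l (j+1)"
    using j sB_apply[OF j, of j] by simp
next
  assume eq: "bl n l j = bl n l (j+1)"
  have "j \<in> {1..2*r}" "j+1 \<in> {1..2*r}" using j by auto
  from bl_mirror[OF l this(1)] bl_mirror[OF l this(2)]
  have "bl n l (2*r+1-j) = bl n l (2*r-j)" using eq by simp
  then show "sB r j \<in> Yg r (bl n l)"
    using eq by (intro YgI sB_WB j) (simp add: sB_apply[OF j])
qed

text \<open>A block preserving \<open>w\<close> has descents only inside blocks, so a reduced word of it uses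
  only the generators of the parabolic subgroup.\<close>

lemma WBpar_eq_Yg:
  assumes l: "l \<in> Lam (n+1) r"
  shows "WBpar n r l = Yg r (bl n l)"
proof
  interpret G: group "WB_group r" by (rule WB_group)
  let ?S = "{sB r j | j. j \<in> {1..r} \<and> j \<notin> {\<Sum>k\<in>{1..i}. l k | i. i \<in> {1..n}}}"
  have gen: "sB r j \<in> ?S" if "j \<in> {1..r}" "bl n l j = bl n l (j+1)" for j
    using that bl_adjacent[OF l that(1)] by blast
  have SY: "?S \<subseteq> Yg r (bl n l)"
    using sB_Yg_iff[OF l] bl_adjacent[OF l] by auto
  show "WBpar n r l \<subseteq> Yg r (bl n l)"
  proof
    fix w assume "w \<in> WBpar n r l"
    then have "w \<in> generate (WB_group r) ?S" by (simp add: WBpar_def)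
    then show "w \<in> Yg r (bl n l)"
    proof (induction rule: generate.induct)
      case one
      show ?case by (simp only: WB_group_simps Yg_id)
    next
      case (incl h)
      then show ?case using SY by blast
    next
      case (inv h)
      then obtain j where j: "h = sB r j" "j \<in> {1..r}" by blast
      have "m_inv (WB_group r) h = h"
        by (rule G.inv_equality) (use j sB_WB[OF j(2)] in \<open>simp_all add: WB_group_def\<close>)
      then show ?case using SY inv by auto
    next
      case (eng h1 h2)
      show ?case using Yg_comp[OF eng.IH] by (simp only: WB_group_simps)
    qed
  qed
  show "Yg r (bl n l) \<subseteq> WBpar n r l"
  proof
    fix w assume "w \<in> Yg r (bl n l)"
    then have "w \<in> generate (WB_group r) ?S"
    proof (induction "ellB r w" arbitrary: w rule: less_induct)
      case less
      note w = Yg_WB[OF less.prems]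
      show ?case
      proof (cases "\<exists>j\<in>{1..r}. pinv w (j+1) < pinv w j")
        case True
        then obtain j where j: "j \<in> {1..r}" "pinv w (j+1) < pinv w j" by blast
        have jr: "j \<in> {1..2*r}" "j+1 \<in> {1..2*r}" using j by auto
        have "bl n l (j+1) \<le> bl n l j"
          using bl_le[OF l less_imp_le[OF j(2)] WB_inv_range[OF w jr(1)]]
            Yg_apply[OF Yg_inv[OF less.prems]] jr by simp
        moreover have "bl n l j \<le> bl n l (j+1)" using bl_le[OF l _ jr(2)] by simp
        ultimately have e: "bl n l j = bl n l (j+1)" by simp
        have sY: "sB r j \<in> Yg r (bl n l)" using sB_Yg_iff[OF l j(1)] e by simp
        have "sB r j \<circ> w \<in> generate (WB_group r) ?S"
          using ellB_down[OF w j] by (intro less.hyps Yg_comp[OF sY less.prems]) simp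
        from generate.eng[OF generate.incl[OF gen[OF j(1) e]] this]
        show ?thesis by (simp only: WB_group_simps sB_comp_sB[OF j(1)])
      next
        case False
        then have "pinv w = id"
          using WB_asc_cases[OF WB_inv[OF w]]
          by (intro no_descent_id[OF WB_inv[OF w]]) metis
        then have "w = id" using WB_inv_inv[OF w] by simp
        then show ?thesis using generate.one[of "WB_group r" ?S] by (simp only: WB_group_simps)
      qed
    qed
    then show "w \<in> WBpar n r l" by (simp add: WBpar_def)
  qed
qed

text \<open>Two families of fibres with equal sizes, both compatible with a fixed point free involution, are
  matched by removing one orbit of the involution at a time: it consists of two points, whose fibres
  correspond to each other.\<close>

lemma equivariant_matching:
  assumes "finite X" "finite Y"
    and a: "\<And>x. x \<in> X \<Longrightarrow> a x \<in> X \<and> a (a x) = x \<and> a x \<noteq> x"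
    and b: "\<And>y. y \<in> Y \<Longrightarrow> b y \<in> Y \<and> b (b y) = y \<and> b y \<noteq> y"
    and F: "\<And>x. x \<in> X \<Longrightarrow> F (a x) = \<iota> (F x)"
    and G: "\<And>y. y \<in> Y \<Longrightarrow> G (b y) = \<iota> (G y)"
    and c: "\<And>i. card {x \<in> X. F x = i} = card {y \<in> Y. G y = i}"
  shows "\<exists>w. bij_betw w X Y \<and> (\<forall>x\<in>X. G (w x) = F x \<and> w (a x) = b (w x))"
  using assms
proof (induction "card X" arbitrary: X Y rule: less_induct)
  case less
  note fX = less.prems(1) and fY = less.prems(2) and a = less.prems(3) and b = less.prems(4)
    and F = less.prems(5) and G = less.prems(6) and c = less.prems(7)
  show ?case
  proof (cases "X = {}")
    case True
    have "Y = {}"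
    proof (rule ccontr)
      assume "Y \<noteq> {}"
      then obtain y where "y \<in> Y" by blast
      then have "card {y' \<in> Y. G y' = G y} > 0" using fY by (auto simp: card_gt_0_iff)
      then show False using c[of "G y"] True by simp
    qed
    then show ?thesis using True by (simp add: bij_betw_def)
  next
    case False
    then obtain x where x: "x \<in> X" by blast
    have "card {x' \<in> X. F x' = F x} > 0" using fX x by (auto simp: card_gt_0_iff)
    then have "card {y' \<in> Y. G y' = F x} > 0" using c by simp
    then obtain y where y: "y \<in> Y" "G y = F x" by (auto simp: card_gt_0_iff)
    note ax = a[OF x] and by' = b[OF y(1)]
    have ne: "x \<noteq> a x" "y \<noteq> b y" using ax by' by metis+
    define X' Y' where "X' = X - {x, a x}" and "Y' = Y - {y, b y}"
    have cardX: "card {z \<in> X. F z = i} = card {z \<in> X'. F z = i} + card {z \<in> {x, a x}. F z = i}" for i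
    proof -
      have "{z \<in> X. F z = i} = {z \<in> X'. F z = i} \<union> {z \<in> {x, a x}. F z = i}"
        using x ax by (auto simp: X'_def)
      then show ?thesis
        using fX by (simp only:) (rule card_Un_disjoint, auto simp: X'_def)
    qed
    have cardY: "card {z \<in> Y. G z = i} = card {z \<in> Y'. G z = i} + card {z \<in> {y, b y}. G z = i}" for i
    proof -
      have "{z \<in> Y. G z = i} = {z \<in> Y'. G z = i} \<union> {z \<in> {y, b y}. G z = i}"
        using y by' by (auto simp: Y'_def)
      then show ?thesis
        using fY by (simp only:) (rule card_Un_disjoint, auto simp: Y'_def)
    qed
    have pair: "card {z \<in> {p, p'}. h z = i} = (if h p = i then 1 else 0) + (if h p' = i then 1 else 0)"
      if "p \<noteq> p'" for p p' i and h :: "'z \<Rightarrow> 'c"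
    proof -
      have "{z \<in> {p, p'}. h z = i} = (if h p = i then {p} else {}) \<union> (if h p' = i then {p'} else {})"
        by auto
      then show ?thesis using that by simp
    qed
    have c': "card {z \<in> X'. F z = i} = card {z \<in> Y'. G z = i}" for i
    proof -
      have "card {z \<in> {x, a x}. F z = i} = card {z \<in> {y, b y}. G z = i}"
        using pair[OF ne(1), of F i] pair[OF ne(2), of G i] F[OF x] G[OF y(1)] y(2) by simp
      then show ?thesis using c[of i] cardX[of i] cardY[of i] by simp
    qed
    have a': "a z \<in> X' \<and> a (a z) = z \<and> a z \<noteq> z" if "z \<in> X'" for z
      using that a[of z] ax by (auto simp: X'_def)
    have b': "b z \<in> Y' \<and> b (b z) = z \<and> b z \<noteq> z" if "z \<in> Y'" for z
      using that b[of z] by' by (auto simp: Y'_def)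
    have "card X' < card X" unfolding X'_def using fX x by (intro psubset_card_mono) auto
    from less.hyps[OF this _ _ a' b' _ _ c'] obtain w where
      w: "bij_betw w X' Y'" "\<And>z. z \<in> X' \<Longrightarrow> G (w z) = F z \<and> w (a z) = b (w z)"
      using fX fY F G by (auto simp: X'_def Y'_def)
    define v where "v = w(x := y, a x := b y)"
    have v1: "v x = y" "v (a x) = b y" using ne by (simp_all add: v_def)
    have v2: "v z = w z" if "z \<in> X'" for z using that by (simp add: v_def X'_def)
    have "bij_betw v X' Y'" using w(1) v2 by (simp cong: bij_betw_cong)
    moreover have "bij_betw v {x, a x} {y, b y}"
      using v1 ax by' by (auto simp: bij_betw_def inj_on_def)
    ultimately have "bij_betw v (X' \<union> {x, a x}) (Y' \<union> {y, b y})"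
      by (rule bij_betw_combine) (auto simp: Y'_def)
    moreover have "X' \<union> {x, a x} = X" "Y' \<union> {y, b y} = Y"
      using x ax y by' by (auto simp: X'_def Y'_def)
    moreover have "G (v z) = F z \<and> v (a z) = b (v z)" if "z \<in> X" for z
    proof (cases "z \<in> X'")
      case True
      then show ?thesis using w(2)[OF True] v2 a' by simp
    next
      case False
      then have "z = x \<or> z = a x" using that by (auto simp: X'_def)
      then show ?thesis using v1 ax by' F[OF x] G[OF y(1)] y(2) by auto
    qed
    ultimately show ?thesis by auto
  qed
qed

lemma mirror_range: "x \<in> {1..2*r::nat} \<Longrightarrow> 2*r+1-x \<in> {1..2*r} \<and> 2*r+1-(2*r+1-x) = x \<and> 2*r+1-x \<noteq> x"
proof -
  assume x: "x \<in> {1..2*r}"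
  have "2*r+1 \<noteq> 2*x" by presburger
  then show ?thesis using x by auto
qed

lemma WB_from_bij:
  assumes "bij_betw w {1..2*r} {1..2*r}" "\<And>x. x \<in> {1..2*r} \<Longrightarrow> w (2*r+1-x) = 2*r+1 - w x"
  shows "\<exists>v\<in>WB r. \<forall>x\<in>{1..2*r}. v x = w x"
proof -
  define v where "v x = (if x \<in> {1..2*r} then w x else x)" for x
  have e: "v x = w x" if "x \<in> {1..2*r}" for x using that by (simp add: v_def)
  have "bij_betw v {1..2*r} {1..2*r} = bij_betw w {1..2*r} {1..2*r}"
    by (rule bij_betw_cong) (rule e)
  then have "bij_betw v {1..2*r} {1..2*r}" using assms(1) by simp
  then have "v permutes {1..2*r}" by (rule bij_imp_permutes) (auto simp: v_def)
  then have "v \<in> WB r"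
    by (rule WBI) (use assms(2) e mirror_range in metis)
  then show ?thesis using e by blast
qed

text \<open>For the block maps of two compositions this is the matrix of the double coset of \<open>w\<close>.\<close>

definition cnt :: "nat \<Rightarrow> (nat \<Rightarrow> nat) \<Rightarrow> (nat \<Rightarrow> nat) \<Rightarrow> (nat \<Rightarrow> nat) \<Rightarrow> nmat" where
  "cnt r b c w i j = card {x \<in> {1..2*r}. c x = j \<and> b (w x) = i}"

text \<open>The pairs of the column block of \<open>x\<close> and the row block of its image have the same distribution for
  both permutations, so a mirror symmetric matching \<open>k'\<close> exchanges them; it preserves the column
  blocks, and the row factor \<open>k\<close> is then forced.\<close>

lemma cnt_orbit:
  assumes w: "w \<in> WB r" and v: "v \<in> WB r"
    and b: "\<And>x. x \<in> {1..2*r} \<Longrightarrow> b (2*r+1-x) = M - b x"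
    and c: "\<And>x. x \<in> {1..2*r} \<Longrightarrow> c (2*r+1-x) = M - c x"
    and eq: "cnt r b c w = cnt r b c v"
  shows "\<exists>k\<in>Yg r b. \<exists>k'\<in>Yg r c. v = k \<circ> w \<circ> k'"
proof -
  let ?X = "{1..2*r}" and ?m = "\<lambda>x. 2*r+1-x"
  have "\<exists>u. bij_betw u ?X ?X \<and> (\<forall>x\<in>?X. (c (u x), b (w (u x))) = (c x, b (v x)) \<and> u (?m x) = ?m (u x))"
  proof (rule equivariant_matching[where \<iota> = "\<lambda>(i,j). (M - i, M - j)"])
    fix x assume x: "x \<in> ?X"
    show "(c (?m x), b (v (?m x))) = (\<lambda>(i,j). (M - i, M - j)) (c x, b (v x))"
      "(c (?m x), b (w (?m x))) = (\<lambda>(i,j). (M - i, M - j)) (c x, b (w x))"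
      using WB_mirror[OF w x] WB_mirror[OF v x] b[OF WB_range[OF w x]] b[OF WB_range[OF v x]] c[OF x]
      by simp_all
  next
    fix ij :: "nat \<times> nat"
    have "card {x \<in> ?X. (c x, b (u x)) = ij} = cnt r b c u (snd ij) (fst ij)" for u
      unfolding cnt_def by (rule arg_cong[of _ _ card]) auto
    then show "card {x \<in> ?X. (c x, b (v x)) = ij} = card {x \<in> ?X. (c x, b (w x)) = ij}"
      using eq by simp
  qed (use mirror_range in auto)
  then obtain u where u: "bij_betw u ?X ?X"
    "\<And>x. x \<in> ?X \<Longrightarrow> c (u x) = c x \<and> b (w (u x)) = b (v x) \<and> u (?m x) = ?m (u x)"
    by auto
  from WB_from_bij[OF u(1)] u(2) obtain k' where k': "k' \<in> WB r" "\<And>x. x \<in> ?X \<Longrightarrow> k' x = u x"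
    by blast
  have kY: "k' \<in> Yg r c" using k' u(2) by (intro YgI) auto
  define k where "k = v \<circ> (pinv k' \<circ> pinv w)"
  have "k \<in> Yg r b"
  proof (rule YgI)
    show "k \<in> WB r" unfolding k_def by (intro WB_comp WB_inv v w k'(1))
    fix y assume y: "y \<in> ?X"
    define x where "x = pinv k' (pinv w y)"
    have x: "x \<in> ?X" unfolding x_def by (intro WB_inv_range[OF k'(1)] WB_inv_range[OF w] y)
    have "w (k' x) = y" by (simp add: x_def WB_inv_apply[OF w] WB_inv_apply[OF k'(1)])
    then show "b (k y) = b y" using u(2)[OF x] k'(2)[OF x] by (simp add: k_def x_def)
  qed
  moreover have "v = k \<circ> w \<circ> k'"
    by (rule ext) (simp add: k_def WB_inv_apply[OF w] WB_inv_apply[OF k'(1)])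
  ultimately show ?thesis using kY by blast
qed

lemma cnt_Yg:
  assumes "w \<in> WB r" "k \<in> Yg r b" "k' \<in> Yg r c"
  shows "cnt r b c (k \<circ> w \<circ> k') = cnt r b c w"
proof (intro ext)
  fix i j
  note k = Yg_WB[OF assms(2)] and k' = Yg_WB[OF assms(3)]
  have "bij_betw k' {x \<in> {1..2*r}. c x = j \<and> b ((k \<circ> w \<circ> k') x) = i} {x \<in> {1..2*r}. c x = j \<and> b (w x) = i}"
  proof (rule bij_betw_byWitness[where f' = "pinv k'"])
    show "k' ` {x \<in> {1..2*r}. c x = j \<and> b ((k \<circ> w \<circ> k') x) = i} \<subseteq> {x \<in> {1..2*r}. c x = j \<and> b (w x) = i}"
      using WB_range[OF k'] WB_range[OF assms(1)] Yg_apply[OF assms(2)] Yg_apply[OF assms(3)] by auto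
    show "pinv k' ` {x \<in> {1..2*r}. c x = j \<and> b (w x) = i} \<subseteq> {x \<in> {1..2*r}. c x = j \<and> b ((k \<circ> w \<circ> k') x) = i}"
    proof (rule image_subsetI)
      fix x assume x: "x \<in> {x \<in> {1..2*r}. c x = j \<and> b (w x) = i}"
      then have "x \<in> {1..2*r}" by simp
      note r = WB_inv_range[OF k' this] WB_range[OF assms(1) this]
      show "pinv k' x \<in> {x \<in> {1..2*r}. c x = j \<and> b ((k \<circ> w \<circ> k') x) = i}"
        using x r Yg_apply[OF Yg_inv[OF assms(3)] \<open>x \<in> {1..2*r}\<close>] Yg_apply[OF assms(2) r(2)]
        by (simp add: WB_inv_apply[OF k'])
    qed
  qed (simp_all add: WB_inv_apply[OF k'])
  then show "cnt r b c (k \<circ> w \<circ> k') i j = cnt r b c w i j"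
    unfolding cnt_def by (rule bij_betw_same_card)
qed

lemma card_triples_row:
  assumes "finite I" "finite J"
  shows "card {(i',j,k). i' \<in> I \<and> j \<in> J \<and> k < A i' j \<and> i' = i} = (if i \<in> I then \<Sum>j\<in>J. A i j else (0::nat))"
proof (cases "i \<in> I")
  case True
  have "{(i',j,k). i' \<in> I \<and> j \<in> J \<and> k < A i' j \<and> i' = i} = Pair i ` (SIGMA j:J. {..<A i j})"
    using True by auto
  then show ?thesis using True assms by (simp add: card_image inj_on_def)
next
  case False
  then have e: "{(i',j,k). i' \<in> I \<and> j \<in> J \<and> k < A i' j \<and> i' = i} = {}" by auto
  show ?thesis unfolding e using False by simp
qed

text \<open>Cut the cell \<open>(i,j)\<close> into \<open>A i j\<close> labelled units.  Central symmetry together with reversal of the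
  labels is an involution \<open>\<beta>\<close> of the units, free of fixed points because the central entry is even.
  The points can be matched with the units by columns (\<open>w1\<close>) and by rows (\<open>w2\<close>), and the permutation
  sought compares the two matchings.\<close>

lemma cnt_exists:
  fixes A :: nmat
  assumes b: "\<And>x. x \<in> {1..2*r} \<Longrightarrow> b (2*r+1-x) = 2*n+2 - b x \<and> b x \<in> {1..2*n+1}"
    and c: "\<And>x. x \<in> {1..2*r} \<Longrightarrow> c (2*r+1-x) = 2*n+2 - c x \<and> c x \<in> {1..2*n+1}"
    and sym: "\<And>i j. i \<in> {1..2*n+1} \<Longrightarrow> j \<in> {1..2*n+1} \<Longrightarrow> A i j = A (2*n+2-i) (2*n+2-j)"
    and out: "\<And>i j. \<not> (i \<in> {1..2*n+1} \<and> j \<in> {1..2*n+1}) \<Longrightarrow> A i j = 0"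
    and ev: "even (A (n+1) (n+1))"
    and row: "\<And>i. i \<in> {1..2*n+1} \<Longrightarrow> ro n A i = card {x \<in> {1..2*r}. b x = i}"
    and col: "\<And>j. j \<in> {1..2*n+1} \<Longrightarrow> co n A j = card {x \<in> {1..2*r}. c x = j}"
  shows "\<exists>w\<in>WB r. cnt r b c w = A"
proof -
  let ?N = "{1..2*n+1}" and ?X = "{1..2*r}" and ?m = "\<lambda>x. 2*r+1-x"
  define Y where "Y = {(i,j,k). i \<in> ?N \<and> j \<in> ?N \<and> k < A i j}"
  define \<beta> where "\<beta> = (\<lambda>(i,j,k). (2*n+2-i, 2*n+2-j, A i j - 1 - k))"
  have "Y = (SIGMA i:?N. SIGMA j:?N. {..<A i j})" by (auto simp: Y_def)
  then have fY: "finite Y" by simp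
  have inv: "\<beta> y \<in> Y \<and> \<beta> (\<beta> y) = y \<and> \<beta> y \<noteq> y" if yY: "y \<in> Y" for y
  proof -
    obtain i j k where y: "y = (i,j,k)" "i \<in> ?N" "j \<in> ?N" "k < A i j"
      using yY by (cases y) (auto simp: Y_def)
    have i': "2*n+2-i \<in> ?N" "2*n+2-(2*n+2-i) = i" and j': "2*n+2-j \<in> ?N" "2*n+2-(2*n+2-j) = j"
      using y by auto
    have s: "A (2*n+2-i) (2*n+2-j) = A i j" using sym[OF y(2,3)] by simp
    have "\<beta> y \<in> Y" using y i'(1) j'(1) s by (simp add: \<beta>_def Y_def)
    moreover have "\<beta> (\<beta> y) = y" using y i'(2) j'(2) s by (simp add: \<beta>_def)
    moreover have "\<beta> y \<noteq> y"
    proof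
      assume e: "\<beta> y = y"
      then have "2*n+2-i = i" "2*n+2-j = j" "A i j - 1 - k = k" using y by (simp_all add: \<beta>_def)
      then have "i = n+1" "j = n+1" "A i j = 2*k+1" using y by auto
      then show False using ev by simp
    qed
    ultimately show ?thesis by blast
  qed
  have \<beta>12: "fst (\<beta> y) = 2*n+2 - fst y" "fst (snd (\<beta> y)) = 2*n+2 - fst (snd y)" for y
    by (simp_all add: \<beta>_def split: prod.split)
  have cardi: "card {y \<in> Y. fst y = i} = card {x \<in> ?X. b x = i}" for i
  proof -
    have "{y \<in> Y. fst y = i} = {(i',j,k). i' \<in> ?N \<and> j \<in> ?N \<and> k < A i' j \<and> i' = i}"
      by (auto simp: Y_def)
    then have "card {y \<in> Y. fst y = i} = (if i \<in> ?N then ro n A i else 0)"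
      using card_triples_row[of ?N ?N A i] by (simp add: ro_def)
    also have "\<dots> = card {x \<in> ?X. b x = i}"
    proof (cases "i \<in> ?N")
      case False
      then have e: "{x \<in> ?X. b x = i} = {}" using b by blast
      show ?thesis unfolding e if_not_P[OF False] by simp
    qed (simp add: row)
    finally show ?thesis .
  qed
  have cardj: "card {y \<in> Y. fst (snd y) = j} = card {x \<in> ?X. c x = j}" for j
  proof -
    have "bij_betw (\<lambda>(i,j,k). (j,i,k)) {y \<in> Y. fst (snd y) = j}
       {(j',i,k). j' \<in> ?N \<and> i \<in> ?N \<and> k < A i j' \<and> j' = j}"
      by (rule bij_betw_byWitness[where f' = "\<lambda>(j,i,k). (i,j,k)"]) (auto simp: Y_def)
    then have "card {y \<in> Y. fst (snd y) = j} = card {(j',i,k). j' \<in> ?N \<and> i \<in> ?N \<and> k < A i j' \<and> j' = j}"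
      by (rule bij_betw_same_card)
    also have "\<dots> = (if j \<in> ?N then co n A j else 0)"
      using card_triples_row[of ?N ?N "\<lambda>j i. A i j" j] by (simp add: co_def)
    also have "\<dots> = card {x \<in> ?X. c x = j}"
    proof (cases "j \<in> ?N")
      case False
      then have e: "{x \<in> ?X. c x = j} = {}" using c by blast
      show ?thesis unfolding e if_not_P[OF False] by simp
    qed (simp add: col)
    finally show ?thesis .
  qed
  have "\<exists>w. bij_betw w ?X Y \<and> (\<forall>x\<in>?X. fst (snd (w x)) = c x \<and> w (?m x) = \<beta> (w x))"
    by (rule equivariant_matching[where \<iota> = "\<lambda>j. 2*n+2-j"])
      (use fY inv \<beta>12 c mirror_range[of _ r] cardj in auto)
  then obtain w1 where w1: "bij_betw w1 ?X Y"
    "\<And>x. x \<in> ?X \<Longrightarrow> fst (snd (w1 x)) = c x \<and> w1 (?m x) = \<beta> (w1 x)" by blast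
  have "\<exists>w. bij_betw w ?X Y \<and> (\<forall>x\<in>?X. fst (w x) = b x \<and> w (?m x) = \<beta> (w x))"
    by (rule equivariant_matching[where \<iota> = "\<lambda>j. 2*n+2-j"])
      (use fY inv \<beta>12 b mirror_range[of _ r] cardi in auto)
  then obtain w2 where w2: "bij_betw w2 ?X Y"
    "\<And>x. x \<in> ?X \<Longrightarrow> fst (w2 x) = b x \<and> w2 (?m x) = \<beta> (w2 x)" by blast
  define u where "u = inv_into ?X w2 \<circ> w1"
  have u: "bij_betw u ?X ?X"
    unfolding u_def by (rule bij_betw_trans[OF w1(1) bij_betw_inv_into[OF w2(1)]])
  have ux: "u x \<in> ?X" if "x \<in> ?X" for x using u that by (auto simp: bij_betw_def)
  have w2u: "w2 (u x) = w1 x" if "x \<in> ?X" for x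
    unfolding u_def o_apply using w1(1) w2(1) that
    by (intro f_inv_into_f) (auto simp: bij_betw_def)
  have "u (?m x) = ?m (u x)" if x: "x \<in> ?X" for x
  proof -
    have mx: "?m x \<in> ?X" "?m (u x) \<in> ?X" using mirror_range[OF x] mirror_range[OF ux[OF x]] by blast+
    have "w2 (u (?m x)) = w2 (?m (u x))"
      using w2u[OF mx(1)] w2u[OF x] w1(2)[OF x] w2(2)[OF ux[OF x]] by simp
    then show ?thesis
      by (rule inj_onD[OF bij_betw_imp_inj_on[OF w2(1)] _ ux[OF mx(1)] mx(2)])
  qed
  from WB_from_bij[OF u this] obtain w where w: "w \<in> WB r" "\<And>x. x \<in> ?X \<Longrightarrow> w x = u x" by blast
  have "cnt r b c w i j = A i j" for i j
  proof -
    have "bij_betw w1 {x \<in> ?X. c x = j \<and> b (w x) = i} {y \<in> Y. fst (snd y) = j \<and> fst y = i}"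
    proof -
      have eq: "fst (snd (w1 x)) = c x" "fst (w1 x) = b (w x)" if "x \<in> ?X" for x
        using w1(2)[OF that] w2(2)[OF ux[OF that]] w2u[OF that] w(2)[OF that] by simp_all
      have "w1 ` {x \<in> ?X. c x = j \<and> b (w x) = i} = {y \<in> Y. fst (snd y) = j \<and> fst y = i}"
      proof
        show "{y \<in> Y. fst (snd y) = j \<and> fst y = i} \<subseteq> w1 ` {x \<in> ?X. c x = j \<and> b (w x) = i}"
        proof
          fix y assume y: "y \<in> {y \<in> Y. fst (snd y) = j \<and> fst y = i}"
          then have "y \<in> w1 ` ?X" using w1(1) by (simp add: bij_betw_def)
          then obtain x where x: "x \<in> ?X" "y = w1 x" by blast
          then show "y \<in> w1 ` {x \<in> ?X. c x = j \<and> b (w x) = i}" using y eq[OF x(1)] by auto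
        qed
      qed (use eq w1(1) in \<open>auto simp: bij_betw_def\<close>)
      moreover have "inj_on w1 {x \<in> ?X. c x = j \<and> b (w x) = i}"
        by (rule inj_on_subset[OF bij_betw_imp_inj_on[OF w1(1)]]) auto
      ultimately show ?thesis by (intro bij_betw_imageI)
    qed
    then have "cnt r b c w i j = card {y \<in> Y. fst (snd y) = j \<and> fst y = i}"
      unfolding cnt_def by (rule bij_betw_same_card)
    also have "{y \<in> Y. fst (snd y) = j \<and> fst y = i} = (\<lambda>k. (i,j,k)) ` {k. k < A i j}"
    proof
      show "{y \<in> Y. fst (snd y) = j \<and> fst y = i} \<subseteq> (\<lambda>k. (i,j,k)) ` {k. k < A i j}"
        by (auto simp: Y_def)
      show "(\<lambda>k. (i,j,k)) ` {k. k < A i j} \<subseteq> {y \<in> Y. fst (snd y) = j \<and> fst y = i}"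
      proof
        fix y assume "y \<in> (\<lambda>k. (i,j,k)) ` {k. k < A i j}"
        then obtain k where k: "y = (i,j,k)" "k < A i j" by blast
        then have "i \<in> ?N \<and> j \<in> ?N" using out[of i j] by (metis not_less_zero)
        then show "y \<in> {y \<in> Y. fst (snd y) = j \<and> fst y = i}" using k by (simp add: Y_def)
      qed
    qed
    also have "card \<dots> = A i j" by (simp add: card_image inj_on_def)
    finally show ?thesis .
  qed
  then show ?thesis using w(1) by blast
qed

section \<open>Sums over cosets of parabolic subgroups\<close>

text \<open>Intersecting with type D covers all cases: if the last part of the composition vanishes, the
  whole Young subgroup already lies in \<open>WD\<close>.\<close>

definition KD :: "nat \<Rightarrow> (nat \<Rightarrow> nat) \<Rightarrow> (nat \<Rightarrow> nat) set" where
  "KD r b = Yg r b \<inter> WD r"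

lemma KD_WB: "KD r b \<subseteq> WB r"
  by (auto simp: KD_def Yg_def)

lemma KD_iff: "w \<in> KD r b \<longleftrightarrow> w \<in> Yg r b \<and> \<not> oddB r w"
  by (auto simp: KD_def Yg_def WD_iff)

lemma KD_id: "id \<in> KD r b"
  unfolding KD_iff using Yg_id oddB_id by blast

lemma KD_comp: "u \<in> KD r b \<Longrightarrow> w \<in> KD r b \<Longrightarrow> u \<circ> w \<in> KD r b"
  unfolding KD_iff by (metis Yg_comp Yg_WB oddB_comp)

lemma KD_inv: "w \<in> KD r b \<Longrightarrow> pinv w \<in> KD r b"
  unfolding KD_iff by (metis Yg_inv Yg_WB oddB_inv)

text \<open>Ascents at adjacent points of the first half imply the mirrored ascents in the second half, and
  blocks are intervals.\<close>

lemma increasing_on_blocks: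
  assumes l: "l \<in> Lam (n+1) r" and w: "w \<in> WB r"
    and inc: "\<And>j. j \<in> {1..r} \<Longrightarrow> bl n l j = bl n l (j+1) \<Longrightarrow> w j < w (j+1)"
    and x: "x \<in> {1..2*r}" and y: "y \<in> {1..2*r}" and xy: "x < y" and b: "bl n l x = bl n l y"
  shows "w x < w y"
proof -
  have adj: "w j < w (j+1)" if j: "1 \<le> j" "j + 1 \<le> 2*r" "bl n l j = bl n l (j+1)" for j
  proof (cases "j \<le> r")
    case True
    then show ?thesis using inc[of j] j by simp
  next
    case False
    define i where "i = 2*r - j"
    have i: "i \<in> {1..r}" "i \<in> {1..2*r}" "i + 1 \<in> {1..2*r}" "2*r+1-i = j+1" "2*r+1-(i+1) = j"
      using False j by (auto simp: i_def)
    have jr: "j \<in> {1..2*r}" "j+1 \<in> {1..2*r}" using j by auto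
    have "2*n+2 - bl n l i = 2*n+2 - bl n l (i+1)"
      using bl_mirror[OF l i(2)] bl_mirror[OF l i(3)] j(3) unfolding i(4,5) by simp
    then have "bl n l i = bl n l (i+1)"
      using bl_props(4)[OF l i(2)] bl_props(4)[OF l i(3)] by linarith
    from inc[OF i(1) this] show ?thesis
      using WB_mirror[OF w i(2)] WB_mirror[OF w i(3)] WB_range[OF w i(2)] WB_range[OF w i(3)]
      unfolding i(4,5) by simp
  qed
  have "w x < w (x + d + 1)" if "x + d + 1 \<le> y" for d
    using that
  proof (induction d)
    case 0
    have "bl n l (x+1) \<le> bl n l y" "bl n l x \<le> bl n l (x+1)"
      using 0 x y by (auto intro!: bl_le[OF l])
    then show ?case using adj[of x] x y xy b by simp
  next
    case (Suc d)
    have "bl n l (x+d+1) \<le> bl n l (x+Suc d+1)" "bl n l (x+Suc d+1) \<le> bl n l y" "bl n l x \<le> bl n l (x+d+1)"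
      using Suc.prems x y by (auto intro!: bl_le[OF l])
    then have "w (x+d+1) < w (x+d+1+1)"
      using adj[of "x+d+1"] Suc.prems x y b by simp
    then show ?case using Suc by simp
  qed
  from this[of "y - x - 1"] xy show ?thesis by simp
qed

lemma Yg_descent_adjacent:
  assumes l: "l \<in> Lam (n+1) r" and v: "v \<in> Yg r (bl n l)" and j: "j \<in> {1..r}" and d: "v (j+1) < v j"
  shows "bl n l j = bl n l (j+1)"
proof -
  have jr: "j \<in> {1..2*r}" "j+1 \<in> {1..2*r}" using j by auto
  have "bl n l (j+1) \<le> bl n l j"
    using bl_le[OF l less_imp_le[OF d] WB_range[OF Yg_WB[OF v] jr(1)]]
      Yg_apply[OF v jr(1)] Yg_apply[OF v jr(2)] by simp
  moreover have "bl n l j \<le> bl n l (j+1)" using bl_le[OF l _ jr(2)] by simp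
  ultimately show ?thesis by simp
qed

lemma sB_swap_values:
  assumes "j \<in> {1..r}" shows "sB r j j = j+1" "sB r j (j+1) = j"
  using sB_apply[OF assms, of j] sB_apply[OF assms, of "j+1"] by simp_all

lemma sB_KD:
  assumes l: "l \<in> Lam (n+1) r" and j: "j \<in> {1..r}" "j \<noteq> r" and b: "bl n l j = bl n l (j+1)"
  shows "sB r j \<in> KD r (bl n l)"
  unfolding KD_iff using sB_Yg_iff[OF l j(1)] oddB_sB[OF j(1)] b j(2) by blast

text \<open>When \<open>sB r r\<close> belongs to the Young subgroup it normalizes the even part.\<close>

lemma KD_conj_last:
  assumes r: "1 \<le> r" and s: "sB r r \<in> Yg r b" and k: "k \<in> KD r b"
  shows "sB r r \<circ> k \<circ> sB r r \<in> KD r b"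
proof -
  have rr: "r \<in> {1..r}" using r by simp
  have kW: "k \<in> WB r" "k \<in> Yg r b" "\<not> oddB r k" using k Yg_WB unfolding KD_iff by blast+
  have "sB r r \<circ> k \<circ> sB r r \<in> Yg r b" by (intro Yg_comp s kW)
  moreover have "\<not> oddB r (sB r r \<circ> k \<circ> sB r r)"
    using oddB_comp[OF WB_comp[OF sB_WB[OF rr] kW(1)] sB_WB[OF rr]]
      oddB_comp[OF sB_WB[OF rr] kW(1)] kW(3) by blast
  ultimately show ?thesis unfolding KD_iff by blast
qed

text \<open>A middle block of size zero leaves no block that meets both halves of \<open>{1..2*r}\<close>.\<close>

lemma Yg_even:
  assumes l: "l \<in> Lam (n+1) r" and z: "l (n+1) = 0" and w: "w \<in> Yg r (bl n l)"
  shows "\<not> oddB r w"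
proof -
  have "w x \<le> r" if x: "x \<in> {1..r}" for x
  proof (rule ccontr)
    assume "\<not> w x \<le> r"
    have xr: "x \<in> {1..2*r}" using x by simp
    have "n + 1 \<le> bl n l (w x)"
      using bl_high[OF l, of "w x"] \<open>\<not> w x \<le> r\<close> WB_range[OF Yg_WB[OF w] xr] by simp
    moreover have "bl n l x \<le> n + 1" using bl_low[OF l] x by simp
    ultimately have "bl n l x = n + 1" using Yg_apply[OF w xr] by simp
    then show False using bl_mid_nonzero[OF l xr] z by simp
  qed
  then have "{i \<in> {1..r}. w i > r} = {}" by (auto simp: not_less)
  then show ?thesis unfolding oddB_def by (simp only: card.empty) simp
qed

context heckeB
begin

text \<open>The lengths add: a descent of \<open>v\<close> lies inside a block, where \<open>w\<close> is increasing, so it is also a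
  descent of \<open>w \<circ> v\<close> and can be split off on the right.\<close>

lemma Tw_mult_Yg:
  assumes l: "l \<in> Lam (n+1) r" and w: "w \<in> WB r"
    and inc: "\<And>j. j \<in> {1..r} \<Longrightarrow> bl n l j = bl n l (j+1) \<Longrightarrow> w j < w (j+1)"
    and v: "v \<in> Yg r (bl n l)"
  shows "Tw r (w \<circ> v) = Tw r w \<cdot> Tw r v"
  using v
proof (induction "ellB r v" arbitrary: v rule: less_induct)
  case less
  note v = Yg_WB[OF less.prems]
  show ?case
  proof (cases "\<exists>j\<in>{1..r}. v (j+1) < v j")
    case True
    then obtain j where j: "j \<in> {1..r}" "v (j+1) < v j" by blast
    have jr: "j \<in> {1..2*r}" "j+1 \<in> {1..2*r}" using j by auto
    note b = Yg_descent_adjacent[OF l less.prems j]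
    have s: "sB r j \<in> Yg r (bl n l)" using sB_Yg_iff[OF l j(1)] b by simp
    define u where "u = v \<circ> sB r j"
    have u: "u \<in> Yg r (bl n l)" unfolding u_def by (rule Yg_comp[OF less.prems s])
    note uW = Yg_WB[OF u]
    have vu: "v = u \<circ> sB r j"
      unfolding u_def by (simp only: o_assoc[symmetric] sB_comp_self[OF j(1)] o_id)
    have up: "u j < u (j+1)" unfolding u_def o_apply sB_swap_values[OF j(1)] by (rule j(2))
    have "ellB r u < ellB r v" using ellB_right_down[OF v j] unfolding u_def by simp
    from less.hyps[OF this u] have IH: "Tw r (w \<circ> u) = Tw r w \<cdot> Tw r u" .
    have "(w \<circ> u) j < (w \<circ> u) (j+1)"
      unfolding o_apply
      by (rule increasing_on_blocks[OF l w inc])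
        (use up WB_range[OF uW jr(1)] WB_range[OF uW jr(2)] Yg_apply[OF u jr(1)] Yg_apply[OF u jr(2)] b in simp_all)
    from Tw_right_up[OF WB_comp[OF w uW] j(1) this]
    have "Tw r (w \<circ> v) = (Tw r w \<cdot> Tw r u) \<cdot> Tgen r j"
      by (simp only: vu o_assoc IH)
    also have "\<dots> = Tw r w \<cdot> (Tw r u \<cdot> Tgen r j)"
      by (simp only: H.m_assoc Tw_closed[OF w] Tw_closed[OF uW] Tgen_closed'[OF j(1)])
    also have "Tw r u \<cdot> Tgen r j = Tw r v"
      unfolding vu by (rule Tw_right_up[OF uW j(1) up])
    finally show ?thesis .
  next
    case False
    then have "v = id"
      using WB_asc_cases[OF v] by (intro no_descent_id[OF v]) metis
    then show ?thesis using w by (simp only: o_id Tw_id H.r_one Tw_closed)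
  qed
qed

lemma Tw_Yg_mult:
  assumes l: "l \<in> Lam (n+1) r" and w: "w \<in> WB r"
    and inc: "\<And>j. j \<in> {1..r} \<Longrightarrow> bl n l j = bl n l (j+1) \<Longrightarrow> pinv w j < pinv w (j+1)"
    and v: "v \<in> Yg r (bl n l)"
  shows "Tw r (v \<circ> w) = Tw r v \<cdot> Tw r w"
  using v
proof (induction "ellB r v" arbitrary: v rule: less_induct)
  case less
  note v = Yg_WB[OF less.prems] and iY = Yg_inv[OF less.prems]
  show ?case
  proof (cases "\<exists>j\<in>{1..r}. pinv v (j+1) < pinv v j")
    case True
    then obtain j where j: "j \<in> {1..r}" "pinv v (j+1) < pinv v j" by blast
    have jr: "j \<in> {1..2*r}" "j+1 \<in> {1..2*r}" using j by auto
    note b = Yg_descent_adjacent[OF l iY j]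
    have s: "sB r j \<in> Yg r (bl n l)" using sB_Yg_iff[OF l j(1)] b by simp
    define u where "u = sB r j \<circ> v"
    have u: "u \<in> Yg r (bl n l)" unfolding u_def by (rule Yg_comp[OF s less.prems])
    note uW = Yg_WB[OF u] and uI = Yg_inv[OF u]
    have vu: "v = sB r j \<circ> u"
      unfolding u_def by (simp only: sB_comp_sB[OF j(1)])
    have up: "pinv u j < pinv u (j+1)"
      unfolding u_def inv_sB_comp[OF j(1) v] sB_swap_values[OF j(1)] by (rule j(2))
    have "ellB r u < ellB r v" using ellB_down[OF v j] unfolding u_def by simp
    from less.hyps[OF this u] have IH: "Tw r (u \<circ> w) = Tw r u \<cdot> Tw r w" .
    have "pinv (u \<circ> w) j < pinv (u \<circ> w) (j+1)"
      unfolding WB_inv_comp[OF uW w] o_apply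
      by (rule increasing_on_blocks[OF l WB_inv[OF w] inc])
        (use up WB_inv_range[OF uW jr(1)] WB_inv_range[OF uW jr(2)] Yg_apply[OF uI jr(1)] Yg_apply[OF uI jr(2)] b in simp_all)
    from Tw_left_up[OF WB_comp[OF uW w] j(1) this]
    have "Tw r (v \<circ> w) = Tgen r j \<cdot> (Tw r u \<cdot> Tw r w)"
      unfolding vu o_assoc[symmetric] IH by simp
    also have "\<dots> = (Tgen r j \<cdot> Tw r u) \<cdot> Tw r w"
      by (simp only: H.m_assoc Tw_closed[OF w] Tw_closed[OF uW] Tgen_closed'[OF j(1)])
    also have "Tgen r j \<cdot> Tw r u = Tw r v"
      unfolding vu by (rule Tw_left_up[OF uW j(1) up])
    finally show ?thesis .
  next
    case False
    then have "pinv v = id"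
      using WB_asc_cases[OF WB_inv[OF v]] by (intro no_descent_id[OF WB_inv[OF v]]) metis
    then have "v = id" using WB_inv_inv[OF v] by simp
    then show ?thesis using w by (simp only: id_o Tw_id H.l_one Tw_closed)
  qed
qed

lemma TS_conj_last_commute:
  assumes s: "sB r r \<in> Yg r b"
  shows "TS (KD r b) \<cdot> Tgen r r = Tgen r r \<cdot> TS (KD r b)"
proof -
  have r1: "1 \<le> r" using r2 by simp
  have ss: "sB r r \<circ> (sB r r \<circ> w) = w" "(w \<circ> sB r r) \<circ> sB r r = w" for w
    using sB_comp_sB[OF r_mem, of w] sB_comp_self[OF r_mem] by (simp_all only: o_assoc[symmetric] o_id)
  have "(\<lambda>w. w \<circ> sB r r) ` KD r b = (\<lambda>w. sB r r \<circ> w) ` KD r b"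
  proof (intro equalityI image_subsetI)
    fix k assume k: "k \<in> KD r b"
    note c = KD_conj_last[OF r1 s k]
    show "k \<circ> sB r r \<in> (\<lambda>w. sB r r \<circ> w) ` KD r b"
      by (rule image_eqI[OF _ c]) (simp only: o_assoc[symmetric] ss)
    show "sB r r \<circ> k \<in> (\<lambda>w. w \<circ> sB r r) ` KD r b"
      by (rule image_eqI[OF _ c]) (simp only: ss)
  qed
  then show ?thesis
    by (simp only: TS_right_last[OF KD_WB] TS_left_last[OF KD_WB])
qed

text \<open>Moving to the minimal representative of a coset uses generators of the subgroup, except
  for steps by \<open>sB r r\<close>, which only contribute a factor commuting with the sum.\<close>

lemma TS_right_coset:
  assumes l: "l \<in> Lam (n+1) r" and w: "w \<in> WB r"
  shows "\<exists>u\<in>WB r. TS ((\<lambda>k. w \<circ> k) ` KD r (bl n l)) = Tw r u \<cdot> TS (KD r (bl n l))"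
  using w
proof (induction "ellB r w" arbitrary: w rule: less_induct)
  case less
  note w = less.prems
  let ?K = "KD r (bl n l)"
  show ?case
  proof (cases "\<exists>j\<in>{1..r}. bl n l j = bl n l (j+1) \<and> w (j+1) < w j")
    case True
    then obtain j where j: "j \<in> {1..r}" "bl n l j = bl n l (j+1)" "w (j+1) < w j" by blast
    define v where "v = w \<circ> sB r j"
    have v: "v \<in> WB r" unfolding v_def by (intro WB_comp sB_WB j w)
    have wv: "w = v \<circ> sB r j"
      unfolding v_def by (simp only: o_assoc[symmetric] sB_comp_self[OF j(1)] o_id)
    have "ellB r v < ellB r w" using ellB_right_down[OF w j(1,3)] unfolding v_def by simp
    from less.hyps[OF this v] obtain u where u: "u \<in> WB r" "TS ((\<lambda>k. v \<circ> k) ` ?K) = Tw r u \<cdot> TS ?K" by blast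
    show ?thesis
    proof (cases "j = r")
      case False
      note s = sB_KD[OF l j(1) False j(2)]
      have "(\<lambda>k. w \<circ> k) ` ?K = (\<lambda>k. v \<circ> k) ` ?K"
      proof (intro equalityI image_subsetI)
        fix k assume k: "k \<in> ?K"
        show "w \<circ> k \<in> (\<lambda>k. v \<circ> k) ` ?K"
          by (rule image_eqI[OF _ KD_comp[OF s k]]) (simp only: wv o_assoc)
        show "v \<circ> k \<in> (\<lambda>k. w \<circ> k) ` ?K"
          by (rule image_eqI[OF _ KD_comp[OF s k]]) (simp only: v_def o_assoc)
      qed
      then show ?thesis using u by (intro bexI[of _ u]) simp_all
    next
      case True
      have s: "sB r r \<in> Yg r (bl n l)" using sB_Yg_iff[OF l r_mem] j(2) True by simp
      have r1: "1 \<le> r" using r2 by simp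
      have "(\<lambda>k. w \<circ> k) ` ?K = (\<lambda>w. w \<circ> sB r r) ` ((\<lambda>k. v \<circ> k) ` ?K)"
        unfolding image_image
      proof (intro equalityI image_subsetI)
        fix k assume k: "k \<in> ?K"
        note c = KD_conj_last[OF r1 s k]
        show "w \<circ> k \<in> (\<lambda>k. v \<circ> k \<circ> sB r r) ` ?K"
          by (rule image_eqI[OF _ c])
            (simp only: wv True o_assoc[symmetric] sB_comp_self[OF r_mem] o_id)
        show "v \<circ> k \<circ> sB r r \<in> (\<lambda>k. w \<circ> k) ` ?K"
          by (rule image_eqI[OF _ c])
            (simp only: wv True o_assoc[symmetric] sB_comp_sB[OF r_mem])
      qed
      moreover have sub: "(\<lambda>k. v \<circ> k) ` ?K \<subseteq> WB r" using WB_comp[OF v] KD_WB by blast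
      ultimately have "TS ((\<lambda>k. w \<circ> k) ` ?K) = (Tw r u \<cdot> TS ?K) \<cdot> Tgen r r"
        using TS_right_last[OF sub] u(2) by (simp only:)
      also have "\<dots> = (Tw r u \<cdot> Tgen r r) \<cdot> TS ?K"
        using TS_conj_last_commute[OF s] Tw_closed[OF u(1)] TS_closed[OF KD_WB] Tgen_closed'[OF r_mem]
        by (simp only: H.m_assoc)
      also have "\<dots> = Tw r (u \<circ> sB r r) \<cdot> TS ?K"
        by (simp only: Tw_right_last[OF u(1)])
      finally show ?thesis
        using WB_comp[OF u(1) sB_WB[OF r_mem]] by (intro bexI[of _ "u \<circ> sB r r"])
    qed
  next
    case False
    then have inc: "w j < w (j+1)" if "j \<in> {1..r}" "bl n l j = bl n l (j+1)" for j
      using that WB_asc_cases[OF w, of j] by blast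
    have inj: "inj_on (\<lambda>k. w \<circ> k) ?K"
      by (rule inj_on_inverseI[of _ "\<lambda>k. pinv w \<circ> k"]) (simp only: o_assoc WB_comp_inv[OF w] id_o)
    have "TS ((\<lambda>k. w \<circ> k) ` ?K) = (\<Oplus>\<^bsub>HB r\<^esub> k\<in>?K. Tw r (w \<circ> k))"
      unfolding TS_def
      by (rule H.finsum_reindex[OF _ inj], rule Pi_I)
        (erule imageE, hypsubst, rule Tw_closed, rule WB_comp[OF w], erule subsetD[OF KD_WB])
    also have "\<dots> = (\<Oplus>\<^bsub>HB r\<^esub> k\<in>?K. Tw r w \<cdot> Tw r k)"
    proof (rule H.finsum_cong'[OF refl])
      show "(\<lambda>k. Tw r w \<cdot> Tw r k) \<in> ?K \<rightarrow> carrier (HB r)"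
        using KD_WB w by (intro Pi_I H.m_closed Tw_closed) auto
      fix k assume "k \<in> ?K"
      then have "k \<in> Yg r (bl n l)" by (simp only: KD_iff)
      from Tw_mult_Yg[OF l w inc this] show "Tw r (w \<circ> k) = Tw r w \<cdot> Tw r k" by simp
    qed
    also have "\<dots> = Tw r w \<cdot> TS ?K"
      unfolding TS_def using KD_WB w
      by (intro H.finsum_rdistr[symmetric] finite_subset[OF KD_WB finite_WB]) auto
    finally show ?thesis using w by blast
  qed
qed

lemma TS_left_coset:
  assumes l: "l \<in> Lam (n+1) r" and w: "w \<in> WB r"
  shows "\<exists>u\<in>WB r. (oddB r u \<longleftrightarrow> oddB r w) \<and> TS ((\<lambda>k. k \<circ> w) ` KD r (bl n l)) = TS (KD r (bl n l)) \<cdot> Tw r u"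
  using w
proof (induction "ellB r w" arbitrary: w rule: less_induct)
  case less
  note w = less.prems
  let ?K = "KD r (bl n l)"
  show ?case
  proof (cases "\<exists>j\<in>{1..r}. bl n l j = bl n l (j+1) \<and> pinv w (j+1) < pinv w j")
    case True
    then obtain j where j: "j \<in> {1..r}" "bl n l j = bl n l (j+1)" "pinv w (j+1) < pinv w j" by blast
    define v where "v = sB r j \<circ> w"
    have v: "v \<in> WB r" unfolding v_def by (intro WB_comp sB_WB j w)
    have wv: "w = sB r j \<circ> v"
      unfolding v_def by (simp only: sB_comp_sB[OF j(1)])
    have "ellB r v < ellB r w" using ellB_down[OF w j(1,3)] unfolding v_def by simp
    from less.hyps[OF this v] obtain u where u: "u \<in> WB r" "oddB r u \<longleftrightarrow> oddB r v"
      "TS ((\<lambda>k. k \<circ> v) ` ?K) = TS ?K \<cdot> Tw r u" by blast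
    show ?thesis
    proof (cases "j = r")
      case False
      note s = sB_KD[OF l j(1) False j(2)]
      have "(\<lambda>k. k \<circ> w) ` ?K = (\<lambda>k. k \<circ> v) ` ?K"
      proof (intro equalityI image_subsetI)
        fix k assume k: "k \<in> ?K"
        show "k \<circ> w \<in> (\<lambda>k. k \<circ> v) ` ?K"
          by (rule image_eqI[OF _ KD_comp[OF k s]]) (simp only: wv o_assoc)
        show "k \<circ> v \<in> (\<lambda>k. k \<circ> w) ` ?K"
          by (rule image_eqI[OF _ KD_comp[OF k s]]) (simp only: v_def o_assoc)
      qed
      moreover have "oddB r v \<longleftrightarrow> oddB r w"
        unfolding v_def oddB_sB_comp[OF w j(1)] using False by simp
      ultimately show ?thesis using u by (intro bexI[of _ u]) simp_all
    next
      case True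
      have s: "sB r r \<in> Yg r (bl n l)" using sB_Yg_iff[OF l r_mem] j(2) True by simp
      have r1: "1 \<le> r" using r2 by simp
      have "(\<lambda>k. k \<circ> w) ` ?K = (\<lambda>w. sB r r \<circ> w) ` ((\<lambda>k. k \<circ> v) ` ?K)"
        unfolding image_image
      proof (intro equalityI image_subsetI)
        fix k assume k: "k \<in> ?K"
        note c = KD_conj_last[OF r1 s k]
        show "k \<circ> w \<in> (\<lambda>k. sB r r \<circ> (k \<circ> v)) ` ?K"
          by (rule image_eqI[OF _ c])
            (simp only: wv True o_assoc[symmetric] sB_comp_sB[OF r_mem])
        show "sB r r \<circ> (k \<circ> v) \<in> (\<lambda>k. k \<circ> w) ` ?K"
          by (rule image_eqI[OF _ c])
            (simp only: wv True o_assoc[symmetric] sB_comp_sB[OF r_mem])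
      qed
      moreover have sub: "(\<lambda>k. k \<circ> v) ` ?K \<subseteq> WB r" using WB_comp[OF _ v] KD_WB by blast
      ultimately have "TS ((\<lambda>k. k \<circ> w) ` ?K) = Tgen r r \<cdot> (TS ?K \<cdot> Tw r u)"
        using TS_left_last[OF sub] u(3) by (simp only:)
      also have "\<dots> = (Tgen r r \<cdot> TS ?K) \<cdot> Tw r u"
        using Tw_closed[OF u(1)] TS_closed[OF KD_WB] Tgen_closed'[OF r_mem]
        by (simp only: H.m_assoc)
      also have "\<dots> = TS ?K \<cdot> (Tgen r r \<cdot> Tw r u)"
        using TS_conj_last_commute[OF s] Tw_closed[OF u(1)] TS_closed[OF KD_WB] Tgen_closed'[OF r_mem]
        by (simp only: H.m_assoc[symmetric])
      also have "\<dots> = TS ?K \<cdot> Tw r (sB r r \<circ> u)"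
        by (simp only: Tw_left_last[OF u(1)])
      finally have e: "TS ((\<lambda>k. k \<circ> w) ` ?K) = TS ?K \<cdot> Tw r (sB r r \<circ> u)" .
      have "oddB r (sB r r \<circ> u) \<longleftrightarrow> oddB r w"
        unfolding oddB_sB_comp[OF u(1) r_mem] using u(2)
        unfolding v_def True oddB_sB_comp[OF w r_mem] by simp
      then show ?thesis
        using WB_comp[OF sB_WB[OF r_mem] u(1)] e by blast
    qed
  next
    case False
    then have inc: "pinv w j < pinv w (j+1)" if "j \<in> {1..r}" "bl n l j = bl n l (j+1)" for j
      using that WB_asc_cases[OF WB_inv[OF w], of j] by blast
    have inj: "inj_on (\<lambda>k. k \<circ> w) ?K"
      by (rule inj_on_inverseI[of _ "\<lambda>k. k \<circ> pinv w"])
        (simp only: o_assoc[symmetric] WB_comp_inv[OF w] o_id)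
    have "TS ((\<lambda>k. k \<circ> w) ` ?K) = (\<Oplus>\<^bsub>HB r\<^esub> k\<in>?K. Tw r (k \<circ> w))"
      unfolding TS_def
      by (rule H.finsum_reindex[OF _ inj], rule Pi_I)
        (erule imageE, hypsubst, rule Tw_closed, rule WB_comp[OF _ w], erule subsetD[OF KD_WB])
    also have "\<dots> = (\<Oplus>\<^bsub>HB r\<^esub> k\<in>?K. Tw r k \<cdot> Tw r w)"
    proof (rule H.finsum_cong'[OF refl])
      show "(\<lambda>k. Tw r k \<cdot> Tw r w) \<in> ?K \<rightarrow> carrier (HB r)"
        using KD_WB w by (intro Pi_I H.m_closed Tw_closed) auto
      fix k assume "k \<in> ?K"
      then have "k \<in> Yg r (bl n l)" by (simp only: KD_iff)
      from Tw_Yg_mult[OF l w inc this] show "Tw r (k \<circ> w) = Tw r k \<cdot> Tw r w" by simp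
    qed
    also have "\<dots> = TS ?K \<cdot> Tw r w"
      unfolding TS_def using KD_WB w
      by (intro H.finsum_ldistr[symmetric] finite_subset[OF KD_WB finite_WB]) auto
    finally show ?thesis using w by blast
  qed
qed

text \<open>An invariant set is a disjoint union of cosets; they are removed one at a time.\<close>

lemma TS_right_invariant:
  assumes l: "l \<in> Lam (n+1) r" and D: "D \<subseteq> WB r"
    and inv: "\<And>w k. w \<in> D \<Longrightarrow> k \<in> KD r (bl n l) \<Longrightarrow> w \<circ> k \<in> D"
  shows "\<exists>y\<in>carrier (HB r). TS D = y \<cdot> TS (KD r (bl n l))"
  using D inv
proof (induction "card D" arbitrary: D rule: less_induct)
  case less
  let ?K = "KD r (bl n l)"
  note D = less.prems(1) and inv = less.prems(2)
  have fin: "finite D" using finite_subset[OF D finite_WB] .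
  show ?case
  proof (cases "D = {}")
    case True
    then show ?thesis
      by (intro bexI[of _ "\<zero>\<^bsub>HB r\<^esub>"]) (simp_all add: H.l_null TS_closed[OF KD_WB])
  next
    case False
    then obtain w where w: "w \<in> D" by blast
    then have wW: "w \<in> WB r" using D by blast
    define C where "C = (\<lambda>k. w \<circ> k) ` ?K"
    have CD: "C \<subseteq> D" using inv[OF w] by (auto simp: C_def)
    have wC: "w \<in> C" unfolding C_def by (rule image_eqI[OF _ KD_id]) (simp only: o_id)
    have inv': "v \<circ> k \<in> D - C" if v: "v \<in> D - C" and k: "k \<in> ?K" for v k
    proof -
      have "v \<circ> k \<notin> C"
      proof
        assume "v \<circ> k \<in> C"
        then obtain k' where k': "k' \<in> ?K" "v \<circ> k = w \<circ> k'" by (auto simp: C_def)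
        have kW: "k \<in> WB r" using k KD_WB by blast
        have "v = v \<circ> k \<circ> pinv k" by (simp only: o_assoc[symmetric] WB_comp_inv[OF kW] o_id)
        also have "\<dots> = w \<circ> (k' \<circ> pinv k)" unfolding k'(2) by (simp only: o_assoc)
        finally have "v \<in> C" unfolding C_def using KD_comp[OF k'(1) KD_inv[OF k]] by blast
        then show False using v by blast
      qed
      then show ?thesis using inv v k by blast
    qed
    have "card (D - C) < card D" using wC w fin by (intro psubset_card_mono) auto
    from less.hyps[OF this _ inv'] D obtain y where y: "y \<in> carrier (HB r)" "TS (D - C) = y \<cdot> TS ?K" by blast
    obtain u where u: "u \<in> WB r" "TS C = Tw r u \<cdot> TS ?K"
      using TS_right_coset[OF l wW] unfolding C_def by blast
    have "TS D = TS ((D - C) \<union> C)" using CD by (simp add: Un_absorb2)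
    also have "\<dots> = TS (D - C) \<boxplus> TS C" using D CD by (intro TS_Un_disjoint) auto
    also have "\<dots> = (y \<boxplus> Tw r u) \<cdot> TS ?K"
      unfolding y(2) u(2) using y(1) u(1) by (simp add: H.l_distr TS_closed[OF KD_WB])
    finally show ?thesis using y(1) u(1) by (intro bexI[of _ "y \<boxplus> Tw r u"]) auto
  qed
qed

text \<open>The cofactor is recorded as an element of \<open>HD r\<close>, since it has to act on the right of the generator
  inside the right ideal; this is why \<open>TS_left_coset\<close> keeps track of the parity.\<close>

lemma TS_left_invariant:
  assumes l: "l \<in> Lam (n+1) r" and D: "D \<subseteq> WD r"
    and inv: "\<And>w k. w \<in> D \<Longrightarrow> k \<in> KD r (bl n l) \<Longrightarrow> k \<circ> w \<in> D"
  shows "\<exists>z\<in>HD r. TS D = TS (KD r (bl n l)) \<cdot> z"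
  using D inv
proof (induction "card D" arbitrary: D rule: less_induct)
  case less
  let ?K = "KD r (bl n l)"
  note D = less.prems(1) and inv = less.prems(2)
  have DW: "D \<subseteq> WB r" using D by (auto simp: WD_iff)
  have fin: "finite D" using finite_subset[OF DW finite_WB] .
  show ?case
  proof (cases "D = {}")
    case True
    then show ?thesis
      by (intro bexI[of _ "\<zero>\<^bsub>HB r\<^esub>"]) (simp_all add: H.r_null TS_closed[OF KD_WB] HD_zero)
  next
    case False
    then obtain w where w: "w \<in> D" by blast
    then have wW: "w \<in> WB r" "\<not> oddB r w" using D by (auto simp: WD_iff)
    define C where "C = (\<lambda>k. k \<circ> w) ` ?K"
    have CD: "C \<subseteq> D" using inv[OF w] by (auto simp: C_def)
    have wC: "w \<in> C" unfolding C_def by (rule image_eqI[OF _ KD_id]) (simp only: id_o)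
    have inv': "k \<circ> v \<in> D - C" if v: "v \<in> D - C" and k: "k \<in> ?K" for v k
    proof -
      have "k \<circ> v \<notin> C"
      proof
        assume "k \<circ> v \<in> C"
        then obtain k' where k': "k' \<in> ?K" "k \<circ> v = k' \<circ> w" by (auto simp: C_def)
        have kW: "k \<in> WB r" using k KD_WB by blast
        have "v = pinv k \<circ> (k \<circ> v)" by (simp only: o_assoc WB_comp_inv[OF kW] id_o)
        also have "\<dots> = (pinv k \<circ> k') \<circ> w" unfolding k'(2) by (simp only: o_assoc)
        finally have "v \<in> C" unfolding C_def using KD_comp[OF KD_inv[OF k] k'(1)] by blast
        then show False using v by blast
      qed
      then show ?thesis using inv v k by blast
    qed
    have "card (D - C) < card D" using wC w fin by (intro psubset_card_mono) auto
    from less.hyps[OF this _ inv'] D obtain y where y: "y \<in> HD r" "TS (D - C) = TS ?K \<cdot> y" by blast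
    obtain u where u: "u \<in> WB r" "oddB r u \<longleftrightarrow> oddB r w" "TS C = TS ?K \<cdot> Tw r u"
      using TS_left_coset[OF l wW(1)] unfolding C_def by blast
    have uH: "Tw r u \<in> HD r" using u wW(2) by (intro Tw_HD) (simp add: WD_iff)
    have "TS D = TS ((D - C) \<union> C)" using CD by (simp add: Un_absorb2)
    also have "\<dots> = TS (D - C) \<boxplus> TS C" using DW CD by (intro TS_Un_disjoint) auto
    also have "\<dots> = TS ?K \<cdot> (y \<boxplus> Tw r u)"
      unfolding y(2) u(3) using HD_carrier[OF y(1)] HD_carrier[OF uH]
      by (simp add: H.r_distr TS_closed[OF KD_WB])
    finally show ?thesis using HD_add[OF y(1) uH] by blast
  qed
qed

end

section \<open>Homomorphisms given by left multiplication\<close>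

lemma finite_Lam: "finite (Lam k m)"
proof (rule finite_subset)
  show "Lam k m \<subseteq> {f. \<forall>x. (x \<in> {1..k} \<longrightarrow> f x \<in> {..m}) \<and> (x \<notin> {1..k} \<longrightarrow> f x = 0)}"
  proof (rule subsetI)
    fix f assume f: "f \<in> Lam k m"
    have "f x \<le> m" if "x \<in> {1..k}" for x
      using member_le_sum[OF that, of f] f by (simp add: Lam_def)
    then show "f \<in> {f. \<forall>x. (x \<in> {1..k} \<longrightarrow> f x \<in> {..m}) \<and> (x \<notin> {1..k} \<longrightarrow> f x = 0)}"
      using f by (simp add: Lam_def)
  qed
qed (rule finite_set_of_finite_funs, simp_all)

lemma finite_LamD: "finite (LamD n r)"
proof -
  have "UNIV = {Plus, Minus}" using sg.exhaust by auto
  then have "finite (UNIV :: sg set)" by (metis finite.emptyI finite_insert)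
  then have "finite (LBul ` Lam (n+1) r \<union> (\<lambda>(e,l). LSgn e l) ` (UNIV \<times> Lam (n+1) r))"
    using finite_Lam by blast
  then show ?thesis by (rule finite_subset[rotated]) (auto simp: LamD_def)
qed

text \<open>All parabolic subgroups of type D are conjugates of the even part of a Young subgroup.\<close>

lemma WDpar_lam_br:
  assumes r: "1 \<le> r" and l: "l \<in> Lam (n+1) r"
  shows "WDpar n r (lam_br n l e) = (\<lambda>k. s_pow r e \<circ> k \<circ> s_pow r e) ` KD r (bl n l)"
proof -
  have rr: "r \<in> {1..r}" using r by simp
  show ?thesis
  proof (cases "l (n+1) = 0")
    case True
    have "Yg r (bl n l) = KD r (bl n l)"
      using Yg_even[OF l True] by (auto simp: KD_iff)
    then show ?thesis
      using True by (cases e) (simp_all add: lam_br_def WBpar_eq_Yg[OF l] id_def[symmetric])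
  next
    case False
    have s: "sB r r \<in> Yg r (bl n l)"
      unfolding sB_Yg_iff[OF l rr] using bl_mid[OF l False r] by simp
    have eK: "WDpar n r (lam_br n l e) = KD r (bl n l)"
      using False by (simp add: lam_br_def KD_def WBpar_eq_Yg[OF l])
    show ?thesis
    proof (cases e)
      case Plus
      then show ?thesis unfolding eK by (simp only: s_pow.simps id_o o_id image_ident)
    next
      case Minus
      have "KD r (bl n l) = (\<lambda>k. sB r r \<circ> k \<circ> sB r r) ` KD r (bl n l)"
      proof (rule equalityI)
        show "(\<lambda>k. sB r r \<circ> k \<circ> sB r r) ` KD r (bl n l) \<subseteq> KD r (bl n l)"
          by (rule image_subsetI) (rule KD_conj_last[OF r s])
        show "KD r (bl n l) \<subseteq> (\<lambda>k. sB r r \<circ> k \<circ> sB r r) ` KD r (bl n l)"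
        proof
          fix k assume k: "k \<in> KD r (bl n l)"
          have "k = sB r r \<circ> (sB r r \<circ> k \<circ> sB r r) \<circ> sB r r"
            by (simp only: o_assoc[symmetric] sB_comp_sB[OF rr] sB_comp_self[OF rr] o_id)
          then show "k \<in> (\<lambda>k. sB r r \<circ> k \<circ> sB r r) ` KD r (bl n l)"
            using KD_conj_last[OF r s k] by blast
        qed
      qed
      then show ?thesis using eK unfolding Minus s_pow.simps by (rule trans[rotated])
    qed
  qed
qed

lemma lam_br_LamD: "l \<in> Lam (n+1) r \<Longrightarrow> lam_br n l e \<in> LamD n r"
  by (auto simp: lam_br_def LamD_def)

lemma LamD_lam_br:
  assumes "\<alpha> \<in> LamD n r" obtains l e where "l \<in> Lam (n+1) r" "\<alpha> = lam_br n l e"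
proof -
  from assms consider l where "\<alpha> = LBul l" "l \<in> Lam (n+1) r" "l (n+1) \<noteq> 0"
    | e l where "\<alpha> = LSgn e l" "l \<in> Lam (n+1) r" "l (n+1) = 0"
    by (auto simp: LamD_def)
  then show ?thesis
  proof cases
    case (1 l)
    then show ?thesis using that[of l Plus] by (simp add: lam_br_def)
  next
    case (2 e l)
    then show ?thesis using that[of l e] by (simp add: lam_br_def)
  qed
qed

lemma s_pow_WB: "1 \<le> r \<Longrightarrow> s_pow r e \<in> WB r"
  by (cases e) (simp_all only: s_pow.simps WB_id, rule sB_WB, simp)

lemma s_pow_s_pow: "1 \<le> r \<Longrightarrow> s_pow r e \<circ> s_pow r e = id"
  by (cases e) (simp_all only: s_pow.simps o_id, rule sB_comp_self, simp)

lemma oddB_s_pow: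
  assumes "1 \<le> r" shows "oddB r (s_pow r e) \<longleftrightarrow> e = Minus"
proof (cases e)
  case Plus
  then show ?thesis by (simp only: s_pow.simps oddB_id sg.distinct)
next
  case Minus
  have "oddB r (sB r r)" using oddB_sB[of r r] assms by simp
  then show ?thesis unfolding Minus s_pow.simps by simp
qed

lemma WDpar_WB:
  assumes "1 \<le> r" "\<alpha> \<in> LamD n r" shows "WDpar n r \<alpha> \<subseteq> WB r"
proof -
  obtain l e where "l \<in> Lam (n+1) r" "\<alpha> = lam_br n l e" using assms(2) by (rule LamD_lam_br)
  then show ?thesis
    using subsetD[OF KD_WB] s_pow_WB[OF assms(1)]
    by (simp only: WDpar_lam_br[OF assms(1)]) (intro image_subsetI WB_comp)
qed

context heckeB
begin

lemma r1: "1 \<le> r" using r2 by simp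

lemma xD_TS: "xD n r \<alpha> = TS (WDpar n r \<alpha>)"
  by (simp add: xD_def TS_def)

lemma xD_closed: "\<alpha> \<in> LamD n r \<Longrightarrow> xD n r \<alpha> \<in> carrier (HB r)"
  unfolding xD_TS by (intro TS_closed WDpar_WB r1)

lemma xH_iff: "x \<in> xH n r \<alpha> \<longleftrightarrow> (\<exists>h\<in>HD r. x = xD n r \<alpha> \<cdot> h)"
  by (auto simp: xH_def)

lemma xH_carrier: "\<alpha> \<in> LamD n r \<Longrightarrow> x \<in> xH n r \<alpha> \<Longrightarrow> x \<in> carrier (HB r)"
  unfolding xH_iff using xD_closed HD_carrier by auto

lemma xH_add:
  assumes "\<alpha> \<in> LamD n r" "x \<in> xH n r \<alpha>" "y \<in> xH n r \<alpha>"
  shows "x \<boxplus> y \<in> xH n r \<alpha>"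
proof -
  obtain h k where h: "h \<in> HD r" "k \<in> HD r" "x = xD n r \<alpha> \<cdot> h" "y = xD n r \<alpha> \<cdot> k"
    using assms(2,3) by (auto simp: xH_iff)
  then have "x \<boxplus> y = xD n r \<alpha> \<cdot> (h \<boxplus> k)"
    using xD_closed[OF assms(1)] HD_carrier by (simp add: H.r_distr)
  then show ?thesis using HD_add[OF h(1,2)] by (auto simp: xH_iff)
qed

lemma xH_act:
  assumes "\<alpha> \<in> LamD n r" "x \<in> xH n r \<alpha>" "h \<in> HD r"
  shows "x \<cdot> h \<in> xH n r \<alpha>"
proof -
  obtain k where k: "k \<in> HD r" "x = xD n r \<alpha> \<cdot> k" using assms(2) by (auto simp: xH_iff)
  then have "x \<cdot> h = xD n r \<alpha> \<cdot> (k \<cdot> h)"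
    using xD_closed[OF assms(1)] HD_carrier assms(3) by (simp add: H.m_assoc)
  then show ?thesis using HD_mult[OF k(1) assms(3)] by (auto simp: xH_iff)
qed

lemma xH_zero: "\<alpha> \<in> LamD n r \<Longrightarrow> \<zero>\<^bsub>HB r\<^esub> \<in> xH n r \<alpha>"
  unfolding xH_iff using HD_zero xD_closed by (intro bexI[of _ "\<zero>\<^bsub>HB r\<^esub>"]) auto

lemma xH_const:
  assumes "\<alpha> \<in> LamD n r" "x \<in> xH n r \<alpha>"
  shows "Hconst r c \<cdot> x \<in> xH n r \<alpha>"
  using xH_act[OF assms HD_const, of c] Hconst_central[OF r2 xH_carrier[OF assms], of c] by simp

lemma DS_apply: "x \<in> DS n r \<Longrightarrow> \<alpha> \<in> LamD n r \<Longrightarrow> x \<alpha> \<in> xH n r \<alpha>"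
  by (auto simp: DS_def PiE_def Pi_def)

lemma DS_carrier: "x \<in> DS n r \<Longrightarrow> \<alpha> \<in> LamD n r \<Longrightarrow> x \<alpha> \<in> carrier (HB r)"
  using DS_apply xH_carrier by blast

lemma DS_I: "(\<And>\<alpha>. \<alpha> \<in> LamD n r \<Longrightarrow> f \<alpha> \<in> xH n r \<alpha>) \<Longrightarrow> (\<lambda>\<alpha>\<in>LamD n r. f \<alpha>) \<in> DS n r"
  by (auto simp: DS_def)

lemma DS_eqI:
  assumes "x \<in> DS n r" "y \<in> DS n r" "\<And>\<alpha>. \<alpha> \<in> LamD n r \<Longrightarrow> x \<alpha> = y \<alpha>"
  shows "x = y"
  using assms unfolding DS_def by (intro PiE_ext)

lemma ds_add_DS: "x \<in> DS n r \<Longrightarrow> y \<in> DS n r \<Longrightarrow> ds_add n r x y \<in> DS n r"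
  unfolding ds_add_def by (intro DS_I xH_add DS_apply)

lemma ds_act_DS: "x \<in> DS n r \<Longrightarrow> h \<in> HD r \<Longrightarrow> ds_act n r x h \<in> DS n r"
  unfolding ds_act_def by (intro DS_I xH_act DS_apply)

lemma ds_zero_DS: "ds_zero n r \<in> DS n r"
  unfolding ds_zero_def by (intro DS_I xH_zero)

lemma ds_inj_DS: "x \<in> xH n r \<alpha> \<Longrightarrow> ds_inj n r \<alpha> x \<in> DS n r"
  unfolding ds_inj_def by (intro DS_I) (simp add: xH_zero)

lemma SD_simps:
  "f \<oplus>\<^bsub>SD n r\<^esub> g = (\<lambda>x\<in>DS n r. ds_add n r (f x) (g x))"
  "f \<otimes>\<^bsub>SD n r\<^esub> g = compose (DS n r) f g"
  "\<zero>\<^bsub>SD n r\<^esub> = (\<lambda>x\<in>DS n r. ds_zero n r)"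
  "c \<odot>\<^bsub>SD n r\<^esub> f = (\<lambda>x\<in>DS n r. ds_smult n r c (f x))"
  by (simp_all add: SD_def)

lemma SD_carrier_iff: "f \<in> carrier (SD n r) \<longleftrightarrow> f \<in> DS n r \<rightarrow>\<^sub>E DS n r \<and>
    (\<forall>x\<in>DS n r. \<forall>y\<in>DS n r. f (ds_add n r x y) = ds_add n r (f x) (f y)) \<and>
    (\<forall>x\<in>DS n r. \<forall>h\<in>HD r. f (ds_act n r x h) = ds_act n r (f x) h)"
  by (simp add: SD_def)

lemma SD_apply: "f \<in> carrier (SD n r) \<Longrightarrow> x \<in> DS n r \<Longrightarrow> f x \<in> DS n r"
  unfolding SD_carrier_iff by auto

lemma SD_eqI:
  assumes "f \<in> DS n r \<rightarrow>\<^sub>E DS n r" "g \<in> DS n r \<rightarrow>\<^sub>E DS n r" "\<And>x. x \<in> DS n r \<Longrightarrow> f x = g x"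
  shows "f = g"
  by (rule PiE_ext[OF assms(1,2)]) (rule assms(3))

lemma ds_add_assoc:
  assumes "x \<in> DS n r" "y \<in> DS n r" "z \<in> DS n r"
  shows "ds_add n r (ds_add n r x y) z = ds_add n r x (ds_add n r y z)"
  using assms by (intro DS_eqI[of _ n] ds_add_DS) (auto simp: ds_add_def H.a_assoc DS_carrier)

lemma ds_add_comm:
  assumes "x \<in> DS n r" "y \<in> DS n r"
  shows "ds_add n r x y = ds_add n r y x"
  using assms by (intro DS_eqI[of _ n] ds_add_DS) (auto simp: ds_add_def H.a_comm DS_carrier)

lemma ds_add_swap:
  assumes "a \<in> DS n r" "b \<in> DS n r" "c \<in> DS n r" "d \<in> DS n r"
  shows "ds_add n r (ds_add n r a b) (ds_add n r c d) = ds_add n r (ds_add n r a c) (ds_add n r b d)"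
  using assms by (intro DS_eqI[of _ n] ds_add_DS) (auto simp: ds_add_def H.a_ac DS_carrier)

lemma ds_zero_add: "x \<in> DS n r \<Longrightarrow> ds_add n r (ds_zero n r) x = x"
  by (intro DS_eqI[of _ n] ds_add_DS ds_zero_DS) (auto simp: ds_add_def ds_zero_def DS_carrier)

lemma ds_act_add:
  assumes "x \<in> DS n r" "y \<in> DS n r" "h \<in> HD r"
  shows "ds_act n r (ds_add n r x y) h = ds_add n r (ds_act n r x h) (ds_act n r y h)"
  using assms HD_carrier
  by (intro DS_eqI[of _ n] ds_add_DS ds_act_DS) (auto simp: ds_add_def ds_act_def H.l_distr DS_carrier)

lemma ds_act_zero:
  assumes "h \<in> HD r" shows "ds_act n r (ds_zero n r) h = ds_zero n r"
  using assms HD_carrier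
  by (intro DS_eqI[of _ n] ds_zero_DS ds_act_DS) (auto simp: ds_zero_def ds_act_def)

lemma SD_abelian_monoid: "abelian_monoid (SD n r)"
proof (rule abelian_monoidI)
  fix f g assume f: "f \<in> carrier (SD n r)" and g: "g \<in> carrier (SD n r)"
  note fg = SD_apply[OF f] SD_apply[OF g]
  have add: "f (ds_add n r x y) = ds_add n r (f x) (f y)" "g (ds_add n r x y) = ds_add n r (g x) (g y)"
    if "x \<in> DS n r" "y \<in> DS n r" for x y
    using that f g unfolding SD_carrier_iff by blast+
  have act: "f (ds_act n r x h) = ds_act n r (f x) h" "g (ds_act n r x h) = ds_act n r (g x) h"
    if "x \<in> DS n r" "h \<in> HD r" for x h
    using that f g unfolding SD_carrier_iff by blast+
  show "f \<oplus>\<^bsub>SD n r\<^esub> g \<in> carrier (SD n r)"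
    unfolding SD_carrier_iff SD_simps
    using fg by (auto simp: ds_add_DS ds_act_DS add act ds_add_swap ds_act_add)
  show "f \<oplus>\<^bsub>SD n r\<^esub> g = g \<oplus>\<^bsub>SD n r\<^esub> f"
    unfolding SD_simps using fg by (intro restrict_ext ds_add_comm)
  show "\<zero>\<^bsub>SD n r\<^esub> \<oplus>\<^bsub>SD n r\<^esub> f = f"
  proof (rule SD_eqI)
    show "\<zero>\<^bsub>SD n r\<^esub> \<oplus>\<^bsub>SD n r\<^esub> f \<in> DS n r \<rightarrow>\<^sub>E DS n r"
      unfolding SD_simps using fg by (auto simp: ds_add_DS ds_zero_DS)
    show "f \<in> DS n r \<rightarrow>\<^sub>E DS n r" using f unfolding SD_carrier_iff by blast
  qed (use fg in \<open>auto simp: SD_simps ds_zero_add\<close>)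
  fix k assume k: "k \<in> carrier (SD n r)"
  show "f \<oplus>\<^bsub>SD n r\<^esub> g \<oplus>\<^bsub>SD n r\<^esub> k = f \<oplus>\<^bsub>SD n r\<^esub> (g \<oplus>\<^bsub>SD n r\<^esub> k)"
    unfolding SD_simps using fg SD_apply[OF k] by (intro restrict_ext) (simp add: ds_add_assoc)
next
  show "\<zero>\<^bsub>SD n r\<^esub> \<in> carrier (SD n r)"
    unfolding SD_carrier_iff SD_simps
    by (auto simp: ds_add_DS ds_zero_DS ds_zero_add ds_act_DS ds_act_zero)
qed

text \<open>A homomorphism is determined on the generators \<open>xD n r \<gamma>\<close>, since a tuple is the finite
  sum of its components.\<close>

lemma SD_determined:
  assumes f: "f \<in> carrier (SD n r)" and g: "g \<in> carrier (SD n r)" and ne: "LamD n r \<noteq> {}"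
    and eq: "\<And>\<gamma> h. \<gamma> \<in> LamD n r \<Longrightarrow> h \<in> HD r \<Longrightarrow>
      f (ds_inj n r \<gamma> (xD n r \<gamma> \<cdot> h)) = g (ds_inj n r \<gamma> (xD n r \<gamma> \<cdot> h))"
  shows "f = g"
proof (rule SD_eqI)
  show "f \<in> DS n r \<rightarrow>\<^sub>E DS n r" "g \<in> DS n r \<rightarrow>\<^sub>E DS n r"
    using f g unfolding SD_carrier_iff by blast+
  fix x assume x: "x \<in> DS n r"
  define cut where "cut S = (\<lambda>\<alpha>\<in>LamD n r. if \<alpha> \<in> S then x \<alpha> else \<zero>\<^bsub>HB r\<^esub>)" for S
  have cutDS: "cut S \<in> DS n r" for S
    unfolding cut_def by (intro DS_I) (simp add: DS_apply[OF x] xH_zero)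
  have gen: "f (ds_inj n r \<gamma> y) = g (ds_inj n r \<gamma> y)" if "\<gamma> \<in> LamD n r" "y \<in> xH n r \<gamma>" for \<gamma> y
    using that eq by (auto simp: xH_iff)
  have "f (cut S) = g (cut S)" if "finite S" "S \<subseteq> LamD n r" for S
    using that
  proof (induction S rule: finite_induct)
    case empty
    obtain \<gamma> where "\<gamma> \<in> LamD n r" using ne by blast
    moreover have "cut {} = ds_inj n r \<gamma> \<zero>\<^bsub>HB r\<^esub>" by (simp add: cut_def ds_inj_def)
    ultimately show ?case using gen xH_zero by simp
  next
    case (insert \<gamma> S)
    then have \<gamma>: "\<gamma> \<in> LamD n r" by simp
    have i: "ds_inj n r \<gamma> (x \<gamma>) \<in> DS n r" by (intro ds_inj_DS DS_apply x \<gamma>)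
    have e: "cut (insert \<gamma> S) = ds_add n r (cut S) (ds_inj n r \<gamma> (x \<gamma>))"
      using insert.hyps DS_carrier[OF x]
      by (intro DS_eqI[of _ n] cutDS ds_add_DS i) (auto simp: cut_def ds_add_def ds_inj_def)
    have "f (cut (insert \<gamma> S)) = ds_add n r (f (cut S)) (f (ds_inj n r \<gamma> (x \<gamma>)))"
      unfolding e using f cutDS i unfolding SD_carrier_iff by blast
    moreover have "g (cut (insert \<gamma> S)) = ds_add n r (g (cut S)) (g (ds_inj n r \<gamma> (x \<gamma>)))"
      unfolding e using g cutDS i unfolding SD_carrier_iff by blast
    ultimately show ?case using insert gen[OF \<gamma> DS_apply[OF x \<gamma>]] by simp
  qed
  from this[OF finite_LamD order_refl] have "f (cut (LamD n r)) = g (cut (LamD n r))" .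
  moreover have "cut (LamD n r) = x"
    by (rule DS_eqI[OF cutDS x]) (simp add: cut_def)
  ultimately show "f x = g x" by simp
qed

text \<open>Left multiplication by \<open>y\<close>, from the summand \<open>\<beta>\<close> of the direct sum to the summand \<open>\<alpha>\<close>.\<close>

definition opS :: "nat \<Rightarrow> lamD \<Rightarrow> lamD \<Rightarrow> hecke \<Rightarrow> schur" where
  "opS n \<alpha> \<beta> y = (\<lambda>x\<in>DS n r. ds_inj n r \<alpha> (y \<cdot> x \<beta>))"

definition maps_xH :: "nat \<Rightarrow> lamD \<Rightarrow> lamD \<Rightarrow> hecke \<Rightarrow> bool" where
  "maps_xH n \<alpha> \<beta> y \<longleftrightarrow> \<alpha> \<in> LamD n r \<and> \<beta> \<in> LamD n r \<and> y \<in> carrier (HB r) \<and>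
     (\<forall>x\<in>xH n r \<beta>. y \<cdot> x \<in> xH n r \<alpha>)"

lemma maps_xHD:
  assumes "maps_xH n \<alpha> \<beta> y"
  shows "\<alpha> \<in> LamD n r" "\<beta> \<in> LamD n r" "y \<in> carrier (HB r)" "x \<in> xH n r \<beta> \<Longrightarrow> y \<cdot> x \<in> xH n r \<alpha>"
  using assms by (auto simp: maps_xH_def)

lemma opS_carrier:
  assumes "maps_xH n \<alpha> \<beta> y"
  shows "opS n \<alpha> \<beta> y \<in> carrier (SD n r)"
proof -
  note m = maps_xHD[OF assms]
  have inj: "ds_inj n r \<alpha> (y \<cdot> x \<beta>) \<in> DS n r" if "x \<in> DS n r" for x
    by (intro ds_inj_DS m(4) DS_apply that m(2))
  have "ds_inj n r \<alpha> (y \<cdot> ds_add n r x x' \<beta>) = ds_add n r (ds_inj n r \<alpha> (y \<cdot> x \<beta>)) (ds_inj n r \<alpha> (y \<cdot> x' \<beta>))"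
    if "x \<in> DS n r" "x' \<in> DS n r" for x x'
    using that m(1-3)
    by (intro DS_eqI[of _ n] ds_add_DS inj) (auto simp: ds_add_def ds_inj_def DS_carrier H.r_distr)
  moreover have "ds_inj n r \<alpha> (y \<cdot> ds_act n r x h \<beta>) = ds_act n r (ds_inj n r \<alpha> (y \<cdot> x \<beta>)) h"
    if "x \<in> DS n r" "h \<in> HD r" for x h
    using that m(1-3) HD_carrier
    by (intro DS_eqI[of _ n] ds_act_DS inj) (auto simp: ds_act_def ds_inj_def DS_carrier H.m_assoc)
  ultimately show ?thesis
    unfolding SD_carrier_iff opS_def using inj by (simp add: ds_add_DS ds_act_DS)
qed

lemma maps_xH_I:
  assumes "\<alpha> \<in> LamD n r" "\<beta> \<in> LamD n r" "y \<in> carrier (HB r)"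
    and "y \<cdot> xD n r \<beta> = xD n r \<alpha> \<cdot> z" "z \<in> HD r"
  shows "maps_xH n \<alpha> \<beta> y"
  unfolding maps_xH_def
proof (intro conjI ballI assms)
  fix x assume "x \<in> xH n r \<beta>"
  then obtain h where h: "h \<in> HD r" "x = xD n r \<beta> \<cdot> h" by (auto simp: xH_iff)
  note cl = HD_carrier[OF h(1)] HD_carrier[OF assms(5)] xD_closed[OF assms(1)] xD_closed[OF assms(2)] assms(3)
  have "y \<cdot> x = (y \<cdot> xD n r \<beta>) \<cdot> h" unfolding h(2) using cl by (simp add: H.m_assoc)
  also have "\<dots> = xD n r \<alpha> \<cdot> (z \<cdot> h)" unfolding assms(4) using cl by (simp add: H.m_assoc)
  finally show "y \<cdot> x \<in> xH n r \<alpha>" using HD_mult[OF assms(5) h(1)] by (auto simp: xH_iff)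
qed

lemma opS_eqI:
  assumes "maps_xH n \<alpha> \<beta> y" "maps_xH n \<alpha> \<beta> y'" "y \<cdot> xD n r \<beta> = y' \<cdot> xD n r \<beta>"
  shows "opS n \<alpha> \<beta> y = opS n \<alpha> \<beta> y'"
  unfolding opS_def
proof (rule restrict_ext)
  fix x assume "x \<in> DS n r"
  then have "x \<beta> \<in> xH n r \<beta>" by (rule DS_apply[OF _ maps_xHD(2)[OF assms(1)]])
  then obtain h where h: "h \<in> HD r" "x \<beta> = xD n r \<beta> \<cdot> h" by (auto simp: xH_iff)
  have "y \<cdot> x \<beta> = y' \<cdot> x \<beta>"
    unfolding h(2) using maps_xHD(2,3)[OF assms(1)] maps_xHD(3)[OF assms(2)] HD_carrier[OF h(1)] assms(3)
    by (simp add: H.m_assoc[symmetric] xD_closed)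
  then show "ds_inj n r \<alpha> (y \<cdot> x \<beta>) = ds_inj n r \<alpha> (y' \<cdot> x \<beta>)" by simp
qed

text \<open>The multiplication takes the values prescribed for the basis map, and \<open>SD_determined\<close> shows that
  these values single it out.\<close>

lemma phi_std_eq_opS:
  assumes m: "maps_xH n \<alpha> \<beta> y"
    and D: "dcoset (WDpar n r \<alpha>) d (WDpar n r \<beta>) = D" "D \<subseteq> WB r"
    and y: "y \<cdot> xD n r \<beta> = TS D"
  shows "phi_std n r \<alpha> \<beta> d = opS n \<alpha> \<beta> y"
  unfolding phi_std_def D(1)
proof (rule the_equality)
  note mm = maps_xHD[OF m]
  have v: "(if \<beta> = \<gamma> then ds_inj n r \<alpha> (\<Oplus>\<^bsub>HB r\<^esub> w\<in>D. Tw r w \<cdot> h) else ds_zero n r) =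
      opS n \<alpha> \<beta> y (ds_inj n r \<gamma> (xD n r \<gamma> \<cdot> h))" if "\<gamma> \<in> LamD n r" "h \<in> HD r" for \<gamma> h
  proof -
    have x: "ds_inj n r \<gamma> (xD n r \<gamma> \<cdot> h) \<in> DS n r" using that by (intro ds_inj_DS) (auto simp: xH_iff)
    have "(\<Oplus>\<^bsub>HB r\<^esub> w\<in>D. Tw r w \<cdot> h) = TS D \<cdot> h"
      unfolding TS_def using D(2) HD_carrier[OF that(2)]
      by (intro H.finsum_ldistr[symmetric] finite_subset[OF D(2) finite_WB]) auto
    also have "\<dots> = y \<cdot> (xD n r \<beta> \<cdot> h)"
      unfolding y[symmetric] using mm(2,3) HD_carrier[OF that(2)] by (simp add: H.m_assoc xD_closed)
    finally have e: "(\<Oplus>\<^bsub>HB r\<^esub> w\<in>D. Tw r w \<cdot> h) = y \<cdot> (xD n r \<beta> \<cdot> h)" .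
    have z: "ds_inj n r \<alpha> \<zero>\<^bsub>HB r\<^esub> = ds_zero n r" by (simp add: ds_inj_def ds_zero_def)
    have a: "opS n \<alpha> \<beta> y (ds_inj n r \<gamma> (xD n r \<gamma> \<cdot> h)) =
        ds_inj n r \<alpha> (y \<cdot> ds_inj n r \<gamma> (xD n r \<gamma> \<cdot> h) \<beta>)"
      unfolding opS_def by (rule restrict_apply'[OF x])
    have b: "ds_inj n r \<gamma> (xD n r \<gamma> \<cdot> h) \<beta> = (if \<beta> = \<gamma> then xD n r \<gamma> \<cdot> h else \<zero>\<^bsub>HB r\<^esub>)"
      unfolding ds_inj_def by (rule restrict_apply'[OF mm(2)])
    show ?thesis
      unfolding e a b using z mm(3) by (cases "\<beta> = \<gamma>") simp_all
  qed
  show "opS n \<alpha> \<beta> y \<in> carrier (SD n r) \<and> (\<forall>\<gamma>\<in>LamD n r. \<forall>h\<in>HD r. opS n \<alpha> \<beta> y (ds_inj n r \<gamma> (xD n r \<gamma> \<cdot> h)) =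
      (if \<beta> = \<gamma> then ds_inj n r \<alpha> (\<Oplus>\<^bsub>HB r\<^esub> w\<in>D. Tw r w \<cdot> h) else ds_zero n r))"
    using opS_carrier[OF m] v by simp
  fix f assume f: "f \<in> carrier (SD n r) \<and> (\<forall>\<gamma>\<in>LamD n r. \<forall>h\<in>HD r. f (ds_inj n r \<gamma> (xD n r \<gamma> \<cdot> h)) =
      (if \<beta> = \<gamma> then ds_inj n r \<alpha> (\<Oplus>\<^bsub>HB r\<^esub> w\<in>D. Tw r w \<cdot> h) else ds_zero n r))"
  then show "f = opS n \<alpha> \<beta> y"
    using mm(1) v by (intro SD_determined[OF _ opS_carrier[OF m]]) auto
qed

text \<open>A left multiplication is determined by the image \<open>t\<close> of the generator \<open>xD n r \<beta>\<close>, and \<open>t\<close> depends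
  linearly on it, so identities between homomorphisms become identities between elements of the
  algebra.\<close>

definition reps :: "nat \<Rightarrow> lamD \<Rightarrow> lamD \<Rightarrow> hecke \<Rightarrow> schur \<Rightarrow> bool" where
  "reps n \<alpha> \<beta> t f \<longleftrightarrow> (\<exists>y. maps_xH n \<alpha> \<beta> y \<and> f = opS n \<alpha> \<beta> y \<and> y \<cdot> xD n r \<beta> = t)"

lemma reps_carrier: "reps n \<alpha> \<beta> t f \<Longrightarrow> f \<in> carrier (SD n r)"
  using opS_carrier by (auto simp: reps_def)

lemma reps_closed: "reps n \<alpha> \<beta> t f \<Longrightarrow> t \<in> carrier (HB r)"
  unfolding reps_def using maps_xHD(2,3) xD_closed by blast

lemma reps_unique: "reps n \<alpha> \<beta> t f \<Longrightarrow> reps n \<alpha> \<beta> t g \<Longrightarrow> f = g"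
  unfolding reps_def using opS_eqI by blast

lemma maps_xH_add:
  assumes "maps_xH n \<alpha> \<beta> y" "maps_xH n \<alpha> \<beta> y'"
  shows "maps_xH n \<alpha> \<beta> (y \<boxplus> y')"
  using maps_xHD[OF assms(1)] maps_xHD[OF assms(2)] xH_carrier[OF maps_xHD(2)[OF assms(1)]]
  unfolding maps_xH_def by (auto simp: H.l_distr xH_add)

lemma maps_xH_const:
  assumes "maps_xH n \<alpha> \<beta> y"
  shows "maps_xH n \<alpha> \<beta> (Hconst r c \<cdot> y)"
  using maps_xHD[OF assms] xH_carrier[OF maps_xHD(2)[OF assms]]
  unfolding maps_xH_def by (auto simp: H.m_assoc xH_const)

lemma maps_xH_zero: "\<alpha> \<in> LamD n r \<Longrightarrow> \<beta> \<in> LamD n r \<Longrightarrow> maps_xH n \<alpha> \<beta> \<zero>\<^bsub>HB r\<^esub>"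
  unfolding maps_xH_def using xH_carrier by (auto simp: xH_zero)

lemma reps_add:
  assumes "reps n \<alpha> \<beta> t f" "reps n \<alpha> \<beta> t' f'"
  shows "reps n \<alpha> \<beta> (t \<boxplus> t') (f \<oplus>\<^bsub>SD n r\<^esub> f')"
proof -
  obtain y y' where y: "maps_xH n \<alpha> \<beta> y" "f = opS n \<alpha> \<beta> y" "y \<cdot> xD n r \<beta> = t"
    and y': "maps_xH n \<alpha> \<beta> y'" "f' = opS n \<alpha> \<beta> y'" "y' \<cdot> xD n r \<beta> = t'"
    using assms by (auto simp: reps_def)
  note m = maps_xHD[OF y(1)] and m' = maps_xHD[OF y'(1)]
  have "f \<oplus>\<^bsub>SD n r\<^esub> f' = opS n \<alpha> \<beta> (y \<boxplus> y')"
    unfolding SD_simps y(2) y'(2) opS_def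
  proof (rule restrict_ext)
    fix x assume x: "x \<in> DS n r"
    note xc = DS_carrier[OF x m(2)]
    show "ds_add n r ((\<lambda>x\<in>DS n r. ds_inj n r \<alpha> (y \<cdot> x \<beta>)) x) ((\<lambda>x\<in>DS n r. ds_inj n r \<alpha> (y' \<cdot> x \<beta>)) x) =
        ds_inj n r \<alpha> ((y \<boxplus> y') \<cdot> x \<beta>)"
      unfolding ds_add_def ds_inj_def restrict_apply'[OF x]
      by (rule restrict_ext) (use xc m(3) m'(3) in \<open>simp add: H.l_distr\<close>)
  qed
  moreover have "(y \<boxplus> y') \<cdot> xD n r \<beta> = t \<boxplus> t'"
    unfolding y(3)[symmetric] y'(3)[symmetric] using m(2,3) m'(3) by (simp add: H.l_distr xD_closed)
  ultimately show ?thesis unfolding reps_def using maps_xH_add[OF y(1) y'(1)] by blast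
qed

lemma reps_zero:
  assumes "\<alpha> \<in> LamD n r" "\<beta> \<in> LamD n r"
  shows "reps n \<alpha> \<beta> \<zero>\<^bsub>HB r\<^esub> \<zero>\<^bsub>SD n r\<^esub>"
proof -
  have "\<zero>\<^bsub>SD n r\<^esub> = opS n \<alpha> \<beta> \<zero>\<^bsub>HB r\<^esub>"
    unfolding SD_simps opS_def using DS_carrier[OF _ assms(2)]
    by (intro restrict_ext) (auto simp: ds_zero_def ds_inj_def)
  then show ?thesis
    unfolding reps_def using maps_xH_zero[OF assms] xD_closed[OF assms(2)] by auto
qed

lemma reps_term:
  assumes ab: "\<alpha> \<in> LamD n r" "\<beta> \<in> LamD n r" and t: "t \<in> carrier (HB r)"
    and f: "c \<noteq> 0 \<Longrightarrow> reps n \<alpha> \<beta> t f"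
  shows "reps n \<alpha> \<beta> (Hconst r c \<cdot> t) (term_SD n r c f)"
proof (cases "c = 0")
  case True
  then show ?thesis
    using reps_zero[OF ab] t by (simp add: term_SD_def Hconst_0[OF r2])
next
  case False
  then obtain y where y: "maps_xH n \<alpha> \<beta> y" "f = opS n \<alpha> \<beta> y" "y \<cdot> xD n r \<beta> = t"
    using f by (auto simp: reps_def)
  note m = maps_xHD[OF y(1)]
  have "c \<odot>\<^bsub>SD n r\<^esub> f = opS n \<alpha> \<beta> (Hconst r c \<cdot> y)"
    unfolding SD_simps y(2) opS_def
  proof (rule restrict_ext)
    fix x assume x: "x \<in> DS n r"
    note xc = DS_carrier[OF x m(2)]
    show "ds_smult n r c ((\<lambda>x\<in>DS n r. ds_inj n r \<alpha> (y \<cdot> x \<beta>)) x) = ds_inj n r \<alpha> (Hconst r c \<cdot> y \<cdot> x \<beta>)"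
      unfolding ds_smult_def ds_inj_def restrict_apply'[OF x]
      by (rule restrict_ext) (use xc m(3) in \<open>simp add: H.m_assoc\<close>)
  qed
  moreover have "(Hconst r c \<cdot> y) \<cdot> xD n r \<beta> = Hconst r c \<cdot> t"
    unfolding y(3)[symmetric] using m(2,3) by (simp add: H.m_assoc xD_closed)
  ultimately show ?thesis
    using False unfolding reps_def term_SD_def using maps_xH_const[OF y(1)] by auto
qed

lemma reps_finsum:
  assumes ab: "\<alpha> \<in> LamD n r" "\<beta> \<in> LamD n r"
    and fin: "finite P" and f: "\<And>p. p \<in> P \<Longrightarrow> reps n \<alpha> \<beta> (t p) (f p)"
  shows "reps n \<alpha> \<beta> (\<Oplus>\<^bsub>HB r\<^esub> p\<in>P. t p) (\<Oplus>\<^bsub>SD n r\<^esub> p\<in>P. f p)"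
  using fin f
proof (induction P rule: finite_induct)
  case empty
  interpret S: abelian_monoid "SD n r" by (rule SD_abelian_monoid)
  show ?case using reps_zero[OF ab] by simp
next
  case (insert p P)
  interpret S: abelian_monoid "SD n r" by (rule SD_abelian_monoid)
  have t: "t \<in> P \<rightarrow> carrier (HB r)" "t p \<in> carrier (HB r)"
    using insert.prems reps_closed by blast+
  have f: "f \<in> P \<rightarrow> carrier (SD n r)" "f p \<in> carrier (SD n r)"
    using insert.prems reps_carrier by blast+
  have "reps n \<alpha> \<beta> (t p \<boxplus> (\<Oplus>\<^bsub>HB r\<^esub> p\<in>P. t p)) (f p \<oplus>\<^bsub>SD n r\<^esub> (\<Oplus>\<^bsub>SD n r\<^esub> p\<in>P. f p))"
    using insert by (intro reps_add) auto
  then show ?case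
    using insert.hyps t f by (simp add: H.finsum_insert S.finsum_insert)
qed

lemma reps_mult:
  assumes m: "maps_xH n \<alpha> \<beta> y" and g: "reps n \<beta> \<gamma> t g"
  shows "reps n \<alpha> \<gamma> (y \<cdot> t) (opS n \<alpha> \<beta> y \<otimes>\<^bsub>SD n r\<^esub> g)"
proof -
  obtain z where z: "maps_xH n \<beta> \<gamma> z" "g = opS n \<beta> \<gamma> z" "z \<cdot> xD n r \<gamma> = t"
    using g by (auto simp: reps_def)
  note my = maps_xHD[OF m] and mz = maps_xHD[OF z(1)]
  have "opS n \<alpha> \<beta> y \<otimes>\<^bsub>SD n r\<^esub> g = opS n \<alpha> \<gamma> (y \<cdot> z)"
    unfolding SD_simps z(2) compose_def
    unfolding opS_def[of n \<alpha> \<gamma>]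
  proof (rule restrict_ext)
    fix x assume x: "x \<in> DS n r"
    note xc = DS_carrier[OF x mz(2)]
    have i: "ds_inj n r \<beta> (z \<cdot> x \<gamma>) \<in> DS n r" by (intro ds_inj_DS mz(4) DS_apply x mz(2))
    show "opS n \<alpha> \<beta> y (opS n \<beta> \<gamma> z x) = ds_inj n r \<alpha> (y \<cdot> z \<cdot> x \<gamma>)"
      unfolding opS_def restrict_apply'[OF x] restrict_apply'[OF i]
      unfolding ds_inj_def[of n r \<beta>] restrict_apply'[OF my(2)]
      using xc my(3) mz(3) by (simp add: H.m_assoc)
  qed
  moreover have "maps_xH n \<alpha> \<gamma> (y \<cdot> z)"
    unfolding maps_xH_def using my mz xH_carrier[OF mz(2)] by (auto simp: H.m_assoc)
  moreover have "(y \<cdot> z) \<cdot> xD n r \<gamma> = y \<cdot> t"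
    unfolding z(3)[symmetric] using my(3) mz(2,3) by (simp add: H.m_assoc xD_closed)
  ultimately show ?thesis unfolding reps_def by blast
qed

lemma TS_image_right:
  assumes "D \<subseteq> WB r"
  shows "TS ((\<lambda>w. w \<circ> s_pow r e) ` D) = TS D \<cdot> (if e = Plus then \<one>\<^bsub>HB r\<^esub> else Tgen r r)"
  using TS_right_last[OF assms] TS_closed[OF assms]
  by (cases e) (simp_all only: s_pow.simps o_id image_ident H.r_one if_True if_False sg.distinct simp_thms)

text \<open>For \<open>e = Minus\<close> the parabolic subgroup is a conjugate of the even Young subgroup; twisting \<open>D\<close> on the
  right by \<open>sB r r\<close> reduces this case to \<open>TS_right_invariant\<close>.\<close>

lemma TS_factor_right:
  assumes l: "l \<in> Lam (n+1) r" and D: "D \<subseteq> WB r"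
    and inv: "\<And>w k. w \<in> D \<Longrightarrow> k \<in> WDpar n r (lam_br n l e) \<Longrightarrow> w \<circ> k \<in> D"
  shows "\<exists>y\<in>carrier (HB r). TS D = y \<cdot> xD n r (lam_br n l e)"
proof -
  let ?s = "s_pow r e" and ?K = "KD r (bl n l)"
  define T where "T = (if e = Plus then \<one>\<^bsub>HB r\<^esub> else Tgen r r)"
  have T: "T \<in> carrier (HB r)" "T \<cdot> T = \<one>\<^bsub>HB r\<^esub>"
    using Tgen_square_last[OF r2] r_mem by (auto simp: T_def)
  note right = TS_image_right[of _ e, folded T_def]
  note sW = s_pow_WB[OF r1, of e] and ss = s_pow_s_pow[OF r1, of e]
  define E where "E = (\<lambda>w. w \<circ> ?s) ` D"
  have E: "E \<subseteq> WB r" using D WB_comp[OF _ sW] by (auto simp: E_def)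
  have DE: "D = (\<lambda>w. w \<circ> ?s) ` E"
    unfolding E_def image_image by (simp only: o_assoc[symmetric] ss o_id image_ident)
  have "\<exists>y\<in>carrier (HB r). TS E = y \<cdot> TS ?K"
  proof (rule TS_right_invariant[OF l E])
    fix w k assume w: "w \<in> E" and k: "k \<in> ?K"
    then obtain v where v: "v \<in> D" "w = v \<circ> ?s" by (auto simp: E_def)
    have "?s \<circ> k \<circ> ?s \<in> WDpar n r (lam_br n l e)"
      unfolding WDpar_lam_br[OF r1 l] using k by blast
    from inv[OF v(1) this] have "v \<circ> (?s \<circ> k \<circ> ?s) \<circ> ?s \<in> E" unfolding E_def by blast
    moreover have "v \<circ> (?s \<circ> k \<circ> ?s) \<circ> ?s = w \<circ> k"
      unfolding v(2) by (simp only: o_assoc[symmetric] ss o_id)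
    ultimately show "w \<circ> k \<in> E" by simp
  qed
  then obtain y where y: "y \<in> carrier (HB r)" "TS E = y \<cdot> TS ?K" by blast
  have K: "TS ?K \<in> carrier (HB r)" by (rule TS_closed[OF KD_WB])
  have im: "(\<lambda>w. ?s \<circ> w) ` ?K \<subseteq> WB r" using KD_WB WB_comp[OF sW] by blast
  have left: "TS ((\<lambda>w. ?s \<circ> w) ` ?K) = T \<cdot> TS ?K"
    using TS_left_last[OF KD_WB] K
    unfolding T_def by (cases e) (simp_all only: s_pow.simps id_o image_ident H.l_one if_True if_False sg.distinct simp_thms)
  have "xD n r (lam_br n l e) = TS ((\<lambda>w. w \<circ> ?s) ` ((\<lambda>w. ?s \<circ> w) ` ?K))"
    unfolding xD_TS WDpar_lam_br[OF r1 l] image_image ..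
  then have x: "xD n r (lam_br n l e) = T \<cdot> TS ?K \<cdot> T"
    unfolding right[OF im] left .
  have "TS D = (y \<cdot> TS ?K) \<cdot> T"
    unfolding y(2)[symmetric] right[OF E, symmetric] DE[symmetric] ..
  also have "\<dots> = y \<cdot> ((T \<cdot> T) \<cdot> TS ?K) \<cdot> T" unfolding T(2) using K by simp
  also have "\<dots> = (y \<cdot> T) \<cdot> xD n r (lam_br n l e)"
    unfolding x using T(1) K y(1) by (simp only: H.m_assoc H.m_closed)
  finally show ?thesis using y(1) T(1) by blast
qed

text \<open>A double coset is invariant under both parabolic subgroups, so its sum factors through both
  generators: it is \<open>y\<close> times one generator, and it lies in the right ideal of the other.\<close>

lemma reps_phi_std:
  assumes l: "l \<in> Lam (n+1) r" "l (n+1) \<noteq> 0" and m: "m \<in> Lam (n+1) r"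
    and D: "dcoset (WDpar n r (LBul l)) d (WDpar n r (lam_br n m e)) = D" "D \<subseteq> WD r"
  shows "reps n (LBul l) (lam_br n m e) (TS D) (phi_std n r (LBul l) (lam_br n m e) d)"
    and "y \<in> carrier (HB r) \<Longrightarrow> y \<cdot> xD n r (lam_br n m e) = TS D \<Longrightarrow>
      maps_xH n (LBul l) (lam_br n m e) y \<and>
      phi_std n r (LBul l) (lam_br n m e) d = opS n (LBul l) (lam_br n m e) y"
proof -
  have lb: "LBul l = lam_br n l Plus" using l(2) by (simp add: lam_br_def)
  have DW: "D \<subseteq> WB r" using D(2) by (auto simp: WD_iff)
  have a: "LBul l \<in> LamD n r" "lam_br n m e \<in> LamD n r"
    unfolding lb by (intro lam_br_LamD l m)+
  have wd: "WDpar n r (LBul l) = KD r (bl n l)"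
    unfolding lb WDpar_lam_br[OF r1 l(1)] by (simp only: s_pow.simps id_o o_id image_ident)
  have K: "k \<circ> k' \<in> KD r (bl n l)" if "k \<in> KD r (bl n l)" "k' \<in> KD r (bl n l)" for k k'
    using KD_comp that by blast
  have K': "k \<circ> k' \<in> WDpar n r (lam_br n m e)"
    if kk: "k \<in> WDpar n r (lam_br n m e)" "k' \<in> WDpar n r (lam_br n m e)" for k k'
  proof -
    let ?s = "s_pow r e"
    obtain u u' where u: "u \<in> KD r (bl n m)" "u' \<in> KD r (bl n m)" "k = ?s \<circ> u \<circ> ?s" "k' = ?s \<circ> u' \<circ> ?s"
      using kk unfolding WDpar_lam_br[OF r1 m] by blast
    have "k \<circ> k' = ?s \<circ> u \<circ> (?s \<circ> ?s) \<circ> u' \<circ> ?s" unfolding u(3,4) by (simp only: o_assoc)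
    then have "k \<circ> k' = ?s \<circ> (u \<circ> u') \<circ> ?s" unfolding s_pow_s_pow[OF r1] by (simp only: o_id o_assoc)
    then show ?thesis unfolding WDpar_lam_br[OF r1 m] using KD_comp[OF u(1,2)] by blast
  qed
  have "\<exists>z\<in>HD r. TS D = TS (KD r (bl n l)) \<cdot> z"
  proof (rule TS_left_invariant[OF l(1) D(2)])
    fix w k assume w: "w \<in> D" and k: "k \<in> KD r (bl n l)"
    then obtain u v where "u \<in> KD r (bl n l)" "v \<in> WDpar n r (lam_br n m e)" "w = u \<circ> d \<circ> v"
      unfolding D(1)[symmetric] dcoset_def wd by blast
    then show "k \<circ> w \<in> D"
      unfolding D(1)[symmetric] dcoset_def wd using K[OF k] by (metis (mono_tags, lifting) mem_Collect_eq o_assoc)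
  qed
  then obtain z where z: "z \<in> HD r" "TS D = xD n r (LBul l) \<cdot> z" unfolding xD_TS wd by blast
  have "\<exists>y\<in>carrier (HB r). TS D = y \<cdot> xD n r (lam_br n m e)"
  proof (rule TS_factor_right[OF m DW])
    fix w k assume w: "w \<in> D" and k: "k \<in> WDpar n r (lam_br n m e)"
    then obtain u v where "u \<in> WDpar n r (LBul l)" "v \<in> WDpar n r (lam_br n m e)" "w = u \<circ> d \<circ> v"
      unfolding D(1)[symmetric] dcoset_def by blast
    then show "w \<circ> k \<in> D"
      unfolding D(1)[symmetric] dcoset_def using K'[OF _ k] by (metis (mono_tags, lifting) mem_Collect_eq o_assoc)
  qed
  then obtain y where y: "y \<in> carrier (HB r)" "y \<cdot> xD n r (lam_br n m e) = TS D" by metis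
  have *: "maps_xH n (LBul l) (lam_br n m e) y \<and>
      phi_std n r (LBul l) (lam_br n m e) d = opS n (LBul l) (lam_br n m e) y"
    if "y \<in> carrier (HB r)" "y \<cdot> xD n r (lam_br n m e) = TS D" for y
  proof -
    have "maps_xH n (LBul l) (lam_br n m e) y"
      by (rule maps_xH_I[OF a that(1) _ z(1)]) (use that(2) z(2) in simp)
    then show ?thesis using phi_std_eq_opS[OF _ D(1) DW that(2)] by blast
  qed
  show "reps n (LBul l) (lam_br n m e) (TS D) (phi_std n r (LBul l) (lam_br n m e) d)"
    unfolding reps_def using *[OF y] y(2) by blast
  show "y \<in> carrier (HB r) \<Longrightarrow> y \<cdot> xD n r (lam_br n m e) = TS D \<Longrightarrow>
      maps_xH n (LBul l) (lam_br n m e) y \<and>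
      phi_std n r (LBul l) (lam_br n m e) d = opS n (LBul l) (lam_br n m e) y" for y
    by (rule *)
qed

end

section \<open>The multiplication formula in the generic algebra\<close>

text \<open>Composition on the left with the cycle that sends the value \<open>c - k\<close> to \<open>c\<close> and shifts the values
  between down by one.\<close>

fun rot :: "nat \<Rightarrow> nat \<Rightarrow> nat \<Rightarrow> (nat \<Rightarrow> nat) \<Rightarrow> nat \<Rightarrow> nat" where
  "rot r c 0 v = v"
| "rot r c (Suc k) v = rot r c k (sB r (c - Suc k) \<circ> v)"

text \<open>The exponent of \<open>qq\<close> that the position of the value \<open>c - k\<close> picks up from the values \<open>c - k'\<close> placed to
  the right of it.\<close>

definition gr :: "nat \<Rightarrow> (nat \<Rightarrow> nat) \<Rightarrow> nat \<Rightarrow> nat \<Rightarrow> nat" where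
  "gr c v m k = (\<Sum>k'<m. if pinv v (c - k) < pinv v (c - k') then 1 else 0)"

lemma gr_Suc: "gr c v (Suc m) k = gr c v m k + (if pinv v (c - k) < pinv v (c - m) then 1 else 0)"
  by (simp add: gr_def)

lemma rot_WB:
  assumes "c \<le> r" shows "v \<in> WB r \<Longrightarrow> k < c \<Longrightarrow> rot r c k v \<in> WB r"
proof (induction k arbitrary: v)
  case (Suc k)
  then have "c - Suc k \<in> {1..r}" using assms by auto
  then show ?case using Suc by (simp only: rot.simps) (intro Suc.IH WB_comp sB_WB, auto)
qed simp

lemma rot_comp: "rot r c k (u \<circ> v) = rot r c k u \<circ> v"
  by (induction k arbitrary: u) (simp_all only: rot.simps o_assoc)

lemma rot_sB_commute:
  assumes "c \<le> r" "1 \<le> j"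
  shows "j + k + 2 \<le> c \<Longrightarrow> rot r c k (sB r j \<circ> v) = sB r j \<circ> rot r c k v"
proof (induction k arbitrary: v)
  case (Suc k)
  have "sB r j \<circ> sB r (c - Suc k) = sB r (c - Suc k) \<circ> sB r j"
    by (rule sB_commute) (use assms Suc.prems in auto)
  then have e: "sB r (c - Suc k) \<circ> (sB r j \<circ> v) = sB r j \<circ> (sB r (c - Suc k) \<circ> v)"
    by (simp only: o_assoc)
  have "j + k + 2 \<le> c" using Suc.prems by simp
  then show ?case unfolding rot.simps e by (rule Suc.IH)
qed (simp only: rot.simps)

lemma rot_id_apply:
  assumes "c \<le> r"
  shows "k < c \<Longrightarrow> y \<in> {1..r} \<Longrightarrow>
    rot r c k id y = (if y = c - k then c else if c - k < y \<and> y \<le> c then y - 1 else y)"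
proof (induction k arbitrary: y)
  case (Suc k)
  define j where "j = c - Suc k"
  have j: "1 \<le> j" "j < r" "c - k = j + 1" "j + 1 \<le> c" using Suc.prems assms by (auto simp: j_def)
  have "rot r c (Suc k) id = rot r c k id \<circ> sB r j"
  proof -
    have "rot r c (Suc k) id = rot r c k (id \<circ> sB r j)" by (simp only: rot.simps j_def o_id id_o)
    then show ?thesis by (simp only: rot_comp)
  qed
  then have e: "rot r c (Suc k) id y = rot r c k id (sB r j y)" by simp
  have s: "sB r j y = (if y = j then j+1 else if y = j+1 then j else y)"
    using sB_small[OF j(1,2)] Suc.prems(2) by simp
  have "sB r j y \<in> {1..r}" using s j Suc.prems(2) by auto
  have "rot r c k id (sB r j y) =
     (if sB r j y = j+1 then c else if j+1 < sB r j y \<and> sB r j y \<le> c then sB r j y - 1 else sB r j y)"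
    by (rule Suc.IH[OF _ \<open>sB r j y \<in> {1..r}\<close>, unfolded j(3)]) (use Suc.prems in simp)
  then show ?case
    unfolding e j_def[symmetric] s using j by (cases "y = j"; cases "y = j+1") auto
qed simp

context heckeB
begin

text \<open>The chain \<open>Yel c k\<close> is \<open>T\<^sub>c\<^sub>-\<^sub>k \<dots> T\<^sub>c\<^sub>-\<^sub>1\<close>, and \<open>Gop c k\<close> is its effect on coefficient functions.\<close>

fun Gop :: "nat \<Rightarrow> nat \<Rightarrow> ((nat \<Rightarrow> nat) \<Rightarrow> int poly) \<Rightarrow> (nat \<Rightarrow> nat) \<Rightarrow> int poly" where
  "Gop c 0 f = f"
| "Gop c (Suc k) f = Lop (c - Suc k) (Gop c k f)"

fun Yel :: "nat \<Rightarrow> nat \<Rightarrow> hecke" where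
  "Yel c 0 = \<one>\<^bsub>HB r\<^esub>"
| "Yel c (Suc k) = Tgen r (c - Suc k) \<cdot> Yel c k"

definition Ysum :: "nat \<Rightarrow> nat \<Rightarrow> hecke" where
  "Ysum c g = (\<Oplus>\<^bsub>HB r\<^esub> k\<in>{..g}. Yel c k)"

lemma Yel_closed:
  assumes "c \<le> r" shows "k < c \<Longrightarrow> Yel c k \<in> carrier (HB r)"
proof (induction k)
  case (Suc k)
  then have "c - Suc k \<in> {1..r}" using assms by auto
  then show ?case using Suc by (simp only: Yel.simps) (intro H.m_closed Tgen_closed' Suc.IH, auto)
qed simp

lemma Ysum_closed:
  assumes "c \<le> r" "g < c" shows "Ysum c g \<in> carrier (HB r)"
  unfolding Ysum_def using assms by (intro H.finsum_closed Pi_I Yel_closed) auto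

lemma Yel_ev:
  assumes "c \<le> r" shows "k < c \<Longrightarrow> Yel c k \<cdot> ev f = ev (Gop c k f)"
proof (induction k)
  case (Suc k)
  then have c: "c - Suc k \<in> {1..r}" "1 \<le> c - Suc k" "c - Suc k < r" using assms by auto
  have "Yel c (Suc k) \<cdot> ev f = Tgen r (c - Suc k) \<cdot> (Yel c k \<cdot> ev f)"
    unfolding Yel.simps using Yel_closed[OF assms, of k] Suc.prems
    by (simp only: H.m_assoc Tgen_closed'[OF c(1)] ev_closed Suc_lessD)
  also have "Yel c k \<cdot> ev f = ev (Gop c k f)" using Suc by simp
  also have "Tgen r (c - Suc k) \<cdot> ev (Gop c k f) = ev (Gop c (Suc k) f)"
    unfolding Gop.simps by (rule ev_left[OF c(2,3)])
  finally show ?case .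
qed simp

text \<open>The invariance of \<open>f\<close> allows the generators left over after an unfinished cycle to be absorbed, so
  that only the cycles \<open>rot r c k\<close> occur.  The first summand comes from going through the whole chain;
  the others from the term \<open>qq - 1\<close> of the quadratic relation.\<close>

lemma Gop_formula:
  assumes c: "c \<le> r" "g < c"
    and f: "\<And>w j. w \<in> WB r \<Longrightarrow> c - g \<le> j \<Longrightarrow> j + 2 \<le> c \<Longrightarrow> f (sB r j \<circ> w) = f w"
  shows "m \<le> g \<Longrightarrow> v \<in> WB r \<Longrightarrow> Gop c m f v = qq ^ gr c v m m * f (rot r c m v) +
    (qq - 1) * (\<Sum>k<m. if pinv v (c - k) < pinv v (c - m) then qq ^ gr c v m k * f (rot r c k v) else 0)"
proof (induction m arbitrary: v)
  case 0
  then show ?case by (simp add: gr_def)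
next
  case (Suc m)
  define j where "j = c - Suc m"
  have j: "1 \<le> j" "j < r" "j \<in> {1..r}" "c - m = j + 1" "j + 1 \<le> c" "c - g \<le> j"
    using Suc.prems c by (auto simp: j_def)
  define v' where "v' = sB r j \<circ> v"
  note v = Suc.prems(2)
  have v': "v' \<in> WB r" unfolding v'_def by (intro WB_comp sB_WB j v)
  define a b where "a = pinv v j" and "b = pinv v (j+1)"
  have om: "pinv v' (c - k) = pinv v (c - k)" if "k < m" for k
  proof -
    have "c - k \<le> r" "c - k \<noteq> j" "c - k \<noteq> j + 1" using that Suc.prems c by (auto simp: j_def)
    then show ?thesis unfolding v'_def inv_sB_comp[OF j(3) v] using sB_small[OF j(1,2)] by simp
  qed
  have omm: "pinv v' (c - m) = a"
    unfolding v'_def inv_sB_comp[OF j(3) v] j(4) a_def sB_apply[OF j(3)] by simp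
  have rotk: "f (rot r c k v') = f (rot r c k v)" if "k < m" for k
  proof -
    have "rot r c k v' = sB r j \<circ> rot r c k v"
      unfolding v'_def by (rule rot_sB_commute[OF c(1) j(1)]) (use that Suc.prems c in \<open>auto simp: j_def\<close>)
    moreover have "rot r c k v \<in> WB r" by (rule rot_WB[OF c(1) v]) (use that Suc.prems c in auto)
    moreover have "j + 2 \<le> c" using that Suc.prems c by (auto simp: j_def)
    ultimately show ?thesis using f j(6) by simp
  qed
  have rotm: "rot r c m v' = rot r c (Suc m) v" by (simp add: v'_def j_def)
  have grk: "gr c v' m k = gr c v m k" if "k < m" for k
    unfolding gr_def by (rule sum.cong) (use om that in auto)
  have grm: "gr c v' m m = (\<Sum>k'<m. if a < pinv v (c - k') then 1 else 0)"
    unfolding gr_def omm by (rule sum.cong) (use om in auto)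
  have grS: "gr c v (Suc m) (Suc m) = gr c v' m m + (if a < b then 1 else 0)"
  proof -
    have "pinv v (c - Suc m) = a" "pinv v (c - m) = b" by (simp_all only: j_def[symmetric] a_def j(4) b_def)
    note e = this
    have "gr c v m (Suc m) = (\<Sum>k'<m. if a < pinv v (c - k') then 1 else 0)"
      unfolding gr_def e(1) ..
    then show ?thesis by (simp only: gr_Suc e grm)
  qed
  let ?f = "\<lambda>k. f (rot r c k v)" and ?o = "\<lambda>k. pinv v (c - k)"
  let ?R = "\<lambda>k. qq ^ gr c v m k * ?f k"
  have IH': "Gop c m f v' = qq ^ gr c v' m m * ?f (Suc m) + (qq - 1) * (\<Sum>k<m. if ?o k < a then ?R k else 0)"
  proof -
    have "m \<le> g" using Suc.prems(1) by simp
    from Suc.IH[OF this v'] show ?thesis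
      unfolding rotm omm
      by (simp only:) (intro arg_cong2[of _ _ _ _ "(+)"] arg_cong2[of _ _ _ _ "(*)"] refl sum.cong,
          simp add: om rotk grk)
  qed
  have IH: "Gop c m f v = qq ^ gr c v m m * ?f m + (qq - 1) * (\<Sum>k<m. if ?o k < b then ?R k else 0)"
    using Suc.IH[of v] Suc.prems v unfolding j(4) b_def by simp
  have ab: "a \<noteq> b" unfolding a_def b_def using WB_inj[OF WB_inv[OF v], of j "j+1"] by simp
  have S: "(\<Sum>k<Suc m. if ?o k < ?o (Suc m) then qq ^ gr c v (Suc m) k * ?f k else 0) =
     (\<Sum>k<m. if ?o k < a then qq ^ (gr c v m k + (if ?o k < b then 1 else 0)) * ?f k else 0) +
     (if b < a then qq ^ gr c v m m * ?f m else 0)"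
  proof -
    have "?o (Suc m) = a" "?o m = b" by (simp_all only: j_def[symmetric] a_def j(4) b_def)
    then show ?thesis by (simp add: gr_Suc cong: if_cong)
  qed
  have G: "Gop c (Suc m) f v = (if a < b then qq * Gop c m f v' else Gop c m f v' + (qq - 1) * Gop c m f v)"
    unfolding Gop.simps Lop_def j_def[symmetric] a_def b_def v'_def ..
  show ?case
  proof (cases "a < b")
    case True
    have "(\<Sum>k<m. if ?o k < a then qq ^ (gr c v m k + (if ?o k < b then 1 else 0)) * ?f k else 0) =
        qq * (\<Sum>k<m. if ?o k < a then ?R k else 0)"
      unfolding sum_distrib_left by (rule sum.cong) (use True in auto)
    then show ?thesis unfolding S G IH' grS by (simp add: True less_not_sym[OF True] algebra_simps)
  next
    case False
    then have ba: "b < a" using ab by simp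
    have "(\<Sum>k<m. if ?o k < a then qq ^ (gr c v m k + (if ?o k < b then 1 else 0)) * ?f k else 0) =
        (\<Sum>k<m. if ?o k < a then ?R k else 0) + (qq - 1) * (\<Sum>k<m. if ?o k < b then ?R k else 0)"
      unfolding sum_distrib_left sum.distrib[symmetric]
      by (rule sum.cong) (use ba in \<open>auto simp: algebra_simps\<close>)
    then show ?thesis unfolding S G IH IH' grS by (simp only: ba not_less_iff_gr_or_eq if_True less_not_sym[OF ba] if_False add_0_right) (simp add: algebra_simps)
  qed
qed

text \<open>Passing from \<open>m\<close> to \<open>m+1\<close> raises the exponent of an earlier term by one exactly when
  \<open>Gop_formula\<close> contributes \<open>qq - 1\<close> times this term.\<close>

lemma Gop_sum:
  assumes c: "c \<le> r" "g < c"
    and f: "\<And>w j. w \<in> WB r \<Longrightarrow> c - g \<le> j \<Longrightarrow> j + 2 \<le> c \<Longrightarrow> f (sB r j \<circ> w) = f w"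
    and v: "v \<in> WB r"
  shows "m \<le> g \<Longrightarrow> (\<Sum>k\<le>m. Gop c k f v) = (\<Sum>k\<le>m. qq ^ gr c v (Suc m) k * f (rot r c k v))"
proof (induction m)
  case 0
  then show ?case by (simp add: gr_def)
next
  case (Suc m)
  let ?f = "\<lambda>k. f (rot r c k v)" and ?o = "\<lambda>k. pinv v (c - k)"
  have "(\<Sum>k\<le>m. qq ^ gr c v (Suc (Suc m)) k * ?f k) =
      (\<Sum>k\<le>m. qq ^ gr c v (Suc m) k * ?f k) +
      (qq - 1) * (\<Sum>k\<le>m. if ?o k < ?o (Suc m) then qq ^ gr c v (Suc m) k * ?f k else 0)"
    unfolding sum_distrib_left sum.distrib[symmetric] gr_Suc[of c v "Suc m"]
    by (rule sum.cong) (auto simp: algebra_simps)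
  moreover have "gr c v (Suc (Suc m)) (Suc m) = gr c v (Suc m) (Suc m)" by (simp add: gr_Suc)
  ultimately show ?case
    using Suc.IH Suc.prems Gop_formula[OF c f Suc.prems v]
    by (simp add: lessThan_Suc_atMost algebra_simps)
qed

lemma Ysum_ev:
  assumes c: "c \<le> r" "g < c"
    and f: "\<And>w j. w \<in> WB r \<Longrightarrow> c - g \<le> j \<Longrightarrow> j + 2 \<le> c \<Longrightarrow> f (sB r j \<circ> w) = f w"
  shows "Ysum c g \<cdot> ev f = ev (\<lambda>v. \<Sum>k\<le>g. qq ^ gr c v (Suc g) k * f (rot r c k v))"
proof -
  have "Ysum c g \<cdot> ev f = (\<Oplus>\<^bsub>HB r\<^esub> k\<in>{..g}. Yel c k \<cdot> ev f)"
    unfolding Ysum_def using c by (intro H.finsum_ldistr ev_closed Pi_I Yel_closed) auto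
  also have "\<dots> = (\<Oplus>\<^bsub>HB r\<^esub> k\<in>{..g}. ev (Gop c k f))"
    using c by (intro H.finsum_cong' Yel_ev) auto
  also have "\<dots> = ev (\<lambda>v. \<Sum>k\<le>g. Gop c k f v)"
    by (rule ev_sum[symmetric]) simp
  also have "\<dots> = ev (\<lambda>v. \<Sum>k\<le>g. qq ^ gr c v (Suc g) k * f (rot r c k v))"
    by (rule ev_cong) (rule Gop_sum[OF c f], simp_all)
  finally show ?thesis .
qed

end

subsection \<open>Moving one point between neighbouring blocks\<close>

lemma qint_eq_sum: "qint m = (\<Sum>i<m. qq ^ i)"
proof -
  have "(qq - 1) * (\<Sum>i<m. qq ^ i) = qq ^ m - 1"
    using power_diff_1_eq[of qq m] by simp
  moreover have "qq - 1 \<noteq> 0" by (simp add: qq_def one_pCons)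
  ultimately show ?thesis unfolding qint_def by (metis nonzero_mult_div_cancel_left)
qed

text \<open>Along \<open>K\<close> the numbers of larger elements are \<open>0, \<dots>, card K - 1\<close>, each once.\<close>

lemma sum_power_rank:
  fixes \<omega> :: "'a \<Rightarrow> nat" and q :: "'b :: comm_semiring_1"
  assumes "finite K" "inj_on \<omega> K"
  shows "(\<Sum>k\<in>K. q ^ card {k'\<in>K. \<omega> k < \<omega> k'}) = (\<Sum>i<card K. q ^ i)"
  using assms
proof (induction "card K" arbitrary: K)
  case 0
  then show ?case by simp
next
  case (Suc N)
  then have ne: "K \<noteq> {}" by auto
  define k0 where "k0 = arg_min_on \<omega> K"
  have k0: "k0 \<in> K" "\<And>k. k \<in> K \<Longrightarrow> \<omega> k0 \<le> \<omega> k"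
    unfolding k0_def using arg_min_if_finite[OF Suc.prems(1) ne, of \<omega>] arg_min_least[OF Suc.prems(1) ne]
    by auto
  define K' where "K' = K - {k0}"
  have fin: "finite K'" and K: "K = insert k0 K'" "k0 \<notin> K'" using Suc.prems k0 by (auto simp: K'_def)
  have N: "card K' = N" using Suc.hyps(2) Suc.prems(1) k0(1) by (simp add: K'_def)
  have less: "\<omega> k0 < \<omega> k" if "k \<in> K'" for k
    using k0 that Suc.prems(2) by (fastforce simp: K'_def inj_on_def le_less)
  have e0: "{k'\<in>K. \<omega> k0 < \<omega> k'} = K'" using less K by auto
  have ek: "{k'\<in>K. \<omega> k < \<omega> k'} = {k'\<in>K'. \<omega> k < \<omega> k'}" if "k \<in> K'" for k
    using less[OF that] K by auto
  have "(\<Sum>k\<in>K. q ^ card {k'\<in>K. \<omega> k < \<omega> k'}) =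
      q ^ card {k'\<in>K. \<omega> k0 < \<omega> k'} + (\<Sum>k\<in>K'. q ^ card {k'\<in>K. \<omega> k < \<omega> k'})"
    using fin K by (metis (no_types, lifting) sum.insert)
  also have "\<dots> = q ^ N + (\<Sum>k\<in>K'. q ^ card {k'\<in>K'. \<omega> k < \<omega> k'})"
    unfolding e0 N by (simp add: ek cong: sum.cong)
  also have "(\<Sum>k\<in>K'. q ^ card {k'\<in>K'. \<omega> k < \<omega> k'}) = (\<Sum>i<N. q ^ i)"
    using Suc.hyps(1)[OF N[symmetric] fin] Suc.prems(2) N K by (simp add: inj_on_def)
  finally show ?case using Suc.hyps(2) by (simp add: add.commute flip: Suc.hyps(2))
qed

lemma Eth_neighbour_zero: "Eth n h p (h+1) p = 0"
proof -
  have "h + 1 \<noteq> 2*n+2-h" by presburger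
  then show ?thesis by (simp add: Eth_def)
qed

text \<open>Both units that are taken away fall into the same cell only in the centre of the matrix, where the
  entry is even and hence at least two.\<close>

lemma shift_exact:
  fixes A :: nmat
  assumes h: "h \<in> {1..n}" and p: "p \<in> {1..2*n+1}"
    and sym: "\<And>i j. i \<in> {1..2*n+1} \<Longrightarrow> j \<in> {1..2*n+1} \<Longrightarrow> A i j = A (2*n+2-i) (2*n+2-j)"
    and ev: "even (A (n+1) (n+1))" and pos: "A (h+1) p > 0"
  shows "shift n h A p i j + Eth n (h+1) p i j = A i j + Eth n h p i j"
proof -
  have s: "A (2*n+2-(h+1)) (2*n+2-p) = A (h+1) p" using sym[of "h+1" p] h p by simp
  have "Eth n (h+1) p i j \<le> A i j"
  proof (cases "(i = h+1 \<and> j = p) \<and> (i = 2*n+2-(h+1) \<and> j = 2*n+2-p)")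
    case True
    then have "h = n" "p = n+1" using h p by auto
    then have "A (n+1) (n+1) \<ge> 2" using pos ev by (metis One_nat_def Suc_leI dvd_imp_le numeral_2_eq_2)
    then show ?thesis using True \<open>h = n\<close> \<open>p = n+1\<close> by (simp add: Eth_def)
  next
    case False
    then show ?thesis using s pos by (auto simp: Eth_def)
  qed
  then show ?thesis by (simp add: shift_def)
qed

lemma shift_iff:
  fixes M M' A :: nmat
  assumes h: "h \<in> {1..n}" and p: "p \<in> {1..2*n+1}"
    and sym: "\<And>i j. i \<in> {1..2*n+1} \<Longrightarrow> j \<in> {1..2*n+1} \<Longrightarrow> A i j = A (2*n+2-i) (2*n+2-j)"
    and ev: "even (A (n+1) (n+1))"
    and eq: "\<And>i j. M i j + Eth n (h+1) p i j = M' i j + Eth n h p i j"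
  shows "M' = A \<longleftrightarrow> A (h+1) p > 0 \<and> M = shift n h A p"
proof
  assume M': "M' = A"
  have "M i j = shift n h A p i j" for i j
    using eq[of i j] by (simp add: shift_def M')
  moreover have "A (h+1) p > 0"
  proof -
    have "Eth n (h+1) p (h+1) p \<ge> 1" by (simp add: Eth_def)
    then show ?thesis using eq[of "h+1" p] unfolding M' Eth_neighbour_zero by linarith
  qed
  ultimately show "A (h+1) p > 0 \<and> M = shift n h A p" by blast
next
  assume r: "A (h+1) p > 0 \<and> M = shift n h A p"
  then have "M' i j = A i j" for i j
    using eq[of i j] shift_exact[where A = A and i = i and j = j, OF h p sym ev] by simp
  then show "M' = A" by blast
qed

lemma card_remove_pair:
  assumes "finite X" "t \<in> X" "t' \<in> X" "t \<noteq> t'"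
  shows "card {x \<in> X. Q x} = card {x \<in> X - {t,t'}. Q x} + (of_bool (Q t) + of_bool (Q t'))"
proof -
  have e: "{x \<in> X. Q x} = {x \<in> X - {t,t'}. Q x} \<union> {x \<in> {t,t'}. Q x}" using assms by auto
  have "card {x \<in> {t,t'}. Q x} = of_bool (Q t) + of_bool (Q t')"
  proof -
    have "{x \<in> {t,t'}. Q x} = (if Q t then {t} else {}) \<union> (if Q t' then {t'} else {})" by auto
    then show ?thesis using assms(4) by simp
  qed
  moreover have "card ({x \<in> X - {t,t'}. Q x} \<union> {x \<in> {t,t'}. Q x}) =
      card {x \<in> X - {t,t'}. Q x} + card {x \<in> {t,t'}. Q x}"
    by (rule card_Un_disjoint) (use assms(1) in auto)
  ultimately show ?thesis using e by simp
qed

lemma card_sum_fibres: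
  assumes "finite S" "finite J"
  shows "card {k \<in> S. f k \<in> J} = (\<Sum>j\<in>J. card {k \<in> S. f k = j})"
proof -
  have "{k \<in> S. f k \<in> J} = (\<Union>j\<in>J. {k \<in> S. f k = j})" by auto
  then show ?thesis using assms by (simp only:) (rule card_UN_disjoint, auto)
qed

text \<open>The parity of the entries in the first half of the middle row block that come from the
  right half of the columns.  When the central entry of the matrix vanishes it separates the
  double cosets of the even subgroup inside a double coset of the full one.\<close>

definition lsign :: "nat \<Rightarrow> nat \<Rightarrow> (nat \<Rightarrow> nat) \<Rightarrow> (nat \<Rightarrow> nat) \<Rightarrow> (nat \<Rightarrow> nat) \<Rightarrow> bool" where
  "lsign n r b c w \<longleftrightarrow> odd (card {i \<in> {1..r}. b i = n+1 \<and> c (pinv w i) > n+1})"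

lemma lsign_sB:
  assumes w: "w \<in> WB r" and j: "1 \<le> j" "j < r" and b: "b j = b (j+1)"
  shows "lsign n r b c (sB r j \<circ> w) \<longleftrightarrow> lsign n r b c w"
proof -
  have jr: "j \<in> {1..r}" using j by simp
  have s: "sB r j i = (if i = j then j+1 else if i = j+1 then j else i)" if "i \<in> {1..r}" for i
    using sB_small[OF j] that by simp
  have sr: "sB r j i \<in> {1..r}" "b (sB r j i) = b i" if "i \<in> {1..r}" for i
    using s[OF that] that j b by auto
  have "bij_betw (sB r j) {i \<in> {1..r}. b i = n+1 \<and> c (pinv (sB r j \<circ> w) i) > n+1}
      {i \<in> {1..r}. b i = n+1 \<and> c (pinv w i) > n+1}"
  proof (rule bij_betw_byWitness[where f' = "sB r j"])
    show "sB r j ` {i \<in> {1..r}. b i = n+1 \<and> c (pinv (sB r j \<circ> w) i) > n+1} \<subseteq>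
        {i \<in> {1..r}. b i = n+1 \<and> c (pinv w i) > n+1}"
    proof (rule image_subsetI)
      fix i assume i: "i \<in> {i \<in> {1..r}. b i = n+1 \<and> c (pinv (sB r j \<circ> w) i) > n+1}"
      then have ir: "i \<in> {1..r}" by simp
      show "sB r j i \<in> {i \<in> {1..r}. b i = n+1 \<and> c (pinv w i) > n+1}"
        using i sr[OF ir] unfolding inv_sB_comp[OF jr w] by simp
    qed
    show "sB r j ` {i \<in> {1..r}. b i = n+1 \<and> c (pinv w i) > n+1} \<subseteq>
        {i \<in> {1..r}. b i = n+1 \<and> c (pinv (sB r j \<circ> w) i) > n+1}"
    proof (rule image_subsetI)
      fix i assume i: "i \<in> {i \<in> {1..r}. b i = n+1 \<and> c (pinv w i) > n+1}"
      then have ir: "i \<in> {1..r}" by simp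
      show "sB r j i \<in> {i \<in> {1..r}. b i = n+1 \<and> c (pinv (sB r j \<circ> w) i) > n+1}"
        using i sr[OF ir] unfolding inv_sB_comp[OF jr w] by (simp add: sB_sB[OF jr])
    qed
  qed (simp_all add: sB_sB[OF jr])
  then show ?thesis unfolding lsign_def by (simp only: bij_betw_same_card)
qed

lemma lsign_right:
  assumes w: "w \<in> WB r" and k: "k \<in> Yg r c"
  shows "lsign n r b c (w \<circ> k) \<longleftrightarrow> lsign n r b c w"
proof -
  note kW = Yg_WB[OF k]
  have "c (pinv (w \<circ> k) i) = c (pinv w i)" if "i \<in> {1..r}" for i
  proof -
    have "i \<in> {1..2*r}" using that by simp
    then show ?thesis
      unfolding WB_inv_comp[OF w kW] o_apply by (intro Yg_apply[OF Yg_inv[OF k]] WB_inv_range[OF w])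
  qed
  then have "{i \<in> {1..r}. b i = n+1 \<and> c (pinv (w \<circ> k) i) > n+1} = {i \<in> {1..r}. b i = n+1 \<and> c (pinv w i) > n+1}"
    by auto
  then show ?thesis unfolding lsign_def by simp
qed

text \<open>Two compositions of which the first arises from the second by moving one unit from part \<open>h + 1\<close> to
  part \<open>h\<close>.  The block \<open>h\<close> of \<open>lam\<close> consists of the \<open>g + 1\<close> points \<open>cc - g, \<dots>, cc\<close>, and only \<open>cc\<close> and
  its mirror image belong to different blocks for the two compositions.\<close>

locale block_move = heckeB r for r :: nat +
  fixes n h :: nat and lam mu :: "nat \<Rightarrow> nat"
  assumes h: "h \<in> {1..n}"
    and lam: "lam \<in> Lam (n+1) r" and mu: "mu \<in> Lam (n+1) r"
    and lam_h: "lam h = mu h + 1" and mu_h: "mu (h+1) = lam (h+1) + 1"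
    and rest: "\<And>i. i \<noteq> h \<Longrightarrow> i \<noteq> h+1 \<Longrightarrow> lam i = mu i"
begin

definition g :: nat where "g = mu h"
definition cc :: nat where "cc = psum n lam h"

abbreviation "b \<equiv> bl n lam"
abbreviation "b' \<equiv> bl n mu"
abbreviation "Y \<equiv> Ysum cc g"

lemma psum_lam_mu: "i \<le> n \<Longrightarrow> psum n lam i = psum n mu i + (if i = h then 1 else 0)"
proof (induction i)
  case 0
  then show ?case using h by simp
next
  case (Suc i)
  have "hat n lam (Suc i) = lam (Suc i)" "hat n mu (Suc i) = mu (Suc i)"
    using Suc.prems by (simp_all add: hat_def)
  then show ?case
    using Suc lam_h mu_h rest[of "Suc i"] by (auto simp: psum_Suc)
qed

lemma psum_low: "psum n lam (h-1) + g + 1 = cc" "psum n mu (h-1) = psum n lam (h-1)" "psum n mu h + 1 = cc"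
proof -
  have hh: "Suc (h-1) = h" "h - 1 \<le> n" "h - 1 \<noteq> h" "h \<le> n" using h by auto
  have "psum n lam h = psum n lam (h-1) + hat n lam h" using psum_Suc[of n lam "h-1"] hh(1) by simp
  moreover have "hat n lam h = g + 1" using h lam_h by (simp add: hat_def g_def)
  ultimately show "psum n lam (h-1) + g + 1 = cc" by (simp add: cc_def)
  show "psum n mu (h-1) = psum n lam (h-1)" using psum_lam_mu[OF hh(2)] hh(3) by simp
  show "psum n mu h + 1 = cc" using psum_lam_mu[OF hh(4)] by (simp add: cc_def)
qed

lemma cc: "g < cc" "cc \<le> r"
proof -
  show "g < cc" using psum_low by simp
  show "cc \<le> r" using psum_mono[of h n n lam] psum_n[OF lam] h by (simp add: cc_def)
qed

lemma b_h: "cc - g \<le> y \<Longrightarrow> y \<le> cc \<Longrightarrow> b y = h"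
  using h psum_low(1) by (intro bl_eqI) (auto simp: cc_def)

lemma b_h_conv:
  assumes "y \<in> {1..2*r}" "b y = h" shows "cc - g \<le> y" "y \<le> cc"
  using bl_props(1,2)[OF lam assms(1)] psum_low(1) unfolding assms(2) by (simp_all add: cc_def)

lemma b'_cc: "b' cc = h+1"
proof (rule bl_eqI)
  show "psum n mu (h + 1 - 1) < cc" using psum_low(3) by simp
  have "hat n mu (Suc h) \<ge> 1" using h mu_h by (cases "h = n") (auto simp: hat_def)
  then show "cc \<le> psum n mu (h + 1)" using psum_low(3) psum_Suc[of n mu h] by simp
qed simp

lemma b'_b:
  assumes y: "y \<in> {1..r}" "y \<noteq> cc" shows "b' y = b y"
proof (rule bl_eqI)
  have yr: "y \<in> {1..2*r}" using y by simp
  note p = bl_props[OF lam yr]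
  have le: "b y \<le> n+1" using bl_low[OF lam] y by simp
  show "1 \<le> b y" by (rule p(3))
  show "psum n mu (b y - 1) < y"
    using psum_lam_mu[of "b y - 1"] p(1) le by simp
  show "y \<le> psum n mu (b y)"
  proof (cases "b y = n+1")
    case True
    then show ?thesis using psum_mid[OF mu] y by simp
  next
    case False
    then have "b y \<le> n" using le by simp
    from psum_lam_mu[OF this] p(2) y(2) show ?thesis by (auto simp: cc_def split: if_splits)
  qed
qed

lemma rot_alt: "rot r cc k w = rot r cc k id \<circ> w"
  using rot_comp[of r cc k id w] by (simp only: id_o)

lemma rot_id_WB: "k \<le> g \<Longrightarrow> rot r cc k id \<in> WB r"
  using cc by (intro rot_WB) auto

lemma rot_low:
  assumes k: "k \<le> g" and y: "y \<in> {1..r}"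
  shows "rot r cc k id y \<in> {1..r}" "b' (rot r cc k id y) = (if y = cc - k then h+1 else b y)"
proof -
  have kc: "k < cc" using k cc by simp
  note e = rot_id_apply[OF cc(2) kc y]
  show "rot r cc k id y \<in> {1..r}" unfolding e using y cc kc by auto
  consider "y = cc - k" | "cc - k < y" "y \<le> cc" | "y \<noteq> cc" "\<not> (cc - k < y \<and> y \<le> cc)" "y \<noteq> cc - k" by linarith
  then show "b' (rot r cc k id y) = (if y = cc - k then h+1 else b y)"
  proof cases
    case 1
    then show ?thesis unfolding e using b'_cc by simp
  next
    case 2
    have "b' (y - 1) = b (y - 1)" using 2 y kc by (intro b'_b) auto
    also have "\<dots> = h" using 2 k by (intro b_h) auto
    also have "\<dots> = b y" using 2 k by (intro b_h[symmetric]) auto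
    finally show ?thesis unfolding e using 2 by simp
  next
    case 3
    then show ?thesis unfolding e using b'_b[OF y 3(1)] by auto
  qed
qed

lemma b_ck: "k \<le> g \<Longrightarrow> b (cc - k) = h"
  using cc by (intro b_h) auto

lemma rot_high:
  assumes k: "k \<le> g" and y: "y \<in> {1..2*r}" "y \<noteq> cc - k" "y \<noteq> 2*r+1-(cc-k)"
  shows "b' (rot r cc k id y) = b y"
proof (cases "y \<le> r")
  case True
  then show ?thesis using rot_low(2)[OF k, of y] y by simp
next
  case False
  define z where "z = 2*r+1-y"
  have z: "z \<in> {1..r}" "z \<in> {1..2*r}" "2*r+1-z = y" "z \<noteq> cc - k"
    using False y by (auto simp: z_def)
  have "rot r cc k id y = 2*r+1 - rot r cc k id z"
    using WB_mirror[OF rot_id_WB[OF k] z(2)] z(3) by simp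
  moreover have "rot r cc k id z \<in> {1..2*r}" using rot_low(1)[OF k z(1)] by auto
  ultimately have "b' (rot r cc k id y) = 2*n+2 - b' (rot r cc k id z)"
    using bl_mirror[OF mu] by simp
  also have "\<dots> = 2*n+2 - b z" using rot_low(2)[OF k z(1)] z(4) by simp
  also have "\<dots> = b y" using bl_mirror[OF lam z(2)] z(3) by simp
  finally show ?thesis .
qed

text \<open>Passing from \<open>w\<close> to \<open>rot r cc k w\<close> changes the row block of exactly two points: the one that \<open>w\<close>
  sends to \<open>cc - k\<close>, and its mirror image.\<close>

lemma cnt_move:
  assumes w: "w \<in> WB r" and k: "k \<le> g"
    and c: "\<And>x. x \<in> {1..2*r} \<Longrightarrow> c (2*r+1-x) = 2*n+2 - c x"
  shows "cnt r b c w i j + Eth n (h+1) (c (pinv w (cc-k))) i j =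
    cnt r b' c (rot r cc k w) i j + Eth n h (c (pinv w (cc-k))) i j"
proof -
  let ?X = "{1..2*r}"
  define t where "t = pinv w (cc - k)"
  define t' where "t' = 2*r+1-t"
  have ck: "cc - k \<in> {1..r}" "cc - k \<in> ?X" using k cc by auto
  have t: "t \<in> ?X" unfolding t_def by (rule WB_inv_range[OF w ck(2)])
  have wt: "w t = cc - k" by (simp add: t_def WB_inv_apply[OF w])
  have t': "t' \<in> ?X" "t' \<noteq> t" using mirror_range[OF t] by (simp_all add: t'_def)
  have wt': "w t' = 2*r+1-(cc-k)" unfolding t'_def WB_mirror[OF w t] wt ..
  have ct': "c t' = 2*n+2 - c t" unfolding t'_def by (rule c[OF t])
  have bt: "b (w t) = h" "b (w t') = 2*n+2-h"
    using b_ck[OF k] bl_mirror[OF lam ck(2)] by (simp_all add: wt wt')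
  have r0: "rot r cc k id (cc - k) \<in> ?X" using rot_low(1)[OF k ck(1)] by auto
  have bt1: "b' (rot r cc k w t) = h+1"
    unfolding rot_alt[of k w] o_apply wt using rot_low(2)[OF k ck(1)] by simp
  have "rot r cc k w t' = 2*r+1 - rot r cc k id (cc-k)"
    unfolding rot_alt[of k w] o_apply wt' by (rule WB_mirror[OF rot_id_WB[OF k] ck(2)])
  then have bt2: "b' (rot r cc k w t') = 2*n+2-(h+1)"
    using bl_mirror[OF mu r0] rot_low(2)[OF k ck(1)] by simp
  have "{x \<in> ?X - {t,t'}. c x = j \<and> b' (rot r cc k w x) = i} = {x \<in> ?X - {t,t'}. c x = j \<and> b (w x) = i}"
  proof (rule Collect_cong, rule conj_cong[OF refl], rule conj_cong[OF refl])
    fix x assume x: "x \<in> ?X - {t,t'}"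
    have "w x \<noteq> cc - k" using x WB_inj[OF w, of x t] wt by auto
    moreover have "w x \<noteq> 2*r+1-(cc-k)" using x WB_inj[OF w, of x t'] wt' by auto
    moreover have "w x \<in> ?X" using x WB_range[OF w] by blast
    ultimately have "b' (rot r cc k id (w x)) = b (w x)" by (intro rot_high[OF k])
    then show "(b' (rot r cc k w x) = i) = (b (w x) = i)" unfolding rot_alt[of k w] o_apply by simp
  qed
  moreover have "cnt r b c w i j = card {x \<in> ?X - {t,t'}. c x = j \<and> b (w x) = i} + Eth n h (c t) i j"
  proof -
    have "(c t = j \<and> b (w t) = i) = (i = h \<and> j = c t)"
      "(c t' = j \<and> b (w t') = i) = (i = 2*n+2-h \<and> j = 2*n+2-c t)"
      unfolding bt ct' by blast+
    then show ?thesis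
      unfolding cnt_def Eth_def card_remove_pair[OF finite_atLeastAtMost t t'(1) t'(2)[symmetric]]
      by (simp only:)
  qed
  moreover have "cnt r b' c (rot r cc k w) i j =
      card {x \<in> ?X - {t,t'}. c x = j \<and> b' (rot r cc k w x) = i} + Eth n (h+1) (c t) i j"
  proof -
    have "(c t = j \<and> b' (rot r cc k w t) = i) = (i = h+1 \<and> j = c t)"
      "(c t' = j \<and> b' (rot r cc k w t') = i) = (i = 2*n+2-(h+1) \<and> j = 2*n+2-c t)"
      unfolding bt1 bt2 ct' by blast+
    then show ?thesis
      unfolding cnt_def Eth_def card_remove_pair[OF finite_atLeastAtMost t t'(1) t'(2)[symmetric]]
      by (simp only:)
  qed
  ultimately show ?thesis unfolding t_def[symmetric] by simp
qed

text \<open>The point sent to \<open>cc - k\<close> is the only one in the first half whose row block changes, and it enters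
  the middle row block precisely for \<open>h = n\<close>.\<close>

lemma lsign_move:
  assumes w: "w \<in> WB r" and k: "k \<le> g"
  shows "lsign n r b' c (rot r cc k w) \<longleftrightarrow>
    (if h = n \<and> c (pinv w (cc-k)) > n+1 then \<not> lsign n r b c w else lsign n r b c w)"
proof -
  let ?p = "rot r cc k id"
  note pW = rot_id_WB[OF k]
  have ck: "cc - k \<in> {1..r}" using k cc by auto
  have h1: "h \<noteq> n+1" using h by simp
  define S where "S = {i \<in> {1..r}. b i = n+1 \<and> c (pinv w i) > n+1}"
  define S' where "S' = {y \<in> {1..r}. b' (?p y) = n+1 \<and> c (pinv w y) > n+1}"
  have inj: "inj_on ?p {1..r}" using WB_inj[OF pW] by (simp add: inj_on_def)
  have "?p ` {1..r} = {1..r}"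
    by (rule endo_inj_surj[OF _ _ inj]) (use rot_low(1)[OF k] in auto)
  then have bij: "bij_betw ?p {1..r} {1..r}" using inj by (simp add: bij_betw_def)
  have pv: "pinv (rot r cc k w) (?p y) = pinv w y" for y
    unfolding rot_alt[of k w] WB_inv_comp[OF pW w] o_apply WB_inv_apply(1)[OF pW] ..
  have "{i \<in> {1..r}. b' i = n+1 \<and> c (pinv (rot r cc k w) i) > n+1} = ?p ` S'"
  proof
    show "?p ` S' \<subseteq> {i \<in> {1..r}. b' i = n+1 \<and> c (pinv (rot r cc k w) i) > n+1}"
    proof (rule image_subsetI)
      fix y assume y: "y \<in> S'"
      then have yr: "y \<in> {1..r}" "b' (?p y) = n+1" "c (pinv w y) > n+1" unfolding S'_def by blast+
      show "?p y \<in> {i \<in> {1..r}. b' i = n+1 \<and> c (pinv (rot r cc k w) i) > n+1}"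
        unfolding mem_Collect_eq pv using rot_low(1)[OF k yr(1)] yr(2,3) by blast
    qed
    show "{i \<in> {1..r}. b' i = n+1 \<and> c (pinv (rot r cc k w) i) > n+1} \<subseteq> ?p ` S'"
    proof
      fix i assume i: "i \<in> {i \<in> {1..r}. b' i = n+1 \<and> c (pinv (rot r cc k w) i) > n+1}"
      then have "i \<in> ?p ` {1..r}" using \<open>?p ` {1..r} = {1..r}\<close> by simp
      then obtain y where y: "y \<in> {1..r}" "i = ?p y" by blast
      then have "y \<in> S'" using i unfolding S'_def mem_Collect_eq by (simp only: pv)
      then show "i \<in> ?p ` S'" using y(2) by blast
    qed
  qed
  moreover have "card (?p ` S') = card S'"
    by (rule card_image) (rule inj_on_subset[OF inj], auto simp: S'_def)
  ultimately have l': "lsign n r b' c (rot r cc k w) \<longleftrightarrow> odd (card S')" by (simp only: lsign_def)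
  have S'1: "S' = {y \<in> {1..r}. (if y = cc - k then h+1 else b y) = n+1 \<and> c (pinv w y) > n+1}"
    unfolding S'_def using rot_low(2)[OF k] by auto
  have cS: "cc - k \<notin> S" using b_ck[OF k] h1 by (simp add: S_def)
  show ?thesis
  proof (cases "h = n \<and> c (pinv w (cc-k)) > n+1")
    case True
    then have "S' = insert (cc - k) S" unfolding S'1 S_def using ck by auto
    moreover have "finite S" by (simp add: S_def)
    ultimately have "odd (card S') \<longleftrightarrow> \<not> odd (card S)" using cS by simp
    then show ?thesis unfolding l' if_P[OF True] unfolding lsign_def S_def[symmetric] .
  next
    case False
    then have "S' = S" unfolding S'1 S_def using b_ck[OF k] h1 by auto
    then show ?thesis unfolding l' if_not_P[OF False] unfolding lsign_def S_def[symmetric] by (simp only:)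
  qed
qed

lemma rot_oddB:
  assumes w: "w \<in> WB r" and k: "k \<le> g" shows "oddB r (rot r cc k w) \<longleftrightarrow> oddB r w"
  using k w
proof (induction k arbitrary: w)
  case (Suc k)
  have j: "cc - Suc k \<in> {1..r}" "cc - Suc k \<noteq> r" using Suc.prems cc by auto
  have "k \<le> g" using Suc.prems(1) by simp
  note ih = Suc.IH[OF this WB_comp[OF sB_WB[OF j(1)] Suc.prems(2)]]
  show ?case
    unfolding rot.simps ih oddB_sB_comp[OF Suc.prems(2) j(1)] if_not_P[OF j(2)] ..
qed simp

lemma gr_card: "gr c v (Suc m) k = card {k' \<in> {..m}. pinv v (c - k) < pinv v (c - k')}"
  unfolding gr_def lessThan_Suc_atMost by (subst sum.If_cases) (simp_all add: Int_def)

text \<open>The values \<open>cc - k\<close> fill the row block \<open>h\<close>, with \<open>A h p + 1\<close> of them in column block \<open>p\<close>.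
  Those in later column blocks stand to the right of each of these and contribute the common power
  of \<open>qq\<close>; the order among the \<open>A h p + 1\<close> themselves contributes the quantum integer.\<close>

lemma move_coefficient:
  fixes A :: nmat
  assumes v: "v \<in> WB r" and nu: "nu \<in> Lam (n+1) r" and p: "p \<in> {1..2*n+1}"
    and pos: "A (h+1) p > 0" and eq: "cnt r b (bl n nu) v = shift n h A p"
  shows "(\<Sum>k\<in>{k \<in> {..g}. bl n nu (pinv v (cc - k)) = p}. qq ^ gr cc v (Suc g) k) = gcf n h A p"
proof -
  let ?c = "bl n nu" and ?o = "\<lambda>k. pinv v (cc - k)"
  let ?p = "\<lambda>k. ?c (?o k)"
  define K where "K = {k \<in> {..g}. ?p k = p}"
  have oX: "?o k \<in> {1..2*r}" if "k \<le> g" for k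
    using that cc by (intro WB_inv_range[OF v]) auto
  have inj: "inj_on ?o {..g}"
  proof (rule inj_onI)
    fix k k' assume k: "k \<in> {..g}" "k' \<in> {..g}" "?o k = ?o k'"
    then have "cc - k = cc - k'" using WB_inj[OF WB_inv[OF v]] by blast
    then show "k = k'" using k cc by auto
  qed
  have count: "card {k \<in> {..g}. ?p k = j} = cnt r b ?c v h j" for j
  proof -
    have "bij_betw ?o {k \<in> {..g}. ?p k = j} {x \<in> {1..2*r}. ?c x = j \<and> b (v x) = h}"
    proof (rule bij_betw_byWitness[where f' = "\<lambda>x. cc - v x"])
      show "?o ` {k \<in> {..g}. ?p k = j} \<subseteq> {x \<in> {1..2*r}. ?c x = j \<and> b (v x) = h}"
        using oX b_ck by (auto simp: WB_inv_apply[OF v])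
      show "\<forall>k\<in>{k \<in> {..g}. ?p k = j}. cc - v (?o k) = k"
        using cc by (auto simp: WB_inv_apply[OF v])
      have vx: "cc - (cc - v x) = v x" "cc - v x \<le> g" if "x \<in> {1..2*r}" "b (v x) = h" for x
        using b_h_conv[OF WB_range[OF v that(1)] that(2)] by simp_all
      show "\<forall>x\<in>{x \<in> {1..2*r}. ?c x = j \<and> b (v x) = h}. ?o (cc - v x) = x"
        using vx by (auto simp: WB_inv_apply[OF v])
      show "(\<lambda>x. cc - v x) ` {x \<in> {1..2*r}. ?c x = j \<and> b (v x) = h} \<subseteq> {k \<in> {..g}. ?p k = j}"
        using vx by (auto simp: WB_inv_apply[OF v])
    qed
    then show ?thesis unfolding cnt_def by (rule bij_betw_same_card)
  qed
  have row: "shift n h A p h j = A h j + (if j = p then 1 else 0)" for j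
  proof -
    have "h \<noteq> 2*n+2-h" "h \<noteq> 2*n+2-(h+1)" "h \<noteq> h+1" using h by auto
    then show ?thesis by (simp add: shift_def Eth_def)
  qed
  have cardK: "card K = A h p + 1"
    unfolding K_def count eq row by simp
  have high: "card {k \<in> {..g}. ?p k \<in> {p<..2*n+1}} = (\<Sum>j\<in>{p<..2*n+1}. A h j)"
    unfolding card_sum_fibres[OF finite_atMost finite_greaterThanAtMost] count eq row
    by (rule sum.cong) auto
  have "gr cc v (Suc g) k = (\<Sum>j\<in>{p<..2*n+1}. A h j) + card {k' \<in> K. ?o k < ?o k'}" if k: "k \<in> K" for k
  proof -
    have "{k' \<in> {..g}. ?o k < ?o k'} = {k' \<in> {..g}. ?p k' \<in> {p<..2*n+1}} \<union> {k' \<in> K. ?o k < ?o k'}"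
    proof (intro equalityI subsetI)
      fix k' assume k': "k' \<in> {k' \<in> {..g}. ?o k < ?o k'}"
      then have "?p k \<le> ?p k'" using bl_le[OF nu _ oX, of "?o k" k'] by simp
      moreover have "?p k' \<le> 2*n+1" using bl_props(4)[OF nu oX, of k'] k' by simp
      ultimately show "k' \<in> {k' \<in> {..g}. ?p k' \<in> {p<..2*n+1}} \<union> {k' \<in> K. ?o k < ?o k'}"
        using k k' by (auto simp: K_def)
    next
      fix k' assume k': "k' \<in> {k' \<in> {..g}. ?p k' \<in> {p<..2*n+1}} \<union> {k' \<in> K. ?o k < ?o k'}"
      have "?o k < ?o k'" if "?p k' > p" "k' \<le> g"
      proof (rule ccontr)
        assume "\<not> ?o k < ?o k'"
        then have "?p k' \<le> ?p k" using bl_le[OF nu _ oX, of "?o k'" k] k by (simp add: K_def)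
        then show False using that k by (simp add: K_def)
      qed
      then show "k' \<in> {k' \<in> {..g}. ?o k < ?o k'}" using k' by (auto simp: K_def)
    qed
    then have "gr cc v (Suc g) k = card ({k' \<in> {..g}. ?p k' \<in> {p<..2*n+1}} \<union> {k' \<in> K. ?o k < ?o k'})"
      unfolding gr_card by simp
    also have "\<dots> = card {k' \<in> {..g}. ?p k' \<in> {p<..2*n+1}} + card {k' \<in> K. ?o k < ?o k'}"
      by (rule card_Un_disjoint) (auto simp: K_def)
    finally show ?thesis unfolding high .
  qed
  then have "(\<Sum>k\<in>K. qq ^ gr cc v (Suc g) k) =
      (\<Sum>k\<in>K. qq ^ (\<Sum>j\<in>{p<..2*n+1}. A h j) * qq ^ card {k' \<in> K. ?o k < ?o k'})"
    by (intro sum.cong refl) (simp add: power_add)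
  also have "\<dots> = qq ^ (\<Sum>j\<in>{p<..2*n+1}. A h j) * (\<Sum>i<card K. qq ^ i)"
    unfolding sum_distrib_left[symmetric]
    by (subst sum_power_rank) (auto simp: K_def intro: inj_on_subset[OF inj])
  also have "\<dots> = gcf n h A p"
    unfolding cardK qint_eq_sum[symmetric] gcf_def using pos by simp
  finally show ?thesis unfolding K_def .
qed

text \<open>For a fixed \<open>v\<close>, the terms that survive are those \<open>k\<close> for which \<open>rot r cc k v\<close> lies in the set on the
  left hand side; by \<open>shift_iff\<close> this prescribes the matrix of \<open>v\<close> in terms of the column block \<open>p\<close> of
  the moved point, and the terms with the same \<open>p\<close> add up to \<open>gcf n h A p\<close>.  The predicates \<open>P\<close> and
  \<open>P' p\<close> allow the double cosets to be cut into pieces.\<close>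

theorem Ysum_TS:
  fixes A :: nmat
  assumes nu: "nu \<in> Lam (n+1) r"
    and sym: "\<And>i j. i \<in> {1..2*n+1} \<Longrightarrow> j \<in> {1..2*n+1} \<Longrightarrow> A i j = A (2*n+2-i) (2*n+2-j)"
    and ev: "even (A (n+1) (n+1))"
    and inv: "\<And>w j. w \<in> WB r \<Longrightarrow> 1 \<le> j \<Longrightarrow> j < r \<Longrightarrow> b' j = b' (j+1) \<Longrightarrow> P (sB r j \<circ> w) = P w"
    and move: "\<And>w k. w \<in> WB r \<Longrightarrow> k \<le> g \<Longrightarrow> A (h+1) (bl n nu (pinv w (cc-k))) > 0 \<Longrightarrow>
      P (rot r cc k w) = P' (bl n nu (pinv w (cc-k))) w"
  shows "Y \<cdot> TS {w \<in> WB r. P w \<and> cnt r b' (bl n nu) w = A} =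
    (\<Oplus>\<^bsub>HB r\<^esub> p\<in>{1..2*n+1}. Hconst r (gcf n h A p) \<cdot> TS {w \<in> WB r. P' p w \<and> cnt r b (bl n nu) w = shift n h A p})"
proof -
  let ?c = "bl n nu" and ?N = "{1..2*n+1}"
  define D where "D = {w \<in> WB r. P w \<and> cnt r b' ?c w = A}"
  define E where "E p = {w \<in> WB r. P' p w \<and> cnt r b ?c w = shift n h A p}" for p
  have DW: "D \<subseteq> WB r" and EW: "E p \<subseteq> WB r" for p by (auto simp: D_def E_def)
  let ?f = "\<lambda>w. if w \<in> D then 1 else (0 :: int poly)"
  have f: "?f (sB r j \<circ> w) = ?f w" if w: "w \<in> WB r" and j: "cc - g \<le> j" "j + 2 \<le> cc" for w j
  proof -
    have jr: "j \<in> {1..r}" "j < r" "j + 1 \<in> {1..r}" "j \<noteq> cc" "j + 1 \<noteq> cc" using j cc by auto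
    have bj: "b' j = b' (j+1)"
      using b'_b[OF jr(1,4)] b'_b[OF jr(3,5)] b_h[of j] b_h[of "j+1"] j by simp
    have sY: "sB r j \<in> Yg r b'" using sB_Yg_iff[OF mu jr(1)] bj by simp
    have "cnt r b' ?c (sB r j \<circ> w) = cnt r b' ?c w"
      using cnt_Yg[OF w sY Yg_id, of ?c] by (simp only: o_id)
    moreover have "P (sB r j \<circ> w) = P w" using inv[OF w _ jr(2) bj] jr(1) by simp
    moreover have "sB r j \<circ> w \<in> WB r" by (intro WB_comp sB_WB jr w)
    ultimately show ?thesis using w by (simp add: D_def)
  qed
  have "Y \<cdot> TS D = Y \<cdot> ev ?f" unfolding ev_indicator[OF DW] ..
  also have "\<dots> = ev (\<lambda>v. \<Sum>k\<le>g. qq ^ gr cc v (Suc g) k * ?f (rot r cc k v))"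
    by (rule Ysum_ev[OF cc(2,1) f])
  also have "\<dots> = ev (\<lambda>v. \<Sum>p\<in>?N. gcf n h A p * (if v \<in> E p then 1 else 0))"
  proof (rule ev_cong)
    fix v assume v: "v \<in> WB r"
    let ?p = "\<lambda>k. ?c (pinv v (cc - k))"
    have pN: "?p k \<in> ?N" if "k \<le> g" for k
      using that cc by (intro bl_range[OF nu] WB_inv_range[OF v]) auto
    have ind: "?f (rot r cc k v) = (if A (h+1) (?p k) > 0 \<and> v \<in> E (?p k) then 1 else 0)" if k: "k \<le> g" for k
    proof -
      have "rot r cc k v \<in> WB r" using rot_WB[OF cc(2) v, of k] k cc by simp
      moreover have "cnt r b' ?c (rot r cc k v) = A \<longleftrightarrow> A (h+1) (?p k) > 0 \<and> cnt r b ?c v = shift n h A (?p k)"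
        by (rule shift_iff[where A = A, OF h pN[OF k] sym ev]) (assumption | rule cnt_move[where c = "bl n nu", OF v k bl_mirror[OF nu]])+
      ultimately show ?thesis using move[OF v k] v by (auto simp: D_def E_def)
    qed
    have "(\<Sum>k\<le>g. qq ^ gr cc v (Suc g) k * ?f (rot r cc k v)) =
        (\<Sum>k\<le>g. \<Sum>p\<in>?N. if p = ?p k then
          qq ^ gr cc v (Suc g) k * (if A (h+1) p > 0 \<and> v \<in> E p then 1 else 0) else 0)"
    proof (rule sum.cong[OF refl])
      fix k assume "k \<in> {..g}"
      then have k: "k \<le> g" by simp
      show "qq ^ gr cc v (Suc g) k * ?f (rot r cc k v) = (\<Sum>p\<in>?N. if p = ?p k then
          qq ^ gr cc v (Suc g) k * (if A (h+1) p > 0 \<and> v \<in> E p then 1 else 0) else 0)"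
        unfolding sum.delta[OF finite_atLeastAtMost] if_P[OF pN[OF k]] ind[OF k] ..
    qed
    also have "\<dots> = (\<Sum>p\<in>?N. \<Sum>k\<le>g. if p = ?p k then
          qq ^ gr cc v (Suc g) k * (if A (h+1) p > 0 \<and> v \<in> E p then 1 else 0) else 0)"
      by (rule sum.swap)
    also have "\<dots> = (\<Sum>p\<in>?N. gcf n h A p * (if v \<in> E p then 1 else 0))"
    proof (rule sum.cong[OF refl])
      fix p assume p: "p \<in> ?N"
      show "(\<Sum>k\<le>g. if p = ?p k then
          qq ^ gr cc v (Suc g) k * (if A (h+1) p > 0 \<and> v \<in> E p then 1 else 0) else 0) =
          gcf n h A p * (if v \<in> E p then 1 else 0)"
      proof (cases "A (h+1) p > 0 \<and> v \<in> E p")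
        case True
        then have "(\<Sum>k\<in>{k \<in> {..g}. ?p k = p}. qq ^ gr cc v (Suc g) k) = gcf n h A p"
          by (intro move_coefficient[OF v nu p]) (auto simp: E_def)
        moreover have "(\<Sum>k\<le>g. if p = ?p k then qq ^ gr cc v (Suc g) k else 0) =
            (\<Sum>k\<in>{k \<in> {..g}. ?p k = p}. qq ^ gr cc v (Suc g) k)"
          by (subst sum.If_cases) (auto intro!: sum.cong)
        ultimately show ?thesis
          unfolding if_P[OF True] if_P[OF conjunct2[OF True]] mult_1_right by (simp only:)
      next
        case False
        then show ?thesis by (auto simp: gcf_def intro!: sum.neutral)
      qed
    qed
    finally show "(\<Sum>k\<le>g. qq ^ gr cc v (Suc g) k * ?f (rot r cc k v)) =
        (\<Sum>p\<in>?N. gcf n h A p * (if v \<in> E p then 1 else 0))" .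
  qed
  also have "\<dots> = (\<Oplus>\<^bsub>HB r\<^esub> p\<in>?N. ev (\<lambda>v. gcf n h A p * (if v \<in> E p then 1 else 0)))"
    by (rule ev_sum) simp
  also have "\<dots> = (\<Oplus>\<^bsub>HB r\<^esub> p\<in>?N. Hconst r (gcf n h A p) \<cdot> TS (E p))"
    using EW by (intro H.finsum_cong') (auto simp: ev_smult ev_indicator)
  finally show ?thesis unfolding D_def E_def .
qed

end

section \<open>Double cosets of type D and the basis maps\<close>

text \<open>Descents of an element of the Young subgroup lie inside the blocks.\<close>

lemma Yg_induct [consumes 2, case_names id step]:
  assumes l: "l \<in> Lam (n+1) r" and k: "k \<in> Yg r (bl n l)" and id: "Q id"
    and step: "\<And>j k. j \<in> {1..r} \<Longrightarrow> bl n l j = bl n l (j+1) \<Longrightarrow> k \<in> Yg r (bl n l) \<Longrightarrow> Q k \<Longrightarrow> Q (sB r j \<circ> k)"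
  shows "Q k"
  using k
proof (induction "ellB r k" arbitrary: k rule: less_induct)
  case less
  note k = Yg_WB[OF less.prems] and iY = Yg_inv[OF less.prems]
  show ?case
  proof (cases "\<exists>j\<in>{1..r}. pinv k (j+1) < pinv k j")
    case True
    then obtain j where j: "j \<in> {1..r}" "pinv k (j+1) < pinv k j" by blast
    note b = Yg_descent_adjacent[OF l iY j]
    have s: "sB r j \<in> Yg r (bl n l)" using sB_Yg_iff[OF l j(1)] b by simp
    have u: "sB r j \<circ> k \<in> Yg r (bl n l)" by (rule Yg_comp[OF s less.prems])
    have "ellB r (sB r j \<circ> k) < ellB r k" using ellB_down[OF k j] by simp
    from step[OF j(1) b u less.hyps[OF this u]] show ?thesis by (simp only: sB_comp_sB[OF j(1)])
  next
    case False
    then have "pinv k = id"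
      using WB_asc_cases[OF WB_inv[OF k]] by (intro no_descent_id[OF WB_inv[OF k]]) metis
    then have "k = id" using WB_inv_inv[OF k] by simp
    then show ?thesis using id by (simp only:)
  qed
qed

text \<open>With a vanishing central entry every reflection \<open>sB r r\<close> in the row group flips \<open>lsign\<close>.\<close>

lemma lsign_Yg:
  assumes l: "l \<in> Lam (n+1) r" and m: "m \<in> Lam (n+1) r" and r: "1 \<le> r"
    and k: "k \<in> Yg r (bl n l)" and w: "w \<in> WB r" and z: "cnt r (bl n l) (bl n m) w (n+1) (n+1) = 0"
  shows "lsign n r (bl n l) (bl n m) (k \<circ> w) \<longleftrightarrow> lsign n r (bl n l) (bl n m) w \<noteq> oddB r k"
  using l k
proof (induction rule: Yg_induct)
  case id
  then show ?case by (simp only: id_o oddB_id simp_thms)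
next
  case (step j k)
  let ?ls = "lsign n r (bl n l) (bl n m)"
  note kW = Yg_WB[OF step(3)]
  have v: "k \<circ> w \<in> WB r" by (rule WB_comp[OF kW w])
  have o: "oddB r (sB r j \<circ> k) \<longleftrightarrow> (if j = r then \<not> oddB r k else oddB r k)"
    by (rule oddB_sB_comp[OF kW step(1)])
  have "?ls (sB r j \<circ> (k \<circ> w)) \<longleftrightarrow> (if j = r then \<not> ?ls (k \<circ> w) else ?ls (k \<circ> w))"
  proof (cases "j = r")
    case False
    then show ?thesis using lsign_sB[OF v _ _ step(2)] step(1) by simp
  next
    case True
    let ?v = "k \<circ> w"
    have rr: "r \<in> {1..r}" "r \<in> {1..2*r}" "r + 1 \<in> {1..2*r}" "2*r+1-r = r+1" using r by auto
    have br: "bl n l r = n+1"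
    proof -
      have "bl n l r \<le> n+1" "n+1 \<le> bl n l (r+1)"
        using bl_low[OF l] bl_high[OF l, of "r+1"] r by auto
      then show ?thesis using step(2) True by simp
    qed
    have "cnt r (bl n l) (bl n m) (k \<circ> w) = cnt r (bl n l) (bl n m) w"
      using cnt_Yg[OF w step(3) Yg_id] by (simp only: o_id)
    then have "cnt r (bl n l) (bl n m) ?v (n+1) (n+1) = 0" using z by (simp only:)
    then have c0: "card {x \<in> {1..2*r}. bl n m x = n+1 \<and> bl n l (?v x) = n+1} = 0" unfolding cnt_def .
    have "finite {x \<in> {1..2*r}. bl n m x = n+1 \<and> bl n l (?v x) = n+1}" by simp
    from c0[unfolded card_0_eq[OF this]]
    have "{x \<in> {1..2*r}. bl n m x = n+1 \<and> bl n l (?v x) = n+1} = {}" .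
    moreover have x: "pinv ?v r \<in> {1..2*r}" by (rule WB_inv_range[OF v rr(2)])
    ultimately have ne: "bl n m (pinv ?v r) \<noteq> n+1"
      using br WB_inv_apply(2)[OF v, of r] unfolding Collect_empty_eq by metis
    have "pinv ?v (r+1) = 2*r+1 - pinv ?v r" using WB_mirror[OF WB_inv[OF v] rr(2)] rr(4) by simp
    then have "bl n m (pinv ?v (r+1)) = 2*n+2 - bl n m (pinv ?v r)" using bl_mirror[OF m x] by simp
    then have flip: "bl n m (pinv ?v (r+1)) > n+1 \<longleftrightarrow> \<not> bl n m (pinv ?v r) > n+1" using ne by auto
    define S where "S = {i \<in> {1..r}. bl n l i = n+1 \<and> bl n m (pinv ?v i) > n+1}"
    define S' where "S' = {i \<in> {1..r}. bl n l i = n+1 \<and> bl n m (pinv (sB r r \<circ> ?v) i) > n+1}"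
    have e: "i \<in> S' \<longleftrightarrow> (if i = r then r \<notin> S else i \<in> S)" for i
    proof (cases "i = r")
      case True
      have "r \<in> S' \<longleftrightarrow> bl n m (pinv ?v (r+1)) > n+1"
        unfolding S'_def inv_sB_comp[OF rr(1) v] mem_Collect_eq sB_swap_values[OF rr(1)] using rr(1) br by blast
      moreover have "r \<in> S \<longleftrightarrow> bl n m (pinv ?v r) > n+1"
        unfolding S_def mem_Collect_eq using rr(1) br by blast
      ultimately show ?thesis unfolding True using flip by simp
    next
      case False
      have "sB r r i = i" if "i \<in> {1..r}" using that False by (simp add: sB_last[OF r])
      then have "i \<in> S' \<longleftrightarrow> i \<in> S"
        unfolding S_def S'_def inv_sB_comp[OF rr(1) v] mem_Collect_eq by metis
      then show ?thesis using False by simp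
    qed
    have fin: "finite S" "finite S'" by (simp_all add: S_def S'_def)
    have "odd (card S') \<longleftrightarrow> \<not> odd (card S)"
    proof (cases "r \<in> S")
      case True
      have "i \<in> S \<longleftrightarrow> i \<in> insert r S'" for i using e[of i] True by (cases "i = r") simp_all
      then have "S = insert r S'" by blast
      moreover have "r \<notin> S'" using e[of r] True by simp
      ultimately show ?thesis using fin by simp
    next
      case False
      have "i \<in> S' \<longleftrightarrow> i \<in> insert r S" for i using e[of i] False by (cases "i = r") simp_all
      then have "S' = insert r S" by blast
      then show ?thesis using fin False by simp
    qed
    then show ?thesis unfolding lsign_def S_def S'_def if_P[OF True] unfolding True .
  qed
  then show ?case unfolding o_assoc[symmetric] o using step.IH by (auto simp del: o_apply)
qed

subsection \<open>The triple of a matrix\<close>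

lemma ro_cnt:
  assumes l: "l \<in> Lam (n+1) r" and m: "m \<in> Lam (n+1) r" and w: "w \<in> WB r" and i: "i \<in> {1..2*n+1}"
  shows "ro n (cnt r (bl n l) (bl n m) w) i = hat n l i"
proof -
  have "{k \<in> {x \<in> {1..2*r}. bl n l (w x) = i}. bl n m k = j} = {x \<in> {1..2*r}. bl n m x = j \<and> bl n l (w x) = i}" for j
    by blast
  moreover have "finite {x \<in> {1..2*r}. bl n l (w x) = i}" by simp
  ultimately have e1: "ro n (cnt r (bl n l) (bl n m) w) i = card {x \<in> {x \<in> {1..2*r}. bl n l (w x) = i}. bl n m x \<in> {1..2*n+1}}"
    unfolding ro_def cnt_def by (simp only: card_sum_fibres finite_atLeastAtMost)
  moreover have "{x \<in> {x \<in> {1..2*r}. bl n l (w x) = i}. bl n m x \<in> {1..2*n+1}} = {x \<in> {1..2*r}. bl n l (w x) = i}"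
    using bl_range[OF m] by blast
  moreover have "card {x \<in> {1..2*r}. bl n l (w x) = i} = card {y \<in> {1..2*r}. bl n l y = i}"
  proof (rule bij_betw_same_card[of w], rule bij_betw_byWitness[where f' = "pinv w"])
    show "w ` {x \<in> {1..2*r}. bl n l (w x) = i} \<subseteq> {y \<in> {1..2*r}. bl n l y = i}"
      using WB_range[OF w] by blast
    show "pinv w ` {y \<in> {1..2*r}. bl n l y = i} \<subseteq> {x \<in> {1..2*r}. bl n l (w x) = i}"
      using WB_inv_range[OF w] WB_inv_apply(2)[OF w] by auto
  qed (simp_all add: WB_inv_apply[OF w])
  ultimately show ?thesis using card_bl[OF l i] by (simp only:)
qed

lemma co_cnt:
  assumes l: "l \<in> Lam (n+1) r" and m: "m \<in> Lam (n+1) r" and w: "w \<in> WB r" and j: "j \<in> {1..2*n+1}"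
  shows "co n (cnt r (bl n l) (bl n m) w) j = hat n m j"
proof -
  have "{k \<in> {x \<in> {1..2*r}. bl n m x = j}. bl n l (w k) = i} = {x \<in> {1..2*r}. bl n m x = j \<and> bl n l (w x) = i}" for i
    by blast
  moreover have "finite {x \<in> {1..2*r}. bl n m x = j}" by simp
  ultimately have "co n (cnt r (bl n l) (bl n m) w) j = card {x \<in> {x \<in> {1..2*r}. bl n m x = j}. bl n l (w x) \<in> {1..2*n+1}}"
    unfolding co_def cnt_def by (simp only: card_sum_fibres finite_atLeastAtMost)
  moreover have "{x \<in> {x \<in> {1..2*r}. bl n m x = j}. bl n l (w x) \<in> {1..2*n+1}} = {x \<in> {1..2*r}. bl n m x = j}"
    using bl_range[OF l WB_range[OF w]] by blast
  ultimately show ?thesis using card_bl[OF m j] by (simp only:)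
qed

lemma cnt_outside:
  assumes l: "l \<in> Lam (n+1) r" and m: "m \<in> Lam (n+1) r" and w: "w \<in> WB r"
    and ij: "\<not> (i \<in> {1..2*n+1} \<and> j \<in> {1..2*n+1})"
  shows "cnt r (bl n l) (bl n m) w i j = 0"
proof -
  have "{x \<in> {1..2*r}. bl n m x = j \<and> bl n l (w x) = i} = {}"
    using bl_range[OF m] bl_range[OF l WB_range[OF w]] ij by blast
  then show ?thesis unfolding cnt_def by (simp only: card.empty)
qed

lemma triple_mat_cnt:
  assumes l: "l \<in> Lam (n+1) r" and m: "m \<in> Lam (n+1) r" and w: "w \<in> WB r"
  shows "triple_mat n (l, w, m) = cnt r (bl n l) (bl n m) w"
proof (intro ext)
  fix i j
  show "triple_mat n (l, w, m) i j = cnt r (bl n l) (bl n m) w i j"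
  proof (cases "i \<in> {1..2*n+1} \<and> j \<in> {1..2*n+1}")
    case True
    then have i: "i \<in> {1..2*n+1}" and j: "j \<in> {1..2*n+1}" by blast+
    have "bij_betw w {x \<in> {1..2*r}. bl n m x = j \<and> bl n l (w x) = i} (block (hat n l) i \<inter> w ` block (hat n m) j)"
    proof (rule bij_betw_imageI)
      show "inj_on w {x \<in> {1..2*r}. bl n m x = j \<and> bl n l (w x) = i}"
        using WB_inj[OF w] by (simp add: inj_on_def)
      show "w ` {x \<in> {1..2*r}. bl n m x = j \<and> bl n l (w x) = i} = block (hat n l) i \<inter> w ` block (hat n m) j"
        using block_iff[OF l i] block_iff[OF m j] WB_range[OF w] by blast
    qed
    from bij_betw_same_card[OF this] show ?thesis
      unfolding triple_mat_def cnt_def prod.case if_P[OF True] by simp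
  next
    case False
    then show ?thesis unfolding cnt_outside[OF l m w False] triple_mat_def prod.case if_not_P[OF False] by simp
  qed
qed

lemma hat_inject:
  assumes "l \<in> Lam (n+1) r" "l' \<in> Lam (n+1) r" "\<And>i. i \<in> {1..2*n+1} \<Longrightarrow> hat n l i = hat n l' i"
  shows "l = l'"
proof
  fix i
  consider "i \<in> {1..n}" | "i = n+1" | "i \<notin> {1..n+1}" by fastforce
  then show "l i = l' i"
  proof cases
    case 1
    then show ?thesis using assms(3)[of i] by (simp add: hat_def)
  next
    case 2
    then show ?thesis using assms(3)[of i] by (simp add: hat_def)
  next
    case 3
    then show ?thesis using assms(1,2) by (simp add: Lam_def)
  qed
qed

lemma Xi_symD: "A \<in> Xi n r \<Longrightarrow> i \<in> {1..2*n+1} \<Longrightarrow> j \<in> {1..2*n+1} \<Longrightarrow> A i j = A (2*n+2-i) (2*n+2-j)"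
  unfolding Xi_def by blast

lemma Xi_even:
  assumes A: "A \<in> Xi n r" and ro: "even (ro n A (n+1))"
  shows "even (A (n+1) (n+1))"
proof -
  have N: "{1..2*n+1} = {1..n} \<union> {n+2..2*n+1} \<union> {n+1}" by auto
  have "(\<Sum>j\<in>{n+2..2*n+1}. A (n+1) j) = (\<Sum>j\<in>{1..n}. A (n+1) j)"
  proof (rule sum.reindex_bij_witness[of _ "\<lambda>j. 2*n+2-j" "\<lambda>j. 2*n+2-j"])
    fix j assume j: "j \<in> {n+2..2*n+1}"
    have "2*n+2-(n+1) = n+1" by simp
    then show "A (n+1) (2*n+2-j) = A (n+1) j" using Xi_symD[OF A, of "n+1" j] j by simp
  qed auto
  moreover have "ro n A (n+1) = (\<Sum>j\<in>{1..n}. A (n+1) j) + (\<Sum>j\<in>{n+2..2*n+1}. A (n+1) j) + A (n+1) (n+1)"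
    unfolding ro_def N by (subst sum.union_disjoint, auto)+
  ultimately have "ro n A (n+1) = 2 * (\<Sum>j\<in>{1..n}. A (n+1) j) + A (n+1) (n+1)" by simp
  then show ?thesis using ro by simp
qed

lemma cnt_realize:
  assumes A: "A \<in> Xi n r" and l: "l \<in> Lam (n+1) r" and m: "m \<in> Lam (n+1) r"
    and ro: "ro n A = hat n l" and co: "co n A = hat n m"
  shows "\<exists>w\<in>WB r. cnt r (bl n l) (bl n m) w = A"
proof (rule cnt_exists)
  fix x assume x: "x \<in> {1..2*r}"
  show "bl n l (2*r+1-x) = 2*n+2 - bl n l x \<and> bl n l x \<in> {1..2*n+1}"
    using bl_mirror[OF l x] bl_range[OF l x] by blast
  show "bl n m (2*r+1-x) = 2*n+2 - bl n m x \<and> bl n m x \<in> {1..2*n+1}"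
    using bl_mirror[OF m x] bl_range[OF m x] by blast
next
  show "even (A (n+1) (n+1))" using Xi_even[OF A] ro by (simp add: hat_def)
  show "A i j = A (2*n+2-i) (2*n+2-j)" if "i \<in> {1..2*n+1}" "j \<in> {1..2*n+1}" for i j
    by (rule Xi_symD[OF A that])
  show "A i j = 0" if "\<not> (i \<in> {1..2*n+1} \<and> j \<in> {1..2*n+1})" for i j
    using A that unfolding Xi_def by blast
  show "ro n A i = card {x \<in> {1..2*r}. bl n l x = i}" if "i \<in> {1..2*n+1}" for i
    unfolding ro card_bl[OF l that] ..
  show "co n A j = card {x \<in> {1..2*r}. bl n m x = j}" if "j \<in> {1..2*n+1}" for j
    unfolding co card_bl[OF m that] ..
qed

lemma dcosetI: "u \<in> P \<Longrightarrow> v \<in> Q \<Longrightarrow> u \<circ> d \<circ> v \<in> dcoset P d Q"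
  unfolding dcoset_def by blast

text \<open>The triple chosen for \<open>A\<close> is some preimage of \<open>A\<close>: row and column sums recover \<open>l\<close> and \<open>m\<close>, and minimality
  of the length excludes descents inside the blocks.\<close>

lemma mat_triple_props:
  assumes A: "A \<in> Xi n r" and l: "l \<in> Lam (n+1) r" and m: "m \<in> Lam (n+1) r"
    and ro: "ro n A = hat n l" and co: "co n A = hat n m"
  shows "\<exists>d. mat_triple n r A = (l, d, m) \<and> d \<in> WB r \<and> cnt r (bl n l) (bl n m) d = A \<and>
    (\<forall>j\<in>{1..r}. bl n l j = bl n l (j+1) \<longrightarrow> pinv d j < pinv d (j+1)) \<and>
    (\<forall>j\<in>{1..r}. bl n m j = bl n m (j+1) \<longrightarrow> d j < d (j+1))"
proof -
  let ?D = "\<lambda>l w m. dcoset (WBpar n r l) w (WBpar n r m)"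
  obtain w where w: "w \<in> WB r" "cnt r (bl n l) (bl n m) w = A" using cnt_realize[OF assms] by blast
  define d where "d = arg_min (lenB r) (\<lambda>v. v \<in> ?D l w m)"
  have "w \<in> ?D l w m"
    unfolding WBpar_eq_Yg[OF l] WBpar_eq_Yg[OF m] using dcosetI[OF Yg_id Yg_id, of w] by (simp only: id_o o_id)
  then have d: "d \<in> ?D l w m" unfolding d_def by (rule arg_min_natI[of "\<lambda>v. v \<in> ?D l w m"])
  have dmin: "lenB r d \<le> lenB r v" if "v \<in> ?D l w m" for v
    unfolding d_def using that by (rule arg_min_nat_le[of "\<lambda>v. v \<in> ?D l w m"])
  obtain k k' where k: "k \<in> Yg r (bl n l)" "k' \<in> Yg r (bl n m)" "d = k \<circ> w \<circ> k'"
    using d unfolding WBpar_eq_Yg[OF l] WBpar_eq_Yg[OF m] dcoset_def by blast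
  have dW: "d \<in> WB r" unfolding k(3) by (rule WB_comp[OF WB_comp[OF Yg_WB[OF k(1)] w(1)] Yg_WB[OF k(2)]])
  have dA: "triple_mat n (l, d, m) = A"
    unfolding triple_mat_cnt[OF l m dW] unfolding k(3) cnt_Yg[OF w(1) k(1,2)] by (rule w(2))
  have sub: "v \<in> ?D l w m" if v: "v \<in> ?D l d m" for v
  proof -
    obtain u u' where u: "u \<in> Yg r (bl n l)" "u' \<in> Yg r (bl n m)" "v = u \<circ> d \<circ> u'"
      using v unfolding WBpar_eq_Yg[OF l] WBpar_eq_Yg[OF m] dcoset_def by blast
    have "v = (u \<circ> k) \<circ> w \<circ> (k' \<circ> u')" unfolding u(3) k(3) by (simp only: o_assoc)
    then show ?thesis
      unfolding WBpar_eq_Yg[OF l] WBpar_eq_Yg[OF m]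
      using dcosetI[OF Yg_comp[OF u(1) k(1)] Yg_comp[OF k(2) u(2)]] by simp
  qed
  have "(l, d, m) \<in> triples n r"
    unfolding triples_def using l m dW dmin[OF sub] by blast
  then have im: "A \<in> triple_mat n ` triples n r" using dA by (metis image_eqI)
  obtain l' d' m' where t: "mat_triple n r A = (l', d', m')" by (cases "mat_triple n r A") auto
  have "mat_triple n r A \<in> triples n r" "triple_mat n (mat_triple n r A) = A"
    unfolding mat_triple_def using inv_into_into[OF im] f_inv_into_f[OF im] by blast+
  then have l': "l' \<in> Lam (n+1) r" and m': "m' \<in> Lam (n+1) r" and d': "d' \<in> WB r"
    and mn: "\<And>v. v \<in> ?D l' d' m' \<Longrightarrow> lenB r d' \<le> lenB r v" and e: "triple_mat n (l', d', m') = A"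
    unfolding t triples_def by auto
  note c = e[unfolded triple_mat_cnt[OF l' m' d']]
  have ll: "l' = l"
    using ro_cnt[OF l' m' d'] unfolding c ro by (intro hat_inject[OF l' l]) simp
  have mm: "m' = m"
    using co_cnt[OF l' m' d'] unfolding c co by (intro hat_inject[OF m' m]) simp
  have mn': "ellB r d' \<le> ellB r (u \<circ> d' \<circ> u')" if "u \<in> Yg r (bl n l)" "u' \<in> Yg r (bl n m)" for u u'
  proof -
    have "u \<circ> d' \<circ> u' \<in> ?D l' d' m'"
      unfolding ll mm WBpar_eq_Yg[OF l] WBpar_eq_Yg[OF m] by (rule dcosetI[OF that])
    moreover have "u \<circ> d' \<circ> u' \<in> WB r" using that Yg_WB d' WB_comp by metis
    ultimately show ?thesis using mn lenB_eq_ellB d' by metis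
  qed
  have "pinv d' j < pinv d' (j+1)" if j: "j \<in> {1..r}" "bl n l j = bl n l (j+1)" for j
  proof (rule WB_asc_cases[OF WB_inv[OF d'], of j])
    assume "pinv d' (j+1) < pinv d' j"
    from ellB_down[OF d' j(1) this] mn'[OF _ Yg_id, of "sB r j"] sB_Yg_iff[OF l j(1)] j(2)
    show ?thesis by (simp only: o_id) simp
  qed
  moreover have "d' j < d' (j+1)" if j: "j \<in> {1..r}" "bl n m j = bl n m (j+1)" for j
  proof (rule WB_asc_cases[OF d', of j])
    assume "d' (j+1) < d' j"
    from ellB_right_down[OF d' j(1) this] mn'[OF Yg_id, of "sB r j"] sB_Yg_iff[OF m j(1)] j(2)
    show ?thesis by (simp only: id_o) simp
  qed
  ultimately show ?thesis using t c d' unfolding ll mm by blast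
qed

text \<open>The middle block is symmetric under the mirror and \<open>pinv d\<close> is increasing on it, so its first half is
  filled from the first half of \<open>{1..2*r}\<close>.\<close>

lemma minimal_lsign:
  assumes l: "l \<in> Lam (n+1) r" and m: "m \<in> Lam (n+1) r" and d: "d \<in> WB r"
    and inc: "\<And>j. j \<in> {1..r} \<Longrightarrow> bl n l j = bl n l (j+1) \<Longrightarrow> pinv d j < pinv d (j+1)"
  shows "\<not> lsign n r (bl n l) (bl n m) d"
proof -
  have "\<not> bl n m (pinv d i) > n+1" if i: "i \<in> {1..r}" "bl n l i = n+1" for i
  proof -
    have i': "i \<in> {1..2*r}" "2*r+1-i \<in> {1..2*r}" "i < 2*r+1-i" using i by auto
    have "bl n l i = bl n l (2*r+1-i)" using bl_mirror[OF l i'(1)] i(2) by simp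
    from increasing_on_blocks[OF l WB_inv[OF d] inc i' this]
    have "pinv d i < 2*r+1 - pinv d i" using WB_mirror[OF WB_inv[OF d] i'(1)] by simp
    then have "pinv d i \<le> r" by simp
    from bl_low[OF m this] show ?thesis by simp
  qed
  then have "{i \<in> {1..r}. bl n l i = n+1 \<and> bl n m (pinv d i) > n+1} = {}" by blast
  then show ?thesis unfolding lsign_def by (simp only: card.empty) simp
qed

text \<open>No point of a middle block changes sides, since \<open>d\<close> and \<open>pinv d\<close> are increasing there.  The other sign
  changes are, up to the mirror, the points counted in the corner block of the matrix.\<close>

lemma minimal_oddB:
  assumes l: "l \<in> Lam (n+1) r" and m: "m \<in> Lam (n+1) r" and d: "d \<in> WB r"
    and incl: "\<And>j. j \<in> {1..r} \<Longrightarrow> bl n l j = bl n l (j+1) \<Longrightarrow> pinv d j < pinv d (j+1)"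
    and incr: "\<And>j. j \<in> {1..r} \<Longrightarrow> bl n m j = bl n m (j+1) \<Longrightarrow> d j < d (j+1)"
  shows "oddB r d \<longleftrightarrow> sgn_mat n (cnt r (bl n l) (bl n m) d) = Minus"
proof -
  let ?X = "{1..2*r}"
  have low: "d x \<le> r" if x: "x \<in> {1..r}" "bl n m x = n+1" for x
  proof -
    have x': "x \<in> ?X" "2*r+1-x \<in> ?X" "x < 2*r+1-x" using x by auto
    have "bl n m x = bl n m (2*r+1-x)" using bl_mirror[OF m x'(1)] x(2) by simp
    from increasing_on_blocks[OF m d incr x' this]
    have "d x < 2*r+1 - d x" using WB_mirror[OF d x'(1)] by simp
    then show ?thesis by simp
  qed
  have low': "pinv d y \<le> r" if y: "y \<in> {1..r}" "bl n l y = n+1" for y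
  proof -
    have y': "y \<in> ?X" "2*r+1-y \<in> ?X" "y < 2*r+1-y" using y by auto
    have "bl n l y = bl n l (2*r+1-y)" using bl_mirror[OF l y'(1)] y(2) by simp
    from increasing_on_blocks[OF l WB_inv[OF d] incl y' this]
    have "pinv d y < 2*r+1 - pinv d y" using WB_mirror[OF WB_inv[OF d] y'(1)] by simp
    then show ?thesis by simp
  qed
  have char: "x \<in> {1..r} \<and> d x > r \<longleftrightarrow> bl n m (2*r+1-x) \<in> {n+2..2*n+1} \<and> bl n l (d (2*r+1-x)) \<in> {1..n}"
    if x: "x \<in> ?X" for x
  proof -
    note dx = WB_range[OF d x] and bm = bl_range[OF m x]
    note bd = bl_range[OF l dx]
    have e: "bl n m (2*r+1-x) = 2*n+2 - bl n m x" "bl n l (d (2*r+1-x)) = 2*n+2 - bl n l (d x)"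
      using bl_mirror[OF m x] bl_mirror[OF l dx] WB_mirror[OF d x] by simp_all
    have "bl n m (2*r+1-x) \<in> {n+2..2*n+1} \<and> bl n l (d (2*r+1-x)) \<in> {1..n} \<longleftrightarrow>
        bl n m x \<le> n \<and> n + 2 \<le> bl n l (d x)"
      unfolding e using bm bd by auto
    also have "\<dots> \<longleftrightarrow> x \<in> {1..r} \<and> d x > r"
    proof
      assume a: "bl n m x \<le> n \<and> n + 2 \<le> bl n l (d x)"
      then have "\<not> r < x" using bl_high[OF m, of x] x by auto
      moreover have "\<not> d x \<le> r" using bl_low[OF l, of "d x"] a by auto
      ultimately show "x \<in> {1..r} \<and> d x > r" using x by auto
    next
      assume a: "x \<in> {1..r} \<and> d x > r"
      then have "bl n m x \<le> n+1" "n + 1 \<le> bl n l (d x)"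
        using bl_low[OF m, of x] bl_high[OF l, of "d x"] dx by auto
      moreover have "bl n m x \<noteq> n+1" using low[of x] a by auto
      moreover have "bl n l (d x) \<noteq> n+1"
      proof
        assume b: "bl n l (d x) = n+1"
        have y: "2*r+1 - d x \<in> {1..r}" using a dx by auto
        have "bl n l (2*r+1 - d x) = n+1" using bl_mirror[OF l dx] b by simp
        from low'[OF y this] have "2*r+1-x \<le> r"
          using WB_mirror[OF WB_inv[OF d] dx] WB_inv_apply(1)[OF d, of x] by simp
        then show False using a by auto
      qed
      ultimately show "bl n m x \<le> n \<and> n + 2 \<le> bl n l (d x)" by simp
    qed
    finally show ?thesis by blast
  qed
  have "bij_betw (\<lambda>x. 2*r+1-x) {x \<in> {1..r}. d x > r}
      {y \<in> ?X. bl n m y \<in> {n+2..2*n+1} \<and> bl n l (d y) \<in> {1..n}}"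
  proof (rule bij_betw_byWitness[where f' = "\<lambda>x. 2*r+1-x"])
    show "(\<lambda>x. 2*r+1-x) ` {x \<in> {1..r}. d x > r} \<subseteq> {y \<in> ?X. bl n m y \<in> {n+2..2*n+1} \<and> bl n l (d y) \<in> {1..n}}"
    proof (rule image_subsetI)
      fix x assume x: "x \<in> {x \<in> {1..r}. d x > r}"
      then have "x \<in> ?X" by simp
      then show "2*r+1-x \<in> {y \<in> ?X. bl n m y \<in> {n+2..2*n+1} \<and> bl n l (d y) \<in> {1..n}}"
        using char x mirror_range by blast
    qed
    show "(\<lambda>x. 2*r+1-x) ` {y \<in> ?X. bl n m y \<in> {n+2..2*n+1} \<and> bl n l (d y) \<in> {1..n}} \<subseteq> {x \<in> {1..r}. d x > r}"
    proof (rule image_subsetI)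
      fix y assume y: "y \<in> {y \<in> ?X. bl n m y \<in> {n+2..2*n+1} \<and> bl n l (d y) \<in> {1..n}}"
      then have mr: "2*r+1-y \<in> ?X" "2*r+1-(2*r+1-y) = y" using mirror_range by blast+
      show "2*r+1-y \<in> {x \<in> {1..r}. d x > r}" using char[OF mr(1)] y unfolding mr(2) by blast
    qed
    show "\<forall>x\<in>{x \<in> {1..r}. d x > r}. 2*r+1-(2*r+1-x) = x"
    proof
      fix x assume "x \<in> {x \<in> {1..r}. d x > r}"
      then have "x \<in> ?X" by simp
      then show "2*r+1-(2*r+1-x) = x" using mirror_range by blast
    qed
    show "\<forall>y\<in>{y \<in> ?X. bl n m y \<in> {n+2..2*n+1} \<and> bl n l (d y) \<in> {1..n}}. 2*r+1-(2*r+1-y) = y"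
      using mirror_range by blast
  qed
  then have c1: "card {x \<in> {1..r}. d x > r} = card {y \<in> ?X. bl n m y \<in> {n+2..2*n+1} \<and> bl n l (d y) \<in> {1..n}}"
    by (rule bij_betw_same_card)
  have c2: "{y \<in> ?X. bl n m y \<in> {n+2..2*n+1} \<and> bl n l (d y) \<in> {1..n}} =
      {y \<in> {y \<in> ?X. bl n m y \<in> {n+2..2*n+1}}. bl n l (d y) \<in> {1..n}}" by blast
  have c3: "card {y \<in> {y \<in> ?X. bl n m y \<in> {n+2..2*n+1}}. bl n l (d y) \<in> {1..n}} =
      (\<Sum>i\<in>{1..n}. card {y \<in> {y \<in> ?X. bl n m y \<in> {n+2..2*n+1}}. bl n l (d y) = i})"
    by (rule card_sum_fibres) simp_all
  have c4: "card {y \<in> {y \<in> ?X. bl n m y \<in> {n+2..2*n+1}}. bl n l (d y) = i} =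
      (\<Sum>j\<in>{n+2..2*n+1}. cnt r (bl n l) (bl n m) d i j)" for i
  proof -
    have s1: "{y \<in> {y \<in> ?X. bl n m y \<in> {n+2..2*n+1}}. bl n l (d y) = i} =
        {y \<in> {y \<in> ?X. bl n l (d y) = i}. bl n m y \<in> {n+2..2*n+1}}" by blast
    have s2: "card {y \<in> {y \<in> ?X. bl n l (d y) = i}. bl n m y \<in> {n+2..2*n+1}} =
        (\<Sum>j\<in>{n+2..2*n+1}. card {y \<in> {y \<in> ?X. bl n l (d y) = i}. bl n m y = j})"
      by (rule card_sum_fibres) simp_all
    have s3: "{y \<in> {y \<in> ?X. bl n l (d y) = i}. bl n m y = j} = {x \<in> ?X. bl n m x = j \<and> bl n l (d x) = i}" for j
      by blast
    show ?thesis unfolding s1 s2 s3 cnt_def ..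
  qed
  have "card {x \<in> {1..r}. d x > r} = (\<Sum>i\<in>{1..n}. \<Sum>j\<in>{n+2..2*n+1}. cnt r (bl n l) (bl n m) d i j)"
    unfolding c1 c2 c3 c4 ..
  then show ?thesis unfolding oddB_def sgn_mat_def by simp
qed

subsection \<open>Double cosets\<close>

lemma dcoset_subgroup_eq:
  assumes P: "\<And>u v. u \<in> P \<Longrightarrow> v \<in> P \<Longrightarrow> u \<circ> v \<in> P" "\<And>u. u \<in> P \<Longrightarrow> \<exists>u'\<in>P. u' \<circ> u = id"
    and Q: "\<And>u v. u \<in> Q \<Longrightarrow> v \<in> Q \<Longrightarrow> u \<circ> v \<in> Q" "\<And>u. u \<in> Q \<Longrightarrow> \<exists>u'\<in>Q. u \<circ> u' = id"
    and d': "d' \<in> dcoset P d Q"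
  shows "dcoset P d' Q = dcoset P d Q"
proof -
  obtain u v where u: "u \<in> P" "v \<in> Q" "d' = u \<circ> d \<circ> v" using d' unfolding dcoset_def by blast
  obtain u' where u': "u' \<in> P" "u' \<circ> u = id" using P(2)[OF u(1)] by blast
  obtain v' where v': "v' \<in> Q" "v \<circ> v' = id" using Q(2)[OF u(2)] by blast
  show ?thesis
  proof (intro equalityI subsetI)
    fix x assume "x \<in> dcoset P d' Q"
    then obtain a b where a: "a \<in> P" "b \<in> Q" "x = a \<circ> d' \<circ> b" unfolding dcoset_def by blast
    have "x = (a \<circ> u) \<circ> d \<circ> (v \<circ> b)" unfolding a(3) u(3) by (simp only: o_assoc)
    then show "x \<in> dcoset P d Q" using dcosetI[OF P(1)[OF a(1) u(1)] Q(1)[OF u(2) a(2)]] by simp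
  next
    fix x assume "x \<in> dcoset P d Q"
    then obtain a b where a: "a \<in> P" "b \<in> Q" "x = a \<circ> d \<circ> b" unfolding dcoset_def by blast
    have "(a \<circ> u') \<circ> d' \<circ> (v' \<circ> b) = a \<circ> (u' \<circ> u) \<circ> d \<circ> (v \<circ> v') \<circ> b"
      unfolding u(3) by (simp only: o_assoc)
    also have "\<dots> = x" unfolding u'(2) v'(2) a(3) by (simp only: o_id)
    finally show "x \<in> dcoset P d' Q"
      using dcosetI[OF P(1)[OF a(1) u'(1)] Q(1)[OF v'(1) a(2)], of d'] by simp
  qed
qed

lemma WDpar_subgroup:
  assumes r: "1 \<le> r" and l: "l \<in> Lam (n+1) r"
  shows "u \<in> WDpar n r (lam_br n l e) \<Longrightarrow> v \<in> WDpar n r (lam_br n l e) \<Longrightarrow> u \<circ> v \<in> WDpar n r (lam_br n l e)"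
    and "u \<in> WDpar n r (lam_br n l e) \<Longrightarrow> \<exists>u'\<in>WDpar n r (lam_br n l e). u' \<circ> u = id \<and> u \<circ> u' = id"
    and "id \<in> WDpar n r (lam_br n l e)"
proof -
  let ?s = "s_pow r e"
  note W = WDpar_lam_br[OF r l, of e] and ss = s_pow_s_pow[OF r, of e]
  have conj: "(?s \<circ> a \<circ> ?s) \<circ> (?s \<circ> b \<circ> ?s) = ?s \<circ> (a \<circ> b) \<circ> ?s" for a b
  proof -
    have "(?s \<circ> a \<circ> ?s) \<circ> (?s \<circ> b \<circ> ?s) = ?s \<circ> a \<circ> (?s \<circ> ?s) \<circ> b \<circ> ?s" by (simp only: o_assoc)
    then show ?thesis unfolding ss by (simp only: o_id o_assoc)
  qed
  have conj_id: "?s \<circ> id \<circ> ?s = id" using ss by (simp only: o_id)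
  show "u \<circ> v \<in> WDpar n r (lam_br n l e)"
    if uv: "u \<in> WDpar n r (lam_br n l e)" "v \<in> WDpar n r (lam_br n l e)"
  proof -
    obtain a b where ab: "a \<in> KD r (bl n l)" "b \<in> KD r (bl n l)" "u = ?s \<circ> a \<circ> ?s" "v = ?s \<circ> b \<circ> ?s"
      using uv unfolding W by blast
    show ?thesis unfolding W ab(3,4) conj using KD_comp[OF ab(1,2)] by blast
  qed
  show "\<exists>u'\<in>WDpar n r (lam_br n l e). u' \<circ> u = id \<and> u \<circ> u' = id" if u: "u \<in> WDpar n r (lam_br n l e)"
  proof -
    obtain a where a: "a \<in> KD r (bl n l)" "u = ?s \<circ> a \<circ> ?s" using u unfolding W by blast
    have aW: "a \<in> WB r" using a(1) KD_WB by blast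
    have "?s \<circ> pinv a \<circ> ?s \<in> WDpar n r (lam_br n l e)" unfolding W using KD_inv[OF a(1)] by blast
    moreover have "(?s \<circ> pinv a \<circ> ?s) \<circ> u = id \<and> u \<circ> (?s \<circ> pinv a \<circ> ?s) = id"
      by (simp only: a(2) conj WB_comp_inv[OF aW] conj_id simp_thms)
    ultimately show ?thesis by blast
  qed
  show "id \<in> WDpar n r (lam_br n l e)"
    unfolding W using imageI[OF KD_id, of "\<lambda>k. ?s \<circ> k \<circ> ?s"] conj_id by (simp only:)
qed

text \<open>Every element of a double coset of subgroups generates it, in particular one of minimal length.\<close>

lemma dcoset_min_repD:
  assumes r: "1 \<le> r" and l: "l \<in> Lam (n+1) r" and m: "m \<in> Lam (n+1) r"
  shows "dcoset (WDpar n r (lam_br n l e)) (min_repD n r (lam_br n l e) (lam_br n m e') d) (WDpar n r (lam_br n m e')) =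
    dcoset (WDpar n r (lam_br n l e)) d (WDpar n r (lam_br n m e'))"
proof (rule dcoset_subgroup_eq)
  have "d \<in> dcoset (WDpar n r (lam_br n l e)) d (WDpar n r (lam_br n m e'))"
    using dcosetI[OF WDpar_subgroup(3)[OF r l] WDpar_subgroup(3)[OF r m], of d e e'] by (simp only: id_o o_id)
  then show "min_repD n r (lam_br n l e) (lam_br n m e') d \<in> dcoset (WDpar n r (lam_br n l e)) d (WDpar n r (lam_br n m e'))"
    unfolding min_repD_def
    by (rule arg_min_natI[of "\<lambda>w. w \<in> dcoset (WDpar n r (lam_br n l e)) d (WDpar n r (lam_br n m e'))"])
qed (use WDpar_subgroup[OF r l] WDpar_subgroup[OF r m] in blast)+

lemma sB_last_Yg:
  assumes "1 \<le> r" "l \<in> Lam (n+1) r" "l (n+1) \<noteq> 0" shows "sB r r \<in> Yg r (bl n l)"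
  using sB_Yg_iff[OF assms(2), of r] bl_mid[OF assms(2,3,1)] assms(1) by simp

lemma s_pow_Yg:
  assumes "1 \<le> r" "l \<in> Lam (n+1) r" "l (n+1) \<noteq> 0" shows "s_pow r e \<in> Yg r (bl n l)"
  using sB_last_Yg[OF assms] Yg_id by (cases e) (simp_all only: s_pow.simps)

text \<open>Written as \<open>k \<circ> d \<circ> k'\<close>, the element \<open>v \<circ> s_pow r e'\<close> reveals the parity of \<open>k\<close> by \<open>lsign\<close>, and the
  parity of \<open>v\<close> then determines that of \<open>k'\<close>.\<close>

lemma dcoset_signed:
  assumes r: "1 \<le> r" and l: "l \<in> Lam (n+1) r" "l (n+1) \<noteq> 0" and m: "m \<in> Lam (n+1) r"
    and d: "d \<in> WB r" and A: "cnt r (bl n l) (bl n m) d = A" and z: "A (n+1) (n+1) = 0"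
    and ls: "\<not> lsign n r (bl n l) (bl n m) d" and od: "oddB r d \<longleftrightarrow> sg_mult e e' = Minus"
  shows "dcoset (KD r (bl n l)) (s_pow r e \<circ> d \<circ> s_pow r e') (WDpar n r (lam_br n m e')) =
    {v \<in> WD r. lsign n r (bl n l) (bl n m) (v \<circ> s_pow r e') = (e = Minus) \<and>
       cnt r (bl n l) (bl n m) (v \<circ> s_pow r e') = A}"
    (is "?L = ?R")
proof -
  let ?s = "s_pow r e" and ?s' = "s_pow r e'" and ?ls = "lsign n r (bl n l) (bl n m)"
  note sY = s_pow_Yg[OF r l, of e]
  note sW = s_pow_WB[OF r, of e] and sW' = s_pow_WB[OF r, of e']
  note ss = s_pow_s_pow[OF r, of e] and ss' = s_pow_s_pow[OF r, of e']
  have lsk: "?ls (k \<circ> d \<circ> k') \<longleftrightarrow> oddB r k" if k: "k \<in> Yg r (bl n l)" "k' \<in> Yg r (bl n m)" for k k'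
  proof -
    have kd: "k \<circ> d \<in> WB r" by (rule WB_comp[OF Yg_WB[OF k(1)] d])
    have "?ls (k \<circ> d \<circ> k') \<longleftrightarrow> ?ls (k \<circ> d)" by (rule lsign_right[OF kd k(2)])
    also have "\<dots> \<longleftrightarrow> oddB r k" using lsign_Yg[OF l(1) m r k(1) d] ls z A by simp
    finally show ?thesis .
  qed
  have par: "oddB r (k \<circ> d \<circ> k') \<longleftrightarrow> ((oddB r k \<noteq> oddB r d) \<noteq> oddB r k')"
    if "k \<in> Yg r (bl n l)" "k' \<in> Yg r (bl n m)" for k k'
    using oddB_comp[OF WB_comp[OF Yg_WB[OF that(1)] d] Yg_WB[OF that(2)]] oddB_comp[OF Yg_WB[OF that(1)] d] by simp
  show ?thesis
  proof (intro equalityI subsetI)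
    fix v assume "v \<in> ?L"
    then obtain k k' where k: "k \<in> KD r (bl n l)" "k' \<in> KD r (bl n m)"
      "v = k \<circ> (?s \<circ> d \<circ> ?s') \<circ> (?s' \<circ> k' \<circ> ?s')"
      unfolding dcoset_def WDpar_lam_br[OF r m] by blast
    have kY: "k \<in> Yg r (bl n l)" "k' \<in> Yg r (bl n m)" "\<not> oddB r k" "\<not> oddB r k'" using k by (simp_all add: KD_iff)
    have v0: "v = (k \<circ> ?s) \<circ> d \<circ> (?s' \<circ> ?s') \<circ> k' \<circ> ?s'" unfolding k(3) by (simp only: o_assoc)
    then have v: "v = ((k \<circ> ?s) \<circ> d \<circ> k') \<circ> ?s'" unfolding ss' by (simp only: o_id)
    have vs: "v \<circ> ?s' = (k \<circ> ?s) \<circ> d \<circ> k'" unfolding v by (simp only: o_assoc[symmetric] ss' o_id)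
    have ks: "k \<circ> ?s \<in> Yg r (bl n l)" by (rule Yg_comp[OF kY(1) sY])
    have oks: "oddB r (k \<circ> ?s) \<longleftrightarrow> e = Minus"
      using oddB_comp[OF Yg_WB[OF kY(1)] sW] oddB_s_pow[OF r] kY(3) by simp
    have W: "(k \<circ> ?s) \<circ> d \<circ> k' \<in> WB r" by (intro WB_comp Yg_WB[OF ks] d Yg_WB[OF kY(2)])
    have "v \<in> WB r" unfolding v by (rule WB_comp[OF W sW'])
    moreover have "\<not> oddB r v"
      unfolding v oddB_comp[OF W sW'] par[OF ks kY(2)] oks od oddB_s_pow[OF r]
      using kY(4) by (cases e; cases e') (simp_all add: sg_mult_def)
    moreover have "cnt r (bl n l) (bl n m) (v \<circ> ?s') = A" unfolding vs using cnt_Yg[OF d ks kY(2)] A by simp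
    moreover have "?ls (v \<circ> ?s') = (e = Minus)" unfolding vs lsk[OF ks kY(2)] by (rule oks)
    ultimately show "v \<in> ?R" by (simp add: WD_iff)
  next
    fix v assume v: "v \<in> ?R"
    then have vW: "v \<in> WB r" "\<not> oddB r v" by (simp_all add: WD_iff)
    have W: "v \<circ> ?s' \<in> WB r" by (rule WB_comp[OF vW(1) sW'])
    have "\<exists>k\<in>Yg r (bl n l). \<exists>k'\<in>Yg r (bl n m). v \<circ> ?s' = k \<circ> d \<circ> k'"
      by (rule cnt_orbit[where M = "2*n+2", OF d W]) (use v A bl_mirror[OF l(1)] bl_mirror[OF m] in simp_all)
    then obtain k k' where k: "k \<in> Yg r (bl n l)" "k' \<in> Yg r (bl n m)" "v \<circ> ?s' = k \<circ> d \<circ> k'" by blast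
    have ok: "oddB r k \<longleftrightarrow> e = Minus" using v lsk[OF k(1,2)] k(3) by simp
    have "oddB r (v \<circ> ?s') \<longleftrightarrow> e' = Minus" using oddB_comp[OF vW(1) sW'] vW(2) oddB_s_pow[OF r] by simp
    then have ok': "\<not> oddB r k'"
      unfolding k(3) par[OF k(1,2)] ok od by (cases e; cases e') (simp_all add: sg_mult_def)
    have k1: "k \<circ> ?s \<in> KD r (bl n l)"
      unfolding KD_iff using Yg_comp[OF k(1) sY] oddB_comp[OF Yg_WB[OF k(1)] sW] oddB_s_pow[OF r] ok by simp
    have k2: "?s' \<circ> k' \<circ> ?s' \<in> WDpar n r (lam_br n m e')"
      unfolding WDpar_lam_br[OF r m] using k(2) ok' by (intro imageI) (simp add: KD_iff)
    have "(k \<circ> ?s) \<circ> (?s \<circ> d \<circ> ?s') \<circ> (?s' \<circ> k' \<circ> ?s') = k \<circ> (?s \<circ> ?s) \<circ> d \<circ> (?s' \<circ> ?s') \<circ> k' \<circ> ?s'"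
      by (simp only: o_assoc)
    also have "\<dots> = (v \<circ> ?s') \<circ> ?s'" unfolding ss ss' k(3) by (simp only: o_id)
    also have "\<dots> = v" by (simp only: o_assoc[symmetric] ss' o_id)
    finally show "v \<in> ?L" using dcosetI[OF k1 k2, of "?s \<circ> d \<circ> ?s'"] by simp
  qed
qed

text \<open>A nonzero central entry provides an odd element of the row group that \<open>d\<close> carries to the
  column group, so the full double coset meets \<open>WD\<close> in a single double coset.\<close>

lemma dcoset_central:
  assumes l: "l \<in> Lam (n+1) r" and m: "m \<in> Lam (n+1) r"
    and d: "d \<in> WD r" and A: "cnt r (bl n l) (bl n m) d = A" and z: "A (n+1) (n+1) \<noteq> 0"
  shows "dcoset (KD r (bl n l)) d (KD r (bl n m)) = {v \<in> WD r. cnt r (bl n l) (bl n m) v = A}"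
    (is "?L = ?R")
proof -
  have dW: "d \<in> WB r" "\<not> oddB r d" using d by (simp_all add: WD_iff)
  have "card {x \<in> {1..2*r}. bl n m x = n+1 \<and> bl n l (d x) = n+1} \<noteq> 0" using z unfolding A[symmetric] cnt_def .
  then have "{x \<in> {1..2*r}. bl n m x = n+1 \<and> bl n l (d x) = n+1} \<noteq> {}" by (metis card.empty)
  then obtain x where x: "x \<in> {1..2*r}" "bl n m x = n+1" "bl n l (d x) = n+1" by blast
  let ?x = "2*r+1-x"
  have x': "?x \<in> {1..2*r}" "2*r+1-?x = x" "?x \<noteq> x" using mirror_range[OF x(1)] by blast+
  \<comment> \<open>The sign change at a point \<open>x\<close> of the middle block that \<open>d\<close> keeps in the middle block.\<close>
  define t where "t = transpose x ?x"
  have tW: "t \<in> WB r"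
  proof (rule WBI)
    show "t permutes {1..2*r}" unfolding t_def by (rule permutes_swap_id[OF x(1) x'(1)])
    fix y assume y: "y \<in> {1..2*r}"
    then have "2*r+1-y = x \<longleftrightarrow> y = ?x" "2*r+1-y = ?x \<longleftrightarrow> y = x" using x(1) by auto
    then show "t (2*r+1-y) = 2*r+1 - t y"
      unfolding t_def transpose_def using x'(2) by auto
  qed
  have tm: "bl n m ?x = n+1" using bl_mirror[OF m x(1)] x(2) by simp
  have tY: "t \<in> Yg r (bl n m)"
    by (rule YgI[OF tW]) (use x(2) tm in \<open>auto simp: t_def transpose_def\<close>)
  have todd: "oddB r t"
  proof -
    have "{i \<in> {1..r}. t i > r} = {min x ?x}"
      using x(1) by (auto simp: t_def transpose_def min_def)
    then show ?thesis unfolding oddB_def by simp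
  qed
  define k0 where "k0 = d \<circ> t \<circ> pinv d"
  have k0W: "k0 \<in> WB r" unfolding k0_def by (intro WB_comp dW tW WB_inv)
  have k0Y: "k0 \<in> Yg r (bl n l)"
  proof (rule YgI[OF k0W])
    fix y assume y: "y \<in> {1..2*r}"
    define u where "u = pinv d y"
    have du: "d u = y" by (simp add: u_def WB_inv_apply[OF dW(1)])
    have dx: "bl n l (d ?x) = n+1"
      using bl_mirror[OF l WB_range[OF dW(1) x(1)]] WB_mirror[OF dW(1) x(1)] x(3) by simp
    have "k0 y = d (t u)" by (simp add: k0_def u_def)
    then show "bl n l (k0 y) = bl n l y"
      using x(3) dx unfolding t_def transpose_def du[symmetric] by auto
  qed
  have k0odd: "oddB r k0"
    unfolding k0_def using oddB_comp[OF WB_comp[OF dW(1) tW] WB_inv[OF dW(1)]] oddB_comp[OF dW(1) tW]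
      oddB_inv[OF dW(1)] todd dW(2) by simp
  have k0d: "k0 \<circ> d = d \<circ> t"
    unfolding k0_def by (simp only: o_assoc[symmetric] WB_comp_inv[OF dW(1)] o_id)
  have tt: "t \<circ> t = id" unfolding t_def by (rule transpose_comp_involutory)
  show ?thesis
  proof (intro equalityI subsetI)
    fix v assume "v \<in> ?L"
    then obtain k k' where k: "k \<in> KD r (bl n l)" "k' \<in> KD r (bl n m)" "v = k \<circ> d \<circ> k'"
      unfolding dcoset_def by blast
    have kY: "k \<in> Yg r (bl n l)" "k' \<in> Yg r (bl n m)" "\<not> oddB r k" "\<not> oddB r k'" using k by (simp_all add: KD_iff)
    have "v \<in> WB r" unfolding k(3) by (intro WB_comp Yg_WB[OF kY(1)] dW Yg_WB[OF kY(2)])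
    moreover have "\<not> oddB r v"
      unfolding k(3) using oddB_comp[OF WB_comp[OF Yg_WB[OF kY(1)] dW(1)] Yg_WB[OF kY(2)]]
        oddB_comp[OF Yg_WB[OF kY(1)] dW(1)] kY dW by simp
    moreover have "cnt r (bl n l) (bl n m) v = A" unfolding k(3) using cnt_Yg[OF dW(1) kY(1,2)] A by simp
    ultimately show "v \<in> ?R" by (simp add: WD_iff)
  next
    fix v assume v: "v \<in> ?R"
    then have vW: "v \<in> WB r" "\<not> oddB r v" by (simp_all add: WD_iff)
    have "\<exists>k\<in>Yg r (bl n l). \<exists>k'\<in>Yg r (bl n m). v = k \<circ> d \<circ> k'"
      by (rule cnt_orbit[where M = "2*n+2", OF dW(1) vW(1)]) (use v A bl_mirror[OF l] bl_mirror[OF m] in simp_all)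
    then obtain k k' where k: "k \<in> Yg r (bl n l)" "k' \<in> Yg r (bl n m)" "v = k \<circ> d \<circ> k'" by blast
    have eq: "oddB r k \<longleftrightarrow> oddB r k'"
      using vW(2) oddB_comp[OF WB_comp[OF Yg_WB[OF k(1)] dW(1)] Yg_WB[OF k(2)]]
        oddB_comp[OF Yg_WB[OF k(1)] dW(1)] dW(2) unfolding k(3) by simp
    show "v \<in> ?L"
    proof (cases "oddB r k")
      case False
      then show ?thesis unfolding k(3) using k eq by (intro dcosetI) (simp_all add: KD_iff)
    next
      case True
      have "k \<circ> k0 \<in> KD r (bl n l)"
        unfolding KD_iff using Yg_comp[OF k(1) k0Y] oddB_comp[OF Yg_WB[OF k(1)] k0W] k0odd True by simp
      moreover have "t \<circ> k' \<in> KD r (bl n m)"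
        unfolding KD_iff using Yg_comp[OF tY k(2)] oddB_comp[OF tW Yg_WB[OF k(2)]] todd True eq by simp
      moreover have "(k \<circ> k0) \<circ> d \<circ> (t \<circ> k') = v"
      proof -
        have "(k \<circ> k0) \<circ> d \<circ> (t \<circ> k') = k \<circ> (k0 \<circ> d) \<circ> t \<circ> k'" by (simp only: o_assoc)
        also have "\<dots> = k \<circ> d \<circ> (t \<circ> t) \<circ> k'" unfolding k0d by (simp only: o_assoc)
        finally show ?thesis unfolding tt k(3) by (simp only: o_id)
      qed
      ultimately show ?thesis using dcosetI[of "k \<circ> k0" _ "t \<circ> k'" _ d] by metis
    qed
  qed
qed

context heckeB
begin

lemma phi_dot:
  assumes A: "A \<in> Xi n r" and l: "l \<in> Lam (n+1) r" and m: "m \<in> Lam (n+1) r"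
    and ro: "ro n A = hat n l" and co: "co n A = hat n m" and z: "A (n+1) (n+1) \<noteq> 0"
  shows "\<exists>d. phi n r (Dot A) = phi_std n r (LBul l) (lam_br n m Plus) d \<and>
      dcoset (WDpar n r (LBul l)) d (WDpar n r (lam_br n m Plus)) = {v \<in> WD r. cnt r (bl n l) (bl n m) v = A}"
    and "l (n+1) \<noteq> 0" "m (n+1) \<noteq> 0"
proof -
  obtain d where d: "mat_triple n r A = (l, d, m)" "d \<in> WB r" "cnt r (bl n l) (bl n m) d = A"
    using mat_triple_props[OF A l m ro co] by blast
  have "card {x \<in> {1..2*r}. bl n m x = n+1 \<and> bl n l (d x) = n+1} \<noteq> 0" using z unfolding d(3)[symmetric] cnt_def .
  then have "{x \<in> {1..2*r}. bl n m x = n+1 \<and> bl n l (d x) = n+1} \<noteq> {}" by (metis card.empty)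
  then obtain x where x: "x \<in> {1..2*r}" "bl n m x = n+1" "bl n l (d x) = n+1" by blast
  show l0: "l (n+1) \<noteq> 0" by (rule bl_mid_nonzero[OF l WB_range[OF d(2) x(1)] x(3)])
  show m0: "m (n+1) \<noteq> 0" by (rule bl_mid_nonzero[OF m x(1,2)])
  have bul: "LBul l = lam_br n l Plus" "LBul m = lam_br n m Plus" using l0 m0 by (simp_all add: lam_br_def)
  have wd: "WDpar n r (lam_br n l Plus) = KD r (bl n l)" "WDpar n r (lam_br n m Plus) = KD r (bl n m)"
    unfolding WDpar_lam_br[OF r1 l] WDpar_lam_br[OF r1 m] by (simp_all only: s_pow.simps id_o o_id image_ident)
  define d0 where "d0 = (if d \<in> WD r then d else sB r r \<circ> d)"
  have "d0 \<in> WD r \<and> cnt r (bl n l) (bl n m) d0 = A"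
  proof (cases "d \<in> WD r")
    case True
    then show ?thesis using d(3) by (simp add: d0_def)
  next
    case False
    have "sB r r \<circ> d \<in> WB r" by (intro WB_comp sB_WB r_mem d)
    moreover have "\<not> oddB r (sB r r \<circ> d)" using oddB_sB_comp[OF d(2) r_mem] False d(2) by (simp add: WD_iff)
    moreover have "cnt r (bl n l) (bl n m) (sB r r \<circ> d) = A"
      using cnt_Yg[OF d(2) sB_last_Yg[OF r1 l l0] Yg_id, of "bl n m"] d(3) by (simp only: o_id)
    ultimately show ?thesis unfolding d0_def if_not_P[OF False] by (simp only: WD_iff simp_thms)
  qed
  then have d0: "d0 \<in> WD r" "cnt r (bl n l) (bl n m) d0 = A" by blast+
  have dc: "dcoset (KD r (bl n l)) d0 (KD r (bl n m)) = {v \<in> WD r. cnt r (bl n l) (bl n m) v = A}"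
    by (rule dcoset_central[where A = A, OF l m d0 z])
  have "phi n r (Dot A) = phi_std n r (LBul l) (LBul m) (min_repD n r (LBul l) (LBul m) d0)"
    by (simp add: d(1) d0_def Let_def)
  then show "\<exists>d. phi n r (Dot A) = phi_std n r (LBul l) (lam_br n m Plus) d \<and>
      dcoset (WDpar n r (LBul l)) d (WDpar n r (lam_br n m Plus)) = {v \<in> WD r. cnt r (bl n l) (bl n m) v = A}"
    unfolding bul using dcoset_min_repD[OF r1 l m, of Plus Plus d0] unfolding wd dc by blast
qed

lemma reps_phi_dot:
  assumes A: "A \<in> Xi n r" and l: "l \<in> Lam (n+1) r" and m: "m \<in> Lam (n+1) r"
    and ro: "ro n A = hat n l" and co: "co n A = hat n m" and z: "A (n+1) (n+1) \<noteq> 0"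
  shows "reps n (LBul l) (lam_br n m Plus) (TS {v \<in> WD r. cnt r (bl n l) (bl n m) v = A}) (phi n r (Dot A))"
    and "y \<in> carrier (HB r) \<Longrightarrow> y \<cdot> TS (KD r (bl n m)) = TS {v \<in> WD r. cnt r (bl n l) (bl n m) v = A} \<Longrightarrow>
      maps_xH n (LBul l) (lam_br n m Plus) y \<and> phi n r (Dot A) = opS n (LBul l) (lam_br n m Plus) y"
proof -
  obtain d where d: "phi n r (Dot A) = phi_std n r (LBul l) (lam_br n m Plus) d"
    "dcoset (WDpar n r (LBul l)) d (WDpar n r (lam_br n m Plus)) = {v \<in> WD r. cnt r (bl n l) (bl n m) v = A}"
    using phi_dot(1)[OF assms] by blast
  have sub: "{v \<in> WD r. cnt r (bl n l) (bl n m) v = A} \<subseteq> WD r" by blast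
  have x: "xD n r (lam_br n m Plus) = TS (KD r (bl n m))"
    unfolding xD_TS WDpar_lam_br[OF r1 m] by (simp only: s_pow.simps id_o o_id image_ident)
  note p = reps_phi_std[OF l phi_dot(2)[OF assms] m d(2) sub]
  show "reps n (LBul l) (lam_br n m Plus) (TS {v \<in> WD r. cnt r (bl n l) (bl n m) v = A}) (phi n r (Dot A))"
    unfolding d(1) by (rule p(1))
  show "y \<in> carrier (HB r) \<Longrightarrow> y \<cdot> TS (KD r (bl n m)) = TS {v \<in> WD r. cnt r (bl n l) (bl n m) v = A} \<Longrightarrow>
      maps_xH n (LBul l) (lam_br n m Plus) y \<and> phi n r (Dot A) = opS n (LBul l) (lam_br n m Plus) y"
    unfolding d(1) x[symmetric] by (rule p(2))
qed

lemma reps_phi_sgn: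
  assumes A: "A \<in> Xi n r" and l: "l \<in> Lam (n+1) r" "l (n+1) \<noteq> 0" and m: "m \<in> Lam (n+1) r"
    and ro: "ro n A = hat n l" and co: "co n A = hat n m" and z: "A (n+1) (n+1) = 0"
    and e: "sg_mult e e' = sgn_mat n A"
  shows "reps n (LBul l) (lam_br n m e')
    (TS {v \<in> WD r. lsign n r (bl n l) (bl n m) (v \<circ> s_pow r e') = (e = Minus) \<and>
       cnt r (bl n l) (bl n m) (v \<circ> s_pow r e') = A}) (phi n r (Sgn e A e'))"
proof -
  obtain d where d: "mat_triple n r A = (l, d, m)" "d \<in> WB r" "cnt r (bl n l) (bl n m) d = A"
    "\<And>j. j \<in> {1..r} \<Longrightarrow> bl n l j = bl n l (j+1) \<Longrightarrow> pinv d j < pinv d (j+1)"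
    "\<And>j. j \<in> {1..r} \<Longrightarrow> bl n m j = bl n m (j+1) \<Longrightarrow> d j < d (j+1)"
    using mat_triple_props[OF A l(1) m ro co] by blast
  have bul: "lam_br n l e = lam_br n l Plus" "LBul l = lam_br n l Plus" using l(2) by (simp_all add: lam_br_def)
  have wd: "WDpar n r (lam_br n l Plus) = KD r (bl n l)"
    unfolding WDpar_lam_br[OF r1 l(1)] by (simp only: s_pow.simps id_o o_id image_ident)
  have ls: "\<not> lsign n r (bl n l) (bl n m) d" by (rule minimal_lsign[OF l(1) m d(2,4)])
  have od: "oddB r d \<longleftrightarrow> sg_mult e e' = Minus"
    unfolding e d(3)[symmetric] by (rule minimal_oddB[OF l(1) m d(2,4,5)])
  note dc = dcoset_signed[OF r1 l m d(2,3) z ls od]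
  have "phi n r (Sgn e A e') = phi_std n r (lam_br n l e) (lam_br n m e')
      (min_repD n r (lam_br n l e) (lam_br n m e') (s_pow r e \<circ> d \<circ> s_pow r e'))"
    by (simp add: d(1) Let_def)
  then have ph: "phi n r (Sgn e A e') = phi_std n r (LBul l) (lam_br n m e')
      (min_repD n r (lam_br n l Plus) (lam_br n m e') (s_pow r e \<circ> d \<circ> s_pow r e'))"
    unfolding bul(1) bul(2)[symmetric] .
  show ?thesis
    unfolding ph
  proof (rule reps_phi_std(1)[OF l m])
    show "dcoset (WDpar n r (LBul l)) (min_repD n r (lam_br n l Plus) (lam_br n m e') (s_pow r e \<circ> d \<circ> s_pow r e'))
      (WDpar n r (lam_br n m e')) = {v \<in> WD r. lsign n r (bl n l) (bl n m) (v \<circ> s_pow r e') = (e = Minus) \<and>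
       cnt r (bl n l) (bl n m) (v \<circ> s_pow r e') = A}"
      unfolding bul(2) dcoset_min_repD[OF r1 l(1) m] unfolding wd by (rule dc)
  qed blast
qed

end

section \<open>Moving one entry of a matrix\<close>

lemma sum_of_bool_pair:
  assumes "finite I" "finite J"
  shows "(\<Sum>i\<in>I. \<Sum>j\<in>J. of_bool (i = a \<and> j = b)) = (of_bool (a \<in> I \<and> b \<in> J) :: nat)"
proof -
  have "(\<Sum>j\<in>J. of_bool (i = a \<and> j = b)) = (if i = a then of_bool (b \<in> J) else 0 :: nat)" for i
    using assms(2) by (cases "i = a") (simp_all add: of_bool_def sum.delta)
  then show ?thesis using assms(1) by (simp add: of_bool_def sum.delta)
qed

lemma sum_Eth:
  assumes "finite I" "finite J"
  shows "(\<Sum>i\<in>I. \<Sum>j\<in>J. Eth n k p i j) =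
    of_bool (k \<in> I \<and> p \<in> J) + of_bool (2*n+2-k \<in> I \<and> 2*n+2-p \<in> J)"
  unfolding Eth_def by (simp only: sum.distrib sum_of_bool_pair[OF assms])

lemma row_sum_Eth:
  assumes "p \<in> {1..2*n+1}"
  shows "(\<Sum>j\<in>{1..2*n+1}. Eth n k p i j) = of_bool (i = k) + of_bool (i = 2*n+2-k)"
proof -
  have "2*n+2-p \<in> {1..2*n+1}" using assms by auto
  then have "(k \<in> {i} \<and> p \<in> {1..2*n+1}) = (i = k)" "(2*n+2-k \<in> {i} \<and> 2*n+2-p \<in> {1..2*n+1}) = (i = 2*n+2-k)"
    using assms by blast+
  then show ?thesis using sum_Eth[of "{i}" "{1..2*n+1}" n k p] by simp
qed

lemma col_sum_Eth:
  assumes "k \<in> {1..2*n+1}"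
  shows "(\<Sum>i\<in>{1..2*n+1}. Eth n k p i j) = of_bool (j = p) + of_bool (j = 2*n+2-p)"
proof -
  have "2*n+2-k \<in> {1..2*n+1}" using assms by auto
  then have "(k \<in> {1..2*n+1} \<and> p \<in> {j}) = (j = p)" "(2*n+2-k \<in> {1..2*n+1} \<and> 2*n+2-p \<in> {j}) = (j = 2*n+2-p)"
    using assms by blast+
  then show ?thesis using sum_Eth[of "{1..2*n+1}" "{j}" n k p] by simp
qed

lemma sgn_opp: "sg_mult (opp e) e' = opp (sg_mult e e')" "opp (opp e) = e" "sg_mult Plus e = e"
  "sg_mult Minus e = opp e" "(opp e = Minus) = (e \<noteq> Minus)"
  by (cases e; cases e'; simp add: sg_mult_def)+

lemma Eth_sym:
  assumes "k \<in> {1..2*n+1}" "p \<in> {1..2*n+1}" "i \<in> {1..2*n+1}" "j \<in> {1..2*n+1}"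
  shows "Eth n k p (2*n+2-i) (2*n+2-j) = Eth n k p i j"
proof -
  have "2*n+2-i = k \<longleftrightarrow> i = 2*n+2-k" "2*n+2-j = p \<longleftrightarrow> j = 2*n+2-p"
    "2*n+2-i = 2*n+2-k \<longleftrightarrow> i = k" "2*n+2-j = 2*n+2-p \<longleftrightarrow> j = p"
    using assms by auto
  then show ?thesis by (simp add: Eth_def)
qed

text \<open>The matrix \<open>A\<close> of the second factor; its row sums belong to the composition from which the unit is
  taken away.\<close>

locale matrix_move = block_move +
  fixes nu :: "nat \<Rightarrow> nat" and A :: nmat
  assumes nu: "nu \<in> Lam (n+1) r" and A: "A \<in> Xi n r"
    and ro: "ro n A = hat n mu" and co: "co n A = hat n nu"
begin

lemma center_even: "even (A (n+1) (n+1))"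
  by (rule Xi_even[OF A]) (simp add: ro hat_def)

lemmas A_sym = Xi_symD[OF A]

lemma hat_move: "hat n lam i + (of_bool (i = h+1) + of_bool (i = 2*n+2-(h+1))) =
    hat n mu i + (of_bool (i = h) + of_bool (i = 2*n+2-h))"
proof -
  have low: "lam k + of_bool (k = h+1) = mu k + of_bool (k = h)" for k
    using lam_h mu_h rest[of k] by auto
  have hn: "1 \<le> h" "h \<le> n" using h by simp_all
  consider "1 \<le> i" "i \<le> n" | "i = n+1" | "n+2 \<le> i" "i \<le> 2*n+1" | "i = 0 \<or> 2*n+1 < i" by linarith
  then show ?thesis
  proof cases
    case 1
    then have "i \<noteq> 2*n+2-(h+1)" "i \<noteq> 2*n+2-h" using hn by linarith+
    then show ?thesis using low[of i] 1 by (simp add: hat_def)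
  next
    case 2
    then have "i = 2*n+2-(h+1) \<longleftrightarrow> i = h+1" "i \<noteq> 2*n+2-h" "i \<noteq> h" using hn by linarith+
    then show ?thesis using low[of i] 2 by (simp add: hat_def)
  next
    case 3
    then have "2*n+2-i = h+1 \<longleftrightarrow> i = 2*n+2-(h+1)" "2*n+2-i = h \<longleftrightarrow> i = 2*n+2-h"
      "i \<noteq> h+1" "i \<noteq> h" using hn by linarith+
    then show ?thesis using low[of "2*n+2-i"] 3 by (simp add: hat_def)
  next
    case 4
    then have "i \<noteq> 2*n+2-(h+1)" "i \<noteq> 2*n+2-h" "i \<noteq> h+1" "i \<noteq> h" using hn by linarith+
    then show ?thesis using 4 by (auto simp: hat_def)
  qed
qed

context
  fixes p :: nat
  assumes p: "p \<in> {1..2*n+1}" and pos: "A (h+1) p > 0"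
begin

lemma shift_eq: "shift n h A p i j + Eth n (h+1) p i j = A i j + Eth n h p i j"
  by (rule shift_exact[where A = A, OF h p A_sym center_even pos])

lemma sum_shift: "(\<Sum>i\<in>I. \<Sum>j\<in>J. shift n h A p i j) + (\<Sum>i\<in>I. \<Sum>j\<in>J. Eth n (h+1) p i j) =
    (\<Sum>i\<in>I. \<Sum>j\<in>J. A i j) + (\<Sum>i\<in>I. \<Sum>j\<in>J. Eth n h p i j)"
  by (simp only: sum.distrib[symmetric] shift_eq)

lemma ro_shift: "ro n (shift n h A p) = hat n lam"
proof
  fix i
  have "ro n (shift n h A p) i + (of_bool (i = h+1) + of_bool (i = 2*n+2-(h+1))) =
      ro n A i + (of_bool (i = h) + of_bool (i = 2*n+2-h))"
    unfolding ro_def row_sum_Eth[OF p, symmetric] by (simp only: sum.distrib[symmetric] shift_eq)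
  then show "ro n (shift n h A p) i = hat n lam i" unfolding ro using hat_move[of i] by linarith
qed

lemma co_shift: "co n (shift n h A p) = hat n nu"
proof
  fix j
  have hh: "h \<in> {1..2*n+1}" "h+1 \<in> {1..2*n+1}" using h by auto
  have "(\<Sum>i\<in>{1..2*n+1}. shift n h A p i j) + (\<Sum>i\<in>{1..2*n+1}. Eth n (h+1) p i j) =
      (\<Sum>i\<in>{1..2*n+1}. A i j) + (\<Sum>i\<in>{1..2*n+1}. Eth n h p i j)"
    by (simp only: sum.distrib[symmetric] shift_eq)
  then show "co n (shift n h A p) j = hat n nu j"
    unfolding col_sum_Eth[OF hh(1)] col_sum_Eth[OF hh(2)] co[symmetric] co_def by simp
qed

lemma shift_Xi: "shift n h A p \<in> Xi n r"
proof -
  let ?N = "{1..2*n+1}"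
  have hh: "h \<in> ?N" "h+1 \<in> ?N" using h by auto
  have out: "shift n h A p i j = 0" if "\<not> (i \<in> ?N \<and> j \<in> ?N)" for i j
  proof -
    have "A i j = 0" using A that unfolding Xi_def by blast
    moreover have "Eth n h p i j = 0" using hh p that by (auto simp: Eth_def)
    ultimately show ?thesis using shift_eq[of i j] by simp
  qed
  have sym: "shift n h A p i j = shift n h A p (2*n+2-i) (2*n+2-j)" if "i \<in> ?N" "j \<in> ?N" for i j
    using shift_eq[of i j] shift_eq[of "2*n+2-i" "2*n+2-j"] Eth_sym[OF hh(1) p that] Eth_sym[OF hh(2) p that]
      A_sym[OF that] by linarith
  have "(\<Sum>i\<in>?N. \<Sum>j\<in>?N. shift n h A p i j) = 2*r"
    using fun_cong[OF ro_shift] psum_total[OF lam] unfolding ro_def psum_def by simp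
  then show ?thesis unfolding Xi_def using out sym by blast
qed

lemma center_shift:
  "shift n h A p (n+1) (n+1) = A (n+1) (n+1) - (if h = n \<and> p = n+1 then 2 else 0)"
proof -
  have "Eth n h p (n+1) (n+1) = 0" using h by (auto simp: Eth_def)
  moreover have "Eth n (h+1) p (n+1) (n+1) = (if h = n \<and> p = n+1 then 2 else 0)"
    using h p by (auto simp: Eth_def)
  ultimately show ?thesis using shift_eq[of "n+1" "n+1"] by simp
qed

text \<open>The corner block that defines the sign has rows up to \<open>n\<close> and columns beyond \<open>n + 1\<close>; a unit crosses
  its border only when it leaves the middle row, for \<open>h = n\<close>.\<close>

lemma sgn_shift:
  "sgn_mat n (shift n h A p) = (if h = n \<and> p > n+1 then opp (sgn_mat n A) else sgn_mat n A)"
proof -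
  let ?I = "{1..n}" and ?J = "{n+2..2*n+1}"
  have 1: "(\<Sum>i\<in>?I. \<Sum>j\<in>?J. Eth n h p i j) = of_bool (p > n+1)"
    unfolding sum_Eth[OF finite_atLeastAtMost finite_atLeastAtMost] using h p by auto
  have 2: "(\<Sum>i\<in>?I. \<Sum>j\<in>?J. Eth n (h+1) p i j) = of_bool (h \<noteq> n \<and> p > n+1)"
    unfolding sum_Eth[OF finite_atLeastAtMost finite_atLeastAtMost] using h p by auto
  show ?thesis
    using sum_shift[of ?J ?I] unfolding 1 2 sgn_mat_def by (cases "h = n \<and> p > n+1") auto
qed

end

section \<open>The multiplication formula\<close>

text \<open>Right multiplication by \<open>Tgen r r\<close> transports sums over odd elements to sums over even
  ones, so that the formula for \<open>WB r\<close>, restricted to one parity, becomes a formula for \<open>WD r\<close>.\<close>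

lemma Y_TS_even:
  assumes inv: "\<And>w j. w \<in> WB r \<Longrightarrow> 1 \<le> j \<Longrightarrow> j < r \<Longrightarrow> b' j = b' (j+1) \<Longrightarrow> P (sB r j \<circ> w) = P w"
    and move: "\<And>w k. w \<in> WB r \<Longrightarrow> k \<le> g \<Longrightarrow> A (h+1) (bl n nu (pinv w (cc-k))) > 0 \<Longrightarrow>
      P (rot r cc k w) = P' (bl n nu (pinv w (cc-k))) w"
  shows "Y \<cdot> TS {v \<in> WD r. P (v \<circ> s_pow r e) \<and> cnt r b' (bl n nu) (v \<circ> s_pow r e) = A} =
    (\<Oplus>\<^bsub>HB r\<^esub> p\<in>{1..2*n+1}. Hconst r (gcf n h A p) \<cdot>
       TS {v \<in> WD r. P' p (v \<circ> s_pow r e) \<and> cnt r b (bl n nu) (v \<circ> s_pow r e) = shift n h A p})"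
proof -
  define X where "X Q c M = {w \<in> WB r. (oddB r w = (e = Minus) \<and> Q w) \<and> cnt r c (bl n nu) w = M}"
    for Q c M
  define T where "T = (if e = Plus then \<one>\<^bsub>HB r\<^esub> else Tgen r r)"
  have T: "T \<in> carrier (HB r)" unfolding T_def using Tgen_closed'[OF r_mem] by simp
  have cl: "Hconst r c \<in> carrier (HB r)" for c by (rule Hconst_closed[OF r2])
  have XW: "X Q c M \<subseteq> WB r" for Q c M by (auto simp: X_def)
  note sW = s_pow_WB[OF r1, of e] and ss = s_pow_s_pow[OF r1, of e]
  have Xs: "TS {v \<in> WD r. Q (v \<circ> s_pow r e) \<and> cnt r c (bl n nu) (v \<circ> s_pow r e) = M} = TS (X Q c M) \<cdot> T"
    for Q c M
  proof -
    have "(\<lambda>w. w \<circ> s_pow r e) ` X Q c M =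
        {v \<in> WD r. Q (v \<circ> s_pow r e) \<and> cnt r c (bl n nu) (v \<circ> s_pow r e) = M}" (is "_ = ?R")
    proof (rule equalityI)
      show "(\<lambda>w. w \<circ> s_pow r e) ` X Q c M \<subseteq> ?R"
      proof (rule image_subsetI)
        fix w assume w: "w \<in> X Q c M"
        then have wW: "w \<in> WB r" using XW by blast
        have e: "w \<circ> s_pow r e \<circ> s_pow r e = w" by (simp only: o_assoc[symmetric] ss o_id)
        have "\<not> oddB r (w \<circ> s_pow r e)"
          unfolding oddB_comp[OF wW sW] oddB_s_pow[OF r1] using w by (simp add: X_def)
        then show "w \<circ> s_pow r e \<in> ?R"
          using w WB_comp[OF wW sW] unfolding mem_Collect_eq e WD_iff X_def by blast
      qed
      show "?R \<subseteq> (\<lambda>w. w \<circ> s_pow r e) ` X Q c M"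
      proof
        fix v assume v: "v \<in> ?R"
        then have vW: "v \<in> WB r" "\<not> oddB r v" by (simp_all add: WD_iff)
        have "oddB r (v \<circ> s_pow r e) = (e = Minus)"
          unfolding oddB_comp[OF vW(1) sW] oddB_s_pow[OF r1] using vW(2) by simp
        then have "v \<circ> s_pow r e \<in> X Q c M"
          using v WB_comp[OF vW(1) sW] unfolding X_def mem_Collect_eq by blast
        then show "v \<in> (\<lambda>w. w \<circ> s_pow r e) ` X Q c M"
          by (rule rev_image_eqI) (simp only: o_assoc[symmetric] ss o_id)
      qed
    qed
    then show ?thesis using TS_image_right[OF XW, of e Q c M] unfolding T_def by simp
  qed
  have Yc: "Y \<in> carrier (HB r)" by (rule Ysum_closed[OF cc(2,1)])
  have key: "Y \<cdot> TS (X P b' A) = (\<Oplus>\<^bsub>HB r\<^esub> p\<in>{1..2*n+1}. Hconst r (gcf n h A p) \<cdot> TS (X (P' p) b (shift n h A p)))"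
    unfolding X_def
  proof (rule Ysum_TS[where A = A and nu = nu and P = "\<lambda>w. oddB r w = (e = Minus) \<and> P w" and
      P' = "\<lambda>p w. oddB r w = (e = Minus) \<and> P' p w", OF nu A_sym center_even])
    fix w j assume w: "w \<in> WB r" "1 \<le> j" "j < r" "b' j = b' (j+1)"
    have "j \<in> {1..r}" using w by simp
    then have "oddB r (sB r j \<circ> w) = oddB r w" using oddB_sB_comp[OF w(1)] w(3) by simp
    then show "(oddB r (sB r j \<circ> w) = (e = Minus) \<and> P (sB r j \<circ> w)) = (oddB r w = (e = Minus) \<and> P w)"
      using inv[OF w] by blast
  next
    fix w k assume w: "w \<in> WB r" "k \<le> g" "A (h+1) (bl n nu (pinv w (cc-k))) > 0"
    show "(oddB r (rot r cc k w) = (e = Minus) \<and> P (rot r cc k w)) =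
        (oddB r w = (e = Minus) \<and> P' (bl n nu (pinv w (cc-k))) w)"
      using rot_oddB[OF w(1,2)] move[OF w] by blast
  qed
  have "Y \<cdot> (TS (X P b' A) \<cdot> T) =
      (\<Oplus>\<^bsub>HB r\<^esub> p\<in>{1..2*n+1}. Hconst r (gcf n h A p) \<cdot> TS (X (P' p) b (shift n h A p))) \<cdot> T"
    unfolding key[symmetric] by (rule H.m_assoc[symmetric, OF Yc TS_closed[OF XW] T])
  also have "\<dots> = (\<Oplus>\<^bsub>HB r\<^esub> p\<in>{1..2*n+1}. Hconst r (gcf n h A p) \<cdot> TS (X (P' p) b (shift n h A p)) \<cdot> T)"
    by (intro H.finsum_ldistr finite_atLeastAtMost T Pi_I H.m_closed cl TS_closed XW)
  also have "\<dots> = (\<Oplus>\<^bsub>HB r\<^esub> p\<in>{1..2*n+1}. Hconst r (gcf n h A p) \<cdot> (TS (X (P' p) b (shift n h A p)) \<cdot> T))"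
    by (intro H.finsum_cong' refl Pi_I H.m_closed H.m_assoc cl TS_closed XW T)
  finally show ?thesis unfolding Xs .
qed

end

context heckeB
begin

lemma SD_sum_cong:
  assumes "\<And>p. p \<in> P \<Longrightarrow> g p \<in> carrier (SD n r)" "\<And>p. p \<in> P \<Longrightarrow> f p = g p"
  shows "(\<Oplus>\<^bsub>SD n r\<^esub> p\<in>P. f p) = (\<Oplus>\<^bsub>SD n r\<^esub> p\<in>P. g p)"
proof -
  interpret S: abelian_monoid "SD n r" by (rule SD_abelian_monoid)
  show ?thesis by (rule S.finsum_cong') (use assms in auto)
qed

lemma SD_sum_Un:
  assumes "finite P" "finite Q" "P \<inter> Q = {}" "\<And>p. p \<in> P \<union> Q \<Longrightarrow> f p \<in> carrier (SD n r)"
  shows "(\<Oplus>\<^bsub>SD n r\<^esub> p\<in>P \<union> Q. f p) = (\<Oplus>\<^bsub>SD n r\<^esub> p\<in>P. f p) \<oplus>\<^bsub>SD n r\<^esub> (\<Oplus>\<^bsub>SD n r\<^esub> p\<in>Q. f p)"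
proof -
  interpret S: abelian_monoid "SD n r" by (rule SD_abelian_monoid)
  show ?thesis by (rule S.finsum_Un_disjoint) (use assms in auto)
qed

lemma SD_sum_insert:
  assumes "finite P" "q \<notin> P" "\<And>p. p \<in> insert q P \<Longrightarrow> f p \<in> carrier (SD n r)"
  shows "(\<Oplus>\<^bsub>SD n r\<^esub> p\<in>insert q P. f p) = (\<Oplus>\<^bsub>SD n r\<^esub> p\<in>P. f p) \<oplus>\<^bsub>SD n r\<^esub> f q"
    and "f q = \<zero>\<^bsub>SD n r\<^esub> \<Longrightarrow> (\<Oplus>\<^bsub>SD n r\<^esub> p\<in>insert q P. f p) = (\<Oplus>\<^bsub>SD n r\<^esub> p\<in>P. f p)"
proof -
  interpret S: abelian_monoid "SD n r" by (rule SD_abelian_monoid)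
  have c: "(\<Oplus>\<^bsub>SD n r\<^esub> p\<in>P. f p) \<in> carrier (SD n r)" by (rule S.finsum_closed) (use assms in auto)
  have "(\<Oplus>\<^bsub>SD n r\<^esub> p\<in>insert q P. f p) = f q \<oplus>\<^bsub>SD n r\<^esub> (\<Oplus>\<^bsub>SD n r\<^esub> p\<in>P. f p)"
    by (rule S.finsum_insert) (use assms in auto)
  then show *: "(\<Oplus>\<^bsub>SD n r\<^esub> p\<in>insert q P. f p) = (\<Oplus>\<^bsub>SD n r\<^esub> p\<in>P. f p) \<oplus>\<^bsub>SD n r\<^esub> f q"
    using S.a_comm[OF assms(3)[OF insertI1] c] by simp
  show "f q = \<zero>\<^bsub>SD n r\<^esub> \<Longrightarrow> (\<Oplus>\<^bsub>SD n r\<^esub> p\<in>insert q P. f p) = (\<Oplus>\<^bsub>SD n r\<^esub> p\<in>P. f p)"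
    unfolding * using S.r_zero[OF c] by simp
qed

end

lemma gcf_zero: "A (h+1) p = 0 \<Longrightarrow> gcf n h A p = 0"
  by (simp add: gcf_def)

lemma qq_neq_1: "qq - 1 \<noteq> 0"
  by (simp add: qq_def one_pCons)

lemma diag_cnt_one:
  assumes m: "m \<in> Lam (n+1) r"
  shows "cnt r (bl n m) (bl n m) id = diag (hat n m)"
proof (intro ext)
  fix i j
  show "cnt r (bl n m) (bl n m) id i j = diag (hat n m) i j"
  proof (cases "i = j")
    case False
    then have "{x \<in> {1..2*r}. bl n m x = j \<and> bl n m (id x) = i} = {}" by auto
    then show ?thesis using False unfolding cnt_def diag_def by simp
  next
    case True
    show ?thesis
    proof (cases "i \<in> {1..2*n+1}")
      case i: True
      have "{x \<in> {1..2*r}. bl n m x = i \<and> bl n m (id x) = i} = {x \<in> {1..2*r}. bl n m x = i}" by auto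
      then show ?thesis using card_bl[OF m i] True unfolding cnt_def diag_def by simp
    next
      case i: False
      have "hat n m i = 0" using i by (simp add: hat_def) linarith
      then show ?thesis using cnt_outside[OF m m WB_id, of i j] i True by (simp add: diag_def)
    qed
  qed
qed

text \<open>Preserving all blocks means having only diagonal entries.\<close>

lemma KD_eq_cnt:
  assumes m: "m \<in> Lam (n+1) r"
  shows "KD r (bl n m) = {v \<in> WD r. cnt r (bl n m) (bl n m) v = diag (hat n m)}"
proof (intro equalityI subsetI)
  fix k assume "k \<in> KD r (bl n m)"
  then have k: "k \<in> Yg r (bl n m)" "\<not> oddB r k" by (simp_all add: KD_iff)
  have "cnt r (bl n m) (bl n m) k = diag (hat n m)"
    using cnt_Yg[OF WB_id k(1) Yg_id, of "bl n m"] unfolding o_id diag_cnt_one[OF m] .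
  then show "k \<in> {v \<in> WD r. cnt r (bl n m) (bl n m) v = diag (hat n m)}"
    using Yg_WB[OF k(1)] k(2) by (simp add: WD_iff)
next
  fix v assume v: "v \<in> {v \<in> WD r. cnt r (bl n m) (bl n m) v = diag (hat n m)}"
  then have vW: "v \<in> WB r" "\<not> oddB r v" by (simp_all add: WD_iff)
  have "v \<in> Yg r (bl n m)"
  proof (rule YgI[OF vW(1)])
    fix x assume x: "x \<in> {1..2*r}"
    let ?S = "{y \<in> {1..2*r}. bl n m y = bl n m x \<and> bl n m (v y) = bl n m (v x)}"
    have "x \<in> ?S" using x by simp
    then have "?S \<noteq> {}" by blast
    moreover have fin: "finite ?S" by simp
    ultimately have "card ?S \<noteq> 0" using card_0_eq[of ?S] by blast
    then have "cnt r (bl n m) (bl n m) v (bl n m (v x)) (bl n m x) \<noteq> 0" unfolding cnt_def .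
    then show "bl n m (v x) = bl n m x" using v by (auto simp: diag_def split: if_splits)
  qed
  then show "v \<in> KD r (bl n m)" using vW by (simp add: KD_iff)
qed

context block_move
begin

text \<open>The matrix \<open>B\<close> is obtained from the identity double coset by moving one entry, so the
  multiplication formula itself shows that \<open>phi n r (Dot B)\<close> is left multiplication by \<open>Y\<close>.\<close>

lemma phi_move:
  assumes B: "B \<in> Xi n r" "ro n B = hat n lam" "co n B = hat n mu" "B (n+1) (n+1) \<noteq> 0"
    and Bs: "B = shift n h (diag (hat n mu)) (h+1)"
  shows "maps_xH n (LBul lam) (lam_br n mu Plus) Y \<and> phi n r (Dot B) = opS n (LBul lam) (lam_br n mu Plus) Y"
proof (rule reps_phi_dot(2)[OF B(1) lam mu B(2-4)])
  let ?A = "diag (hat n mu)"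
  show Y: "Y \<in> carrier (HB r)" by (rule Ysum_closed[OF cc(2,1)])
  have dW: "cnt r b' b' id = ?A" by (rule diag_cnt_one[OF mu])
  have sym: "?A i j = ?A (2*n+2-i) (2*n+2-j)" if ij: "i \<in> {1..2*n+1}" "j \<in> {1..2*n+1}" for i j
  proof -
    have "2*n+2-i = 2*n+2-j \<longleftrightarrow> i = j" using ij by auto
    then show ?thesis unfolding diag_def hat_sym[OF ij(1)] by presburger
  qed
  have ev: "even (?A (n+1) (n+1))" by (simp add: diag_def hat_def)
  define D where "D p = {w \<in> WB r. \<not> oddB r w \<and> cnt r b b' w = shift n h ?A p}" for p
  have DW: "D p \<subseteq> WB r" for p unfolding D_def by blast
  have "Y \<cdot> TS {w \<in> WB r. \<not> oddB r w \<and> cnt r b' b' w = ?A} =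
    (\<Oplus>\<^bsub>HB r\<^esub> p\<in>{1..2*n+1}. Hconst r (gcf n h ?A p) \<cdot> TS (D p))"
    unfolding D_def
  proof (rule Ysum_TS[where A = ?A and nu = mu and P = "\<lambda>w. \<not> oddB r w" and P' = "\<lambda>p w. \<not> oddB r w", OF mu sym ev])
    fix w j assume w: "w \<in> WB r" "1 \<le> j" "j < r" "b' j = b' (j+1)"
    have "j \<in> {1..r}" using w by simp
    then show "(\<not> oddB r (sB r j \<circ> w)) = (\<not> oddB r w)" using oddB_sB_comp[OF w(1)] w(3) by simp
  next
    fix w k assume w: "w \<in> WB r" "k \<le> g"
    show "(\<not> oddB r (rot r cc k w)) = (\<not> oddB r w)" using rot_oddB[OF w] by blast
  qed
  \<comment> \<open>Row \<open>h + 1\<close> of a diagonal matrix has no other entry to give away.\<close>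
  also have "\<dots> = (\<Oplus>\<^bsub>HB r\<^esub> p\<in>{1..2*n+1}. if h+1 = p then TS (D p) else \<zero>\<^bsub>HB r\<^esub>)"
  proof (intro H.finsum_cong' refl Pi_I)
    fix p
    show "(if h+1 = p then TS (D p) else \<zero>\<^bsub>HB r\<^esub>) \<in> carrier (HB r)" using TS_closed[OF DW] by simp
    show "Hconst r (gcf n h ?A p) \<cdot> TS (D p) = (if h+1 = p then TS (D p) else \<zero>\<^bsub>HB r\<^esub>)"
    proof (cases "h+1 = p")
      case True
      have "hat n mu (h+1) > 0" using h mu_h by (cases "h = n") (auto simp: hat_def)
      moreover have "(\<Sum>j\<in>{p<..2*n+1}. ?A h j) = 0" using True by (simp add: diag_def)
      moreover have "?A h p = 0" using True by (simp add: diag_def)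
      moreover have "qint 1 = 1" unfolding qint_def using qq_neq_1 by simp
      ultimately have "gcf n h ?A p = 1" using True by (simp add: gcf_def diag_def)
      then show ?thesis using True TS_closed[OF DW] by (simp add: Hconst_1[OF r2])
    next
      case False
      then have "gcf n h ?A p = 0" by (simp add: gcf_def diag_def)
      then show ?thesis using False TS_closed[OF DW] by (simp add: Hconst_0[OF r2])
    qed
  qed
  also have "\<dots> = TS (D (h+1))"
    by (rule H.add.finprod_singleton) (use h TS_closed[OF DW] in auto)
  also have "{w \<in> WB r. \<not> oddB r w \<and> cnt r b' b' w = ?A} = KD r b'"
    unfolding KD_eq_cnt[OF mu] WD_iff by blast
  also have "D (h+1) = {v \<in> WD r. cnt r b b' v = B}"
    unfolding D_def Bs WD_iff by blast
  finally show "Y \<cdot> TS (KD r b') = TS {v \<in> WD r. cnt r b b' v = B}" .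
qed

end

context matrix_move
begin

text \<open>The shape of every case of the theorem: \<open>phiA\<close> is given by the sum over the part \<open>P\<close> of a
  double coset, and \<open>f p\<close> by the sum over the part \<open>P' p\<close> of the shifted double coset.\<close>

lemma product_formula:
  assumes maps: "maps_xH n (LBul lam) (lam_br n mu Plus) Y" and mu0: "mu (n+1) \<noteq> 0"
    and inv: "\<And>w j. w \<in> WB r \<Longrightarrow> 1 \<le> j \<Longrightarrow> j < r \<Longrightarrow> b' j = b' (j+1) \<Longrightarrow> P (sB r j \<circ> w) = P w"
    and move: "\<And>w k. w \<in> WB r \<Longrightarrow> k \<le> g \<Longrightarrow> A (h+1) (bl n nu (pinv w (cc-k))) > 0 \<Longrightarrow>
      P (rot r cc k w) = P' (bl n nu (pinv w (cc-k))) w"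
    and phiA: "reps n (LBul mu) (lam_br n nu e)
      (TS {v \<in> WD r. P (v \<circ> s_pow r e) \<and> cnt r b' (bl n nu) (v \<circ> s_pow r e) = A}) phiA"
    and f: "\<And>p. p \<in> {1..2*n+1} \<Longrightarrow> A (h+1) p > 0 \<Longrightarrow> reps n (LBul lam) (lam_br n nu e)
      (TS {v \<in> WD r. P' p (v \<circ> s_pow r e) \<and> cnt r b (bl n nu) (v \<circ> s_pow r e) = shift n h A p}) (f p)"
  shows "opS n (LBul lam) (lam_br n mu Plus) Y \<otimes>\<^bsub>SD n r\<^esub> phiA =
      (\<Oplus>\<^bsub>SD n r\<^esub> p\<in>{1..2*n+1}. term_SD n r (gcf n h A p) (f p))"
    and "p \<in> {1..2*n+1} \<Longrightarrow> term_SD n r (gcf n h A p) (f p) \<in> carrier (SD n r)"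
proof -
  have \<alpha>: "LBul lam \<in> LamD n r" by (rule maps_xHD(1)[OF maps])
  have \<beta>: "lam_br n nu e \<in> LamD n r" by (rule lam_br_LamD[OF nu])
  have bul: "LBul mu = lam_br n mu Plus" using mu0 by (simp add: lam_br_def)
  define E where "E p = {v \<in> WD r. P' p (v \<circ> s_pow r e) \<and> cnt r b (bl n nu) (v \<circ> s_pow r e) = shift n h A p}" for p
  have E: "TS (E p) \<in> carrier (HB r)" for p by (rule TS_closed) (auto simp: E_def WD_iff)
  have t: "reps n (LBul lam) (lam_br n nu e) (Hconst r (gcf n h A p) \<cdot> TS (E p)) (term_SD n r (gcf n h A p) (f p))"
    if p: "p \<in> {1..2*n+1}" for p
  proof (rule reps_term[OF \<alpha> \<beta> E])
    assume "gcf n h A p \<noteq> 0"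
    then have "A (h+1) p > 0" unfolding gcf_def by presburger
    then show "reps n (LBul lam) (lam_br n nu e) (TS (E p)) (f p)" unfolding E_def by (rule f[OF p])
  qed
  show "p \<in> {1..2*n+1} \<Longrightarrow> term_SD n r (gcf n h A p) (f p) \<in> carrier (SD n r)" by (rule reps_carrier[OF t])
  have Y: "Y \<cdot> TS {v \<in> WD r. P (v \<circ> s_pow r e) \<and> cnt r b' (bl n nu) (v \<circ> s_pow r e) = A} =
      (\<Oplus>\<^bsub>HB r\<^esub> p\<in>{1..2*n+1}. Hconst r (gcf n h A p) \<cdot> TS (E p))"
    unfolding E_def by (rule Y_TS_even[where P = P and P' = P' and e = e]) (fact inv, fact move)
  have s: "reps n (LBul lam) (lam_br n nu e)
      (Y \<cdot> TS {v \<in> WD r. P (v \<circ> s_pow r e) \<and> cnt r b' (bl n nu) (v \<circ> s_pow r e) = A})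
      (\<Oplus>\<^bsub>SD n r\<^esub> p\<in>{1..2*n+1}. term_SD n r (gcf n h A p) (f p))"
    unfolding Y by (rule reps_finsum[OF \<alpha> \<beta> finite_atLeastAtMost t])
  show "opS n (LBul lam) (lam_br n mu Plus) Y \<otimes>\<^bsub>SD n r\<^esub> phiA =
      (\<Oplus>\<^bsub>SD n r\<^esub> p\<in>{1..2*n+1}. term_SD n r (gcf n h A p) (f p))"
    by (rule reps_unique[OF reps_mult[OF maps phiA[unfolded bul]] s])
qed

text \<open>A unit that comes from the middle row and from the right half of the columns flips \<open>lsign\<close>, which
  exchanges the two pieces of the double coset: hence the opposite sign.\<close>

lemma sgn_product:
  assumes maps: "maps_xH n (LBul lam) (lam_br n mu Plus) Y" and mu0: "mu (n+1) \<noteq> 0" and lam0: "lam (n+1) \<noteq> 0"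
    and z: "A (n+1) (n+1) = 0" and e: "sg_mult e e' = sgn_mat n A"
  defines "f \<equiv> \<lambda>p. phi n r (Sgn (if h = n \<and> p > n+1 then opp e else e) (shift n h A p) e')"
  shows "opS n (LBul lam) (lam_br n mu Plus) Y \<otimes>\<^bsub>SD n r\<^esub> phi n r (Sgn e A e') =
      (\<Oplus>\<^bsub>SD n r\<^esub> p\<in>{1..2*n+1}. term_SD n r (gcf n h A p) (f p))"
    and "p \<in> {1..2*n+1} \<Longrightarrow> term_SD n r (gcf n h A p) (f p) \<in> carrier (SD n r)"
proof -
  let ?c = "bl n nu"
  define s where "s p = (if h = n \<and> p > n+1 then opp e else e)" for p
  define P where "P w = (lsign n r b' ?c w = (e = Minus))" for w
  define P' where "P' p w = (lsign n r b ?c w = (s p = Minus))" for p w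
  have inv: "P (sB r j \<circ> w) = P w" if "w \<in> WB r" "1 \<le> j" "j < r" "b' j = b' (j+1)" for w j
    unfolding P_def lsign_sB[OF that] ..
  have move: "P (rot r cc k w) = P' (bl n nu (pinv w (cc-k))) w" if w: "w \<in> WB r" "k \<le> g" "A (h+1) (bl n nu (pinv w (cc-k))) > 0" for w k
  proof (cases "h = n \<and> ?c (pinv w (cc-k)) > n+1")
    case True
    show ?thesis unfolding P_def P'_def s_def lsign_move[OF w(1,2)] if_P[OF True] sgn_opp by blast
  next
    case False
    show ?thesis unfolding P_def P'_def s_def lsign_move[OF w(1,2)] if_not_P[OF False] by (rule refl)
  qed
  have phiA: "reps n (LBul mu) (lam_br n nu e')
      (TS {v \<in> WD r. P (v \<circ> s_pow r e') \<and> cnt r b' ?c (v \<circ> s_pow r e') = A}) (phi n r (Sgn e A e'))"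
    unfolding P_def by (rule reps_phi_sgn[OF A mu mu0 nu ro co z e])
  have f: "reps n (LBul lam) (lam_br n nu e')
      (TS {v \<in> WD r. P' p (v \<circ> s_pow r e') \<and> cnt r b ?c (v \<circ> s_pow r e') = shift n h A p}) (f p)"
    if p: "p \<in> {1..2*n+1}" and pos: "A (h+1) p > 0" for p
  proof -
    have z': "shift n h A p (n+1) (n+1) = 0" unfolding center_shift[OF p pos] z by simp
    have e': "sg_mult (s p) e' = sgn_mat n (shift n h A p)"
      unfolding sgn_shift[OF p pos] s_def e[symmetric] by (simp add: sgn_opp)
    show ?thesis
      unfolding P'_def f_def s_def[symmetric]
      by (rule reps_phi_sgn[OF shift_Xi[OF p pos] lam lam0 nu ro_shift[OF p pos] co_shift[OF p pos] z' e'])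
  qed
  show "opS n (LBul lam) (lam_br n mu Plus) Y \<otimes>\<^bsub>SD n r\<^esub> phi n r (Sgn e A e') =
      (\<Oplus>\<^bsub>SD n r\<^esub> p\<in>{1..2*n+1}. term_SD n r (gcf n h A p) (f p))"
    by (rule product_formula(1)[where P = P and P' = P' and f = f and e = e', OF maps mu0])
      (fact inv, fact move, fact phiA, fact f)
  show "term_SD n r (gcf n h A p) (f p) \<in> carrier (SD n r)" if "p \<in> {1..2*n+1}"
    by (rule product_formula(2)[where P = P and P' = P' and f = f and e = e', OF maps mu0])
      (fact inv, fact move, fact phiA, fact f, fact that)
qed

text \<open>When the last two units of the central entry are moved away, the double coset falls apart
  into the two halves distinguished by \<open>lsign\<close>.\<close>

lemma dot_product:
  assumes maps: "maps_xH n (LBul lam) (lam_br n mu Plus) Y" and mu0: "mu (n+1) \<noteq> 0" and lam0: "lam (n+1) \<noteq> 0"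
    and z: "A (n+1) (n+1) \<noteq> 0"
  defines "f \<equiv> \<lambda>p. if h = n \<and> p = n+1 \<and> A (n+1) (n+1) = 2
    then phi n r (Sgn Plus (shift n h A p) (sgn_mat n A)) \<oplus>\<^bsub>SD n r\<^esub>
      phi n r (Sgn Minus (shift n h A p) (opp (sgn_mat n A)))
    else phi n r (Dot (shift n h A p))"
  shows "opS n (LBul lam) (lam_br n mu Plus) Y \<otimes>\<^bsub>SD n r\<^esub> phi n r (Dot A) =
      (\<Oplus>\<^bsub>SD n r\<^esub> p\<in>{1..2*n+1}. term_SD n r (gcf n h A p) (f p))"
    and "p \<in> {1..2*n+1} \<Longrightarrow> term_SD n r (gcf n h A p) (f p) \<in> carrier (SD n r)"
proof -
  let ?c = "bl n nu"
  have nu0: "nu (n+1) \<noteq> 0" by (rule phi_dot(3)[OF A mu nu ro co z])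
  have br: "lam_br n nu e = LBul nu" for e using nu0 by (simp add: lam_br_def)
  have id: "v \<circ> s_pow r Plus = v" for v by (simp only: s_pow.simps o_id)
  have phiA: "reps n (LBul mu) (lam_br n nu Plus)
      (TS {v \<in> WD r. True \<and> cnt r b' ?c (v \<circ> s_pow r Plus) = A}) (phi n r (Dot A))"
    unfolding id simp_thms by (rule reps_phi_dot(1)[OF A mu nu ro co z])
  have f: "reps n (LBul lam) (lam_br n nu Plus)
      (TS {v \<in> WD r. True \<and> cnt r b ?c (v \<circ> s_pow r Plus) = shift n h A p}) (f p)"
    if p: "p \<in> {1..2*n+1}" and pos: "A (h+1) p > 0" for p
  proof (cases "h = n \<and> p = n+1 \<and> A (n+1) (n+1) = 2")
    case False
    have "A (n+1) (n+1) \<ge> 2" using center_even z by (metis dvd_imp_le gr0I)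
    then have z': "shift n h A p (n+1) (n+1) \<noteq> 0" unfolding center_shift[OF p pos] using False z by auto
    have fp: "f p = phi n r (Dot (shift n h A p))" unfolding f_def using False by (rule if_not_P)
    show ?thesis
      unfolding id simp_thms fp
      by (rule reps_phi_dot(1)[OF shift_Xi[OF p pos] lam nu ro_shift[OF p pos] co_shift[OF p pos] z'])
  next
    case True
    define M where "M = shift n h A p"
    have z': "M (n+1) (n+1) = 0" unfolding M_def center_shift[OF p pos] using True by simp
    have sg: "sgn_mat n M = sgn_mat n A" unfolding M_def sgn_shift[OF p pos] using True by simp
    have e: "sg_mult Plus (sgn_mat n A) = sgn_mat n M" "sg_mult Minus (opp (sgn_mat n A)) = sgn_mat n M"
      unfolding sg sgn_opp by (rule refl)+
    note rp = reps_phi_sgn[OF shift_Xi[OF p pos] lam lam0 nu ro_shift[OF p pos] co_shift[OF p pos],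
      folded M_def, OF z']
    have part: "{v \<in> WD r. lsign n r b ?c (v \<circ> s_pow r e') = (e = Minus) \<and> cnt r b ?c (v \<circ> s_pow r e') = M} =
        {v \<in> WD r. lsign n r b ?c v = (e = Minus) \<and> cnt r b ?c v = M}" for e e'
    proof (rule Collect_cong, rule conj_cong[OF refl])
      fix v assume "v \<in> WD r"
      then have v: "v \<in> WB r" by (simp add: WD_iff)
      have sY: "s_pow r e' \<in> Yg r ?c" by (rule s_pow_Yg[OF r1 nu nu0])
      have "cnt r b ?c (v \<circ> s_pow r e') = cnt r b ?c v"
        using cnt_Yg[OF v Yg_id sY, of b] by (simp only: id_o)
      then show "(lsign n r b ?c (v \<circ> s_pow r e') = (e = Minus) \<and> cnt r b ?c (v \<circ> s_pow r e') = M) =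
        (lsign n r b ?c v = (e = Minus) \<and> cnt r b ?c v = M)"
        unfolding lsign_right[OF v sY] by simp
    qed
    let ?E = "\<lambda>e. {v \<in> WD r. lsign n r b ?c v = (e = Minus) \<and> cnt r b ?c v = M}"
    have "{v \<in> WD r. cnt r b ?c v = M} = ?E Plus \<union> ?E Minus" by auto
    moreover have "TS (?E Plus \<union> ?E Minus) = TS (?E Plus) \<boxplus> TS (?E Minus)"
      by (rule TS_Un_disjoint) (auto simp: WD_iff)
    moreover have "reps n (LBul lam) (LBul nu) (TS (?E Plus) \<boxplus> TS (?E Minus))
        (phi n r (Sgn Plus M (sgn_mat n A)) \<oplus>\<^bsub>SD n r\<^esub> phi n r (Sgn Minus M (opp (sgn_mat n A))))"
      by (rule reps_add[OF rp[OF e(1), unfolded part br] rp[OF e(2), unfolded part br]])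
    ultimately have R: "reps n (LBul lam) (LBul nu) (TS {v \<in> WD r. cnt r b ?c v = M})
        (phi n r (Sgn Plus M (sgn_mat n A)) \<oplus>\<^bsub>SD n r\<^esub> phi n r (Sgn Minus M (opp (sgn_mat n A))))"
      by (simp only:)
    have fp: "f p = phi n r (Sgn Plus M (sgn_mat n A)) \<oplus>\<^bsub>SD n r\<^esub> phi n r (Sgn Minus M (opp (sgn_mat n A)))"
      unfolding f_def M_def using True by (rule if_P)
    show ?thesis unfolding id simp_thms br fp M_def[symmetric] by (rule R)
  qed
  show "opS n (LBul lam) (lam_br n mu Plus) Y \<otimes>\<^bsub>SD n r\<^esub> phi n r (Dot A) =
      (\<Oplus>\<^bsub>SD n r\<^esub> p\<in>{1..2*n+1}. term_SD n r (gcf n h A p) (f p))"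
    by (rule product_formula(1)[where P = "\<lambda>_. True" and P' = "\<lambda>_ _. True" and f = f and e = Plus, OF maps mu0])
      (rule refl, rule refl, fact phiA, fact f)
  show "term_SD n r (gcf n h A p) (f p) \<in> carrier (SD n r)" if "p \<in> {1..2*n+1}"
    by (rule product_formula(2)[where P = "\<lambda>_. True" and P' = "\<lambda>_ _. True" and f = f and e = Plus, OF maps mu0])
      (rule refl, rule refl, fact phiA, fact f, fact that)
qed

end

theorem theorem6p2:
  fixes n r h :: nat
    and A B :: nmat
    and \<gamma> lam \<mu> \<nu> :: "nat \<Rightarrow> nat"
    and \<epsilon> :: sg
  assumes "n \<ge> 1" and "r \<ge> 4" and "h \<in> {1..n}"
    and "A \<in> Xi n r" and "B \<in> Xi n r"
    and "\<gamma> \<in> Lam (n+1) (r-1)"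
    and "B = (\<lambda>i j. Eth n h (h+1) i j + diag (hat n \<gamma>) i j)"
    and "lam \<in> Lam (n+1) r" and "\<mu> \<in> Lam (n+1) r" and "\<nu> \<in> Lam (n+1) r"
    and "ro n B = hat n lam" and "co n B = hat n \<mu>"
    and "ro n A = hat n \<mu>" and "co n A = hat n \<nu>"
    and "\<epsilon> = sgn_mat n A"
    and "B (n+1) (n+1) \<noteq> 0"
  shows
    "{X \<in> XiD n r. sym_mat X = B} = {Dot B} \<and>
     (A (n+1) (n+1) \<noteq> 0 \<longrightarrow>
        (h < n \<or> (h = n \<and> A (n+1) (n+1) \<noteq> 2) \<longrightarrow>
           phi n r (Dot B) \<otimes>\<^bsub>SD n r\<^esub> phi n r (Dot A) =
             (\<Oplus>\<^bsub>SD n r\<^esub> p\<in>{1..2*n+1}. term_SD n r (gcf n h A p) (phi n r (Dot (shift n h A p))))) \<and>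
        (h = n \<and> A (n+1) (n+1) = 2 \<longrightarrow>
           phi n r (Dot B) \<otimes>\<^bsub>SD n r\<^esub> phi n r (Dot A) =
             (\<Oplus>\<^bsub>SD n r\<^esub> p\<in>{1..2*n+1} - {n+1}.
                term_SD n r (gcf n n A p) (phi n r (Dot (shift n n A p))))
             \<oplus>\<^bsub>SD n r\<^esub>
             term_SD n r (gcf n n A (n+1))
               (phi n r (Sgn Plus (shift n n A (n+1)) \<epsilon>) \<oplus>\<^bsub>SD n r\<^esub>
                phi n r (Sgn Minus (shift n n A (n+1)) (opp \<epsilon>))))) \<and>
     (A (n+1) (n+1) = 0 \<and> \<mu> (n+1) \<noteq> 0 \<longrightarrow>
        (h < n \<longrightarrow>
           phi n r (Dot B) \<otimes>\<^bsub>SD n r\<^esub> phi n r (Sgn Plus A \<epsilon>) =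
             (\<Oplus>\<^bsub>SD n r\<^esub> p\<in>{1..2*n+1}.
                term_SD n r (gcf n h A p) (phi n r (Sgn Plus (shift n h A p) \<epsilon>)))) \<and>
        (h = n \<longrightarrow>
           phi n r (Dot B) \<otimes>\<^bsub>SD n r\<^esub> phi n r (Sgn Plus A \<epsilon>) =
             (\<Oplus>\<^bsub>SD n r\<^esub> p\<in>{1..<n+1}.
                term_SD n r (gcf n n A p) (phi n r (Sgn Plus (shift n n A p) \<epsilon>)))
             \<oplus>\<^bsub>SD n r\<^esub>
             (\<Oplus>\<^bsub>SD n r\<^esub> p\<in>{n+1<..2*n+1}.
                term_SD n r (gcf n n A p) (phi n r (Sgn Minus (shift n n A p) \<epsilon>)))) \<and>
        (h < n \<longrightarrow>
           phi n r (Dot B) \<otimes>\<^bsub>SD n r\<^esub> phi n r (Sgn Minus A (opp \<epsilon>)) =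
             (\<Oplus>\<^bsub>SD n r\<^esub> p\<in>{1..2*n+1}.
                term_SD n r (gcf n h A p) (phi n r (Sgn Minus (shift n h A p) (opp \<epsilon>))))) \<and>
        (h = n \<longrightarrow>
           phi n r (Dot B) \<otimes>\<^bsub>SD n r\<^esub> phi n r (Sgn Minus A (opp \<epsilon>)) =
             (\<Oplus>\<^bsub>SD n r\<^esub> p\<in>{1..<n+1}.
                term_SD n r (gcf n n A p) (phi n r (Sgn Minus (shift n n A p) (opp \<epsilon>))))
             \<oplus>\<^bsub>SD n r\<^esub>
             (\<Oplus>\<^bsub>SD n r\<^esub> p\<in>{n+1<..2*n+1}.
                term_SD n r (gcf n n A p) (phi n r (Sgn Plus (shift n n A p) (opp \<epsilon>))))))"
proof -
  interpret heckeB r by unfold_locales (use assms(2) in simp)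
  have h: "1 \<le> h" "h \<le> n" using assms(3) by simp_all
  have hh: "h \<in> {1..2*n+1}" "h+1 \<in> {1..2*n+1}" using h by auto
  have d: "(\<Sum>j\<in>{1..2*n+1}. diag (hat n \<gamma>) i j) = hat n \<gamma> i"
    "(\<Sum>j\<in>{1..2*n+1}. diag (hat n \<gamma>) j i) = hat n \<gamma> i" for i
  proof -
    have "i \<notin> {1..2*n+1} \<Longrightarrow> hat n \<gamma> i = 0" by (simp add: hat_def) linarith
    then show "(\<Sum>j\<in>{1..2*n+1}. diag (hat n \<gamma>) i j) = hat n \<gamma> i"
      "(\<Sum>j\<in>{1..2*n+1}. diag (hat n \<gamma>) j i) = hat n \<gamma> i"
      unfolding diag_def by (simp_all only: sum.delta sum.delta' finite_atLeastAtMost) metis+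
  qed
  \<comment> \<open>Row and column sums of \<open>B\<close> show that \<open>lam\<close> and \<open>\<mu>\<close> exceed \<open>\<gamma>\<close> by a unit in part \<open>h\<close> and \<open>h + 1\<close>.\<close>
  have rB: "hat n lam i = hat n \<gamma> i + (of_bool (i = h) + of_bool (i = 2*n+2-h))" for i
    using fun_cong[OF assms(11), of i] row_sum_Eth[OF hh(2), of h i] d(1)[of i]
    unfolding ro_def assms(7) by (simp add: sum.distrib)
  have cB: "hat n \<mu> i = hat n \<gamma> i + (of_bool (i = h+1) + of_bool (i = 2*n+2-(h+1)))" for i
    using fun_cong[OF assms(12), of i] col_sum_Eth[OF hh(1), of "h+1" i] d(2)[of i]
    unfolding co_def assms(7) by (simp add: sum.distrib)
  have lg: "lam i = \<gamma> i + of_bool (i = h)" and mg: "\<mu> i = \<gamma> i + of_bool (i = h+1)" for i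
  proof -
    have "lam i = \<gamma> i + of_bool (i = h) \<and> \<mu> i = \<gamma> i + of_bool (i = h+1)"
    proof (cases "i \<in> {1..n+1}")
      case False
      then have "lam i = 0" "\<mu> i = 0" "\<gamma> i = 0" using assms(6,8,9) unfolding Lam_def by blast+
      moreover have "i \<noteq> h" "i \<noteq> h+1" using False h by auto
      ultimately show ?thesis by simp
    next
      case True
      show ?thesis
      proof (cases "i = n+1")
        case i: True
        have "i \<noteq> h" "i \<noteq> 2*n+2-h" "i = 2*n+2-(h+1) \<longleftrightarrow> i = h+1" using h i by linarith+
        then show ?thesis using rB[of i] cB[of i] i by (simp add: hat_def)
      next
        case False
        then have "1 \<le> i" "i \<le> n" using True by auto
        then have "i \<noteq> 2*n+2-h" "i \<noteq> 2*n+2-(h+1)" using h by linarith+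
        then show ?thesis using rB[of i] cB[of i] \<open>1 \<le> i\<close> \<open>i \<le> n\<close> by (simp add: hat_def)
      qed
    qed
    then show "lam i = \<gamma> i + of_bool (i = h)" "\<mu> i = \<gamma> i + of_bool (i = h+1)" by blast+
  qed
  interpret matrix_move r n h lam \<mu> \<nu> A
    by unfold_locales (use assms(3,4,8-10,13,14) lg mg in simp_all)
  have nh: "(n+1 = h) = False" "(n+1 = 2*n+2-h) = False" using h by auto
  have lam0: "lam (n+1) \<noteq> 0"
    using assms(16) unfolding assms(7) lg Eth_def nh diag_def hat_def by simp
  have mu0: "\<mu> (n+1) \<noteq> 0" using lam0 h unfolding lg mg by simp
  \<comment> \<open>The identity double coset of \<open>\<mu>\<close> has the diagonal matrix; \<open>B\<close> arises from it by moving one unit.\<close>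
  have Bs: "B = shift n h (diag (hat n \<mu>)) (h+1)"
  proof (intro ext)
    fix i j
    have "diag (hat n \<mu>) i j = diag (hat n \<gamma>) i j + Eth n (h+1) (h+1) i j"
      unfolding diag_def cB Eth_def by auto
    then show "B i j = shift n h (diag (hat n \<mu>)) (h+1) i j"
      unfolding shift_def assms(7) by simp
  qed
  note phiB = phi_move[OF assms(5,11,12,16) Bs]
  note maps = conjunct1[OF phiB] and pB = conjunct2[OF phiB]
  have e: "sg_mult Plus \<epsilon> = sgn_mat n A" "sg_mult Minus (opp \<epsilon>) = sgn_mat n A"
    unfolding assms(15) sgn_opp by (rule refl)+
  note dp = dot_product[OF maps mu0 lam0, folded pB assms(15)]
  let ?N = "{1..2*n+1}"
  have X0: "{X \<in> XiD n r. sym_mat X = B} = {Dot B}"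
    using assms(5,16) unfolding XiD_def by auto
  have D1: "phi n r (Dot B) \<otimes>\<^bsub>SD n r\<^esub> phi n r (Dot A) =
      (\<Oplus>\<^bsub>SD n r\<^esub> p\<in>?N. term_SD n r (gcf n h A p) (phi n r (Dot (shift n h A p))))"
    if z: "A (n+1) (n+1) \<noteq> 0" and c: "h < n \<or> (h = n \<and> A (n+1) (n+1) \<noteq> 2)"
  proof -
    have ne: "(h = n \<and> p = n+1 \<and> A (n+1) (n+1) = 2) = False" for p using c by auto
    show ?thesis using dp(1)[OF z] unfolding ne if_False .
  qed
  have D2: "phi n r (Dot B) \<otimes>\<^bsub>SD n r\<^esub> phi n r (Dot A) =
      (\<Oplus>\<^bsub>SD n r\<^esub> p\<in>?N - {n+1}. term_SD n r (gcf n n A p) (phi n r (Dot (shift n n A p))))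
      \<oplus>\<^bsub>SD n r\<^esub> term_SD n r (gcf n n A (n+1))
        (phi n r (Sgn Plus (shift n n A (n+1)) \<epsilon>) \<oplus>\<^bsub>SD n r\<^esub> phi n r (Sgn Minus (shift n n A (n+1)) (opp \<epsilon>)))"
    if z: "A (n+1) (n+1) \<noteq> 0" and c: "h = n" "A (n+1) (n+1) = 2"
  proof -
    define F where "F p = term_SD n r (gcf n h A p) (if h = n \<and> p = n+1 \<and> A (n+1) (n+1) = 2
      then phi n r (Sgn Plus (shift n h A p) \<epsilon>) \<oplus>\<^bsub>SD n r\<^esub> phi n r (Sgn Minus (shift n h A p) (opp \<epsilon>))
      else phi n r (Dot (shift n h A p)))" for p
    have F: "F p \<in> carrier (SD n r)" if "p \<in> ?N" for p unfolding F_def by (rule dp(2)[OF z that])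
    have N: "?N = insert (n+1) (?N - {n+1})" by auto
    have "phi n r (Dot B) \<otimes>\<^bsub>SD n r\<^esub> phi n r (Dot A) = (\<Oplus>\<^bsub>SD n r\<^esub> p\<in>insert (n+1) (?N - {n+1}). F p)"
      using dp(1)[OF z] unfolding F_def N[symmetric] .
    also have "\<dots> = (\<Oplus>\<^bsub>SD n r\<^esub> p\<in>?N - {n+1}. F p) \<oplus>\<^bsub>SD n r\<^esub> F (n+1)"
      by (rule SD_sum_insert(1)) (simp, simp, rule F, auto)
    also have "(\<Oplus>\<^bsub>SD n r\<^esub> p\<in>?N - {n+1}. F p) =
        (\<Oplus>\<^bsub>SD n r\<^esub> p\<in>?N - {n+1}. term_SD n r (gcf n n A p) (phi n r (Dot (shift n n A p))))"
    proof (rule SD_sum_cong[symmetric])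
      fix p assume p: "p \<in> ?N - {n+1}"
      then show "F p \<in> carrier (SD n r)" by (intro F) simp
      show "term_SD n r (gcf n n A p) (phi n r (Dot (shift n n A p))) = F p"
        unfolding F_def using p c by simp
    qed
    also have "F (n+1) = term_SD n r (gcf n n A (n+1))
        (phi n r (Sgn Plus (shift n n A (n+1)) \<epsilon>) \<oplus>\<^bsub>SD n r\<^esub> phi n r (Sgn Minus (shift n n A (n+1)) (opp \<epsilon>)))"
      unfolding F_def c(1) using c(2) by simp
    finally show ?thesis .
  qed
  have low: "phi n r (Dot B) \<otimes>\<^bsub>SD n r\<^esub> phi n r (Sgn e A e') =
      (\<Oplus>\<^bsub>SD n r\<^esub> p\<in>?N. term_SD n r (gcf n h A p) (phi n r (Sgn e (shift n h A p) e')))"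
    if z: "A (n+1) (n+1) = 0" and c: "h < n" and s: "sg_mult e e' = sgn_mat n A" for e e'
  proof -
    have ne: "(h = n \<and> p > n+1) = False" for p using c by auto
    show ?thesis using sgn_product(1)[OF maps mu0 lam0 z s] unfolding pB[symmetric] ne if_False .
  qed
  have mid: "phi n r (Dot B) \<otimes>\<^bsub>SD n r\<^esub> phi n r (Sgn e A e') =
      (\<Oplus>\<^bsub>SD n r\<^esub> p\<in>{1..<n+1}. term_SD n r (gcf n n A p) (phi n r (Sgn e (shift n n A p) e')))
      \<oplus>\<^bsub>SD n r\<^esub>
      (\<Oplus>\<^bsub>SD n r\<^esub> p\<in>{n+1<..2*n+1}. term_SD n r (gcf n n A p) (phi n r (Sgn (opp e) (shift n n A p) e')))"
    if z: "A (n+1) (n+1) = 0" and c: "h = n" and s: "sg_mult e e' = sgn_mat n A" for e e'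
  proof -
    define F where "F p = term_SD n r (gcf n h A p)
      (phi n r (Sgn (if h = n \<and> p > n+1 then opp e else e) (shift n h A p) e'))" for p
    have F: "F p \<in> carrier (SD n r)" if "p \<in> ?N" for p
      unfolding F_def by (rule sgn_product(2)[OF maps mu0 lam0 z s that])
    have N: "?N = insert (n+1) ({1..<n+1} \<union> {n+1<..2*n+1})" by auto
    \<comment> \<open>The vanishing central entry has nothing to give away.\<close>
    have "gcf n h A (n+1) = 0" by (rule gcf_zero) (simp add: z[simplified] c)
    then have F0: "F (n+1) = \<zero>\<^bsub>SD n r\<^esub>" unfolding F_def term_SD_def by simp
    have "phi n r (Dot B) \<otimes>\<^bsub>SD n r\<^esub> phi n r (Sgn e A e') =
        (\<Oplus>\<^bsub>SD n r\<^esub> p\<in>insert (n+1) ({1..<n+1} \<union> {n+1<..2*n+1}). F p)"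
      using sgn_product(1)[OF maps mu0 lam0 z s] unfolding pB[symmetric] F_def N[symmetric] .
    also have "\<dots> = (\<Oplus>\<^bsub>SD n r\<^esub> p\<in>{1..<n+1} \<union> {n+1<..2*n+1}. F p)"
      by (rule SD_sum_insert(2)[where f = F and q = "n+1"]) (simp, simp, rule F, auto simp: F0[simplified])
    also have "\<dots> = (\<Oplus>\<^bsub>SD n r\<^esub> p\<in>{1..<n+1}. F p) \<oplus>\<^bsub>SD n r\<^esub> (\<Oplus>\<^bsub>SD n r\<^esub> p\<in>{n+1<..2*n+1}. F p)"
      by (rule SD_sum_Un) (simp, simp, fastforce, rule F, auto)
    also have "(\<Oplus>\<^bsub>SD n r\<^esub> p\<in>{1..<n+1}. F p) =
        (\<Oplus>\<^bsub>SD n r\<^esub> p\<in>{1..<n+1}. term_SD n r (gcf n n A p) (phi n r (Sgn e (shift n n A p) e')))"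
    proof (rule SD_sum_cong[symmetric])
      fix p assume p: "p \<in> {1..<n+1}"
      then show "F p \<in> carrier (SD n r)" by (intro F) simp
      show "term_SD n r (gcf n n A p) (phi n r (Sgn e (shift n n A p) e')) = F p"
        unfolding F_def using p c by simp
    qed
    also have "(\<Oplus>\<^bsub>SD n r\<^esub> p\<in>{n+1<..2*n+1}. F p) =
        (\<Oplus>\<^bsub>SD n r\<^esub> p\<in>{n+1<..2*n+1}. term_SD n r (gcf n n A p) (phi n r (Sgn (opp e) (shift n n A p) e')))"
    proof (rule SD_sum_cong[symmetric])
      fix p assume p: "p \<in> {n+1<..2*n+1}"
      then show "F p \<in> carrier (SD n r)" by (intro F) simp
      show "term_SD n r (gcf n n A p) (phi n r (Sgn (opp e) (shift n n A p) e')) = F p"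
        unfolding F_def using p c by simp
    qed
    finally show ?thesis .
  qed
  show ?thesis
    by (intro conjI impI; (elim conjE)?; (rule X0 | (rule D1; assumption) | (rule D2; assumption) |
      (rule low[OF _ _ e(1)]; assumption) | (rule low[OF _ _ e(2)]; assumption) |
      (rule mid[OF _ _ e(1), unfolded opp.simps]; assumption) |
      (rule mid[OF _ _ e(2), unfolded opp.simps]; assumption)))
qed

end
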